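(* There exists a generic loop $\ell : S^1 \to M_1$ in the moduli space $M_1$ of long knots such that: (1) $\ell$ is contractible in $M_1$; (2) no diagram in the $1$-parameter family $\ell$ contains a star-like triple crossing; (3) every generic $2$-disc in $M_1$ which contracts $\ell$ (that is, every generic map $\Phi: \mathbb{D}^2 \to M_1$ with $\Phi|_{\partial \mathbb{D}^2} = \ell$) contains star-like triple crossings, i.e. there is a point $s \in \mathbb{D}^2$ such that the diagram of $\Phi(s)$ has a star-like triple crossing.
   Context: A long knot is a smoothly embedded oriented line in $\mathbb{R}^3$ which coincides with the (oriented) $x$-axis outside a compact set. Let $pr: \mathbb{R}^3 \to \mathbb{R}^2$, $pr(x,y,z) = (x,y)$. $M_1$ denotes the topological moduli space of all long knots such that the restriction of the fixed projection $pr$ to the knot is an immersion. The diagram of a long knot in $M_1$ is its image under $pr$ with over/under information given by the $z$-coordinate. A path in $M_1$ is called a regular isotopy; a generic path contains only finitely many non-generic diagrams, which correspond to Reidemeister moves of type II (ordinary self-tangencies) and of type III (ordinary triple crossings). The discriminant $\Sigma\subset M_1$ of non-generic diagrams has a natural stratification, and loops and discs in $M_1$ are called generic if they are transverse to this stratification. A triple crossing of a diagram is a point of the plane through which exactly three branches of the projected oriented knot pass, pairwise transversally. It is called braid-like if the three oriented tangent directions at this point are contained in an open half-plane (this is the only sort of triple crossing which occurs in families of braids), and it is called star-like otherwise (this sort never occurs for braids). *)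

theory Defs
  imports "HOL-Analysis.Analysis"
begin

section \<open>Smooth maps\<close>

primrec C_times :: "nat \<Rightarrow> ('a::euclidean_space \<Rightarrow> 'b::real_normed_vector) \<Rightarrow> bool" where
  "C_times 0 f \<longleftrightarrow> continuous_on UNIV f"
| "C_times (Suc k) f \<longleftrightarrow>
     (\<forall>x. f differentiable (at x)) \<and>
     (\<forall>v. C_times k (\<lambda>x. frechet_derivative f (at x) v))"

definition smooth :: "('a::euclidean_space \<Rightarrow> 'b::real_normed_vector) \<Rightarrow> bool" where
  "smooth f \<longleftrightarrow> (\<forall>k. C_times k f)"

definition velocity :: "(real \<Rightarrow> 'b::real_normed_vector) \<Rightarrow> real \<Rightarrow> 'b" where
  "velocity f = (\<lambda>t. vector_derivative f (at t))"

section \<open>The space of long knots with immersed projection\<close>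

definition pr :: "real^3 \<Rightarrow> real^2" where
  "pr x = vector [x$1, x$2]"

definition x_axis :: "real \<Rightarrow> real^3" where
  "x_axis t = vector [t, 0, 0]"

text \<open>Long knots are handled through parametrizations that are the standard one of the
  \<open>x\<close>-axis outside \<open>[-R, R]\<close>.  Such an injective immersion is proper, hence an embedding.\<close>

definition params_upto :: "real \<Rightarrow> (real \<Rightarrow> real^3) set" where
  "params_upto R = {f. smooth f \<and> inj f \<and> (\<forall>t. velocity f t \<noteq> 0) \<and>
     (\<forall>t. velocity (pr \<circ> f) t \<noteq> 0) \<and> (\<forall>t. \<bar>t\<bar> \<ge> R \<longrightarrow> f t = x_axis t)}"

definition params :: "(real \<Rightarrow> real^3) set" where
  "params = (\<Union>R. params_upto R)"

text \<open>The topology on parametrizations is the inductive limit over \<open>R\<close> of the topologies of uniform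
  convergence of all derivatives.  (Convergence on compact sets alone would allow the
  knotted part to escape to infinity.)\<close>

definition open_params :: "(real \<Rightarrow> real^3) set \<Rightarrow> bool" where
  "open_params U \<longleftrightarrow> U \<subseteq> params \<and>
     (\<forall>R. \<forall>f \<in> U \<inter> params_upto R. \<exists>k. \<exists>e>0. \<forall>g \<in> params_upto R.
        (\<forall>i\<le>k. \<forall>t. dist ((velocity ^^ i) g t) ((velocity ^^ i) f t) < e) \<longrightarrow> g \<in> U)"

definition param_space :: "(real \<Rightarrow> real^3) topology" where
  "param_space = topology open_params"

text \<open>A long knot is the image of a parametrization; its orientation is determined by its
  ends.  The moduli space carries the quotient topology.\<close>

definition M1 :: "(real^3) set topology" where
  "M1 = topology (\<lambda>V. V \<subseteq> range ` params \<and> openin param_space {f \<in> params. range f \<in> V})"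

lemma istopology_open_params: "istopology open_params"
proof -
  define near where "near R f k e =
      {g \<in> params_upto R. \<forall>i\<le>k. \<forall>t. dist ((velocity ^^ i) g t) ((velocity ^^ i) f t) < e}"
    for R f and k :: nat and e :: real
  have op: "open_params U \<longleftrightarrow> U \<subseteq> params \<and>
      (\<forall>R. \<forall>f \<in> U \<inter> params_upto R. \<exists>k. \<exists>e>0. near R f k e \<subseteq> U)" for U
    unfolding open_params_def near_def by (simp only: subset_eq Ball_def mem_Collect_eq imp_conjL)
  have mono: "near R f (max k l) (min e d) \<subseteq> near R f k e \<inter> near R f l d" for R f k l e d
    unfolding near_def by auto
  show ?thesis
    unfolding istopology_def
  proof (intro conjI allI impI)
    fix S T assume S: "open_params S" and T: "open_params T"
    have "\<exists>k. \<exists>e>0. near R f k e \<subseteq> S \<inter> T" if f: "f \<in> S \<inter> T \<inter> params_upto R" for R f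
    proof -
      obtain k e where ke: "e > 0" "near R f k e \<subseteq> S"
        using S f unfolding op by blast
      obtain l d where ld: "d > 0" "near R f l d \<subseteq> T"
        using T f unfolding op by blast
      have "near R f (max k l) (min e d) \<subseteq> S \<inter> T"
        using mono[of R f k l e d] ke(2) ld(2) by blast
      moreover have "min e d > 0" using ke(1) ld(1) by simp
      ultimately show ?thesis by blast
    qed
    moreover have "S \<inter> T \<subseteq> params" using S unfolding op by blast
    ultimately show "open_params (S \<inter> T)" unfolding op by blast
  next
    fix \<K> assume K: "\<forall>K\<in>\<K>. open_params K"
    have "\<exists>k. \<exists>e>0. near R f k e \<subseteq> \<Union>\<K>" if f: "f \<in> \<Union>\<K> \<inter> params_upto R" for R f
    proof -
      obtain K where "K \<in> \<K>" "f \<in> K \<inter> params_upto R" using f by blast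
      moreover from this K obtain k e where "e > 0" "near R f k e \<subseteq> K"
        unfolding op by meson
      ultimately show ?thesis by blast
    qed
    moreover have "\<Union>\<K> \<subseteq> params" using K unfolding op by blast
    ultimately show "open_params (\<Union>\<K>)" unfolding op by blast
  qed
qed

lemma openin_param_space: "openin param_space U \<longleftrightarrow> open_params U"
  unfolding param_space_def by (simp add: istopology_open_params)

lemma topspace_param_space: "topspace param_space = params"
proof -
  have "params_upto R \<subseteq> params" for R
    unfolding params_def by blast
  then have "open_params params"
    unfolding open_params_def using zero_less_one by blast
  then have "params \<subseteq> topspace param_space"
    using openin_subset[of param_space params] by (simp add: openin_param_space)
  moreover have "topspace param_space \<subseteq> params"
    using openin_topspace[of param_space] unfolding openin_param_space open_params_def by blast
  ultimately show ?thesis by (rule subset_antisym[rotated])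
qed

lemma openin_M1:
  "openin M1 V \<longleftrightarrow> V \<subseteq> range ` params \<and> openin param_space {f \<in> params. range f \<in> V}"
proof -
  have "istopology (\<lambda>V. V \<subseteq> range ` params \<and> openin param_space {f \<in> params. range f \<in> V})"
    unfolding istopology_def
  proof (intro conjI allI impI)
    fix S T :: "(real^3) set set"
    assume S: "S \<subseteq> range ` params \<and> openin param_space {f \<in> params. range f \<in> S}"
      and T: "T \<subseteq> range ` params \<and> openin param_space {f \<in> params. range f \<in> T}"
    show "S \<inter> T \<subseteq> range ` params" using S by blast
    have "{f \<in> params. range f \<in> S \<inter> T} =
        {f \<in> params. range f \<in> S} \<inter> {f \<in> params. range f \<in> T}"
      by blast
    then show "openin param_space {f \<in> params. range f \<in> S \<inter> T}"
      using S T by (simp only: openin_Int)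
  next
    fix \<K> :: "(real^3) set set set"
    assume K: "\<forall>K\<in>\<K>. K \<subseteq> range ` params \<and> openin param_space {f \<in> params. range f \<in> K}"
    show "\<Union>\<K> \<subseteq> range ` params" using K by blast
    have "{f \<in> params. range f \<in> \<Union>\<K>} = \<Union> ((\<lambda>K. {f \<in> params. range f \<in> K}) ` \<K>)"
      by blast
    moreover have "openin param_space (\<Union> ((\<lambda>K. {f \<in> params. range f \<in> K}) ` \<K>))"
      by (rule openin_Union) (use K in blast)
    ultimately show "openin param_space {f \<in> params. range f \<in> \<Union>\<K>}"
      by (simp only:)
  qed
  then show ?thesis unfolding M1_def by (simp only: topology_inverse')
qed

lemma topspace_M1: "topspace M1 = range ` params"
proof -
  have "{f \<in> params. range f \<in> range ` params} = topspace param_space"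
    unfolding topspace_param_space by blast
  then have "openin M1 (range ` params)"
    unfolding openin_M1 using openin_topspace[of param_space] by simp
  then have "range ` params \<subseteq> topspace M1" by (rule openin_subset)
  moreover have "topspace M1 \<subseteq> range ` params"
    using openin_topspace[of M1] unfolding openin_M1 by blast
  ultimately show ?thesis by (rule subset_antisym[rotated])
qed

lemma quotient_map_M1: "quotient_map param_space M1 range"
  unfolding quotient_map_def topspace_param_space topspace_M1 openin_M1 by (simp only: simp_thms) blast

section \<open>Multiple points of diagrams\<close>

definition branches :: "(real \<Rightarrow> real^3) \<Rightarrow> real^2 \<Rightarrow> real set" where
  "branches f q = {t. pr (f t) = q}"

definition direction :: "(real \<Rightarrow> real^3) \<Rightarrow> real \<Rightarrow> real^2" where
  "direction f t = velocity (pr \<circ> f) t"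

definition transversal :: "(real \<Rightarrow> real^3) \<Rightarrow> real \<Rightarrow> real \<Rightarrow> bool" where
  "transversal f a b \<longleftrightarrow> \<not> collinear {0, direction f a, direction f b}"

definition multi_crossing :: "nat \<Rightarrow> (real \<Rightarrow> real^3) \<Rightarrow> real^2 \<Rightarrow> bool" where
  "multi_crossing n f q \<longleftrightarrow> finite (branches f q) \<and> card (branches f q) = n \<and>
     pairwise (transversal f) (branches f q)"

definition star_like_triple_crossing :: "(real \<Rightarrow> real^3) \<Rightarrow> real^2 \<Rightarrow> bool" where
  "star_like_triple_crossing f q \<longleftrightarrow> multi_crossing 3 f q \<and>
     \<not> (\<exists>n. \<forall>t \<in> branches f q. n \<bullet> direction f t > 0)"

definition has_star_like_triple_crossing :: "(real^3) set \<Rightarrow> bool" where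
  "has_star_like_triple_crossing K \<longleftrightarrow>
     (\<exists>f \<in> params. range f = K \<and> (\<exists>q. star_like_triple_crossing f q))"

text \<open>Contact of order at least \<open>k\<close>: after a local reparametrization \<open>\<phi>\<close> the two branches
  agree up to order \<open>k\<close>.  Order 1 is tangency; for \<open>k \<ge> 1\<close>, \<open>\<phi>' (a) \<noteq> 0\<close> is automatic
  since the projection is an immersion.\<close>

definition contact_ge :: "nat \<Rightarrow> (real \<Rightarrow> real^3) \<Rightarrow> real \<Rightarrow> real \<Rightarrow> bool" where
  "contact_ge k f a b \<longleftrightarrow> (\<exists>(\<phi>::real \<Rightarrow> real) C. smooth \<phi> \<and> \<phi> a = b \<and>
     (\<forall>\<^sub>F t in at a. norm (pr (f t) - pr (f (\<phi> t))) \<le> C * \<bar>t - a\<bar> ^ Suc k))"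

definition contact :: "nat \<Rightarrow> (real \<Rightarrow> real^3) \<Rightarrow> real \<Rightarrow> real \<Rightarrow> bool" where
  "contact k f a b \<longleftrightarrow> contact_ge k f a b \<and> \<not> contact_ge (Suc k) f a b"

text \<open>\<open>self_tangency 1\<close> is an ordinary self-tangency (Reidemeister II), \<open>self_tangency 2\<close> a
  self-tangency in an ordinary flex.\<close>

definition self_tangency :: "nat \<Rightarrow> (real \<Rightarrow> real^3) \<Rightarrow> real^2 \<Rightarrow> bool" where
  "self_tangency k f q \<longleftrightarrow> (\<exists>a b. a \<noteq> b \<and> branches f q = {a, b} \<and> contact k f a b)"

definition tangency_with_transverse_branch :: "(real \<Rightarrow> real^3) \<Rightarrow> real^2 \<Rightarrow> bool" where
  "tangency_with_transverse_branch f q \<longleftrightarrow>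
     (\<exists>a b c. a \<noteq> b \<and> a \<noteq> c \<and> b \<noteq> c \<and> branches f q = {a, b, c} \<and>
        contact 1 f a b \<and> transversal f a c \<and> transversal f b c)"

section \<open>The stratification of the discriminant\<close>

text \<open>The discriminant is the complement of \<open>stratum0\<close>, the generic diagrams.  As no cusps occur
  in \<open>M1\<close>, the strata of codimension 1 and 2 are exactly the following.\<close>

definition generic_point :: "(real \<Rightarrow> real^3) \<Rightarrow> real^2 \<Rightarrow> bool" where
  "generic_point f q \<longleftrightarrow> (\<exists>n\<le>2. multi_crossing n f q)"

definition codim1_point :: "(real \<Rightarrow> real^3) \<Rightarrow> real^2 \<Rightarrow> bool" where
  "codim1_point f q \<longleftrightarrow> self_tangency 1 f q \<or> multi_crossing 3 f q"

definition codim2_point :: "(real \<Rightarrow> real^3) \<Rightarrow> real^2 \<Rightarrow> bool" where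
  "codim2_point f q \<longleftrightarrow>
     self_tangency 2 f q \<or> tangency_with_transverse_branch f q \<or> multi_crossing 4 f q"

definition stratum0 :: "(real^3) set set" where
  "stratum0 = {range f | f. f \<in> params \<and> (\<forall>q. generic_point f q)}"

definition stratum1 :: "(real^3) set set" where
  "stratum1 = {range f | f. f \<in> params \<and>
     (\<exists>q. codim1_point f q \<and> (\<forall>q'. q' \<noteq> q \<longrightarrow> generic_point f q'))}"

definition stratum2 :: "(real^3) set set" where
  "stratum2 = {range f | f. f \<in> params \<and>
     ((\<exists>q. codim2_point f q \<and> (\<forall>q'. q' \<noteq> q \<longrightarrow> generic_point f q')) \<or>
      (\<exists>q r. q \<noteq> r \<and> codim1_point f q \<and> codim1_point f r \<and>
         (\<forall>q'. q' \<noteq> q \<and> q' \<noteq> r \<longrightarrow> generic_point f q')))}"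

section \<open>Transversality and generic families\<close>

definition smooth_family :: "'a::euclidean_space set \<Rightarrow> ('a \<times> real \<Rightarrow> real^3) \<Rightarrow> bool" where
  "smooth_family X F \<longleftrightarrow> smooth F \<and> (\<exists>R. \<forall>s \<in> X. (\<lambda>t. F (s, t)) \<in> params_upto R)"

definition family_velocity ::
    "('a::euclidean_space \<times> real \<Rightarrow> real^3) \<Rightarrow> 'a \<Rightarrow> 'a \<Rightarrow> real \<Rightarrow> real^3" where
  "family_velocity F s a = (\<lambda>t. frechet_derivative F (at (s, t)) (a, 0))"

text \<open>The vectors tangent to a set of knots \<open>S\<close> at \<open>f\<close>: the velocities of smooth curves in
  \<open>S\<close>.  For \<open>S\<close> invariant under reparametrization, as here, this contains the vector fields
  tangent to the knot itself, so that transversality below is transversality in the quotient.\<close>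

definition tangent_vectors :: "(real^3) set set \<Rightarrow> (real \<Rightarrow> real^3) \<Rightarrow> (real \<Rightarrow> real^3) set" where
  "tangent_vectors S f = {family_velocity G 0 1 | (G :: real \<times> real \<Rightarrow> real^3) \<delta>.
     \<delta> > 0 \<and> smooth_family {-\<delta><..<\<delta>} G \<and> (\<lambda>t. G (0, t)) = f \<and>
     (\<forall>e \<in> {-\<delta><..<\<delta>}. range (\<lambda>t. G (e, t)) \<in> S)}"

definition transverse_at ::
    "('a::euclidean_space \<times> real \<Rightarrow> real^3) \<Rightarrow> 'a set \<Rightarrow> (real^3) set set \<Rightarrow> 'a \<Rightarrow> bool" where
  "transverse_at F T S s \<longleftrightarrow>
     (\<forall>v \<in> tangent_vectors (topspace M1) (\<lambda>t. F (s, t)). \<exists>a \<in> T.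
        \<exists>w \<in> tangent_vectors S (\<lambda>t. F (s, t)). \<forall>t. v t = family_velocity F s a t + w t)"

text \<open>\<open>X\<close> is the parameter manifold and \<open>T s\<close> its tangent space at \<open>s\<close>.  Generic maps are smooth,
  i.e. represented by a smooth family of parametrizations, and transverse to all strata.  All
  knots outside \<open>stratum0 \<union> stratum1 \<union> stratum2\<close> have codimension at least 3, so that for
  parameter spaces of dimension at most 2 transversality to the remaining strata means avoiding them.\<close>

definition generic_map ::
    "'a::euclidean_space set \<Rightarrow> ('a \<Rightarrow> 'a set) \<Rightarrow> ('a \<Rightarrow> (real^3) set) \<Rightarrow> bool" where
  "generic_map X T \<Phi> \<longleftrightarrow> continuous_map (top_of_set X) M1 \<Phi> \<and>
     (\<exists>F. smooth_family X F \<and> (\<forall>s \<in> X. range (\<lambda>t. F (s, t)) = \<Phi> s) \<and>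
        (\<forall>s \<in> X. \<exists>S \<in> {stratum0, stratum1, stratum2}. \<Phi> s \<in> S \<and> transverse_at F (T s) S s))"

definition generic_loop :: "(complex \<Rightarrow> (real^3) set) \<Rightarrow> bool" where
  "generic_loop l \<longleftrightarrow> generic_map (sphere 0 1) (\<lambda>s. {a. orthogonal s a}) l"

definition generic_disc :: "(complex \<Rightarrow> (real^3) set) \<Rightarrow> bool" where
  "generic_disc \<Phi> \<longleftrightarrow> generic_map (cball 0 1) (\<lambda>s. UNIV) \<Phi>"

definition contractible_loop :: "(complex \<Rightarrow> (real^3) set) \<Rightarrow> bool" where
  "contractible_loop l \<longleftrightarrow>
     (\<exists>K. homotopic_with (\<lambda>_. True) (top_of_set (sphere 0 1)) M1 l (\<lambda>_. K))"

end

(* Antiparallel self-tangencies carry an obstruction.  Suppose that a generic disc bounded by the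
   loop has no star-like triple crossing.  Then no antiparallel self-tangency occurs on a third
   branch: by transversality the unfolding of such a diagram contains star-like triple crossings.
   By compactness no third branch passes through a nearly antiparallel positive crossing either.
   For a double point f a = f b with a < b and no further branch, the turning of the chord from f b
   to f t against the tangent at f t, for t > b, ends at a locally constant multiple of the full
   turn.  Let W be the sum, over the nearly antiparallel positive crossings for which it is not 0,
   of a weight that decreases from 1 at a tangency to 0 at a fixed angle.  A tangency creates or
   cancels crossings of weight near 1, so W is continuous modulo 1 on the disc, and continuous
   wherever there is no antiparallel tangency of nonzero turning.  On the boundary of the disc this
   forces the total jump of W to vanish.

   The loop s is a plane curve (x, y) with x = (t^3 - 3 t) / 6 in its knotted part and y affine in
   s in the unit disc; it bounds a disc of long knots for that reason.  Its triple crossings are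
   those at s = 1 and s = -1, and these are braid-like.  Its diagrams have antiparallel tangencies
   of nonzero turning for exactly one s, where W jumps by 1. *)

theory Submission
 imports Defs "HOL-Complex_Analysis.Complex_Analysis"
begin

text \<open>Antiparallel tangencies may be born and cancelled inside a disc, so they need a label
  that survives. The turning is one: it changes only when a later branch runs through the double
  point, and this is what a disc without star-like triple crossings forbids near a tangency.
  Star-likeness enters through signs: if two of three tangents are opposite, their determinants with
  the third, taken in cyclic order, agree in sign, and a first-order unfolding that is onto lets the
  remaining determinant take this sign too, which makes the directions positively dependent. Jumps
  are integral because a crossing that appears or disappears at a tangency has weight 1 there. The
  cubic x reduces double points to zeros of one function \<open>disc\<close> of the sum of the two
  parameters. Diagrams with \<open>g = 0\<close> have a triple point at 0 and plus or minus
  \<open>sqrt 3\<close>, star-like for |K| below \<open>sqrt 3 / 6\<close> and braid-like above. The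
  loop is the ellipse with semi-axes 2/5 in \<open>K\<close> and 1/10 in \<open>g\<close>; since 2/5
  exceeds \<open>sqrt 3 / 6\<close>, it meets braid-like triple points only and surrounds the
  star-like ones.\<close>

abbreviation (input) slice :: "('a * real => 'b) => 'a => real => 'b" where "slice F s == %t. F (s, t)"

section \<open>Calculus of smooth maps\<close>

lemma C_times_SucI:
 assumes "!!x. (f has_derivative f' x) (at x)" "!!v. C_times k (%x. f' x v)"
 shows "C_times (Suc k) f"
proof -
 have "frechet_derivative f (at x) = f' x" for x
  using frechet_derivative_at[OF assms(1)] by simp
 then show ?thesis
  using assms by (auto simp: differentiable_def)
qed

lemma C_times_SucD:
 assumes "C_times (Suc k) f"
 shows "(f has_derivative frechet_derivative f (at x)) (at x)"
  "C_times k (%x. frechet_derivative f (at x) v)"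
 using assms by (auto simp: frechet_derivative_works)

lemma C_times_decr: "C_times (Suc k) f ==> C_times k f"
proof (induction k arbitrary: f)
 case 0
 then show ?case
  by (simp add: continuous_on_eq_continuous_at differentiable_imp_continuous_within)
next
 case (Suc k)
 have "C_times k (%x. frechet_derivative f (at x) v)" for v
  using Suc.prems by (intro Suc.IH) simp
 then show ?case using Suc.prems by simp
qed

lemma C_times_const [simp]: "C_times k (%x. c)"
proof (induction k arbitrary: c)
 case 0
 show ?case by simp
next
 case (Suc k)
 have "((%x. c) has_derivative (%v. 0)) (at x)" for x :: 'a
  by (rule has_derivative_const)
 then show ?case by (rule C_times_SucI) (rule Suc.IH)
qed

lemma C_times_linear:
 assumes "bounded_linear h" shows "C_times k h"
proof (cases k)
 case 0
 then show ?thesis using assms by (simp add: linear_continuous_on)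
next
 case (Suc j)
 then show ?thesis
  using C_times_SucI[of h "%x. h" j] bounded_linear_imp_has_derivative[OF assms] by simp
qed

lemma C_times_bounded_linear:
 assumes h: "bounded_linear h" and f: "C_times k f"
 shows "C_times k (%x. h (f x))"
 using f
proof (induction k arbitrary: f)
 case 0
 then have "continuous_on UNIV (%x. h (f x))"
  by (intro bounded_linear.continuous_on[OF h]) simp
 then show ?case by simp
next
 case (Suc k)
 show ?case
  by (rule C_times_SucI[OF bounded_linear.has_derivative[OF h C_times_SucD(1)[OF Suc.prems]]])
   (rule Suc.IH[OF C_times_SucD(2)[OF Suc.prems]])
qed

lemma C_times_add:
 assumes "C_times k f" "C_times k g"
 shows "C_times k (%x. f x + g x)"
 using assms
proof (induction k arbitrary: f g)
 case 0
 then show ?case by (simp add: continuous_on_add)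
next
 case (Suc k)
 show ?case
  by (rule C_times_SucI[OF has_derivative_add[OF C_times_SucD(1)[OF Suc.prems(1)] C_times_SucD(1)[OF Suc.prems(2)]]])
   (rule Suc.IH[OF C_times_SucD(2)[OF Suc.prems(1)] C_times_SucD(2)[OF Suc.prems(2)]])
qed

text \<open>Leibniz rule: each summand of the derivative contains one undifferentiated factor, whose
  order is lowered by \<open>C_times_decr\<close>. Products, scalings and inner products are
  instances.\<close>

lemma C_times_bilinear:
 assumes pr: "bounded_bilinear B" and "C_times k f" "C_times k g"
 shows "C_times k (%x. B (f x) (g x))"
 using assms(2,3)
proof (induction k arbitrary: f g)
 case 0
 then show ?case by (simp add: bounded_bilinear.continuous_on[OF pr])
next
 case (Suc k)
 note D = C_times_SucD[OF Suc.prems(1)] C_times_SucD[OF Suc.prems(2)]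
 show ?case
  by (rule C_times_SucI[OF bounded_bilinear.FDERIV[OF pr D(1) D(3)]])
   (intro C_times_add Suc.IH D C_times_decr[OF Suc.prems(1)] C_times_decr[OF Suc.prems(2)])
qed

lemma velocity_eq_frechet:
 fixes f :: "real => 'b::real_normed_vector"
 assumes "f differentiable (at x)"
 shows "velocity f x = frechet_derivative f (at x) 1"
proof -
 have "frechet_derivative f (at x) = (%v. v *\<^sub>R frechet_derivative f (at x) 1)"
  by (rule ext) (rule linear_cmul[OF linear_frechet_derivative[OF assms], of _ 1, unfolded real_scaleR_def mult_1_right])
 moreover have "(f has_derivative frechet_derivative f (at x)) (at x)"
  using assms unfolding frechet_derivative_works .
 ultimately have "(f has_derivative (%v. v *\<^sub>R frechet_derivative f (at x) 1)) (at x)"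
  by (rule subst[where P = "%D. (f has_derivative D) (at x)"])
 then have "(f has_vector_derivative frechet_derivative f (at x) 1) (at x)"
  unfolding has_vector_derivative_def .
 then show ?thesis unfolding velocity_def by (rule vector_derivative_at)
qed

lemma C_times_velocity:
 fixes f :: "real => 'b::real_normed_vector"
 assumes "C_times (Suc k) f"
 shows "C_times k (velocity f)" "(f has_vector_derivative velocity f x) (at x)"
proof -
 have d: "f differentiable (at x)" for x
  using assms by simp
 then have "velocity f = (%x. frechet_derivative f (at x) 1)"
  using velocity_eq_frechet by blast
 then show "C_times k (velocity f)" using assms by simp
 show "(f has_vector_derivative velocity f x) (at x)"
  using d[of x] unfolding velocity_def by (simp add: vector_derivative_works)
qed

lemma C_times_Suc_real:
 fixes f :: "real => 'b::real_normed_vector"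
 assumes "!!x. (f has_vector_derivative f' x) (at x)" "C_times k f'"
 shows "C_times (Suc k) f"
proof (rule C_times_SucI)
 show "(f has_derivative (%v. v *\<^sub>R f' x)) (at x)" for x
  using assms(1) by (simp add: has_vector_derivative_def)
 show "C_times k (%x. v *\<^sub>R f' x)" for v
  by (rule C_times_bounded_linear[OF bounded_linear_scaleR_right assms(2)])
qed

text \<open>With a real-valued inner function the chain rule is a scaling of
  \<open>velocity f\<close> at \<open>g x\<close>, so the induction on the order closes up with the
  product rule.\<close>

lemma C_times_compose:
 fixes f :: "real => 'b::real_normed_vector" and g :: "'a::euclidean_space => real"
 assumes "C_times k f" "C_times k g"
 shows "C_times k (%x. f (g x))"
 using assms
proof (induction k arbitrary: f)
 case 0
 then have "continuous_on UNIV f" "continuous_on UNIV g" by simp_all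
 then have "continuous_on UNIV (%x. f (g x))" by (rule continuous_on_compose2) simp
 then show ?case by simp
next
 case (Suc k)
 have d: "((%x. f (g x)) has_derivative (%v. frechet_derivative g (at x) v *\<^sub>R velocity f (g x))) (at x)" for x
  using has_derivative_compose[OF C_times_SucD(1)[OF Suc.prems(2)]
    C_times_velocity(2)[OF Suc.prems(1), unfolded has_vector_derivative_def]] .
 show ?case
  by (rule C_times_SucI[OF d])
   (intro C_times_bilinear[OF bounded_bilinear_scaleR] C_times_SucD(2)[OF Suc.prems(2)]
    Suc.IH C_times_velocity(1)[OF Suc.prems(1)] C_times_decr[OF Suc.prems(2)])
qed

lemma C_times_inverse:
 fixes g :: "'a::euclidean_space => real"
 assumes "C_times k g" "!!x. g x ~= 0"
 shows "C_times k (%x. inverse (g x))"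
 using assms(1)
proof (induction k)
 case 0
 then show ?case using assms(2) by (simp add: continuous_on_inverse)
next
 case (Suc k)
 show ?case
  by (rule C_times_SucI[OF Deriv.has_derivative_inverse[OF assms(2) C_times_SucD(1)[OF Suc.prems]]])
   (intro C_times_bounded_linear[OF bounded_linear_minus[OF bounded_linear_ident]]
    C_times_bilinear[OF bounded_bilinear_mult] Suc.IH C_times_SucD(2)[OF Suc.prems]
    C_times_decr[OF Suc.prems])
qed

lemma smooth_const [simp]: "smooth (%x. c)"
 by (simp add: smooth_def)

lemma smooth_linear: "bounded_linear h ==> smooth h"
 by (simp add: smooth_def C_times_linear)

lemma smooth_bounded_linear: "bounded_linear h ==> smooth f ==> smooth (%x. h (f x))"
 by (simp add: smooth_def C_times_bounded_linear)

lemma smooth_add: "smooth f ==> smooth g ==> smooth (%x. f x + g x)"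
 by (simp add: smooth_def C_times_add)

lemma smooth_bilinear:
 "bounded_bilinear B ==> smooth f ==> smooth g ==> smooth (%x. B (f x) (g x))"
 by (simp add: smooth_def C_times_bilinear)

lemmas smooth_mult = smooth_bilinear[OF bounded_bilinear_mult]
lemmas smooth_scaleR = smooth_bilinear[OF bounded_bilinear_scaleR]
lemmas smooth_minus = smooth_bounded_linear[OF bounded_linear_minus[OF bounded_linear_ident]]

lemma smooth_diff: "smooth f ==> smooth g ==> smooth (%x. f x - g x)"
 using smooth_add[of f "%x. - g x"] smooth_minus[of g] by simp

lemma smooth_compose:
 fixes f :: "real => 'b::real_normed_vector" and g :: "'a::euclidean_space => real"
 shows "smooth f ==> smooth g ==> smooth (%x. f (g x))"
 by (simp add: smooth_def C_times_compose)

lemma smooth_inverse: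
 fixes g :: "'a::euclidean_space => real"
 shows "smooth g ==> (!!x. g x ~= 0) ==> smooth (%x. inverse (g x))"
 by (simp add: smooth_def C_times_inverse)

lemma smooth_power:
 fixes g :: "'a::euclidean_space => real"
 shows "smooth g ==> smooth (%x. g x ^ n)"
 by (induction n) (simp_all add: smooth_mult)

lemma smooth_ident: "smooth (%x. x)"
 using smooth_linear[OF bounded_linear_ident] by simp

lemmas smooth_fst = smooth_linear[OF bounded_linear_fst]
lemmas smooth_snd = smooth_linear[OF bounded_linear_snd]

lemma smooth_continuous: "smooth f ==> continuous_on A f"
 using C_times.simps(1)[of f] continuous_on_subset[of UNIV f A] unfolding smooth_def by blast

lemma smooth_has_derivative: "smooth f ==> (f has_derivative frechet_derivative f (at x)) (at x)"
 using C_times_SucD(1)[of 0 f] unfolding smooth_def by blast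

lemma smooth_frechet: "smooth f ==> smooth (%x. frechet_derivative f (at x) v)"
 using C_times_SucD(2)[of _ f] unfolding smooth_def by blast

lemma smooth_velocity:
 fixes f :: "real => 'b::real_normed_vector"
 shows "smooth f ==> smooth (velocity f)"
  and "smooth f ==> (f has_vector_derivative velocity f x) (at x)"
 unfolding smooth_def using C_times_velocity(1)[of _ f] C_times_velocity(2)[of 0 f] by blast+

section \<open>Flat functions, smooth steps and bumps\<close>

definition flat_fun :: "real poly => real => real" where
 "flat_fun p x = (if x > 0 then poly p (1/x) * exp (- 1/x) else 0)"

lemma poly_times_exp_minus: "((%u::real. poly p u * exp (- u)) \<longlongrightarrow> 0) at_top"
proof -
 have "((%u::real. \<Sum>i\<le>degree p. coeff p i * (u ^ i / exp u)) \<longlongrightarrow> (\<Sum>i\<le>degree p. coeff p i * 0)) at_top"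
  by (intro tendsto_intros tendsto_power_div_exp_0)
 then show ?thesis
  by (simp add: poly_altdef sum_distrib_right exp_minus divide_inverse mult.assoc)
qed

lemma flat_fun_tendsto_0: "(flat_fun p \<longlongrightarrow> 0) (at 0)"
proof (rule filterlim_split_at_real)
 show "(flat_fun p \<longlongrightarrow> 0) (at_left 0)"
  by (rule tendsto_eventually, rule eventually_at_leftI[of "-1"]) (auto simp: flat_fun_def)
 have "((%x. poly p (inverse x) * exp (- inverse x)) \<longlongrightarrow> 0) (at_right (0::real))"
  by (rule filterlim_compose[OF poly_times_exp_minus filterlim_inverse_at_top_right])
 then show "(flat_fun p \<longlongrightarrow> 0) (at_right 0)"
  by (rule Lim_transform_eventually)
   (rule eventually_at_rightI[of 0 1], auto simp: flat_fun_def inverse_eq_divide)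
qed

text \<open>This family of functions is closed under differentiation: differentiating
  \<open>p(1/x) exp(-1/x)\<close> brings down \<open>1/x^2\<close> and replaces \<open>p\<close> by
  \<open>p - pderiv p\<close>. Smoothness of all members then follows by one induction.\<close>

lemma flat_fun_deriv:
 "(flat_fun p has_real_derivative flat_fun ([:0,0,1:] * (p - pderiv p)) x) (at x)"
proof -
 consider "x > 0" | "x < 0" | "x = 0" by linarith
 then show ?thesis
 proof cases
  case 1
  have "((%x. poly p (1/x) * exp (- 1/x)) has_real_derivative
    flat_fun ([:0,0,1:] * (p - pderiv p)) x) (at x)"
   using 1 by (auto intro!: derivative_eq_intros DERIV_chain2[OF poly_DERIV]
     simp: flat_fun_def field_simps power2_eq_square)
  then show ?thesis
   by (rule has_field_derivative_transform_within_open[of _ _ _ "{0<..}"])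
    (use 1 in \<open>auto simp: flat_fun_def\<close>)
 next
  case 2
  have "flat_fun ([:0,0,1:] * (p - pderiv p)) x = 0" using 2 by (simp add: flat_fun_def)
  moreover have "(flat_fun p has_real_derivative 0) (at x)"
   by (rule has_field_derivative_transform_within_open[of "%x. 0" _ _ "{..<0}"])
    (use 2 in \<open>auto simp: flat_fun_def\<close>)
  ultimately show ?thesis by (simp only:)
 next
  case 3
  \<comment> \<open>At 0 the difference quotient is \<open>flat_fun ([:0,1:] * p)\<close>, which
    tends to 0 as well.\<close>
  have "((%h. (flat_fun p (0 + h) - flat_fun p 0) / h) \<longlongrightarrow> 0) (at 0)"
   by (rule Lim_transform_eventually[OF flat_fun_tendsto_0[of "[:0,1:] * p"]])
    (auto simp: flat_fun_def eventually_at_filter)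
  then show ?thesis
   using 3 by (simp add: DERIV_def flat_fun_def)
 qed
qed

lemma smooth_flat_fun: "smooth (flat_fun p)"
proof -
 have "C_times k (flat_fun p)" for k
 proof (induction k arbitrary: p)
  case 0
  show ?case
   using flat_fun_deriv[THEN DERIV_isCont] by (simp add: continuous_at_imp_continuous_on)
 next
  case (Suc k)
  show ?case
   by (rule C_times_Suc_real[OF _ Suc.IH])
    (use flat_fun_deriv has_real_derivative_iff_has_vector_derivative in blast)
 qed
 then show ?thesis by (simp add: smooth_def)
qed

definition smooth_step :: "real => real" where
 "smooth_step x = flat_fun 1 x / (flat_fun 1 x + flat_fun 1 (1 - x))"

lemma flat_fun_1: "flat_fun 1 x >= 0" "x > 0 ==> flat_fun 1 x > 0" "x <= 0 ==> flat_fun 1 x = 0"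
 by (auto simp: flat_fun_def)

lemma flat_fun_1_mono: "x <= y ==> flat_fun 1 x <= flat_fun 1 y"
 by (auto simp: flat_fun_def field_simps)

lemma smooth_step_denom: "flat_fun 1 x + flat_fun 1 (1 - x) > 0"
 using flat_fun_1[of x] flat_fun_1[of "1 - x"] by (cases "x > 0") (auto intro: add_pos_nonneg add_nonneg_pos)

lemma smooth_smooth_step: "smooth smooth_step"
proof -
 have "smooth (%x. flat_fun 1 x * inverse (flat_fun 1 x + flat_fun 1 (1 - x)))"
  by (intro smooth_mult smooth_inverse smooth_add smooth_flat_fun smooth_compose[of "flat_fun 1"] smooth_diff smooth_const smooth_ident)
   (use smooth_step_denom less_irrefl in metis)
 then show ?thesis
  by (simp add: smooth_step_def[abs_def] divide_inverse)
qed

lemma smooth_step_simps: "x <= 0 ==> smooth_step x = 0" "x >= 1 ==> smooth_step x = 1"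
 and smooth_step_range: "0 <= smooth_step x" "smooth_step x <= 1"
 using smooth_step_denom[of x] flat_fun_1[of x] flat_fun_1[of "1 - x"]
 by (auto simp: smooth_step_def field_simps)

lemma smooth_step_mono: "x <= y ==> smooth_step x <= smooth_step y"
proof -
 assume "x <= y"
 then have "flat_fun 1 x * flat_fun 1 (1 - y) <= flat_fun 1 y * flat_fun 1 (1 - x)"
  by (intro mult_mono flat_fun_1_mono flat_fun_1(1)) auto
 then show ?thesis
  using smooth_step_denom[of x] smooth_step_denom[of y]
  by (simp add: smooth_step_def pos_divide_le_eq pos_le_divide_eq) (simp add: algebra_simps)
qed

text \<open>The factor 2 makes the bump equal to 1 near its centre.\<close>

definition bump :: "real => real => real => real" where
 "bump a r t = smooth_step (2 * (1 - ((t - a) / r)\<^sup>2))"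

lemma smooth_bump: "smooth (bump a r)"
proof -
 have "smooth (%t. smooth_step (2 * (1 - ((t - a) * inverse r) ^ 2)))"
  by (intro smooth_compose[OF smooth_smooth_step] smooth_mult smooth_diff smooth_power smooth_const smooth_ident)
 then show ?thesis by (simp add: bump_def[abs_def] divide_inverse)
qed

lemma bump_outside: "r > 0 ==> \<bar>t - a\<bar> >= r ==> bump a r t = 0"
 unfolding bump_def
 using abs_le_square_iff[of r "t - a"]
 by (intro smooth_step_simps(1)) (simp add: power_divide pos_le_divide_eq)

lemma bump_inside: "r > 0 ==> \<bar>t - a\<bar> <= r / 2 ==> bump a r t = 1"
proof -
 assume r: "r > 0" and "abs (t - a) <= r / 2"
 then have "(t - a)\<^sup>2 <= (r/2)\<^sup>2" by (simp add: abs_le_square_iff[symmetric])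
 then have "(t - a)\<^sup>2 * 4 <= r\<^sup>2" by (simp add: power2_eq_square)
 then have "((t - a) / r)\<^sup>2 <= 1/4" using r by (simp add: power_divide divide_simps)
 then show ?thesis unfolding bump_def by (intro smooth_step_simps(2)) simp
qed

section \<open>Planar projections and the cross product\<close>

text \<open>The plane is taken as \<open>complex\<close> so that conjugation, multiplication by
  \<open>\<i>\<close> and arguments are at hand; this is \<open>pr\<close> up to that
  identification.\<close>

definition pz :: "real^3 => complex" where
 "pz x = Complex (x$1) (x$2)"

text \<open>The determinant of two plane vectors, positive when the second lies counterclockwise of
  the first.\<close>

definition crs :: "complex => complex => real" where
 "crs z w = Re z * Im w - Im z * Re w"

lemma pz_simps [simp]: "Re (pz x) = x$1" "Im (pz x) = x$2"
 by (simp_all add: pz_def)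

lemma bounded_linear_pz: "bounded_linear pz"
 unfolding linear_conv_bounded_linear[symmetric]
 by (rule linearI) (simp_all add: complex_eq_iff)

lemma pz_linear [simp]: "pz (x + y) = pz x + pz y" "pz (x - y) = pz x - pz y"
 "pz (c *\<^sub>R x) = c *\<^sub>R pz x" "pz 0 = 0" "pz (- x) = - pz x"
 by (simp_all add: complex_eq_iff)

lemma pr_nth [simp]: "pr x $ 1 = x$1" "pr x $ 2 = x$2"
 by (simp_all add: pr_def)

lemma bounded_linear_pr: "bounded_linear pr"
 unfolding linear_conv_bounded_linear[symmetric]
 by (rule linearI) (simp_all add: vec_eq_iff forall_2)

lemma norm_pr_diff: "norm (pr x - pr y) = cmod (pz x - pz y)"
 by (simp add: norm_vec_def L2_set_def UNIV_2 cmod_def)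

lemma pr_eq_iff: "pr x = pr y \<longleftrightarrow> pz x = pz y"
 by (simp add: vec_eq_iff forall_2 complex_eq_iff)

lemma crs_linear [simp]:
 "crs (x + y) z = crs x z + crs y z" "crs z (x + y) = crs z x + crs z y"
 "crs (x - y) z = crs x z - crs y z" "crs z (x - y) = crs z x - crs z y"
 "crs (c *\<^sub>R x) y = c * crs x y" "crs x (c *\<^sub>R y) = c * crs x y"
 "crs 0 x = 0" "crs x 0 = 0" "crs x x = 0" "crs (- x) y = - crs x y" "crs x (- y) = - crs x y"
 by (simp_all add: crs_def algebra_simps)

lemma bounded_bilinear_crs: "bounded_bilinear crs"
proof (rule bounded_bilinear.intro)
 show "\<exists>K. \<forall>a b. norm (crs a b) <= norm a * norm b * K"
 proof (intro exI allI)
  fix a b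
  have "abs (crs a b) <= abs (Re a) * abs (Im b) + abs (Im a) * abs (Re b)"
   unfolding crs_def by (metis abs_mult abs_triangle_ineq4)
  also have "\<dots> <= norm a * norm b + norm a * norm b"
   by (intro add_mono mult_mono abs_Re_le_cmod abs_Im_le_cmod) auto
  finally show "norm (crs a b) <= norm a * norm b * 2" by simp
 qed
qed simp_all

lemmas crs_continuous = bounded_bilinear.continuous_on[OF bounded_bilinear_crs]
lemmas crs_tendsto = bounded_bilinear.tendsto[OF bounded_bilinear_crs]

lemma crs_swap: "crs y x = - crs x y"
 by (simp add: crs_def algebra_simps)

lemma crs_eq_0D:
 assumes "crs x y = 0" "y ~= 0"
 obtains c where "x = c *\<^sub>R y"
proof -
 have n: "(Re y)\<^sup>2 + (Im y)\<^sup>2 ~= 0" using assms(2) by (simp add: complex_eq_iff sum_power2_eq_zero_iff)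
 have "x = ((Re x * Re y + Im x * Im y) / ((Re y)\<^sup>2 + (Im y)\<^sup>2)) *\<^sub>R y"
  using assms(1) n
  by (simp add: complex_eq_iff crs_def divide_simps) (auto simp: algebra_simps power2_eq_square)
 then show ?thesis using that by blast
qed

lemma velocity_at: "(f has_vector_derivative v) (at t) ==> velocity f t = v"
 unfolding velocity_def by (rule vector_derivative_at)

lemma velocity_linear:
 assumes "bounded_linear h" "smooth f"
 shows "velocity (%t. h (f t)) = (%t. h (velocity f t))"
 by (rule ext) (rule velocity_at[OF bounded_linear.has_vector_derivative[OF assms(1) smooth_velocity(2)[OF assms(2)]]])

lemma direction_nth: "smooth f ==> direction f t = pr (velocity f t)"
 unfolding direction_def comp_def using velocity_linear[OF bounded_linear_pr] by metis

lemma transversal_iff: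
 assumes "smooth f"
 shows "transversal f a b \<longleftrightarrow> crs (pz (velocity f a)) (pz (velocity f b)) ~= 0"
proof -
 let ?u = "pr (velocity f a)" and ?v = "pr (velocity f b)"
 have e: "u = 0 \<longleftrightarrow> u$1 = 0 & u$2 = 0" for u :: "real^2" by (simp add: vec_eq_iff forall_2)
 have "collinear {0, ?u, ?v} \<longleftrightarrow> crs (pz (velocity f a)) (pz (velocity f b)) = 0"
 proof
  assume "collinear {0, ?u, ?v}"
  then show "crs (pz (velocity f a)) (pz (velocity f b)) = 0"
   unfolding collinear_lemma by (auto simp: e crs_def vec_eq_iff forall_2)
 next
  assume c: "crs (pz (velocity f a)) (pz (velocity f b)) = 0"
  show "collinear {0, ?u, ?v}"
  proof (cases "pz (velocity f a) = 0")
   case True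
   then have "?u = 0" by (simp add: e complex_eq_iff)
   then show ?thesis by (simp add: collinear_lemma)
  next
   case False
   have "crs (pz (velocity f b)) (pz (velocity f a)) = 0" using c crs_swap by (metis neg_0_equal_iff_equal)
   then obtain r where "pz (velocity f b) = r *\<^sub>R pz (velocity f a)" using crs_eq_0D False by blast
   then have "?v = r *\<^sub>R ?u" by (simp add: vec_eq_iff forall_2 complex_eq_iff)
   then show ?thesis by (auto simp: collinear_lemma)
  qed
 qed
 then show ?thesis unfolding transversal_def direction_nth[OF assms] by simp
qed

lemma params_uptoD:
 assumes "f \<in> params_upto R"
 shows "smooth f" "inj f" "velocity f t ~= 0" "pz (velocity f t) ~= 0" "abs t >= R ==> f t = x_axis t"
  "abs t >= R ==> pz (f t) = of_real t"
proof -
 show *: "smooth f" "inj f" "velocity f t ~= 0" "abs t >= R ==> f t = x_axis t"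
  using assms by (auto simp: params_upto_def)
 have "velocity (pr \<circ> f) t ~= 0" using assms by (auto simp: params_upto_def)
 then have "pr (velocity f t) ~= 0"
  using direction_nth[OF *(1), of t] unfolding direction_def by simp
 then show "pz (velocity f t) ~= 0" by (auto simp: vec_eq_iff forall_2 complex_eq_iff)
 show "pz (f t) = of_real t" if "abs t >= R"
  using *(4)[OF that] by (simp add: x_axis_def complex_eq_iff)
qed

lemma params_uptoI:
 assumes "smooth f" "inj f" "!!t. pz (velocity f t) ~= 0" "!!t. abs t >= R ==> f t = x_axis t"
 shows "f \<in> params_upto R"
proof -
 have 1: "velocity f t ~= 0" for t using assms(3)[of t] by auto
 have "pr (velocity f t) ~= 0" for t
  using assms(3)[of t] by (auto simp: vec_eq_iff forall_2 complex_eq_iff)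
 then have 2: "velocity (pr \<circ> f) t ~= 0" for t
  using direction_nth[OF assms(1), of t] unfolding direction_def by simp
 show ?thesis using assms 1 2 by (auto simp: params_upto_def)
qed

lemma params_upto_mono: "f \<in> params_upto R ==> R <= R' ==> f \<in> params_upto R'"
 by (auto simp: params_upto_def)

lemma params_upto_params: "f \<in> params_upto R ==> f \<in> params"
 by (auto simp: params_def)

section \<open>Reparametrization\<close>

text \<open>The inverse is carried along, so that symmetry costs only the derivative of the inverse
  and each invariance has to be proved in one direction.\<close>

definition is_reparam :: "(real => real) => (real => real) => (real => real^3) => (real => real^3) => bool" where
 "is_reparam phi theta f g \<longleftrightarrow> smooth phi & smooth theta & (\<forall>t. theta (phi t) = t) & (\<forall>t. phi (theta t) = t) &
  (\<forall>t. velocity phi t > 0) & smooth f & smooth g & (\<forall>t. f t = g (phi t))"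

text \<open>The candidate \<open>inv g\<close> after \<open>f\<close> is the identity beyond
  \<open>R\<close>, and on the compact interval it is continuous because a continuous injection of a
  compact set has a continuous inverse. Its derivative is found by projecting to the tangent of
  \<open>g\<close>; smoothness is a bootstrap, since \<open>phi'\<close> is an expression in
  \<open>velocity f\<close>, \<open>velocity g\<close> and \<open>phi\<close> itself.\<close>

lemma reparam_one:
 assumes f: "f \<in> params_upto R" and g: "g \<in> params_upto R" and R: "R > 0" and r: "range f = range g"
 obtains phi where "smooth phi" "!!t. f t = g (phi t)" "!!t. velocity phi t > 0"
proof -
 define phi where "phi = (%t. inv g (f t))"
 have gphi: "g (phi t) = f t" for t
  unfolding phi_def by (rule f_inv_into_f) (use r in blast)
 have out: "phi t = t" if "abs t >= R" for t
  using gphi[of t] params_uptoD(5)[OF f that] params_uptoD(5)[OF g that] params_uptoD(2)[OF g]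
  by (metis injD)
 have inn: "abs (phi t) <= R" if "abs t <= R" for t
 proof (rule ccontr)
  assume "~ abs (phi t) <= R"
  then have "f (phi t) = f t"
   using gphi[of t] params_uptoD(5)[OF f, of "phi t"] params_uptoD(5)[OF g, of "phi t"] by simp
  then have "phi t = t" using params_uptoD(2)[OF f] by (metis injD)
  then show False using \<open>~ abs (phi t) <= R\<close> that by simp
 qed
 have cg: "continuous_on A g" and cf: "continuous_on A f" for A
  using smooth_continuous params_uptoD(1) f g by blast+
 have cinv: "continuous_on (g ` {-R..R}) (inv g)"
  by (rule continuous_on_inv[OF cg]) (auto simp: params_uptoD(2)[OF g])
 have "continuous_on {-R..R} phi"
  unfolding phi_def
 proof (rule continuous_on_compose2[OF cinv cf])
  show "f ` {-R..R} \<subseteq> g ` {-R..R}"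
  proof
   fix x assume "x \<in> f ` {-R..R}"
   then obtain t where "x = f t" "abs t <= R" by (auto simp: abs_le_iff)
   then show "x \<in> g ` {-R..R}" using gphi[of t] inn[of t] by (intro image_eqI[of _ _ "phi t"]) auto
  qed
 qed
 moreover have "continuous_on ({..-R} \<union> {R..}) phi"
  by (rule continuous_on_eq[OF continuous_on_id]) (use out R in auto)
 ultimately have "continuous_on ({-R..R} \<union> ({..-R} \<union> {R..})) phi"
  by (rule continuous_on_closed_Un[rotated 2]) auto
 moreover have "{-R..R} \<union> ({..-R} \<union> {R..}) = UNIV" by auto
 ultimately have cphi: "continuous_on UNIV phi" by simp
 then have iphi: "isCont phi t" for t by (simp add: continuous_on_eq_continuous_at)
 define phi' where "phi' t = (velocity f t \<bullet> velocity g (phi t)) * inverse (velocity g (phi t) \<bullet> velocity g (phi t))" for t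
 have der: "(phi has_real_derivative phi' t) (at t)" for t
 proof -
  \<comment> \<open>Pairing with the tangent \<open>T\<close> at the image point makes
    \<open>g\<close> a real function with nonzero derivative there; its Caratheodory slope
    \<open>k\<close> can be divided out of the difference quotient of \<open>f\<close>, which leaves
    that of \<open>phi\<close>.\<close>
  define T where "T = velocity g (phi t)"
  have Tn: "T \<bullet> T ~= 0" using params_uptoD(3)[OF g] by (simp add: T_def)
  have "((%u. g u \<bullet> T) has_real_derivative T \<bullet> T) (at (phi t))"
   using bounded_linear.has_vector_derivative[OF bounded_linear_inner_left smooth_velocity(2)[OF params_uptoD(1)[OF g]], of T "phi t"]
   by (simp add: has_real_derivative_iff_has_vector_derivative T_def)
  then obtain k where k: "!!z. g z \<bullet> T - g (phi t) \<bullet> T = k z * (z - phi t)" "isCont k (phi t)" "k (phi t) = T \<bullet> T"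
   unfolding CARAT_DERIV by blast
  have "((%u. f u \<bullet> T) has_real_derivative velocity f t \<bullet> T) (at t)"
   using bounded_linear.has_vector_derivative[OF bounded_linear_inner_left smooth_velocity(2)[OF params_uptoD(1)[OF f]], of T t]
   by (simp add: has_real_derivative_iff_has_vector_derivative)
  then have lim: "((%u. (f u \<bullet> T - f t \<bullet> T) / (u - t)) \<longlongrightarrow> velocity f t \<bullet> T) (at t)"
   by (simp add: has_field_derivative_iff)
  have kl: "((%u. k (phi u)) \<longlongrightarrow> T \<bullet> T) (at t)"
   using isCont_o2[OF iphi k(2)] k(3) by (simp add: isCont_def)
  have "((%u. (f u \<bullet> T - f t \<bullet> T) / (u - t) / k (phi u)) \<longlongrightarrow> velocity f t \<bullet> T / (T \<bullet> T)) (at t)"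
   by (intro tendsto_divide lim kl Tn)
  moreover have "\<forall>\<^sub>F u in at t. k (phi u) ~= 0"
   using tendsto_imp_eventually_ne[OF kl Tn] .
  then have "\<forall>\<^sub>F u in at t. (f u \<bullet> T - f t \<bullet> T) / (u - t) / k (phi u) = (phi u - phi t) / (u - t)"
  proof eventually_elim
   case (elim u)
   show ?case using k(1)[of "phi u"] elim by (simp add: gphi)
  qed
  ultimately have "((%u. (phi u - phi t) / (u - t)) \<longlongrightarrow> velocity f t \<bullet> T / (T \<bullet> T)) (at t)"
   by (rule Lim_transform_eventually)
  then show ?thesis by (simp add: has_field_derivative_iff phi'_def T_def divide_inverse)
 qed
 then have derv: "(phi has_vector_derivative phi' t) (at t)" for t
  by (simp add: has_real_derivative_iff_has_vector_derivative)
 have "C_times k phi" for k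
 proof (induction k)
  case 0
  then show ?case using cphi by simp
 next
  case (Suc k)
  have vg: "C_times k (%t. velocity g (phi t))"
   using C_times_compose[OF _ Suc, of "velocity g"] smooth_velocity(1)[OF params_uptoD(1)[OF g]]
   by (simp add: smooth_def)
  have vf: "C_times k (velocity f)" using smooth_velocity(1)[OF params_uptoD(1)[OF f]] by (simp add: smooth_def)
  have "C_times k phi'"
   unfolding phi'_def[abs_def]
   by (intro C_times_bilinear[OF bounded_bilinear_mult] C_times_inverse
     C_times_bilinear[OF bounded_bilinear_inner] vf vg) (simp add: params_uptoD(3)[OF g])
  then show ?case by (rule C_times_Suc_real[OF derv])
 qed
 then have sm: "smooth phi" by (simp add: smooth_def)
 have vphi: "velocity phi = phi'" using velocity_at[OF derv] by blast
 have nz: "phi' t ~= 0" for t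
 proof
  assume "phi' t = 0"
  then have "(phi has_vector_derivative 0) (at t)" using derv[of t] by simp
  then have "((g \<circ> phi) has_vector_derivative 0 *\<^sub>R velocity g (phi t)) (at t)"
   by (rule vector_diff_chain_at[OF _ smooth_velocity(2)[OF params_uptoD(1)[OF g]]])
  moreover have "g \<circ> phi = f" using gphi by auto
  ultimately have "velocity f t = 0" using velocity_at[of f "0 *\<^sub>R velocity g (phi t)" t] by simp
  then show False using params_uptoD(3)[OF f] by blast
 qed
 \<comment> \<open>Beyond \<open>R\<close> the derivative is 1; being continuous and nowhere 0, it
   is positive everywhere, so both parametrizations run in the same direction.\<close>
 have one: "phi' (R + 1) = 1"
 proof -
  have "((%t. t) has_vector_derivative 1) (at (R+1))" by simp
  then have "(phi has_vector_derivative 1) (at (R+1))"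
   by (rule has_vector_derivative_transform_within_open[of _ _ _ "{R<..}"]) (use out R in auto)
  then show ?thesis using derv[of "R+1"] vector_derivative_unique_at by blast
 qed
 have "phi' t > 0" for t
 proof (rule ccontr)
  assume "~ phi' t > 0"
  then have "phi' t <= 0" by simp
  moreover have "connected (range phi')"
   using smooth_continuous[OF smooth_velocity(1)[OF sm], of UNIV] vphi
   by (intro connected_continuous_image) auto
  ultimately have "0 \<in> range phi'"
   using one connectedD_interval[of "range phi'" "phi' t" "phi' (R+1)" 0] by auto
  then show False using nz by auto
 qed
 then have "velocity phi t > 0" for t by (simp add: vphi)
 then show ?thesis using that[of phi] sm gphi by simp
qed

lemma reparam_exists:
 assumes "f \<in> params" "g \<in> params" and r: "range f = range g"
 obtains phi theta where "is_reparam phi theta f g"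
proof -
 obtain R1 R2 where "f \<in> params_upto R1" "g \<in> params_upto R2" using assms by (auto simp: params_def)
 then have fg: "f \<in> params_upto (max 1 (max R1 R2))" "g \<in> params_upto (max 1 (max R1 R2))"
  by (auto elim: params_upto_mono)
 obtain phi where p: "smooth phi" "!!t. f t = g (phi t)" "!!t. velocity phi t > 0"
  by (rule reparam_one[OF fg _ r]) auto
 obtain theta where c: "smooth theta" "!!t. g t = f (theta t)"
  by (rule reparam_one[OF fg(2,1) _ r[symmetric]]) auto
 have "theta (phi t) = t" for t
 proof -
  have "f (theta (phi t)) = f t" using p(2) c(2) by metis
  then show ?thesis using params_uptoD(2)[OF fg(1)] by (metis injD)
 qed
 moreover have "phi (theta t) = t" for t
 proof -
  have "g (phi (theta t)) = g t" using p(2) c(2) by metis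
  then show ?thesis using params_uptoD(2)[OF fg(2)] by (metis injD)
 qed
 ultimately have "is_reparam phi theta f g"
  using p c params_uptoD(1)[OF fg(1)] params_uptoD(1)[OF fg(2)] by (simp add: is_reparam_def)
 then show ?thesis using that by blast
qed

context
 fixes phi theta f g
 assumes rp: "is_reparam phi theta f g"
begin

lemma reparam_inverse [simp]: "theta (phi t) = t" "phi (theta t) = t"
 using rp by (auto simp: is_reparam_def)

lemma reparam_eq: "f t = g (phi t)"
 using rp by (auto simp: is_reparam_def)

lemma reparam_pos: "velocity phi t > 0"
 using rp by (auto simp: is_reparam_def)

lemma reparam_smooth: "smooth phi" "smooth theta" "smooth f" "smooth g"
 using rp by (auto simp: is_reparam_def)

lemma reparam_inj [simp]: "phi a = phi b \<longleftrightarrow> a = b"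
 by (metis reparam_inverse(1))

lemma reparam_less [simp]: "phi a < phi b \<longleftrightarrow> a < b"
proof -
 have "phi a < phi b" if "a < b" for a b
 proof (rule DERIV_pos_imp_increasing[OF that])
  show "\<exists>y. (phi has_real_derivative y) (at x) & 0 < y" for x
   using smooth_velocity(2)[OF reparam_smooth(1)] reparam_pos
   by (auto simp: has_real_derivative_iff_has_vector_derivative)
 qed
 then show ?thesis by (metis less_asym linorder_neqE_linordered_idom)
qed

lemma reparam_velocity: "velocity f t = velocity phi t *\<^sub>R velocity g (phi t)"
proof -
 have "((g \<circ> phi) has_vector_derivative velocity phi t *\<^sub>R velocity g (phi t)) (at t)"
  by (rule vector_diff_chain_at) (auto intro: smooth_velocity reparam_smooth)
 moreover have "g \<circ> phi = f" using reparam_eq by auto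
 ultimately show ?thesis using velocity_at by metis
qed

lemma reparam_branches: "t \<in> branches f q \<longleftrightarrow> phi t \<in> branches g q"
 by (simp add: branches_def reparam_eq)

lemma reparam_branches_image: "branches g q = phi ` branches f q"
proof -
 have "t \<in> phi ` branches f q" if "t \<in> branches g q" for t
  using that reparam_branches[of "theta t"] by (intro image_eqI[of _ _ "theta t"]) auto
 then show ?thesis using reparam_branches by blast
qed

lemma reparam_inj_on: "inj_on phi A"
 by (simp add: inj_on_def)

lemma reparam_transversal: "transversal f a b \<longleftrightarrow> transversal g (phi a) (phi b)"
 using reparam_pos[of a] reparam_pos[of b]
 by (simp add: transversal_iff reparam_smooth reparam_velocity)

lemma reparam_direction: "direction f t = velocity phi t *\<^sub>R direction g (phi t)"
 by (simp add: direction_nth reparam_smooth reparam_velocity vec_eq_iff forall_2)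

lemma reparam_multi_crossing: "multi_crossing n f q \<longleftrightarrow> multi_crossing n g q"
 unfolding multi_crossing_def reparam_branches_image
 by (simp add: finite_image_iff reparam_inj_on card_image pairwise_image reparam_transversal)
  (auto simp: pairwise_def reparam_transversal)

lemma reparam_star: "star_like_triple_crossing f q \<longleftrightarrow> star_like_triple_crossing g q"
 unfolding star_like_triple_crossing_def reparam_multi_crossing reparam_branches_image
 by (simp add: reparam_direction zero_less_mult_iff reparam_pos order_less_imp_not_less)

text \<open>The matching reparametrization \<open>psi\<close> of \<open>g\<close> is conjugated to
  \<open>theta\<close> after \<open>psi\<close> after \<open>phi\<close>. The order of the error
  survives because the difference quotients of \<open>phi\<close> at \<open>a\<close> are
  bounded.\<close>

lemma reparam_contact_ge:
 assumes "contact_ge k g (phi a) (phi b)"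
 shows "contact_ge k f a b"
proof -
 obtain psi C where p: "smooth psi" "psi (phi a) = phi b"
  "\<forall>\<^sub>F t in at (phi a). norm (pr (g t) - pr (g (psi t))) <= C * abs (t - phi a) ^ Suc k"
  using assms by (auto simp: contact_ge_def)
 have d: "(phi has_real_derivative velocity phi a) (at a)"
  using smooth_velocity(2)[OF reparam_smooth(1)] by (simp add: has_real_derivative_iff_has_vector_derivative)
 have "filterlim phi (at (phi a)) (at a)"
  using DERIV_isCont[OF d] by (auto simp: filterlim_at isCont_def eventually_at_filter)
 then have e1: "\<forall>\<^sub>F t in at a. norm (pr (g (phi t)) - pr (g (psi (phi t)))) <= C * abs (phi t - phi a) ^ Suc k"
  by (rule eventually_compose_filterlim[OF p(3)])
 define L where "L = abs (velocity phi a) + 1"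
 have "((%t. abs ((phi t - phi a) / (t - a))) \<longlongrightarrow> \<bar>velocity phi a\<bar>) (at a)"
  using d by (intro tendsto_rabs) (simp add: has_field_derivative_iff)
 then have e2: "\<forall>\<^sub>F t in at a. abs ((phi t - phi a) / (t - a)) < L"
  by (rule order_tendstoD(2)) (simp add: L_def)
 have ne: "\<forall>\<^sub>F t in at a. t ~= a" by (simp add: eventually_at_filter)
 have "\<forall>\<^sub>F t in at a. norm (pr (f t) - pr (f (theta (psi (phi t))))) <= (abs C * L ^ Suc k) * abs (t - a) ^ Suc k"
  using e1 e2 ne
 proof eventually_elim
  case (elim t)
  have "abs (phi t - phi a) <= L * abs (t - a)" using elim(2,3) by (simp add: divide_simps split: if_splits)
  then have "abs (phi t - phi a) ^ Suc k <= (L * abs (t - a)) ^ Suc k" by (intro power_mono) auto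
  then have "C * abs (phi t - phi a) ^ Suc k <= abs C * (L * abs (t - a)) ^ Suc k" by (intro mult_mono) auto
  then show ?case using elim(1) by (simp add: reparam_eq power_mult_distrib mult_ac)
 qed
 moreover have "smooth (%t. theta (psi (phi t)))"
  by (rule smooth_compose[OF reparam_smooth(2) smooth_compose[OF p(1) reparam_smooth(1)]])
 moreover have "theta (psi (phi a)) = b" using p(2) by simp
 ultimately show ?thesis unfolding contact_ge_def by blast
qed

end

lemma reparam_sym:
 assumes "is_reparam phi theta f g" shows "is_reparam theta phi g f"
proof -
 note r = assms
 have ch: "velocity phi (theta t) * velocity theta t = 1" for t
 proof -
  have "((phi \<circ> theta) has_vector_derivative velocity theta t *\<^sub>R velocity phi (theta t)) (at t)"
   by (rule vector_diff_chain_at) (auto intro: smooth_velocity reparam_smooth[OF r])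
  moreover have "phi \<circ> theta = (%t. t)" using reparam_inverse[OF r] by auto
  ultimately have "((%t. t) has_vector_derivative velocity theta t *\<^sub>R velocity phi (theta t)) (at t)" by simp
  then have "velocity (%t. t) t = velocity theta t * velocity phi (theta t)" 
   by (rule velocity_at[THEN trans]) simp
  moreover have "velocity (%t. t) t = (1::real)" by (rule velocity_at) simp
  ultimately show ?thesis by (simp add: mult.commute)
 qed
 have "velocity theta t > 0" for t
  using ch[of t] reparam_pos[OF r, of "theta t"]
  by (metis zero_less_mult_pos zero_less_one)
 moreover have "g t = f (theta t)" for t
  by (rule trans[OF _ reparam_eq[OF r, symmetric]]) (simp only: reparam_inverse(2)[OF r])
 ultimately show ?thesis
  using reparam_smooth[OF r] reparam_inverse[OF r] unfolding is_reparam_def by blast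
qed

lemma reparam_contact_ge_iff:
 assumes "is_reparam phi theta f g"
 shows "contact_ge k f a b \<longleftrightarrow> contact_ge k g (phi a) (phi b)"
 using reparam_contact_ge[OF assms, of k a b] reparam_contact_ge[OF reparam_sym[OF assms], of k "phi a" "phi b"]
 unfolding reparam_inverse(1)[OF assms] by blast

lemma reparam_contact:
 "is_reparam phi theta f g ==> contact k f a b \<longleftrightarrow> contact k g (phi a) (phi b)"
 unfolding contact_def using reparam_contact_ge_iff by metis

lemma reparam_self_tangency1:
 assumes r: "is_reparam phi theta f g" and s: "self_tangency k f q"
 shows "self_tangency k g q"
proof -
 obtain a b where ab: "a ~= b" "branches f q = {a, b}" "contact k f a b"
  using s by (auto simp: self_tangency_def)
 have "branches g q = {phi a, phi b}" by (simp add: reparam_branches_image[OF r] ab(2))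
 then show ?thesis
  unfolding self_tangency_def using ab reparam_contact[OF r, of k a b] reparam_inj[OF r, of a b]
  by (intro exI[of _ "phi a"] exI[of _ "phi b"]) simp
qed

lemma reparam_self_tangency:
 "is_reparam phi theta f g ==> self_tangency k f q \<longleftrightarrow> self_tangency k g q"
 by (rule iffI) (erule (1) reparam_self_tangency1, erule (1) reparam_self_tangency1[OF reparam_sym])

lemma reparam_tangency_transverse1:
 assumes r: "is_reparam phi theta f g" and s: "tangency_with_transverse_branch f q"
 shows "tangency_with_transverse_branch g q"
proof -
 obtain a b c where ab: "a ~= b" "a ~= c" "b ~= c" "branches f q = {a, b, c}" "contact 1 f a b"
  "transversal f a c" "transversal f b c"
  using s by (auto simp: tangency_with_transverse_branch_def)
 have "branches g q = {phi a, phi b, phi c}" by (simp add: reparam_branches_image[OF r] ab(4))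
 then show ?thesis
  unfolding tangency_with_transverse_branch_def
  using ab reparam_contact[OF r] reparam_inj[OF r] reparam_transversal[OF r]
  by (intro exI[of _ "phi a"] exI[of _ "phi b"] exI[of _ "phi c"]) auto
qed

lemma reparam_tangency_transverse:
 "is_reparam phi theta f g ==> tangency_with_transverse_branch f q \<longleftrightarrow> tangency_with_transverse_branch g q"
 by (rule iffI) (erule (1) reparam_tangency_transverse1, erule (1) reparam_tangency_transverse1[OF reparam_sym])

lemma reparam_points:
 assumes r: "is_reparam phi theta f g"
 shows "generic_point f = generic_point g" "codim1_point f = codim1_point g"
  "codim2_point f = codim2_point g" "star_like_triple_crossing f = star_like_triple_crossing g"
 by (simp_all only: fun_eq_iff generic_point_def codim1_point_def codim2_point_def reparam_multi_crossing[OF r]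
   reparam_self_tangency[OF r] reparam_tangency_transverse[OF r] reparam_star[OF r] simp_thms)

text \<open>The strata are sets of images and ask for some suitable parametrization. All types of
  points are invariant under reparametrization, so the given \<open>f\<close> may be tested
  instead.\<close>

lemma strata_iff:
 assumes f: "f \<in> params"
 shows "range f \<in> stratum0 \<longleftrightarrow> (\<forall>q. generic_point f q)"
  "range f \<in> stratum1 \<longleftrightarrow> (\<exists>q. codim1_point f q & (\<forall>q'. q' ~= q --> generic_point f q'))"
  "range f \<in> stratum2 \<longleftrightarrow> (\<exists>q. codim2_point f q & (\<forall>q'. q' ~= q --> generic_point f q')) \<or>
   (\<exists>q r. q ~= r & codim1_point f q & codim1_point f r &
    (\<forall>q'. q' ~= q & q' ~= r --> generic_point f q'))"
  "has_star_like_triple_crossing (range f) \<longleftrightarrow> (\<exists>q. star_like_triple_crossing f q)"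
proof -
 have key: "(\<exists>g. range f = range g & g \<in> params & Q g) \<longleftrightarrow> Q f"
  if q: "!!g phi theta. is_reparam phi theta f g ==> Q f = Q g" for Q
 proof
  assume "\<exists>g. range f = range g & g \<in> params & Q g"
  then obtain g where g: "range f = range g" "g \<in> params" "Q g" by blast
  obtain phi theta where "is_reparam phi theta f g" using reparam_exists[OF f g(2,1)] .
  then show "Q f" using q g(3) by simp
 next
  assume "Q f" then show "\<exists>g. range f = range g & g \<in> params & Q g" using f by blast
 qed
 show "range f \<in> stratum0 \<longleftrightarrow> (\<forall>q. generic_point f q)"
  unfolding stratum0_def mem_Collect_eq
  by (rule key) (frule reparam_points(1), frule reparam_points(2), frule reparam_points(3), drule reparam_points(4), simp only:)
 show "range f \<in> stratum1 \<longleftrightarrow> (\<exists>q. codim1_point f q & (\<forall>q'. q' ~= q --> generic_point f q'))"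
  unfolding stratum1_def mem_Collect_eq
  by (rule key) (frule reparam_points(1), frule reparam_points(2), frule reparam_points(3), drule reparam_points(4), simp only:)
 show "range f \<in> stratum2 \<longleftrightarrow> (\<exists>q. codim2_point f q & (\<forall>q'. q' ~= q --> generic_point f q')) \<or>
   (\<exists>q r. q ~= r & codim1_point f q & codim1_point f r &
    (\<forall>q'. q' ~= q & q' ~= r --> generic_point f q'))"
  unfolding stratum2_def mem_Collect_eq
  by (rule key) (frule reparam_points(1), frule reparam_points(2), frule reparam_points(3), drule reparam_points(4), simp only:)
 have "has_star_like_triple_crossing (range f) \<longleftrightarrow>
   (\<exists>g. range f = range g & g \<in> params & (\<exists>q. star_like_triple_crossing g q))"
  unfolding has_star_like_triple_crossing_def Bex_def by (intro arg_cong[where f = Ex] ext) auto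
 also have "\<dots> \<longleftrightarrow> (\<exists>q. star_like_triple_crossing f q)"
  by (rule key) (frule reparam_points(1), frule reparam_points(2), frule reparam_points(3), drule reparam_points(4), simp only:)
 finally show "has_star_like_triple_crossing (range f) \<longleftrightarrow> (\<exists>q. star_like_triple_crossing f q)" .
qed

lemma card_le_2_iff:
 "(finite B & card B <= 2) \<longleftrightarrow> ~ (\<exists>a\<in>B. \<exists>b\<in>B. \<exists>c\<in>B. a ~= b & a ~= c & b ~= c)"
proof
 assume f: "finite B & card B <= 2"
 show "~ (\<exists>a\<in>B. \<exists>b\<in>B. \<exists>c\<in>B. a ~= b & a ~= c & b ~= c)"
 proof
  assume "\<exists>a\<in>B. \<exists>b\<in>B. \<exists>c\<in>B. a ~= b & a ~= c & b ~= c"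
  then obtain a b c where abc: "{a, b, c} \<subseteq> B" "a ~= b" "a ~= c" "b ~= c" by blast
  then have "card {a, b, c} <= card B" using f by (intro card_mono) auto
  then show False using f abc by simp
 qed
next
 assume n: "~ (\<exists>a\<in>B. \<exists>b\<in>B. \<exists>c\<in>B. a ~= b & a ~= c & b ~= c)"
 show "finite B & card B <= 2"
 proof (rule ccontr)
  assume "~ ?thesis"
  then have "infinite B | 3 <= card B" by auto
  then obtain T where "T \<subseteq> B" "card T = 3"
   using infinite_arbitrarily_large[of B 3] obtain_subset_with_card_n[of 3 B] by metis
  then show False using n unfolding card_3_iff by auto
 qed
qed

text \<open>Removes cardinalities: what remains speaks of pairs and triples of parameters, the sets
  to which compactness will be applied.\<close>

lemma generic_point_iff:
 "generic_point f q \<longleftrightarrow> (\<forall>a\<in>branches f q. \<forall>b\<in>branches f q. a ~= b --> transversal f a b) &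
  ~ (\<exists>a\<in>branches f q. \<exists>b\<in>branches f q. \<exists>c\<in>branches f q. a ~= b & a ~= c & b ~= c)"
proof -
 have "generic_point f q \<longleftrightarrow> pairwise (transversal f) (branches f q) &
   (finite (branches f q) & card (branches f q) <= 2)"
  unfolding generic_point_def multi_crossing_def by auto
 then show ?thesis unfolding card_le_2_iff pairwise_def by blast
qed

section \<open>Contact of branches in terms of derivatives\<close>

text \<open>Taylor's estimate by induction: a bound for \<open>velocity d\<close> gives one of the
  next order for \<open>d\<close> by the mean value inequality on the segment from
  \<open>a\<close>.\<close>

lemma power_bound_of_derivative:
 fixes d :: "real => 'b::real_normed_vector"
 assumes "smooth d" "\<forall>m\<le>k. (velocity ^^ m) d a = 0"
 shows "\<exists>C. \<forall>t. abs (t - a) <= 1 --> norm (d t) <= C * abs (t - a) ^ Suc k"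
 using assms
proof (induction k arbitrary: d)
 case 0
 have "compact (velocity d ` {a-1..a+1})"
  using smooth_continuous[OF smooth_velocity(1)[OF 0(1)]] by (intro compact_continuous_image) auto
 from compact_imp_bounded[OF this] obtain B where "\<forall>x \<in> velocity d ` {a-1..a+1}. norm x <= B"
  unfolding bounded_iff by (elim exE)
 then have B: "norm (velocity d t) <= B" if "t \<in> {a-1..a+1}" for t using that by simp
 have "norm (d t) <= B * abs (t - a) ^ Suc 0" if t: "abs (t - a) <= 1" for t
 proof -
  have "norm (d t - d a) <= B * norm (t - a)"
  proof (rule differentiable_bound[of "closed_segment a t"])
   show "(d has_derivative (%h. h *\<^sub>R velocity d x)) (at x within closed_segment a t)" for x
    by (rule has_derivative_at_withinI[OF smooth_velocity(2)[OF 0(1), unfolded has_vector_derivative_def]])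
   show "onorm (%h. h *\<^sub>R velocity d x) <= B" if "x \<in> closed_segment a t" for x
   proof (rule onorm_le)
    have "x \<in> {a-1..a+1}" using that t by (auto simp: closed_segment_eq_real_ivl split: if_splits)
    then have "norm (velocity d x) <= B" by (rule B)
    then show "norm (y *\<^sub>R velocity d x) <= B * norm y" for y
     by (simp add: mult.commute[of B] mult_left_mono)
   qed
  qed auto
  then show ?thesis using 0(2) by simp
 qed
 then show ?case by blast
next
 case (Suc k)
 have "\<forall>m\<le>k. (velocity ^^ m) (velocity d) a = 0"
 proof (intro allI impI)
  fix m assume "m <= k"
  then have "(velocity ^^ Suc m) d a = 0" using Suc.prems(2) by blast
  then show "(velocity ^^ m) (velocity d) a = 0" by (simp only: funpow_Suc_right comp_apply)
 qed
 from Suc.IH[OF smooth_velocity(1)[OF Suc.prems(1)] this]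
 obtain C where "\<forall>t. abs (t - a) <= 1 --> norm (velocity d t) <= C * abs (t - a) ^ Suc k" by (elim exE)
 then have C: "abs (t - a) <= 1 ==> norm (velocity d t) <= C * abs (t - a) ^ Suc k" for t by blast
 have C0: "C >= 0" using order_trans[OF norm_ge_zero C[of "a + 1"]] by simp
 have "norm (d t) <= C * abs (t - a) ^ Suc (Suc k)" if t: "abs (t - a) <= 1" for t
 proof -
  have "norm (d t - d a) <= (C * abs (t - a) ^ Suc k) * norm (t - a)"
  proof (rule differentiable_bound[of "closed_segment a t"])
   show "(d has_derivative (%h. h *\<^sub>R velocity d x)) (at x within closed_segment a t)" for x
    by (rule has_derivative_at_withinI[OF smooth_velocity(2)[OF Suc.prems(1), unfolded has_vector_derivative_def]])
   show "onorm (%h. h *\<^sub>R velocity d x) <= C * abs (t - a) ^ Suc k" if x: "x \<in> closed_segment a t" for x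
   proof (rule onorm_le)
    have "abs (x - a) <= abs (t - a)" using x by (auto simp: closed_segment_eq_real_ivl split: if_splits)
    then have "norm (velocity d x) <= C * abs (x - a) ^ Suc k" "C * abs (x - a) ^ Suc k <= C * abs (t - a) ^ Suc k"
     using t C0 by (auto intro!: C mult_left_mono power_mono simp del: power_Suc)
    then show "norm (y *\<^sub>R velocity d x) <= (C * abs (t - a) ^ Suc k) * norm y" for y
     by (simp add: mult.commute[of "C * abs (t - a) ^ Suc k"] mult_left_mono del: power_Suc)
   qed
  qed auto
  moreover have "d a = 0" using Suc.prems(2)[rule_format, of 0] by simp
  ultimately show ?thesis by (simp add: mult_ac)
 qed
 then show ?case by blast
qed

lemma power_dominated_eq_0:
 fixes v :: "'b::real_normed_vector"
 assumes "\<forall>\<^sub>F t in at a. norm (((t - a) ^ k) *\<^sub>R v) <= C * abs (t - a) ^ Suc k"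
 shows "v = 0"
proof -
 have ne: "\<forall>\<^sub>F t in at a. t ~= a" by (simp add: eventually_at_filter)
 have "\<forall>\<^sub>F t in at a. norm v <= C * abs (t - a)"
  using assms ne
 proof eventually_elim
  case (elim t)
  then have "abs (t - a) ^ k * norm v <= abs (t - a) ^ k * (C * abs (t - a))"
   by (simp add: power_abs mult_ac)
  then show ?case using elim(2) by simp
 qed
 moreover have "((%t. C * abs (t - a)) \<longlongrightarrow> C * abs (a - a)) (at a)" by (intro tendsto_intros)
 ultimately have "norm v <= C * abs (a - a)"
  by (intro tendsto_lowerbound[of "%t. C * abs (t - a)"]) auto
 then show ?thesis by simp
qed

lemma velocity_diff_poly:
 fixes d :: "real => 'b::real_normed_vector"
 assumes "smooth d"
 shows "velocity (%t. d t - (c * (t - a) ^ n) *\<^sub>R v) = (%t. velocity d t - (c * (n * (t - a) ^ (n - 1))) *\<^sub>R v)"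
  "smooth (%t. d t - (c * (t - a) ^ n) *\<^sub>R v)"
proof -
 have "((%t. c * (t - a) ^ n) has_real_derivative c * (n * (t - a) ^ (n - 1))) (at t)" for t
  by (auto intro!: derivative_eq_intros)
 then have "((%t. d t - (c * (t - a) ^ n) *\<^sub>R v) has_vector_derivative
   velocity d t - (c * (n * (t - a) ^ (n - 1))) *\<^sub>R v) (at t)" for t
  by (intro has_vector_derivative_diff smooth_velocity(2)[OF assms])
   (auto intro!: derivative_eq_intros simp: has_real_derivative_iff_has_vector_derivative)
 then show "velocity (%t. d t - (c * (t - a) ^ n) *\<^sub>R v) = (%t. velocity d t - (c * (n * (t - a) ^ (n - 1))) *\<^sub>R v)"
  by (intro ext velocity_at)
 show "smooth (%t. d t - (c * (t - a) ^ n) *\<^sub>R v)"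
  by (intro smooth_diff assms smooth_scaleR smooth_mult smooth_power smooth_const smooth_ident)
qed

text \<open>Contact is defined by a growth condition, and this extracts derivatives from it:
  subtract the Taylor term of the order in question, bound the rest by
  \<open>power_bound_of_derivative\<close>, and compare powers of \<open>t - a\<close>.\<close>

lemma derivatives_of_small:
 fixes d :: "real => 'b::real_normed_vector"
 assumes d: "smooth d" and s: "\<forall>\<^sub>F t in at a. norm (d t) <= C * abs (t - a) ^ Suc k"
 shows "d a = 0" "k >= 1 ==> velocity d a = 0" "k >= 2 ==> velocity (velocity d) a = 0"
proof -
 have small: "\<forall>\<^sub>F t in at a. norm (d t) <= abs C * abs (t - a) ^ Suc j" if "j <= k" for j
 proof -
  have "\<forall>\<^sub>F t in at a. abs (t - a) < 1"
   by (auto simp: eventually_at dist_real_def intro!: exI[of _ 1])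
  with s show ?thesis
  proof eventually_elim
   case (elim t)
   have "C * abs (t - a) ^ Suc k <= abs C * abs (t - a) ^ Suc j"
    using elim that by (intro mult_mono power_decreasing) auto
   then show ?case using elim by linarith
  qed
 qed
 have i: "((%t. norm (d t)) \<longlongrightarrow> norm (d a)) (at a)"
  using smooth_continuous[OF d, of UNIV] by (intro tendsto_norm) (simp add: continuous_on_def)
 have lim0: "((%t. abs C * abs (t - a) ^ Suc 0) \<longlongrightarrow> 0) (at a)"
  by (auto intro!: tendsto_eq_intros)
 have "norm (d a) <= 0"
  by (rule tendsto_le[OF at_neq_bot lim0 i small[of 0]]) simp
 then show 0: "d a = 0" by simp
 show 1: "velocity d a = 0" if k: "k >= 1"
 proof -
  let ?e = "%t. d t - (1 * (t - a) ^ 1) *\<^sub>R velocity d a"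
  have "\<forall>m\<le>1. (velocity ^^ m) ?e a = 0"
   using 0 velocity_diff_poly(1)[OF d, of 1 a 1 "velocity d a"] by (auto simp: le_Suc_eq)
  from power_bound_of_derivative[OF velocity_diff_poly(2)[OF d] this] obtain C' where C': "!!t. abs (t - a) <= 1 ==> norm (?e t) <= C' * abs (t - a) ^ Suc 1"
   by (elim exE) auto
  have "\<forall>\<^sub>F t in at a. abs (t - a) <= 1"
   by (auto simp: eventually_at dist_real_def intro!: exI[of _ 1])
  then have "\<forall>\<^sub>F t in at a. norm (((t - a) ^ 1) *\<^sub>R velocity d a) <= (abs C + C') * abs (t - a) ^ Suc 1"
   using small[OF k]
  proof eventually_elim
   case (elim t)
   have "norm (((t - a) ^ 1) *\<^sub>R velocity d a) <= norm (d t) + norm (?e t)"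
    using norm_triangle_ineq4[of "d t" "?e t"] by simp
   also have "\<dots> <= abs C * abs (t - a) ^ Suc 1 + C' * abs (t - a) ^ Suc 1"
    using elim C'[of t] by (intro add_mono) auto
   finally show ?case by (simp only: distrib_right)
  qed
  then show ?thesis by (rule power_dominated_eq_0)
 qed
 show "velocity (velocity d) a = 0" if k: "k >= 2"
 proof -
  have v0: "velocity d a = 0" using 1 k by simp
  let ?v = "velocity (velocity d) a"
  let ?e = "%t. d t - ((1/2) * (t - a) ^ 2) *\<^sub>R ?v"
  have v1: "velocity ?e = (%t. velocity d t - (1 * (t - a) ^ 1) *\<^sub>R ?v)"
   using velocity_diff_poly(1)[OF d, of "1/2" a 2] by (simp add: diff_divide_distrib)
  have v2: "velocity (velocity ?e) a = 0"
   unfolding v1 using velocity_diff_poly(1)[OF smooth_velocity(1)[OF d], of 1 a 1 ?v] by simp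
  have "\<forall>m\<le>2. (velocity ^^ m) ?e a = 0"
  proof (intro allI impI)
   fix m :: nat assume "m <= 2"
   then consider "m = 0" | "m = 1" | "m = 2" by linarith
   then show "(velocity ^^ m) ?e a = 0"
   proof cases
    case 1 then show ?thesis using 0 by simp
   next
    case 2
    have "(velocity ^^ 1) ?e = velocity ?e" by simp
    then show ?thesis using 2 v0 by (simp only: v1) simp
   next
    case 3
    have "(velocity ^^ 2) ?e = velocity (velocity ?e)" by (simp only: numeral_2_eq_2 funpow.simps comp_apply id_apply)
    then show ?thesis using 3 v2 by (simp only:)
   qed
  qed
  from power_bound_of_derivative[OF velocity_diff_poly(2)[OF d] this] obtain C' where C': "!!t. abs (t - a) <= 1 ==> norm (?e t) <= C' * abs (t - a) ^ Suc 2"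
   by (elim exE) auto
  have "\<forall>\<^sub>F t in at a. abs (t - a) <= 1"
   by (auto simp: eventually_at dist_real_def intro!: exI[of _ 1])
  then have "\<forall>\<^sub>F t in at a. norm (((t - a) ^ 2) *\<^sub>R ((1/2) *\<^sub>R ?v)) <= (abs C + C') * abs (t - a) ^ Suc 2"
   using small[OF k]
  proof eventually_elim
   case (elim t)
   have "norm (((t - a) ^ 2) *\<^sub>R ((1/2) *\<^sub>R ?v)) <= norm (d t) + norm (?e t)"
    using norm_triangle_ineq4[of "d t" "?e t"] by simp
   also have "\<dots> <= abs C * abs (t - a) ^ Suc 2 + C' * abs (t - a) ^ Suc 2"
    using elim C'[of t] by (intro add_mono) auto
   finally show ?case by (simp only: distrib_right)
  qed
  then have "(1/2) *\<^sub>R ?v = 0" by (rule power_dominated_eq_0)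
  then show ?thesis by simp
 qed
qed

context
 fixes f :: "real => real^3" and a b :: real
 assumes f: "smooth f" and ab: "pz (f a) = pz (f b)"
begin

abbreviation (input) "p0 \<equiv> %t. pz (f t)"
abbreviation (input) "p1 \<equiv> %t. pz (velocity f t)"
abbreviation (input) "p2 \<equiv> %t. pz (velocity (velocity f) t)"
abbreviation (input) "p3 \<equiv> %t. pz (velocity (velocity (velocity f)) t)"

lemma plane_derivs:
 "(p0 has_vector_derivative p1 t) (at t)" "(p1 has_vector_derivative p2 t) (at t)"
 "(p2 has_vector_derivative p3 t) (at t)"
 by (intro bounded_linear.has_vector_derivative[OF bounded_linear_pz] smooth_velocity f)+

lemma plane_chain:
 assumes "(h has_vector_derivative h' (phi t)) (at (phi t))" "(phi has_real_derivative y) (at t)"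
 shows "((%t. h (phi t)) has_vector_derivative y *\<^sub>R h' (phi t)) (at t)"
 using vector_diff_chain_at[of phi y t h] assms
 by (simp add: has_real_derivative_iff_has_vector_derivative comp_def)

lemma plane_diff_derivs:
 fixes phi :: "real => real"
 assumes s: "smooth phi"
 defines "d \<equiv> %t. p0 t - p0 (phi t)"
 shows "velocity d = (%t. p1 t - velocity phi t *\<^sub>R p1 (phi t))"
  "velocity (velocity d) = (%t. p2 t - velocity (velocity phi) t *\<^sub>R p1 (phi t) - (velocity phi t)\<^sup>2 *\<^sub>R p2 (phi t))"
  "velocity (velocity (velocity d)) = (%t. p3 t - velocity (velocity (velocity phi)) t *\<^sub>R p1 (phi t)
   - (3 * velocity phi t * velocity (velocity phi) t) *\<^sub>R p2 (phi t) - (velocity phi t)^3 *\<^sub>R p3 (phi t))"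
  "smooth d"
proof -
 have r: "(phi has_real_derivative velocity phi t) (at t)"
  "(velocity phi has_real_derivative velocity (velocity phi) t) (at t)"
  "(velocity (velocity phi) has_real_derivative velocity (velocity (velocity phi)) t) (at t)" for t
  using smooth_velocity s by (auto simp: has_real_derivative_iff_has_vector_derivative)
 note c = plane_chain[where h = p0 and h' = p1 and phi = phi, OF plane_derivs(1) r(1)]
  plane_chain[where h = p1 and h' = p2 and phi = phi, OF plane_derivs(2) r(1)]
  plane_chain[where h = p2 and h' = p3 and phi = phi, OF plane_derivs(3) r(1)]
 have "(d has_vector_derivative p1 t - velocity phi t *\<^sub>R p1 (phi t)) (at t)" for t
  unfolding d_def by (intro has_vector_derivative_diff plane_derivs c)
 then show v1: "velocity d = (%t. p1 t - velocity phi t *\<^sub>R p1 (phi t))"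
  by (intro ext velocity_at)
 have "((%t. p1 t - velocity phi t *\<^sub>R p1 (phi t)) has_vector_derivative
   p2 t - (velocity phi t *\<^sub>R (velocity phi t *\<^sub>R p2 (phi t)) + velocity (velocity phi) t *\<^sub>R p1 (phi t))) (at t)" for t
  by (intro has_vector_derivative_diff has_vector_derivative_scaleR plane_derivs c r)
 then show v2: "velocity (velocity d) = (%t. p2 t - velocity (velocity phi) t *\<^sub>R p1 (phi t) - (velocity phi t)\<^sup>2 *\<^sub>R p2 (phi t))"
  unfolding v1 by (intro ext, subst velocity_at) (auto simp: power2_eq_square algebra_simps)
 have "((%t. p2 t - velocity (velocity phi) t *\<^sub>R p1 (phi t) - (velocity phi t)\<^sup>2 *\<^sub>R p2 (phi t)) has_vector_derivative
   p3 t - (velocity (velocity phi) t *\<^sub>R (velocity phi t *\<^sub>R p2 (phi t)) + velocity (velocity (velocity phi)) t *\<^sub>R p1 (phi t))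
   - ((velocity phi t)\<^sup>2 *\<^sub>R (velocity phi t *\<^sub>R p3 (phi t)) + (2 * velocity phi t * velocity (velocity phi) t) *\<^sub>R p2 (phi t))) (at t)" for t
  by (intro has_vector_derivative_diff has_vector_derivative_scaleR plane_derivs c r)
   (auto intro!: derivative_eq_intros r)
 then have "velocity (%t. p2 t - velocity (velocity phi) t *\<^sub>R p1 (phi t) - (velocity phi t)\<^sup>2 *\<^sub>R p2 (phi t)) =
   (%t. p3 t - (velocity (velocity phi) t *\<^sub>R (velocity phi t *\<^sub>R p2 (phi t)) + velocity (velocity (velocity phi)) t *\<^sub>R p1 (phi t))
   - ((velocity phi t)\<^sup>2 *\<^sub>R (velocity phi t *\<^sub>R p3 (phi t)) + (2 * velocity phi t * velocity (velocity phi) t) *\<^sub>R p2 (phi t)))"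
  by (intro ext velocity_at)
 then show "velocity (velocity (velocity d)) = (%t. p3 t - velocity (velocity (velocity phi)) t *\<^sub>R p1 (phi t)
   - (3 * velocity phi t * velocity (velocity phi) t) *\<^sub>R p2 (phi t) - (velocity phi t)^3 *\<^sub>R p3 (phi t))"
  unfolding v2 by (auto simp: fun_eq_iff complex_eq_iff algebra_simps power2_eq_square power3_eq_cube)
 have "smooth p0" by (rule smooth_bounded_linear[OF bounded_linear_pz f])
 then show "smooth d" unfolding d_def by (intro smooth_diff smooth_compose[OF _ s])
qed

text \<open>\<open>c1\<close> and \<open>2 * c2\<close> are the first and second derivative at
  \<open>a\<close> of the reparametrization that realizes the contact.\<close>

lemma contact_geD:
 assumes "contact_ge k f a b"
 obtains c1 c2 where "k >= 1 ==> p1 a = c1 *\<^sub>R p1 b"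
  "k >= 2 ==> p2 a = c1\<^sup>2 *\<^sub>R p2 b + (2 * c2) *\<^sub>R p1 b"
proof -
 obtain phi C where p: "smooth phi" "phi a = b"
  "\<forall>\<^sub>F t in at a. norm (pr (f t) - pr (f (phi t))) <= C * abs (t - a) ^ Suc k"
  using assms by (auto simp: contact_ge_def)
 note d = plane_diff_derivs[OF p(1)]
 note s = derivatives_of_small[OF d(4) p(3)[unfolded norm_pr_diff]]
 show ?thesis
 proof (rule that[of "velocity phi a" "velocity (velocity phi) a / 2"])
  show "p1 a = velocity phi a *\<^sub>R p1 b" if "k >= 1"
   using s(2)[OF that] unfolding d(1) p(2) by simp
  show "p2 a = (velocity phi a)\<^sup>2 *\<^sub>R p2 b + (2 * (velocity (velocity phi) a / 2)) *\<^sub>R p1 b" if "k >= 2"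
   using s(3)[OF that] unfolding d(2) p(2) by (simp add: algebra_simps)
 qed
qed

lemma contact_geI:
 fixes c1 c2 c3 :: real
 assumes "k >= 1 ==> p1 a = c1 *\<^sub>R p1 b" "k >= 2 ==> p2 a = c1\<^sup>2 *\<^sub>R p2 b + (2 * c2) *\<^sub>R p1 b"
  "k >= 3 ==> p3 a = c1^3 *\<^sub>R p3 b + (6 * c1 * c2) *\<^sub>R p2 b + (6 * c3) *\<^sub>R p1 b" "k <= 3"
 shows "contact_ge k f a b"
proof -
 \<comment> \<open>The matching reparametrization can be taken polynomial; three Taylor coefficients
   serve for all orders up to 3.\<close>
 define phi where "phi t = b + c1 * (t - a) + c2 * (t - a)^2 + c3 * (t - a)^3" for t
 have s: "smooth phi"
  unfolding phi_def[abs_def]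
  by (intro smooth_add smooth_mult smooth_power smooth_diff smooth_const smooth_ident)
 have "(phi has_vector_derivative c1 + 2 * c2 * (t - a) + 3 * c3 * (t - a)^2) (at t)" for t
  unfolding phi_def has_real_derivative_iff_has_vector_derivative[symmetric]
  by (auto intro!: derivative_eq_intros)
 then have v1: "velocity phi = (%t. c1 + 2 * c2 * (t - a) + 3 * c3 * (t - a)^2)" by (intro ext velocity_at)
 have "((%t. c1 + 2 * c2 * (t - a) + 3 * c3 * (t - a)^2) has_vector_derivative 2 * c2 + 6 * c3 * (t - a)) (at t)" for t
  unfolding has_real_derivative_iff_has_vector_derivative[symmetric]
  by (auto intro!: derivative_eq_intros)
 then have v2: "velocity (velocity phi) = (%t. 2 * c2 + 6 * c3 * (t - a))" unfolding v1 by (intro ext velocity_at)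
 have "((%t. 2 * c2 + 6 * c3 * (t - a)) has_vector_derivative 6 * c3) (at t)" for t
  unfolding has_real_derivative_iff_has_vector_derivative[symmetric]
  by (auto intro!: derivative_eq_intros)
 then have v3: "velocity (velocity (velocity phi)) = (%t. 6 * c3)" unfolding v2 by (intro ext velocity_at)
 note d = plane_diff_derivs[OF s]
 have pa: "phi a = b" by (simp add: phi_def)
 have "(velocity ^^ m) (%t. p0 t - p0 (phi t)) a = 0" if "m <= k" for m
 proof -
  have e: "(velocity ^^ 1) D = velocity D" "(velocity ^^ 2) D = velocity (velocity D)"
   "(velocity ^^ 3) D = velocity (velocity (velocity D))" for D :: "real => complex"
   by (simp_all add: numeral_2_eq_2 numeral_3_eq_3)
  consider "m = 0" | "m = 1" | "m = 2" | "m = 3" using \<open>m <= k\<close> assms(4) by linarith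
  then show ?thesis
  proof cases
   case 1 then show ?thesis using ab by (simp add: pa)
  next
   case 2 then show ?thesis using assms(1) that by (simp only: e d(1) v1 pa) simp
  next
   case 3 then show ?thesis using assms(1,2) that by (simp only: e d(2) v1 v2[unfolded v1] pa) simp
  next
   case 4 then show ?thesis
    using assms(1,2,3) that
    by (simp only: e d(3) v1 v2[unfolded v1] v3[unfolded v1, unfolded v2[unfolded v1]] pa) (simp add: algebra_simps)
  qed
 qed
 then obtain C where C: "!!t. abs (t - a) <= 1 ==> norm (p0 t - p0 (phi t)) <= C * abs (t - a) ^ Suc k"
  using power_bound_of_derivative[OF d(4)] by (metis (no_types, lifting))
 have "\<forall>\<^sub>F t in at a. abs (t - a) <= 1"
  by (auto simp: eventually_at dist_real_def intro!: exI[of _ 1])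
 then have "\<forall>\<^sub>F t in at a. norm (pr (f t) - pr (f (phi t))) <= C * abs (t - a) ^ Suc k"
  by eventually_elim (simp only: norm_pr_diff C)
 then show ?thesis unfolding contact_ge_def using s pa by blast
qed

text \<open>The second and third order conditions for contact, relative to the reparametrization
 \<open>c1 (t - a) + c2 (t - a)\<^sup>2\<close> that matches the lower orders.\<close>

lemma contact_1_iff:
 assumes n: "p1 b ~= 0"
 shows "contact_ge 1 f a b \<longleftrightarrow> crs (p1 a) (p1 b) = 0"
proof
 assume "contact_ge 1 f a b"
 then obtain c1 where "p1 a = c1 *\<^sub>R p1 b" by (rule contact_geD) (metis order_refl one_le_numeral)
 then show "crs (p1 a) (p1 b) = 0" by simp
next
 assume "crs (p1 a) (p1 b) = 0"
 then obtain c where "p1 a = c *\<^sub>R p1 b" using crs_eq_0D[OF _ n] by blast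
 then show "contact_ge 1 f a b" using contact_geI[of 1 c] by simp
qed

lemma contact_2_iff:
 assumes n: "p1 b ~= 0" and c: "p1 a = c *\<^sub>R p1 b"
 shows "contact_ge 2 f a b \<longleftrightarrow> crs (p2 a - c\<^sup>2 *\<^sub>R p2 b) (p1 b) = 0"
proof
 assume "contact_ge 2 f a b"
 then obtain c1 c2 where c12: "p1 a = c1 *\<^sub>R p1 b" "p2 a = c1\<^sup>2 *\<^sub>R p2 b + (2 * c2) *\<^sub>R p1 b"
  by (rule contact_geD) (metis order_refl one_le_numeral)
 then have "c1 = c" using c n by simp
 then show "crs (p2 a - c\<^sup>2 *\<^sub>R p2 b) (p1 b) = 0" using c12 by simp
next
 assume "crs (p2 a - c\<^sup>2 *\<^sub>R p2 b) (p1 b) = 0"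
 then obtain r where "p2 a - c\<^sup>2 *\<^sub>R p2 b = r *\<^sub>R p1 b" using crs_eq_0D[OF _ n] by blast
 then show "contact_ge 2 f a b"
  using c by (intro contact_geI[of 2 c "r/2"]) (auto simp: algebra_simps)
qed

lemma contact_3I:
 assumes n: "p1 b ~= 0" and c: "p1 a = c *\<^sub>R p1 b" and c2: "p2 a = c\<^sup>2 *\<^sub>R p2 b + (2 * c2) *\<^sub>R p1 b"
  and "crs (p3 a - c^3 *\<^sub>R p3 b - (6 * c * c2) *\<^sub>R p2 b) (p1 b) = 0"
 shows "contact_ge 3 f a b"
proof -
 obtain r where "p3 a - c^3 *\<^sub>R p3 b - (6 * c * c2) *\<^sub>R p2 b = r *\<^sub>R p1 b"
  using crs_eq_0D[OF assms(4) n] by blast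
 then show ?thesis
  using c c2 by (intro contact_geI[of 3 c c2 "r/6"]) (auto simp: algebra_simps)
qed

end

section \<open>Families of plane curves\<close>

text \<open>Tube lemma: the parameters of points of \<open>K\<close> outside \<open>U\<close> form a
  compact, hence closed set that misses \<open>s0\<close>. It carries statements about the double
  and triple points of one diagram over to all nearby diagrams.\<close>

lemma compact_tube:
 fixes K :: "('a::metric_space \<times> 'b::metric_space) set"
 assumes K: "compact K" and U: "open U" and s: "!!y. (s0, y) \<in> K ==> (s0, y) \<in> U"
 obtains delta where "delta > 0" "!!s y. (s, y) \<in> K ==> dist s s0 < delta ==> (s, y) \<in> U"
proof -
 have "compact (fst ` (K - U))"
  by (intro compact_continuous_image compact_diff K U continuous_on_fst continuous_on_id)
 then have "closed (fst ` (K - U))" by (rule compact_imp_closed)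
 moreover have "s0 \<notin> fst ` (K - U)" using s by auto
 ultimately have "open (- fst ` (K - U))" "s0 \<in> - fst ` (K - U)" by (auto simp: closed_def)
 then obtain delta where d: "delta > 0" "ball s0 delta \<subseteq> - fst ` (K - U)"
  unfolding open_contains_ball by blast
 show ?thesis
 proof (rule that[OF d(1)])
  fix s y assume "(s, y) \<in> K" "dist s s0 < delta"
  then have "s \<in> ball s0 delta" by (simp add: dist_commute)
  then have "s \<notin> fst ` (K - U)" using d(2) by blast
  moreover have "s \<in> fst ` (K - U)" if "(s, y) \<notin> U"
   by (rule image_eqI[of _ _ "(s, y)"]) (use that \<open>(s, y) \<in> K\<close> in auto)
  ultimately show "(s, y) \<in> U" by blast
 qed
qed

text \<open>For \<open>phi\<close> known only through \<open>l\<close> after \<open>phi\<close>: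
  once \<open>phi\<close> is continuous, the Caratheodory slope of \<open>l\<close> can be divided
  out.\<close>

lemma DERIV_of_continuous_compose:
 assumes c: "isCont phi t" and l: "(l has_real_derivative L) (at (phi t))" "L ~= 0"
  and m: "((%z. l (phi z)) has_real_derivative m) (at t)"
 shows "(phi has_real_derivative m / L) (at t)"
proof -
 obtain k where k: "!!z. l z - l (phi t) = k z * (z - phi t)" "isCont k (phi t)" "k (phi t) = L"
  using l(1) unfolding CARAT_DERIV by blast
 have lim: "((%u. (l (phi u) - l (phi t)) / (u - t)) \<longlongrightarrow> m) (at t)"
  using m by (simp add: has_field_derivative_iff)
 have kl: "((%u. k (phi u)) \<longlongrightarrow> L) (at t)"
  using isCont_o2[OF c k(2)] k(3) by (simp add: isCont_def)
 have "((%u. (l (phi u) - l (phi t)) / (u - t) / k (phi u)) \<longlongrightarrow> m / L) (at t)"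
  by (intro tendsto_divide lim kl l(2))
 moreover have "\<forall>\<^sub>F u in at t. k (phi u) ~= 0"
  by (rule tendsto_imp_eventually_ne[OF kl l(2)])
 then have "\<forall>\<^sub>F u in at t. (l (phi u) - l (phi t)) / (u - t) / k (phi u) = (phi u - phi t) / (u - t)"
 proof eventually_elim
  case (elim u)
  show ?case using k(1)[of "phi u"] elim by simp
 qed
 ultimately have "((%u. (phi u - phi t) / (u - t)) \<longlongrightarrow> m / L) (at t)"
  by (rule Lim_transform_eventually)
 then show ?thesis by (simp add: has_field_derivative_iff)
qed

lemma inj_on_of_derivative_nonzero:
 fixes u :: "real => real"
 assumes d: "!!t. t \<in> {x..y} ==> (u has_real_derivative u' t) (at t)" "!!t. t \<in> {x..y} ==> u' t ~= 0"
 shows "inj_on u {x..y}"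
proof -
 have "u a ~= u b" if ab: "a \<in> {x..y}" "b \<in> {x..y}" "a < b" for a b
 proof
  assume e: "u a = u b"
  have "\<exists>z>a. z < b & u' z = 0"
  proof -
   have "\<exists>l z. a < z & z < b & (u has_real_derivative l) (at z) & u b - u a = (b - a) * l"
   proof (rule MVT[OF ab(3)])
    show "continuous_on {a..b} u"
     using ab by (intro continuous_at_imp_continuous_on ballI DERIV_isCont[OF d(1)]) auto
    show "u differentiable (at z)" if "a < z" "z < b" for z
     using d(1)[of z] that ab real_differentiable_def by auto
   qed
   then obtain l z where z: "a < z" "z < b" "(u has_real_derivative l) (at z)" "u b - u a = (b - a) * l" by blast
   then have "l = 0" using e ab(3) by simp
   moreover have "u' z = l" using z(1-3) d(1)[of z] ab DERIV_unique by auto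
   ultimately show ?thesis using z by blast
  qed
  then show False using d(2) ab by force
 qed
 then show ?thesis
  by (intro inj_onI) (rule ccontr, metis linorder_neqE_linordered_idom)
qed

text \<open>Both pieces are graphs over the coordinate \<open>u\<close>. Matching parameters by
  \<open>u (phi t) = u t\<close> makes the difference \<open>h\<close> of the heights
  \<open>g\<close> a function of one variable that vanishes at both ends; Rolle's theorem yields
  equal slopes \<open>g' / u'\<close> over a common value of \<open>u\<close>.\<close>

lemma rolle_two_graphs:
 fixes u g :: "real => real"
 assumes "a1 < a2"
  and ua: "!!t. t \<in> {a1..a2} ==> (u has_real_derivative u' t) (at t)" "!!t. t \<in> {a1..a2} ==> u' t ~= 0"
  and ub: "!!t. t \<in> {b1..b2} ==> (u has_real_derivative u' t) (at t)" "!!t. t \<in> {b1..b2} ==> u' t ~= 0"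
  and ga: "!!t. t \<in> {a1..a2} ==> (g has_real_derivative g' t) (at t)"
  and gb: "!!t. t \<in> {b1..b2} ==> (g has_real_derivative g' t) (at t)"
  and B: "x1 \<in> {b1..b2}" "x2 \<in> {b1..b2}"
  and eq: "u a1 = u x1" "u a2 = u x2" "g a1 = g x1" "g a2 = g x2"
 shows "\<exists>a b. a1 < a & a < a2 & b \<in> {b1..b2} & u a = u b & g' a / u' a = g' b / u' b"
proof -
 have ia: "inj_on u {a1..a2}" and ib: "inj_on u {b1..b2}"
  using inj_on_of_derivative_nonzero ua ub by blast+
 have ca: "continuous_on {a1..a2} u" by (intro continuous_at_imp_continuous_on ballI DERIV_isCont[OF ua(1)])
 have cb: "continuous_on {b1..b2} u" by (intro continuous_at_imp_continuous_on ballI DERIV_isCont[OF ub(1)])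
 have cga: "continuous_on {a1..a2} g" by (intro continuous_at_imp_continuous_on ballI DERIV_isCont[OF ga])
 have cgb: "continuous_on {b1..b2} g" by (intro continuous_at_imp_continuous_on ballI DERIV_isCont[OF gb])
 have connb: "connected (u ` {b1..b2})" by (intro connected_continuous_image cb) simp
 have mono: "(u a1 < u t & u t < u a2) | (u a2 < u t & u t < u a1)" if t: "t \<in> {a1<..<a2}" for t
 proof -
  have ne: "u t ~= u a1" "u t ~= u a2" "u a1 ~= u a2"
   using ia t \<open>a1 < a2\<close> by (auto dest!: inj_onD[of u "{a1..a2}"])
  have "strict_mono_on {a1..a2} u | strict_antimono_on {a1..a2} u"
   using injective_eq_monotone_map[OF _ ca] ia by (simp add: is_interval_cc)
  then show ?thesis
   using t by (auto simp: monotone_on_def)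
 qed
 \<comment> \<open>On the first interval \<open>u\<close> is monotone, so its values lie between the
   end values; the second piece attains these, hence everything between them, and \<open>phi\<close>
   is defined throughout.\<close>
 have img: "u t \<in> u ` {b1..b2}" if t: "t \<in> {a1..a2}" for t
 proof (cases "t = a1 | t = a2")
  case True
  then show ?thesis using eq B by auto
 next
  case False
  then have "(u x1 < u t & u t < u x2) | (u x2 < u t & u t < u x1)" using mono[of t] t eq by auto
  moreover have "u x1 \<in> u ` {b1..b2}" "u x2 \<in> u ` {b1..b2}" using B by blast+
  ultimately show ?thesis
   using connectedD_interval[OF connb, of "u x1" "u x2" "u t"] connectedD_interval[OF connb, of "u x2" "u x1" "u t"]
   by linarith
 qed
 define phi where "phi t = inv_into {b1..b2} u (u t)" for t
 have phi: "phi t \<in> {b1..b2}" "u (phi t) = u t" if "t \<in> {a1..a2}" for t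
  unfolding phi_def using inv_into_into[OF img[OF that]] f_inv_into_f[OF img[OF that]] by auto
 have pa: "phi a1 = x1" "phi a2 = x2"
  unfolding phi_def eq by (auto intro!: inv_into_f_f ib B)
 have cinv: "continuous_on (u ` {b1..b2}) (inv_into {b1..b2} u)"
  by (rule continuous_on_inv[OF cb]) (auto simp: ib)
 have cphi: "continuous_on {a1..a2} phi"
  unfolding phi_def by (rule continuous_on_compose2[OF cinv ca]) (use img in auto)
 have dphi: "(phi has_real_derivative u' t / u' (phi t)) (at t)" if t: "a1 < t" "t < a2" for t
 proof (rule DERIV_of_continuous_compose)
  have "t \<in> interior {a1..a2}" using t by simp
  then show "isCont phi t" using cphi continuous_on_interior by blast
  show "(u has_real_derivative u' (phi t)) (at (phi t))" "u' (phi t) ~= 0"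
   using phi[of t] t ub by auto
  show "((%z. u (phi z)) has_real_derivative u' t) (at t)"
   by (rule has_field_derivative_transform_within_open[OF ua(1), of _ "{a1<..<a2}"])
    (use t phi in auto)
 qed
 define h where "h t = g t - g (phi t)" for t
 have dh: "(h has_real_derivative g' z - g' (phi z) * (u' z / u' (phi z))) (at z)" if z: "a1 < z" "z < a2" for z
  unfolding h_def[abs_def]
 proof (rule DERIV_diff)
  show "(g has_real_derivative g' z) (at z)" using ga z by simp
  have "(g has_real_derivative g' (phi z)) (at (phi z))" using gb phi(1)[of z] z by simp
  then show "((%t. g (phi t)) has_real_derivative g' (phi z) * (u' z / u' (phi z))) (at z)"
   by (rule DERIV_chain2[OF _ dphi[OF z]])
 qed
 have "\<exists>l z. a1 < z & z < a2 & (h has_real_derivative l) (at z) & h a2 - h a1 = (a2 - a1) * l"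
 proof (rule MVT[OF \<open>a1 < a2\<close>])
  show "continuous_on {a1..a2} h"
   unfolding h_def by (intro continuous_on_diff cga continuous_on_compose2[OF cgb cphi]) (use phi in auto)
  show "h differentiable (at z)" if "a1 < z" "z < a2" for z
   using dh[OF that] by (auto simp: real_differentiable_def)
 qed
 then obtain l z where z: "a1 < z" "z < a2" "(h has_real_derivative l) (at z)" "h a2 - h a1 = (a2 - a1) * l" by blast
 have "h a1 = 0" "h a2 = 0" using eq pa by (auto simp: h_def)
 then have "l = 0" using z(4) \<open>a1 < a2\<close> by simp
 then have e: "g' z - g' (phi z) * (u' z / u' (phi z)) = 0"
  using DERIV_unique[OF z(3) dh[OF z(1,2)]] by simp
 have "u' z ~= 0" "u' (phi z) ~= 0" using ua(2)[of z] ub(2) phi(1)[of z] z(1,2) by auto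
 then have "g' z / u' z = g' (phi z) / u' (phi z)" using e by (simp add: field_simps)
 then show ?thesis using z(1,2) phi[of z] by (intro exI[of _ z] exI[of _ "phi z"]) auto
qed

section \<open>Families of knots over a compact parameter set and their double points\<close>

definition DT :: "('a::euclidean_space \<times> real => real^3) => 'a \<times> real => real^3" where
 "DT F z = frechet_derivative F (at z) (0, 1)"

lemma smooth_DT: "smooth F ==> smooth (DT F)"
 unfolding DT_def[abs_def] by (rule smooth_frechet)

lemma DT_vector_derivative:
 assumes "smooth F"
 shows "((slice F s) has_vector_derivative DT F (s, t)) (at t)"
proof -
 have "((slice F s) has_derivative (%h. frechet_derivative F (at (s, t)) (0, h))) (at t)"
  by (rule has_derivative_compose[of "%t. (s, t)" "%h. (0, h)", OF _ smooth_has_derivative[OF assms]])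
   (auto intro!: derivative_eq_intros)
 moreover have "frechet_derivative F (at (s, t)) (0, h) = h *\<^sub>R DT F (s, t)" for h
 proof -
  have "linear (frechet_derivative F (at (s, t)))"
   using smooth_has_derivative[OF assms] has_derivative_linear by blast
  from linear_cmul[OF this, of h "(0, 1)"] show ?thesis by (simp add: DT_def)
 qed
 ultimately show ?thesis by (simp add: has_vector_derivative_def)
qed

lemma velocity_DT: "smooth F ==> velocity (slice F s) = (%t. DT F (s, t))"
 by (rule ext) (rule velocity_at[OF DT_vector_derivative])

lemma smooth_slice:
 fixes F :: "'a::euclidean_space \<times> real => real^3"
 assumes F: "smooth F"
 shows "smooth (slice F s)"
proof -
 have "C_times k (slice G s)" if "smooth G" for k and G :: "'a \<times> real => real^3"
  using that
 proof (induction k arbitrary: G)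
  case 0
  have "continuous_on UNIV (slice G s)"
   by (rule continuous_on_compose2[OF smooth_continuous[OF 0, of UNIV]]) (auto intro!: continuous_intros)
  then show ?case by simp
 next
  case (Suc k)
  show ?case
   by (rule C_times_Suc_real[OF DT_vector_derivative[OF Suc.prems] Suc.IH[OF smooth_DT[OF Suc.prems]]])
 qed
 from this[OF F] show ?thesis by (simp add: smooth_def)
qed

text \<open>Injectivity is not part of this notion because perturbations are first shown to form
  such a family and only then to be embeddings, see \<open>perturb_params\<close>.\<close>

locale knot_family =
 fixes F :: "'a::euclidean_space \<times> real => real^3" and S :: "'a set" and R :: real
 assumes smF: "smooth F" and compS: "compact S" and R_pos: "R > 0"
  and imF: "s \<in> S ==> pz (DT F (s, t)) ~= 0"
  and outF: "s \<in> S ==> \<bar>t\<bar> >= R ==> F (s, t) = x_axis t"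
begin

definition "P s t = pz (F (s, t))"
definition "P1 s t = pz (DT F (s, t))"
definition "P2 s t = pz (DT (DT F) (s, t))"
definition "P3 s t = pz (DT (DT (DT F)) (s, t))"

lemma P_deriv:
 "(P s has_vector_derivative P1 s t) (at t)" "(P1 s has_vector_derivative P2 s t) (at t)"
 "(P2 s has_vector_derivative P3 s t) (at t)"
 unfolding P_def[abs_def] P1_def[abs_def] P2_def[abs_def] P3_def[abs_def]
 by (intro bounded_linear.has_vector_derivative[OF bounded_linear_pz] DT_vector_derivative smooth_DT smF)+

lemma P_velocity:
 "pz (velocity (slice F s) t) = P1 s t"
 "pz (velocity (velocity (slice F s)) t) = P2 s t"
 "pz (velocity (velocity (velocity (slice F s))) t) = P3 s t"
 by (simp_all add: velocity_DT smooth_DT smF P1_def P2_def P3_def)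

lemma P_cont:
 assumes "continuous_on A f" "continuous_on A g"
 shows "continuous_on A (%x. P (f x) (g x))" "continuous_on A (%x. P1 (f x) (g x))"
  "continuous_on A (%x. P2 (f x) (g x))" "continuous_on A (%x. P3 (f x) (g x))"
proof -
 have "continuous_on A (%x. pz (G (f x, g x)))" if "smooth G" for G :: "'a \<times> real => real^3"
  by (intro bounded_linear.continuous_on[OF bounded_linear_pz]
    continuous_on_compose2[OF smooth_continuous[OF that, of UNIV]] continuous_on_Pair assms) auto
 then show "continuous_on A (%x. P (f x) (g x))" "continuous_on A (%x. P1 (f x) (g x))"
  "continuous_on A (%x. P2 (f x) (g x))" "continuous_on A (%x. P3 (f x) (g x))"
  unfolding P_def P1_def P2_def P3_def by (simp_all add: smooth_DT smF)
qed

lemma P1_nonzero: "s \<in> S ==> P1 s t ~= 0"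
 using imF by (simp add: P1_def)

lemma P_outside: "s \<in> S ==> \<bar>t\<bar> >= R ==> P s t = of_real t"
 using outF by (simp add: P_def x_axis_def complex_eq_iff)

text \<open>Hadamard's form of the divided difference. It is continuous up to the diagonal, where it
  equals the velocity and so does not vanish. Double points are therefore exactly its zeros, a
  closed condition that cannot degenerate to the diagonal.\<close>

definition "slope s a b = integral {0..1} (%tau. P1 s (a + tau * (b - a)))"

lemma slope_cont:
 assumes "continuous_on A f" "continuous_on A g" "continuous_on A h"
 shows "continuous_on A (%x. slope (f x) (g x) (h x))"
proof -
 have "continuous_on UNIV (%z::'a \<times> real \<times> real. integral (cbox 0 1) (%tau. P1 (fst z) (fst (snd z) + tau * (snd (snd z) - fst (snd z)))))"
  by (rule integral_continuous_on_param) (auto intro!: P_cont continuous_intros simp: case_prod_unfold)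
 then have c: "continuous_on UNIV (%z. slope (fst z) (fst (snd z)) (snd (snd z)))"
  by (simp add: slope_def cbox_interval)
 have "continuous_on A (%x. (f x, g x, h x))" by (intro continuous_on_Pair assms)
 from continuous_on_compose2[OF c this] show ?thesis by simp
qed

lemma slope_eq: "P s b - P s a = (b - a) *\<^sub>R slope s a b"
proof -
 have "((%tau. (b - a) *\<^sub>R P1 s (a + tau * (b - a))) has_integral (P s (a + 1 * (b - a)) - P s (a + 0 * (b - a)))) {0..1}"
 proof (rule fundamental_theorem_of_calculus)
  fix tau :: real
  have "((%tau. a + tau * (b - a)) has_vector_derivative (b - a)) (at tau)"
   by (auto intro!: derivative_eq_intros simp: has_real_derivative_iff_has_vector_derivative[symmetric])
  from vector_diff_chain_at[OF this P_deriv(1)]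
  show "((%tau. P s (a + tau * (b - a))) has_vector_derivative (b - a) *\<^sub>R P1 s (a + tau * (b - a))) (at tau within {0..1})"
   by (auto simp: comp_def intro: has_vector_derivative_at_within)
 qed simp
 then have "integral {0..1} (%tau. (b - a) *\<^sub>R P1 s (a + tau * (b - a))) = P s b - P s a"
  by (intro integral_unique) simp
 then show ?thesis by (simp add: slope_def)
qed

lemma slope_diag: "slope s a a = P1 s a"
 by (simp add: slope_def)

lemma slope_zero_iff: "s \<in> S ==> slope s a b = 0 \<longleftrightarrow> a ~= b & P s a = P s b"
 using slope_eq[of s b a] slope_diag[of s a] P1_nonzero[of s a] by auto

text \<open>The standard ends are injective, so a double point has at least one parameter inside
  \<open>R\<close>; the position there bounds the other parameter, which on an end equals its
  position.\<close>

lemma double_bounded: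
 obtains B where "B >= R" "!!s a b. s \<in> S ==> slope s a b = 0 ==> \<bar>a\<bar> <= B & abs b <= B"
  "!!s t. s \<in> S ==> \<bar>t\<bar> <= R ==> cmod (P s t) <= B"
proof -
 have "compact ((%z. P (fst z) (snd z)) ` (S \<times> {-R..R}))"
  by (intro compact_continuous_image P_cont continuous_intros compact_Times compS) auto
 from compact_imp_bounded[OF this]
 obtain M where M0: "\<forall>x \<in> (%z. P (fst z) (snd z)) ` (S \<times> {-R..R}). norm x <= M"
  unfolding bounded_iff by (elim exE)
 have M: "cmod (P s t) <= M" if "s \<in> S" "abs t <= R" for s t
  by (rule M0[rule_format], rule image_eqI[of _ _ "(s, t)"]) (use that in auto)
 have *: "abs a <= max R M" if s: "s \<in> S" and ab: "a ~= b" "P s a = P s b" for s a b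
 proof (cases "abs a >= R")
  case out: True
  have a: "cmod (P s a) = abs a" using P_outside[OF s out] by simp
  have "~ abs b >= R"
   using P_outside[OF s out] P_outside[OF s, of b] ab by auto
  then have "cmod (P s b) <= M" using M[OF s, of b] by simp
  then show ?thesis using a ab(2) by simp
 qed simp
 show ?thesis
 proof (rule that[of "max R M"])
  show "s \<in> S ==> slope s a b = 0 ==> \<bar>a\<bar> <= max R M & abs b <= max R M" for s a b
   using *[of s a b] *[of s b a] by (auto simp: slope_zero_iff)
  show "s \<in> S ==> \<bar>t\<bar> <= R ==> cmod (P s t) <= max R M" for s t
   using M[of s t] by auto
 qed simp
qed

lemma compact_doubles: "compact {(s, a, b). s \<in> S & slope s a b = 0}"
proof -
 obtain B where B0: "!!s a b. s \<in> S ==> slope s a b = 0 ==> \<bar>a\<bar> <= B & abs b <= B"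
  using double_bounded by metis
 have B: "a \<in> {-B..B}" "b \<in> {-B..B}" if "s \<in> S" "slope s a b = 0" for s a b
  using B0[OF that] by (auto simp: abs_le_iff)
 have "{(s, a, b). s \<in> S & slope s a b = 0} =
   (S \<times> {-B..B} \<times> {-B..B}) \<inter> {z. slope (fst z) (fst (snd z)) (snd (snd z)) = 0}"
  by (rule set_eqI) (auto simp del: atLeastAtMost_iff intro: B)
 moreover have "closed {z. slope (fst z) (fst (snd z)) (snd (snd z)) = 0}"
  by (intro closed_Collect_eq slope_cont continuous_intros)
 ultimately show ?thesis
  by (simp add: compact_Int_closed compact_Times compS)
qed

lemma compact_doubles_closed:
 assumes "closed C"
 shows "compact {(s, a, b). s \<in> S & slope s a b = 0 & (s, a, b) \<in> C}"
proof -
 have "{(s, a, b). s \<in> S & slope s a b = 0 & (s, a, b) \<in> C} = {(s, a, b). s \<in> S & slope s a b = 0} \<inter> C"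
  by auto
 then show ?thesis using compact_Int_closed[OF compact_doubles assms] by simp
qed

lemma closed_tangential: "closed {(s, a, b). crs (P1 s a) (P1 s b) = 0}"
proof -
 have "closed {z. crs (P1 (fst z) (fst (snd z))) (P1 (fst z) (snd (snd z))) = 0}"
  by (intro closed_Collect_eq crs_continuous P_cont continuous_intros)
 then show ?thesis by (simp add: case_prod_unfold)
qed

lemma compact_triples: "compact {(s, a, b, c). s \<in> S & slope s a b = 0 & slope s a c = 0 & slope s b c = 0}"
proof -
 obtain B where B0: "!!s a b. s \<in> S ==> slope s a b = 0 ==> \<bar>a\<bar> <= B & abs b <= B"
  using double_bounded by metis
 have B: "a \<in> {-B..B}" "b \<in> {-B..B}" if "s \<in> S" "slope s a b = 0" for s a b
  using B0[OF that] by (auto simp: abs_le_iff)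
 have "{(s, a, b, c). s \<in> S & slope s a b = 0 & slope s a c = 0 & slope s b c = 0} =
   (S \<times> {-B..B} \<times> {-B..B} \<times> {-B..B}) \<inter> ({z. slope (fst z) (fst (snd z)) (fst (snd (snd z))) = 0} \<inter>
   {z. slope (fst z) (fst (snd z)) (snd (snd (snd z))) = 0} \<inter> {z. slope (fst z) (fst (snd (snd z))) (snd (snd (snd z))) = 0})"
  by (rule set_eqI) (auto simp del: atLeastAtMost_iff intro: B)
 moreover have "closed ({z. slope (fst z) (fst (snd z)) (fst (snd (snd z))) = 0} \<inter>
   {z. slope (fst z) (fst (snd z)) (snd (snd (snd z))) = 0} \<inter> {z. slope (fst z) (fst (snd (snd z))) (snd (snd (snd z))) = 0})"
  by (intro closed_Int closed_Collect_eq slope_cont continuous_intros)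
 ultimately show ?thesis
  by (simp add: compact_Int_closed compact_Times compS)
qed

end

lemma knot_familyI:
 assumes "smooth F" "compact S" "R > 0" "!!s. s \<in> S ==> (slice F s) \<in> params_upto R"
 shows "knot_family F S R"
 using assms params_uptoD(4,5)[OF assms(4)] by unfold_locales (auto simp: velocity_DT)

lemma dist_Pair_le: "dist (a, b) (c, d) <= dist a c + dist b d"
 unfolding dist_Pair_Pair by (rule sqrt_sum_squares_le_sum) auto

text \<open>Five variables: the family parameter and two candidate pairs of parameters of the
  curve.\<close>

lemma nonzero_box:
 fixes h :: "'a::metric_space => real => real => real => real => 'b::real_normed_vector"
 assumes c: "continuous_on UNIV (%(s, a, b, c, d). h s a b c d)" and n: "h s0 a0 b0 c0 d0 ~= 0"
 obtains eps where "eps > 0"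
  "!!s a b c d. dist s s0 < eps ==> \<bar>a - a0\<bar> < eps ==> \<bar>b - b0\<bar> < eps ==> \<bar>c - c0\<bar> < eps ==> \<bar>d - d0\<bar> < eps ==>
   h s a b c d ~= 0"
proof -
 have "isCont (%(s, a, b, c, d). h s a b c d) (s0, a0, b0, c0, d0)"
  using c by (simp add: continuous_on_eq_continuous_at)
 then obtain delta where d: "delta > 0"
  "!!x. dist x (s0, a0, b0, c0, d0) < delta ==> dist ((%(s, a, b, c, d). h s a b c d) x) (h s0 a0 b0 c0 d0) < norm (h s0 a0 b0 c0 d0)"
  using n unfolding continuous_at_eps_delta by (metis (no_types, lifting) case_prod_conv zero_less_norm_iff)
 show ?thesis
 proof (rule that[of "delta/5"])
  fix s a b c d
  assume a: "dist s s0 < delta/5" "abs (a - a0) < delta/5" "abs (b - b0) < delta/5" "abs (c - c0) < delta/5" "abs (d - d0) < delta/5"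
  have "dist (s, a, b, c, d) (s0, a0, b0, c0, d0) <= dist s s0 + (dist a a0 + (dist b b0 + (dist c c0 + dist d d0)))"
   by (intro order_trans[OF dist_Pair_le] add_left_mono order_refl)
  also have "\<dots> < delta" using a by (simp add: dist_real_def)
  finally have "dist (h s a b c d) (h s0 a0 b0 c0 d0) < norm (h s0 a0 b0 c0 d0)" using d(2)[of "(s, a, b, c, d)"] by simp
  then show "h s a b c d ~= 0" by auto
 qed (use d in simp)
qed

context knot_family
begin

lemma smooth_curve: "smooth (slice F s)"
 by (rule smooth_slice[OF smF])

lemma same_point_iff: "pr (F (s, a)) = pr (F (s, b)) \<longleftrightarrow> P s a = P s b"
 by (simp add: pr_eq_iff P_def)

lemma branches_iff: "a \<in> branches (slice F s) q \<longleftrightarrow> pr (F (s, a)) = q"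
 by (simp add: branches_def)

lemma transversal_family_iff: "transversal (slice F s) a b \<longleftrightarrow> crs (P1 s a) (P1 s b) ~= 0"
 by (simp add: transversal_iff[OF smooth_curve] P_velocity)

lemma double_iff:
 "s \<in> S ==> slope s a b = 0 \<longleftrightarrow> a ~= b & pr (F (s, a)) = pr (F (s, b))"
 by (simp add: slope_zero_iff same_point_iff)

lemma not_generic_iff:
 assumes s: "s \<in> S"
 shows "~ generic_point (slice F s) q \<longleftrightarrow>
  (\<exists>a b. slope s a b = 0 & crs (P1 s a) (P1 s b) = 0 & pr (F (s, a)) = q) \<or>
  (\<exists>a b c. slope s a b = 0 & slope s a c = 0 & slope s b c = 0 & pr (F (s, a)) = q)"
 unfolding generic_point_iff transversal_family_iff Ball_def Bex_def branches_iff double_iff[OF s]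
 by (rule iffI, auto) (metis (full_types))+

text \<open>Subtracting the two coincidences gives \<open>(a' - a) A = (b' - b) B\<close>, where the
  divided differences \<open>A\<close> and \<open>B\<close> are close to the two tangents and hence
  independent; so both coefficients vanish.\<close>

lemma double_unique:
 assumes "crs (P1 s0 a0) (P1 s0 b0) ~= 0"
 obtains eps where "eps > 0"
  "!!s a b a' b'. dist s s0 < eps ==> \<bar>a - a0\<bar> < eps ==> \<bar>b - b0\<bar> < eps ==> \<bar>a' - a0\<bar> < eps ==> \<bar>b' - b0\<bar> < eps ==>
   P s a = P s b ==> P s a' = P s b' ==> a = a' & b = b'"
proof -
 have "continuous_on UNIV (%(s, a, b, a', b'). crs (slope s a a') (slope s b b'))"
  unfolding case_prod_unfold by (intro crs_continuous slope_cont continuous_intros)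
 moreover have "crs (slope s0 a0 a0) (slope s0 b0 b0) ~= 0" using assms by (simp add: slope_diag)
 ultimately obtain eps where e: "eps > 0"
  "!!s a b a' b'. dist s s0 < eps ==> \<bar>a - a0\<bar> < eps ==> \<bar>b - b0\<bar> < eps ==> \<bar>a' - a0\<bar> < eps ==> \<bar>b' - b0\<bar> < eps ==>
   crs (slope s a a') (slope s b b') ~= 0"
  by (rule nonzero_box) (rule that)
 show ?thesis
 proof (rule that[OF e(1)])
  fix s a b a' b'
  assume n: "dist s s0 < eps" "abs (a - a0) < eps" "abs (b - b0) < eps" "abs (a' - a0) < eps" "abs (b' - b0) < eps"
   and p: "P s a = P s b" "P s a' = P s b'"
  let ?A = "slope s a a'" and ?B = "slope s b b'"
  have "(a' - a) *\<^sub>R ?A = (b' - b) *\<^sub>R ?B"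
   using slope_eq[of s a' a] slope_eq[of s b' b] p by simp
  then have "crs ((a' - a) *\<^sub>R ?A) ?B = crs ((b' - b) *\<^sub>R ?B) ?B" "crs ?A ((a' - a) *\<^sub>R ?A) = crs ?A ((b' - b) *\<^sub>R ?B)"
   by (simp_all only:)
  then show "a = a' & b = b'" using e(2)[OF n] by simp
 qed
qed

text \<open>The function \<open>gr T k\<close> is the \<open>k\<close>-th derivative of the branch, viewed as a graph over the line
 with direction \<open>T\<close>.\<close>

definition gr :: "complex => nat => 'a => real => real" where
 "gr T k s t = (if k = 0 then crs T (P s t)
  else if k = 1 then crs T (P1 s t) / (T \<bullet> P1 s t)
  else if k = 2 then (crs T (P2 s t) * (T \<bullet> P1 s t) - crs T (P1 s t) * (T \<bullet> P2 s t)) / (T \<bullet> P1 s t)^3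
  else ((crs T (P3 s t) * (T \<bullet> P1 s t) - crs T (P1 s t) * (T \<bullet> P3 s t)) * (T \<bullet> P1 s t)
   - 3 * (crs T (P2 s t) * (T \<bullet> P1 s t) - crs T (P1 s t) * (T \<bullet> P2 s t)) * (T \<bullet> P2 s t)) / (T \<bullet> P1 s t)^5)"

lemma inner_derivs:
 "((%t. T \<bullet> P s t) has_real_derivative T \<bullet> P1 s t) (at t)"
 "((%t. T \<bullet> P1 s t) has_real_derivative T \<bullet> P2 s t) (at t)"
 "((%t. T \<bullet> P2 s t) has_real_derivative T \<bullet> P3 s t) (at t)"
 "((%t. crs T (P s t)) has_real_derivative crs T (P1 s t)) (at t)"
 "((%t. crs T (P1 s t)) has_real_derivative crs T (P2 s t)) (at t)"
 "((%t. crs T (P2 s t)) has_real_derivative crs T (P3 s t)) (at t)"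
 unfolding has_real_derivative_iff_has_vector_derivative
 by (intro P_deriv bounded_linear.has_vector_derivative[OF bounded_linear_inner_right]
   bounded_linear.has_vector_derivative[OF bounded_bilinear.bounded_linear_right[OF bounded_bilinear_crs]])+

lemma gr_deriv:
 assumes k: "k < 3" and n: "T \<bullet> P1 s t ~= 0"
 shows "(gr T k s has_real_derivative gr T (Suc k) s t * (T \<bullet> P1 s t)) (at t)"
proof -
 consider "k = 0" | "k = 1" | "k = 2" using k by linarith
 then show ?thesis
 proof cases
  case 1
  have "gr T 0 s = (%t. crs T (P s t))" by (simp add: gr_def fun_eq_iff)
  then show ?thesis using 1 inner_derivs(4)[of T s t] n by (simp add: gr_def)
 next
  case 2
  have e: "gr T 1 s = (%t. crs T (P1 s t) / (T \<bullet> P1 s t))" by (simp add: gr_def fun_eq_iff)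
  have "((%t. crs T (P1 s t) / (T \<bullet> P1 s t)) has_real_derivative
    (crs T (P2 s t) * (T \<bullet> P1 s t) - crs T (P1 s t) * (T \<bullet> P2 s t)) / ((T \<bullet> P1 s t) * (T \<bullet> P1 s t))) (at t)"
   by (rule DERIV_divide[OF inner_derivs(5) inner_derivs(2) n])
  then show ?thesis
   unfolding 2 e by (rule DERIV_cong) (use n in \<open>simp add: gr_def power3_eq_cube\<close>)
 next
  case 3
  have e: "gr T 2 s = (%t. (crs T (P2 s t) * (T \<bullet> P1 s t) - crs T (P1 s t) * (T \<bullet> P2 s t)) / (T \<bullet> P1 s t)^3)"
   by (simp add: gr_def fun_eq_iff)
  let ?N = "crs T (P2 s t) * (T \<bullet> P1 s t) - crs T (P1 s t) * (T \<bullet> P2 s t)" and ?u = "T \<bullet> P1 s t"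
  let ?N' = "crs T (P3 s t) * (T \<bullet> P1 s t) - crs T (P1 s t) * (T \<bullet> P3 s t)"
  have "((%t. crs T (P2 s t) * (T \<bullet> P1 s t) - crs T (P1 s t) * (T \<bullet> P2 s t)) has_real_derivative ?N') (at t)"
   by (auto intro!: derivative_eq_intros inner_derivs)
  moreover have "((%t. (T \<bullet> P1 s t)^3) has_real_derivative 3 * ?u^2 * (T \<bullet> P2 s t)) (at t)"
   by (auto intro!: derivative_eq_intros inner_derivs)
  ultimately have "((%t. (crs T (P2 s t) * (T \<bullet> P1 s t) - crs T (P1 s t) * (T \<bullet> P2 s t)) / (T \<bullet> P1 s t)^3) has_real_derivative
    (?N' * ?u^3 - ?N * (3 * ?u^2 * (T \<bullet> P2 s t))) / (?u^3 * ?u^3)) (at t)"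
   using n by (intro DERIV_divide) auto
  moreover have "(?N' * ?u^3 - ?N * (3 * ?u^2 * (T \<bullet> P2 s t))) / (?u^3 * ?u^3) = gr T (Suc 2) s t * ?u"
  proof -
   have "(A * u^3 - B * (3 * u^2 * w)) / (u^3 * u^3) = (A * u - 3 * B * w) / u^5 * u" if "u ~= 0" for A B u w :: real
    using that by (simp add: divide_simps) (simp add: power2_eq_square power3_eq_cube algebra_simps power_numeral_reduce)
   from this[OF n, of ?N' ?N "T \<bullet> P2 s t"] show ?thesis by (simp add: gr_def)
  qed
  ultimately show ?thesis unfolding 3 e by (rule DERIV_cong)
 qed
qed

lemma rolle_family:
 assumes k: "k < 3" and x: "x1 < x2" "{x1..x2} \<subseteq> A" "y1 \<in> {b1..b2}" "y2 \<in> {b1..b2}"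
  and n: "!!t. t \<in> A ==> T \<bullet> P1 s t ~= 0" "!!t. t \<in> {b1..b2} ==> T \<bullet> P1 s t ~= 0"
  and eq: "T \<bullet> P s x1 = T \<bullet> P s y1" "T \<bullet> P s x2 = T \<bullet> P s y2" "gr T k s x1 = gr T k s y1" "gr T k s x2 = gr T k s y2"
 obtains x y where "x1 < x" "x < x2" "y \<in> {b1..b2}" "T \<bullet> P s x = T \<bullet> P s y" "gr T (Suc k) s x = gr T (Suc k) s y"
proof -
 have nA: "!!t. t \<in> {x1..x2} ==> T \<bullet> P1 s t ~= 0" using n(1) x(2) by blast
 have "\<exists>a b. x1 < a & a < x2 & b \<in> {b1..b2} & T \<bullet> P s a = T \<bullet> P s b &
   gr T (Suc k) s a * (T \<bullet> P1 s a) / (T \<bullet> P1 s a) = gr T (Suc k) s b * (T \<bullet> P1 s b) / (T \<bullet> P1 s b)"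
  by (rule rolle_two_graphs[OF x(1) inner_derivs(1) nA inner_derivs(1) n(2) gr_deriv[OF k nA] gr_deriv[OF k n(2)] x(3,4) eq])
 then obtain a b where ab: "x1 < a" "a < x2" "b \<in> {b1..b2}" "T \<bullet> P s a = T \<bullet> P s b"
   "gr T (Suc k) s a * (T \<bullet> P1 s a) / (T \<bullet> P1 s a) = gr T (Suc k) s b * (T \<bullet> P1 s b) / (T \<bullet> P1 s b)" by blast
 have "a \<in> A" using ab x(2) by auto
 then show ?thesis using that[OF ab(1-4)] ab(5) n(1)[of a] n(2)[OF ab(3)] by simp
qed

text \<open>Contact of order exactly 1 in terms of derivatives, with \<open>c\<close> the speed
  ratio of the branches; \<open>tang_nondeg2\<close> is order exactly 2. In this form the conditions
  can be compared with nearby diagrams.\<close>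

definition tang_nondeg1 :: "'a => real => real => bool" where
 "tang_nondeg1 s a b \<longleftrightarrow> (\<exists>c. P1 s a = c *\<^sub>R P1 s b & crs (P2 s a - c\<^sup>2 *\<^sub>R P2 s b) (P1 s b) ~= 0)"

definition tang_nondeg2 :: "'a => real => real => bool" where
 "tang_nondeg2 s a b \<longleftrightarrow> (\<exists>c c2. P1 s a = c *\<^sub>R P1 s b & P2 s a = c\<^sup>2 *\<^sub>R P2 s b + (2 * c2) *\<^sub>R P1 s b &
  crs (P3 s a - c^3 *\<^sub>R P3 s b - (6 * c * c2) *\<^sub>R P2 s b) (P1 s b) ~= 0)"

text \<open>Derivatives of a graph do not depend on how the branch is parametrized, so the speed
  ratio drops out: up to sign, the two second derivatives differ by the determinant of
  \<open>tang_nondeg1\<close> over a nonzero factor.\<close>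

lemma tang_nondeg1_gr:
 assumes s: "s \<in> S" and t: "tang_nondeg1 s a b"
 shows "gr (P1 s b) 2 s a ~= gr (P1 s b) 2 s b"
proof -
 obtain c where c: "P1 s a = c *\<^sub>R P1 s b" "crs (P2 s a - c\<^sup>2 *\<^sub>R P2 s b) (P1 s b) ~= 0"
  using t by (auto simp: tang_nondeg1_def)
 define N where "N = P1 s b \<bullet> P1 s b"
 have N: "N ~= 0" using P1_nonzero[OF s] by (simp add: N_def)
 have c0: "c ~= 0" using c(1) P1_nonzero[OF s, of a] by auto
 define v w where "v = crs (P1 s b) (P2 s a)" and "w = crs (P1 s b) (P2 s b)"
 have "v - c\<^sup>2 * w ~= 0" using c(2) crs_swap[of "P1 s b"] by (simp add: v_def w_def)
 moreover have "gr (P1 s b) 2 s a = v * (c * N) / (c * N)^3" "gr (P1 s b) 2 s b = w * N / N^3"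
  by (simp_all add: gr_def c(1) N_def v_def w_def)
 moreover have "v * (c * N) / (c * N)^3 - w * N / N^3 = (v - c\<^sup>2 * w) / (c\<^sup>2 * N\<^sup>2)"
  using N c0 by (simp add: divide_simps) (simp add: power2_eq_square power3_eq_cube algebra_simps)
 ultimately show ?thesis using N c0 by auto
qed

lemma tang_nondeg2_gr:
 assumes s: "s \<in> S" and t: "tang_nondeg2 s a b"
 shows "gr (P1 s b) 3 s a ~= gr (P1 s b) 3 s b"
proof -
 obtain c c2 where c: "P1 s a = c *\<^sub>R P1 s b" "P2 s a = c\<^sup>2 *\<^sub>R P2 s b + (2 * c2) *\<^sub>R P1 s b"
  "crs (P3 s a - c^3 *\<^sub>R P3 s b - (6 * c * c2) *\<^sub>R P2 s b) (P1 s b) ~= 0"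
  using t by (auto simp: tang_nondeg2_def)
 define N where "N = P1 s b \<bullet> P1 s b"
 have N: "N ~= 0" using P1_nonzero[OF s] by (simp add: N_def)
 have c0: "c ~= 0" using c(1) P1_nonzero[OF s, of a] by auto
 define v w v2 u2 where "v = crs (P1 s b) (P3 s a)" and "w = crs (P1 s b) (P3 s b)"
  and "v2 = crs (P1 s b) (P2 s b)" and "u2 = P1 s b \<bullet> P2 s b"
 have ne: "v - c^3 * w - 6 * c * c2 * v2 ~= 0"
  using c(3) crs_swap[of "P1 s b"] by (simp add: v_def w_def v2_def)
 have ga: "gr (P1 s b) 3 s a = (v * (c * N) * (c * N) - 3 * (c\<^sup>2 * v2 * (c * N)) * (c\<^sup>2 * u2 + 2 * c2 * N)) / (c * N)^5"
  and gb: "gr (P1 s b) 3 s b = (w * N * N - 3 * (v2 * N) * u2) / N^5"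
  by (simp_all add: gr_def c(1,2) N_def v_def w_def v2_def u2_def inner_add_right)
 have "(v * (c * N) * (c * N) - 3 * (c\<^sup>2 * v2 * (c * N)) * (c\<^sup>2 * u2 + 2 * c2 * N)) / (c * N)^5 - (w * N * N - 3 * (v2 * N) * u2) / N^5
   = (v - c^3 * w - 6 * c * c2 * v2) / (c^3 * N^3)"
  using N c0 by (simp add: divide_simps) (simp add: power2_eq_square power3_eq_cube algebra_simps power_numeral_reduce)
 then show ?thesis unfolding ga gb using ne N c0 by auto
qed

end

lemma four_increasing:
 fixes A :: "real set"
 assumes "~ (finite A & card A <= 3)"
 obtains x1 x2 x3 x4 where "{x1, x2, x3, x4} \<subseteq> A" "x1 < x2" "x2 < x3" "x3 < x4"
proof -
 have "infinite A | 4 <= card A" using assms by auto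
 then obtain T where T: "T \<subseteq> A" "card T = 4" "finite T"
  using infinite_arbitrarily_large[of A 4] obtain_subset_with_card_n[of 4 A] by (metis card.infinite zero_neq_numeral)
 define xs where "xs = sorted_list_of_set T"
 have l: "length xs = 4" and s: "sorted_wrt (<) xs" and st: "set xs = T"
  using T by (auto simp: xs_def)
 have "xs ! 0 < xs ! 1" "xs ! 1 < xs ! 2" "xs ! 2 < xs ! 3"
  using s l by (auto simp: sorted_wrt_iff_nth_less)
 moreover have "{xs ! 0, xs ! 1, xs ! 2, xs ! 3} \<subseteq> A"
  using T(1) st l nth_mem[of _ xs] by auto
 ultimately show ?thesis using that by blast
qed

context knot_family
begin

lemma tangency_box:
 assumes s0: "s0 \<in> S" and c: "P1 s0 a0 = c *\<^sub>R P1 s0 b0" and T: "T = P1 s0 b0"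
  and k: "k = 2 | k = 3" and g: "gr T k s0 a0 ~= gr T k s0 b0"
 obtains eps where "eps > 0"
  "!!s t. dist s s0 < eps ==> \<bar>t - a0\<bar> < eps ==> T \<bullet> P1 s t ~= 0"
  "!!s t. dist s s0 < eps ==> \<bar>t - b0\<bar> < eps ==> T \<bullet> P1 s t ~= 0"
  "!!s t t'. dist s s0 < eps ==> \<bar>t - a0\<bar> < eps ==> \<bar>t' - b0\<bar> < eps ==> gr T k s t ~= gr T k s t'"
proof -
 define num where "num s t = (if k = 2 then crs T (P2 s t) * (T \<bullet> P1 s t) - crs T (P1 s t) * (T \<bullet> P2 s t)
  else (crs T (P3 s t) * (T \<bullet> P1 s t) - crs T (P1 s t) * (T \<bullet> P3 s t)) * (T \<bullet> P1 s t)
   - 3 * (crs T (P2 s t) * (T \<bullet> P1 s t) - crs T (P1 s t) * (T \<bullet> P2 s t)) * (T \<bullet> P2 s t))" for s t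
 define m :: nat where "m = (if k = 2 then 3 else 5)"
 have gr: "gr T k s t = num s t / (T \<bullet> P1 s t) ^ m" for s t
  using k by (auto simp: gr_def num_def m_def)
 \<comment> \<open>With the denominators multiplied in, one continuous function controls that both
   branches are graphs and that their derivatives of order \<open>k\<close> differ; the last two
   arguments only fit the shape of \<open>nonzero_box\<close>.\<close>
 define h where "h s t t' u u' = (num s t * (T \<bullet> P1 s t') ^ m - num s t' * (T \<bullet> P1 s t) ^ m) * (T \<bullet> P1 s t) * (T \<bullet> P1 s t')"
  for s t t' and u u' :: real
 have cnum: "continuous_on UNIV (%x. num (f x) (g x))" if "continuous_on UNIV f" "continuous_on UNIV g"
  for f :: "'a \<times> real \<times> real \<times> real \<times> real => 'a" and g
  unfolding num_def using k by (cases "k = 2") (auto intro!: continuous_intros crs_continuous P_cont that)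
 have ch: "continuous_on UNIV (%(s, t, t', u, u'). h s t t' u u')"
  unfolding case_prod_unfold h_def by (intro continuous_intros cnum P_cont)
 have ca: "T \<bullet> P1 s0 a0 ~= 0" and cb: "T \<bullet> P1 s0 b0 ~= 0"
  using c P1_nonzero[OF s0, of a0] P1_nonzero[OF s0, of b0] by (auto simp: T)
 have "h s0 a0 b0 0 0 ~= 0"
  using g ca cb by (simp add: gr h_def field_simps)
 with ch obtain eps where e: "eps > 0"
  "!!s a b c d. dist s s0 < eps ==> \<bar>a - a0\<bar> < eps ==> \<bar>b - b0\<bar> < eps ==> \<bar>c - 0\<bar> < eps ==> \<bar>d - 0\<bar> < eps ==>
   h s a b c d ~= 0"
  by (rule nonzero_box) (rule that)
 have h: "h s t t' 0 0 ~= 0" if "dist s s0 < eps" "abs (t - a0) < eps" "abs (t' - b0) < eps" for s t t'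
  using e(2)[OF that, of 0 0] e(1) by simp
 show ?thesis
 proof (rule that[OF e(1)])
  show "T \<bullet> P1 s t ~= 0" if "dist s s0 < eps" "abs (t - a0) < eps" for s t
   using h[OF that, of b0] e(1) by (auto simp: h_def)
  show "T \<bullet> P1 s t ~= 0" if "dist s s0 < eps" "abs (t - b0) < eps" for s t
   using h[OF that(1) _ that(2), of a0] e(1) by (auto simp: h_def)
  show "gr T k s t ~= gr T k s t'" if "dist s s0 < eps" "abs (t - a0) < eps" "abs (t' - b0) < eps" for s t t'
   using h[OF that] by (auto simp: h_def gr field_simps)
 qed
qed

lemma branch_inj:
 assumes n: "!!t. abs (t - b0) < eps ==> T \<bullet> P1 s t ~= 0" and b: "abs (b - b0) < eps" "abs (b' - b0) < eps"
  and eq: "T \<bullet> P s b = T \<bullet> P s b'"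
 shows "b = b'"
proof -
 have "inj_on (%t. T \<bullet> P s t) {min b b'..max b b'}"
  by (rule inj_on_of_derivative_nonzero[OF inner_derivs(1) n]) (use b in \<open>auto simp: abs_less_iff min_def max_def split: if_splits\<close>)
 then show ?thesis using eq by (auto dest: inj_onD)
qed

lemma rolle_family_box:
 assumes k: "k < 3" and x: "x1 < x2" "abs (x1 - a0) < eps" "abs (x2 - a0) < eps" "abs (y1 - b0) < eps" "abs (y2 - b0) < eps"
  and na: "!!t. abs (t - a0) < eps ==> T \<bullet> P1 s t ~= 0" and nb: "!!t. abs (t - b0) < eps ==> T \<bullet> P1 s t ~= 0"
  and eq: "T \<bullet> P s x1 = T \<bullet> P s y1" "T \<bullet> P s x2 = T \<bullet> P s y2" "gr T k s x1 = gr T k s y1" "gr T k s x2 = gr T k s y2"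
 shows "\<exists>x y. x1 < x & x < x2 & abs (x - a0) < eps & abs (y - b0) < eps & T \<bullet> P s x = T \<bullet> P s y &
  gr T (Suc k) s x = gr T (Suc k) s y"
proof -
 have sub: "{x1..x2} \<subseteq> {t. abs (t - a0) < eps}" using x by (auto simp: abs_less_iff)
 have ys: "y1 \<in> {min y1 y2..max y1 y2}" "y2 \<in> {min y1 y2..max y1 y2}" by auto
 have m: "abs (t - b0) < eps" if "t \<in> {min y1 y2..max y1 y2}" for t
  using that x by (auto simp: abs_less_iff min_def max_def split: if_splits)
 have n1: "T \<bullet> P1 s t ~= 0" if "t \<in> {t. abs (t - a0) < eps}" for t using na that by simp
 have n2: "T \<bullet> P1 s t ~= 0" if "t \<in> {min y1 y2..max y1 y2}" for t using nb m that by blast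
 obtain x y where xy: "x1 < x" "x < x2" "y \<in> {min y1 y2..max y1 y2}" "T \<bullet> P s x = T \<bullet> P s y"
  "gr T (Suc k) s x = gr T (Suc k) s y"
  by (rule rolle_family[OF k x(1) sub ys n1 n2 eq]) (simp_all only:)
 moreover have "abs (x - a0) < eps" using xy(1,2) x(2,3) by (auto simp: abs_less_iff)
 ultimately show ?thesis using m by blast
qed

text \<open>A tangency is a double intersection of two graphs. With a further intersection Rolle
  gives another place of equal slopes, and Rolle for the slopes a place of equal second derivatives,
  which nondegeneracy excludes nearby.\<close>

lemma tangency_unique:
 assumes s0: "s0 \<in> S" and nd: "tang_nondeg1 s0 a0 b0"
 obtains eps where "eps > 0"
  "!!s a b a' b'. dist s s0 < eps ==> \<bar>a - a0\<bar> < eps ==> \<bar>b - b0\<bar> < eps ==> \<bar>a' - a0\<bar> < eps ==> \<bar>b' - b0\<bar> < eps ==>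
   P s a = P s b ==> crs (P1 s a) (P1 s b) = 0 ==> P s a' = P s b' ==> a = a' & b = b'"
proof -
 define T where "T = P1 s0 b0"
 obtain c where c: "P1 s0 a0 = c *\<^sub>R P1 s0 b0" using nd by (auto simp: tang_nondeg1_def)
 obtain eps where e: "eps > 0"
  "!!s t. dist s s0 < eps ==> \<bar>t - a0\<bar> < eps ==> T \<bullet> P1 s t ~= 0"
  "!!s t. dist s s0 < eps ==> \<bar>t - b0\<bar> < eps ==> T \<bullet> P1 s t ~= 0"
  "!!s t t'. dist s s0 < eps ==> \<bar>t - a0\<bar> < eps ==> \<bar>t' - b0\<bar> < eps ==> gr T 2 s t ~= gr T 2 s t'"
  using tang_nondeg1_gr[OF s0 nd] by (auto intro: tangency_box[OF s0 c T_def, of 2] simp: T_def)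
 show ?thesis
 proof (rule that[OF e(1)])
  fix s a b a' b'
  assume n: "dist s s0 < eps" "abs (a - a0) < eps" "abs (b - b0) < eps" "abs (a' - a0) < eps" "abs (b' - b0) < eps"
   and p: "P s a = P s b" "crs (P1 s a) (P1 s b) = 0" "P s a' = P s b'"
  note na = e(2)[OF n(1)] and nb = e(3)[OF n(1)]
  have g0: "gr T 0 s a = gr T 0 s b" "gr T 0 s a' = gr T 0 s b'" using p by (simp_all add: gr_def)
  have Tp: "T \<bullet> P s a = T \<bullet> P s b" and Tp': "T \<bullet> P s a' = T \<bullet> P s b'" using p by simp_all
  have "P1 s b ~= 0" using nb[OF n(3)] by auto
  then obtain r where "P1 s a = r *\<^sub>R P1 s b" using p(2) crs_eq_0D by blast
  then have g1: "gr T 1 s a = gr T 1 s b" using na[OF n(2)] by (simp add: gr_def)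
  have "a = a'"
  proof (rule ccontr)
   assume "a ~= a'"
   then have "\<exists>x y. x ~= a & abs (x - a0) < eps & abs (y - b0) < eps & T \<bullet> P s x = T \<bullet> P s y & gr T 1 s x = gr T 1 s y"
   proof (cases "a < a'")
    case True
    have "\<exists>x y. a < x & x < a' & abs (x - a0) < eps & abs (y - b0) < eps & T \<bullet> P s x = T \<bullet> P s y &
      gr T (Suc 0) s x = gr T (Suc 0) s y"
     by (rule rolle_family_box[OF _ True n(2,4,3,5) na nb Tp Tp' g0]) simp
    then show ?thesis by (metis One_nat_def less_irrefl)
   next
    case False
    then have "a' < a" using \<open>a ~= a'\<close> by simp
    have "\<exists>x y. a' < x & x < a & abs (x - a0) < eps & abs (y - b0) < eps & T \<bullet> P s x = T \<bullet> P s y &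
      gr T (Suc 0) s x = gr T (Suc 0) s y"
     by (rule rolle_family_box[OF _ \<open>a' < a\<close> n(4,2,5,3) na nb Tp' Tp g0(2,1)]) simp
    then show ?thesis by (metis One_nat_def less_irrefl)
   qed
   then obtain x y where xy: "x ~= a" "abs (x - a0) < eps" "abs (y - b0) < eps" "T \<bullet> P s x = T \<bullet> P s y" "gr T 1 s x = gr T 1 s y"
    by (elim exE conjE)
   have "\<exists>x y. abs (x - a0) < eps & abs (y - b0) < eps & gr T 2 s x = gr T 2 s y"
   proof (cases "a < x")
    case True
    have "\<exists>u v. a < u & u < x & abs (u - a0) < eps & abs (v - b0) < eps & T \<bullet> P s u = T \<bullet> P s v &
      gr T (Suc 1) s u = gr T (Suc 1) s v"
     by (rule rolle_family_box[OF _ True n(2) xy(2) n(3) xy(3) na nb Tp xy(4) g1 xy(5)]) simp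
    then show ?thesis by (metis One_nat_def numeral_2_eq_2)
   next
    case False
    then have "x < a" using xy(1) by simp
    have "\<exists>u v. x < u & u < a & abs (u - a0) < eps & abs (v - b0) < eps & T \<bullet> P s u = T \<bullet> P s v &
      gr T (Suc 1) s u = gr T (Suc 1) s v"
     by (rule rolle_family_box[OF _ \<open>x < a\<close> xy(2) n(2) xy(3) n(3) na nb xy(4) Tp xy(5) g1]) simp
    then show ?thesis by (metis One_nat_def numeral_2_eq_2)
   qed
   then show False using e(4)[OF n(1)] by blast
  qed
  moreover from this have "b = b'" using branch_inj[of b0 eps T s b b'] nb n p by metis
  ultimately show "a = a' & b = b'" by blast
 qed
qed

text \<open>Four intersections of two graphs force three places of equal slope, two of equal second
  and one of equal third derivative; one of the last two orders is excluded nearby. Intersections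
  are counted by their first parameter, which determines the second.\<close>

lemma tangency_count:
 assumes s0: "s0 \<in> S" and nd: "tang_nondeg1 s0 a0 b0 | tang_nondeg2 s0 a0 b0"
 obtains eps where "eps > 0"
  "!!s. dist s s0 < eps ==> finite {(a, b). abs (a - a0) < eps & abs (b - b0) < eps & P s a = P s b} &
   card {(a, b). abs (a - a0) < eps & abs (b - b0) < eps & P s a = P s b} <= 3"
proof -
 define T where "T = P1 s0 b0"
 obtain c where c: "P1 s0 a0 = c *\<^sub>R P1 s0 b0" using nd by (auto simp: tang_nondeg1_def tang_nondeg2_def)
 obtain k where k: "k = 2 | k = 3" "gr T k s0 a0 ~= gr T k s0 b0"
  using nd tang_nondeg1_gr[OF s0] tang_nondeg2_gr[OF s0] unfolding T_def by metis
 obtain eps where e: "eps > 0"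
  "!!s t. dist s s0 < eps ==> \<bar>t - a0\<bar> < eps ==> T \<bullet> P1 s t ~= 0"
  "!!s t. dist s s0 < eps ==> \<bar>t - b0\<bar> < eps ==> T \<bullet> P1 s t ~= 0"
  "!!s t t'. dist s s0 < eps ==> \<bar>t - a0\<bar> < eps ==> \<bar>t' - b0\<bar> < eps ==> gr T k s t ~= gr T k s t'"
  by (rule tangency_box[OF s0 c T_def k]) (rule that)
 show ?thesis
 proof (rule that[OF e(1)])
  fix s assume s: "dist s s0 < eps"
  note na = e(2)[OF s] and nb = e(3)[OF s]
  define D where "D = {(a, b). abs (a - a0) < eps & abs (b - b0) < eps & P s a = P s b}"
  define Z where "Z j x y \<longleftrightarrow> \<bar>x - a0\<bar> < eps & abs (y - b0) < eps & T \<bullet> P s x = T \<bullet> P s y & gr T j s x = gr T j s y" for j x y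
  have roll: "\<exists>x y. x1 < x & x < x2 & Z (Suc j) x y" if "Z j x1 y1" "Z j x2 y2" "x1 < x2" "j < 3" for j x1 y1 x2 y2
   using rolle_family_box[of j x1 x2 a0 eps y1 b0 y2 T s] that na nb unfolding Z_def by blast
  have inj: "inj_on fst D"
  proof (rule inj_onI)
   fix p q assume pq: "p \<in> D" "q \<in> D" "fst p = fst q"
   obtain a b a' b' where e: "p = (a, b)" "q = (a', b')" by (cases p, cases q) auto
   then have "b = b'" using branch_inj[of b0 eps T s b b'] nb pq by (auto simp: D_def)
   then show "p = q" using pq e by simp
  qed
  have "finite (fst ` D) & card (fst ` D) <= 3"
  proof (rule ccontr)
   assume "~ ?thesis"
   then obtain x1 x2 x3 x4 where x: "{x1, x2, x3, x4} \<subseteq> fst ` D" "x1 < x2" "x2 < x3" "x3 < x4"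
    by (rule four_increasing)
   have "\<exists>y. Z 0 x y" if "x \<in> fst ` D" for x using that by (auto simp: D_def Z_def gr_def)
   then obtain y1 y2 y3 y4 where y: "Z 0 x1 y1" "Z 0 x2 y2" "Z 0 x3 y3" "Z 0 x4 y4" using x(1) by (metis insert_subset)
   obtain u1 v1 where 1: "x1 < u1" "u1 < x2" "Z 1 u1 v1" using roll[OF y(1,2) x(2)] by auto
   obtain u2 v2 where 2: "x2 < u2" "u2 < x3" "Z 1 u2 v2" using roll[OF y(2,3) x(3)] by auto
   obtain u3 v3 where 3: "x3 < u3" "u3 < x4" "Z 1 u3 v3" using roll[OF y(3,4) x(4)] by auto
   obtain w1 z1 where 4: "u1 < w1" "w1 < u2" "Z 2 w1 z1" using roll[OF 1(3) 2(3)] 1 2 by (auto simp: numeral_2_eq_2)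
   obtain w2 z2 where 5: "u2 < w2" "w2 < u3" "Z 2 w2 z2" using roll[OF 2(3) 3(3)] 2 3 by (auto simp: numeral_2_eq_2)
   obtain t r where 6: "Z 3 t r" using roll[OF 4(3) 5(3)] 4 5 by (auto simp: numeral_3_eq_3 numeral_2_eq_2)
   show False using k(1) 4(3) 6 e(4)[OF s] by (auto simp: Z_def)
  qed
  then show "finite D & card D <= 3"
   using finite_image_iff[OF inj] card_image[OF inj] by simp
 qed
qed

end

section \<open>Openness of the generic stratum and persistence of codimension 1 points\<close>

lemma compact_tube_ex:
 fixes K :: "('a::metric_space \<times> 'b::metric_space) set"
 assumes "compact K" "open U" "\<forall>y. (s0, y) \<in> K --> (s0, y) \<in> U"
 shows "\<exists>delta>0. \<forall>s y. (s, y) \<in> K --> dist s s0 < delta --> (s, y) \<in> U"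
proof -
 have "!!y. (s0, y) \<in> K ==> (s0, y) \<in> U" using assms(3) by blast
 from compact_tube[OF assms(1,2) this] show ?thesis by metis
qed

lemma compact_tube_empty:
 fixes K :: "('a::metric_space \<times> 'b::metric_space) set"
 assumes "compact K" "\<forall>y. (s0, y) \<notin> K"
 shows "\<exists>delta>0. \<forall>s y. dist s s0 < delta --> (s, y) \<notin> K"
proof -
 have "\<exists>delta>0. \<forall>s y. (s, y) \<in> K --> dist s s0 < delta --> (s, y) \<in> {}"
  by (rule compact_tube_ex[OF assms(1) open_empty]) (simp add: assms(2))
 then obtain delta where d: "delta > 0" "\<forall>s y. (s, y) \<in> K --> dist s s0 < delta --> (s, y) \<in> {}"
  by (elim exE conjE)
 have "\<forall>s y. dist s s0 < delta --> (s, y) \<notin> K"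
  using d(2) unfolding empty_iff by blast
 then show ?thesis using d(1) by (intro exI[of _ delta]) simp
qed

context knot_family
begin

text \<open>Tangential double points and triple points form compact sets over \<open>S\<close>;
  where their fibres over \<open>s0\<close> are empty, so are the nearby fibres.\<close>

lemma generic_stable:
 assumes s0: "s0 \<in> S" and g: "!!q. generic_point (slice F s0) q"
 obtains delta where "delta > 0" "!!s q. s \<in> S ==> dist s s0 < delta ==> generic_point (slice F s) q"
proof -
 let ?K2 = "{(s, a, b). s \<in> S & slope s a b = 0 & (s, a, b) \<in> {(s, a, b). crs (P1 s a) (P1 s b) = 0}}"
 let ?K3 = "{(s, a, b, c). s \<in> S & slope s a b = 0 & slope s a c = 0 & slope s b c = 0}"
 have n: "~ (\<exists>a b. slope s0 a b = 0 & crs (P1 s0 a) (P1 s0 b) = 0)"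
  "~ (\<exists>a b c. slope s0 a b = 0 & slope s0 a c = 0 & slope s0 b c = 0)"
 proof -
  show "~ (\<exists>a b. slope s0 a b = 0 & crs (P1 s0 a) (P1 s0 b) = 0)"
  proof
   assume "\<exists>a b. slope s0 a b = 0 & crs (P1 s0 a) (P1 s0 b) = 0"
   then obtain a b where "slope s0 a b = 0" "crs (P1 s0 a) (P1 s0 b) = 0" by (elim exE conjE)
   then have "~ generic_point (slice F s0) (pr (F (s0, a)))"
    unfolding not_generic_iff[OF s0] by (intro disjI1 exI[of _ a] exI[of _ b]) simp
   then show False using g by simp
  qed
  show "~ (\<exists>a b c. slope s0 a b = 0 & slope s0 a c = 0 & slope s0 b c = 0)"
  proof
   assume "\<exists>a b c. slope s0 a b = 0 & slope s0 a c = 0 & slope s0 b c = 0"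
   then obtain a b c where "slope s0 a b = 0" "slope s0 a c = 0" "slope s0 b c = 0" by (elim exE conjE)
   then have "~ generic_point (slice F s0) (pr (F (s0, a)))"
    unfolding not_generic_iff[OF s0] by (intro disjI2 exI[of _ a] exI[of _ b] exI[of _ c]) simp
   then show False using g by simp
  qed
 qed
 have e2: "\<forall>y. (s0, y) \<notin> ?K2"
 proof (intro allI notI)
  fix y assume y: "(s0, y) \<in> ?K2"
  obtain a b where "y = (a, b)" by (cases y)
  then have "slope s0 a b = 0 & crs (P1 s0 a) (P1 s0 b) = 0" using y by simp
  then show False using n(1) by (elim notE) (intro exI)
 qed
 have e3: "\<forall>z. (s0, z) \<notin> ?K3"
 proof (intro allI notI)
  fix z assume z: "(s0, z) \<in> ?K3"
  obtain a b c where "z = (a, b, c)" by (cases z)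
  then have "slope s0 a b = 0 & slope s0 a c = 0 & slope s0 b c = 0" using z by simp
  then show False using n(2) by (elim notE) (intro exI)
 qed
 obtain d2 where d2: "d2 > 0" "\<forall>s y. dist s s0 < d2 --> (s, y) \<notin> ?K2"
  using compact_tube_empty[OF compact_doubles_closed[OF closed_tangential] e2] by (elim exE conjE)
 obtain d3 where d3: "d3 > 0" "\<forall>s y. dist s s0 < d3 --> (s, y) \<notin> ?K3"
  using compact_tube_empty[OF compact_triples e3] by (elim exE conjE)
 show ?thesis
 proof (rule that[of "min d2 d3"])
  show "min d2 d3 > 0" using d2 d3 by simp
  fix s q assume s: "s \<in> S" "dist s s0 < min d2 d3"
  show "generic_point (slice F s) q"
  proof (rule ccontr)
   assume "~ ?thesis"
   then consider a b where "slope s a b = 0" "crs (P1 s a) (P1 s b) = 0"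
    | a b c where "slope s a b = 0" "slope s a c = 0" "slope s b c = 0"
    unfolding not_generic_iff[OF s(1)] by blast
   then show False
   proof cases
    case (1 a b) then show False using d2(2)[rule_format, of s "(a, b)"] s by simp
   next
    case (2 a b c) then show False using d3(2)[rule_format, of s "(a, b, c)"] s by simp
   qed
  qed
 qed
qed

text \<open>A failure of injectivity is a double point of the projection with equal heights, again a
  compact condition.\<close>

lemma embedding_stable:
 assumes s0: "s0 \<in> S" and i: "inj (slice F s0)"
 obtains delta where "delta > 0" "!!s. s \<in> S ==> dist s s0 < delta ==> (slice F s) \<in> params_upto R"
proof -
 let ?C = "{(s, a, b). F (s, a) $ 3 = F (s, b) $ 3}"
 let ?K = "{(s, a, b). s \<in> S & slope s a b = 0 & (s, a, b) \<in> ?C}"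
 have "closed {z. F (fst z, fst (snd z)) $ 3 = F (fst z, snd (snd z)) $ 3}"
  by (intro closed_Collect_eq continuous_intros continuous_on_compose2[OF smooth_continuous[OF smF, of UNIV]]) auto
 then have "closed ?C" by (simp add: case_prod_unfold)
 then have K: "compact ?K" by (rule compact_doubles_closed)
 have eq: "F (s, a) = F (s, b)" if "s \<in> S" "slope s a b = 0" "F (s, a) $ 3 = F (s, b) $ 3" for s a b
 proof -
  have "pz (F (s, a)) = pz (F (s, b))" using that(1,2) by (simp add: slope_zero_iff P_def)
  then have "F (s, a) $ 1 = F (s, b) $ 1" "F (s, a) $ 2 = F (s, b) $ 2" by (metis pz_simps)+
  then show ?thesis using that(3) by (simp add: vec_eq_iff forall_3)
 qed
 have e: "\<forall>y. (s0, y) \<notin> ?K"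
  using eq[OF s0] injD[OF i] slope_zero_iff[OF s0] by auto
 obtain d where d: "d > 0" "\<forall>s y. dist s s0 < d --> (s, y) \<notin> ?K"
  using compact_tube_empty[OF K e] by (elim exE conjE)
 show ?thesis
 proof (rule that[OF d(1)])
  fix s assume s: "s \<in> S" "dist s s0 < d"
  have "inj (slice F s)"
  proof (rule injI)
   fix a b assume ab: "F (s, a) = F (s, b)"
   show "a = b"
   proof (rule ccontr)
    assume "a ~= b"
    then have "(s, (a, b)) \<in> ?K" using ab s by (simp add: slope_zero_iff P_def)
    then show False using d(2) s by blast
   qed
  qed
  moreover have "pz (velocity (slice F s) t) ~= 0" for t
   using P1_nonzero[OF s(1)] P_velocity by simp
  ultimately show "(slice F s) \<in> params_upto R"
   using outF[OF s(1)] by (intro params_uptoI smooth_curve) auto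
 qed
qed

text \<open>Used to exclude contact of order 2 wherever the second graph derivatives are known to
  differ.\<close>

lemma contact_2_gr:
 assumes "P1 s a = c *\<^sub>R P1 s b" "P2 s a = c\<^sup>2 *\<^sub>R P2 s b + (2 * c2) *\<^sub>R P1 s b" "T \<bullet> P1 s a ~= 0" "T \<bullet> P1 s b ~= 0"
 shows "gr T 2 s a = gr T 2 s b"
proof -
 have "c ~= 0" using assms by auto
 then show ?thesis
  using assms by (simp add: gr_def inner_add_right divide_simps)
   (simp add: power2_eq_square power3_eq_cube algebra_simps)
qed

text \<open>The pair \<open>a0\<close>, \<open>b0\<close> stays tangent by assumption, so only
  further singular points or a higher contact could spoil the stratum. The tube lemma confines
  tangencies to the neighbourhood of the pair, where \<open>tangency_unique\<close> applies; higher
  contact is excluded by the second graph derivatives.\<close>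

lemma tangency_persists:
 assumes s0: "s0 \<in> S" and ab: "a0 ~= b0"
  and P: "!!s. s \<in> S ==> P s a0 = P s b0" "!!s. s \<in> S ==> crs (P1 s a0) (P1 s b0) = 0"
  and nd: "tang_nondeg1 s0 a0 b0"
  and only: "!!a b. slope s0 a b = 0 ==> crs (P1 s0 a) (P1 s0 b) = 0 ==> (a, b) = (a0, b0) | (a, b) = (b0, a0)"
  and no3: "!!a b c. slope s0 a b = 0 ==> slope s0 a c = 0 ==> slope s0 b c = 0 ==> False"
 obtains delta where "delta > 0" "!!s. s \<in> S ==> dist s s0 < delta ==> codim1_point (slice F s) (pr (F (s, a0))) &
   (\<forall>q. q ~= pr (F (s, a0)) --> generic_point (slice F s) q)"
proof -
 let ?K2 = "{(s, a, b). s \<in> S & slope s a b = 0 & (s, a, b) \<in> {(s, a, b). crs (P1 s a) (P1 s b) = 0}}"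
 let ?K3 = "{(s, a, b, c). s \<in> S & slope s a b = 0 & slope s a c = 0 & slope s b c = 0}"
 obtain e1 where e1: "e1 > 0"
  "!!s a b a' b'. dist s s0 < e1 ==> \<bar>a - a0\<bar> < e1 ==> \<bar>b - b0\<bar> < e1 ==> \<bar>a' - a0\<bar> < e1 ==> \<bar>b' - b0\<bar> < e1 ==>
   P s a = P s b ==> crs (P1 s a) (P1 s b) = 0 ==> P s a' = P s b' ==> a = a' & b = b'"
  by (rule tangency_unique[OF s0 nd]) (rule that)
 obtain c where c: "P1 s0 a0 = c *\<^sub>R P1 s0 b0" using nd by (auto simp: tang_nondeg1_def)
 define T where "T = P1 s0 b0"
 have g: "gr T 2 s0 a0 ~= gr T 2 s0 b0" using tang_nondeg1_gr[OF s0 nd] by (simp add: T_def)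
 obtain e2 where e2: "e2 > 0"
  "!!s t. dist s s0 < e2 ==> \<bar>t - a0\<bar> < e2 ==> T \<bullet> P1 s t ~= 0"
  "!!s t. dist s s0 < e2 ==> \<bar>t - b0\<bar> < e2 ==> T \<bullet> P1 s t ~= 0"
  "!!s t t'. dist s s0 < e2 ==> \<bar>t - a0\<bar> < e2 ==> \<bar>t' - b0\<bar> < e2 ==> gr T 2 s t ~= gr T 2 s t'"
  by (rule tangency_box[OF s0 c T_def _ g]) (blast, rule that)
 let ?U = "ball s0 e1 \<times> {a0 - e1<..<a0 + e1} \<times> {b0 - e1<..<b0 + e1} \<union> ball s0 e1 \<times> {b0 - e1<..<b0 + e1} \<times> {a0 - e1<..<a0 + e1}"
 have oU: "open ?U" by (intro open_Un open_Times) auto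
 have in2: "\<forall>y. (s0, y) \<in> ?K2 --> (s0, y) \<in> ?U"
 proof (intro allI impI)
  fix y assume y: "(s0, y) \<in> ?K2"
  obtain a b where ab: "y = (a, b)" by (cases y) auto
  then have "(a, b) = (a0, b0) | (a, b) = (b0, a0)" using y by (intro only) auto
  then show "(s0, y) \<in> ?U" using e1(1) unfolding ab by (elim disjE) simp_all
 qed
 have in3: "\<forall>z. (s0, z) \<notin> ?K3"
  using no3 by auto
 obtain d2 where d2: "d2 > 0" "\<forall>s y. (s, y) \<in> ?K2 --> dist s s0 < d2 --> (s, y) \<in> ?U"
  using compact_tube_ex[OF compact_doubles_closed[OF closed_tangential] oU in2] by (elim exE conjE)
 obtain d3 where d3: "d3 > 0" "\<forall>s y. dist s s0 < d3 --> (s, y) \<notin> ?K3"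
  using compact_tube_empty[OF compact_triples in3] by (elim exE conjE)
 define d where "d = Min {d2, d3, e1, e2}"
 have dpos: "d > 0" using d2(1) d3(1) e1(1) e2(1) by (simp add: d_def)
 show ?thesis
 proof (rule that[OF dpos])
  fix s assume s: "s \<in> S" "dist s s0 < d"
  then have ds: "dist s s0 < d2" "dist s s0 < d3" "dist s s0 < e1" "dist s s0 < e2" by (simp_all add: d_def)
  have no3s: False if "slope s a b = 0" "slope s a c = 0" "slope s b c = 0" for a b c
   using d3(2)[rule_format, of s "(a, b, c)"] that s(1) ds(2) by simp
  have pp: "P s a0 = P s b0" and cc: "crs (P1 s a0) (P1 s b0) = 0" using P[OF s(1)] by auto
  have sl: "slope s a0 b0 = 0" using pp ab s(1) by (simp add: slope_zero_iff)
  have tan: "(a, b) = (a0, b0) | (a, b) = (b0, a0)" if "slope s a b = 0" "crs (P1 s a) (P1 s b) = 0" for a b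
  proof -
   have "P s a = P s b" using that(1) by (simp add: slope_zero_iff[OF s(1)])
   have "(s, (a, b)) \<in> ?U" using d2(2)[rule_format, of s "(a, b)"] that s(1) ds(1) by simp
   then consider "abs (a - a0) < e1" "abs (b - b0) < e1" | "abs (a - b0) < e1" "abs (b - a0) < e1" by (auto simp: abs_less_iff)
   then show ?thesis
   proof cases
    case 1
    then show ?thesis using e1(2)[OF ds(3) 1, of a0 b0] e1(1) \<open>P s a = P s b\<close> that(2) pp by simp
   next
    case 2
    have "crs (P1 s b) (P1 s a) = 0" using that(2) crs_swap[of "P1 s b"] by simp
    then show ?thesis using e1(2)[OF ds(3) 2(2,1), of a0 b0] e1(1) \<open>P s a = P s b\<close> pp by simp
   qed
  qed
  have gen: "generic_point (slice F s) q" if q: "q ~= pr (F (s, a0))" for q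
  proof (rule ccontr)
   assume "~ ?thesis"
   then consider a b where "slope s a b = 0" "crs (P1 s a) (P1 s b) = 0" "pr (F (s, a)) = q"
    | a b c where "slope s a b = 0" "slope s a c = 0" "slope s b c = 0"
    unfolding not_generic_iff[OF s(1)] by blast
   then show False
   proof cases
    case (1 a b)
    then have "a = a0 | a = b0" using tan by blast
    then show False using 1(3) q pp same_point_iff[of s b0 a0] by auto
   next
    case (2 a b c) then show False by (rule no3s)
   qed
  qed
  have br: "branches (slice F s) (pr (F (s, a0))) = {a0, b0}"
  proof -
   have "t = a0 | t = b0" if "pr (F (s, t)) = pr (F (s, a0))" for t
   proof (rule ccontr)
    assume t: "~ ?thesis"
    have "P s t = P s a0" using that same_point_iff[of s t a0] by simp
    then have "slope s a0 t = 0" "slope s b0 t = 0" using t pp s(1) by (auto simp: slope_zero_iff)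
    then show False using no3s[OF sl] by blast
   qed
   then show ?thesis using pp same_point_iff[of s b0 a0] by (auto simp: branches_def)
  qed
  have pf: "pz (F (s, a0)) = pz (F (s, b0))" using pp by (simp add: P_def)
  have nz: "pz (velocity (slice F s) b0) ~= 0" using P1_nonzero[OF s(1)] P_velocity by simp
  have "contact_ge 1 (slice F s) a0 b0"
   using contact_1_iff[OF smooth_curve pf nz] cc P_velocity by simp
  moreover have "~ contact_ge 2 (slice F s) a0 b0"
  proof
   assume "contact_ge 2 (slice F s) a0 b0"
   then obtain c1 c2 where "P1 s a0 = c1 *\<^sub>R P1 s b0" "P2 s a0 = c1\<^sup>2 *\<^sub>R P2 s b0 + (2 * c2) *\<^sub>R P1 s b0"
    using contact_geD[OF smooth_curve pf] unfolding P_velocity by (metis order_refl one_le_numeral)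
   then have "gr T 2 s a0 = gr T 2 s b0"
    using e2(1) e2(2)[OF ds(4), of a0] e2(3)[OF ds(4), of b0] by (intro contact_2_gr[of s a0 c1 b0 c2]) auto
   then show False using e2(1) e2(4)[OF ds(4), of a0 b0] by simp
  qed
  ultimately have "contact 1 (slice F s) a0 b0" by (simp add: contact_def numeral_2_eq_2)
  then have "self_tangency 1 (slice F s) (pr (F (s, a0)))"
   unfolding self_tangency_def using br ab by blast
  then show "codim1_point (slice F s) (pr (F (s, a0))) &
   (\<forall>q. q ~= pr (F (s, a0)) --> generic_point (slice F s) q)"
   using gen by (simp add: codim1_point_def)
 qed
qed

text \<open>The scheme of \<open>tangency_persists\<close>, with \<open>double_unique\<close> for
  two of the three pairs. Restricting to sorted triples leaves a single point in the fibre over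
  \<open>s0\<close>.\<close>

lemma triple_persists:
 assumes s0: "s0 \<in> S" and abc: "a0 < b0" "b0 < c0"
  and P: "!!s. s \<in> S ==> P s a0 = P s b0" "!!s. s \<in> S ==> P s a0 = P s c0"
  and tv: "!!a b. slope s0 a b = 0 ==> crs (P1 s0 a) (P1 s0 b) ~= 0"
  and only: "!!a b c. a < b ==> b < c ==> P s0 a = P s0 b ==> P s0 a = P s0 c ==> (a, b, c) = (a0, b0, c0)"
 obtains delta where "delta > 0" "!!s. s \<in> S ==> dist s s0 < delta ==> codim1_point (slice F s) (pr (F (s, a0))) &
   (\<forall>q. q ~= pr (F (s, a0)) --> generic_point (slice F s) q)"
proof -
 let ?K2 = "{(s, a, b). s \<in> S & slope s a b = 0 & (s, a, b) \<in> {(s, a, b). crs (P1 s a) (P1 s b) = 0}}"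
 let ?K3 = "{(s, a, b, c). s \<in> S & slope s a b = 0 & slope s a c = 0 & slope s b c = 0}
  \<inter> {(s, a, b, c). a <= b & b <= c}"
 have t1: "crs (P1 s0 a0) (P1 s0 b0) ~= 0" and t2: "crs (P1 s0 a0) (P1 s0 c0) ~= 0"
  using abc P[OF s0] by (auto intro!: tv simp: slope_zero_iff[OF s0])
 obtain e1 where e1: "e1 > 0"
  "!!s a b a' b'. dist s s0 < e1 ==> \<bar>a - a0\<bar> < e1 ==> \<bar>b - b0\<bar> < e1 ==> \<bar>a' - a0\<bar> < e1 ==> \<bar>b' - b0\<bar> < e1 ==>
   P s a = P s b ==> P s a' = P s b' ==> a = a' & b = b'"
  by (rule double_unique[OF t1]) (rule that)
 obtain e2 where e2: "e2 > 0"
  "!!s a b a' b'. dist s s0 < e2 ==> \<bar>a - a0\<bar> < e2 ==> \<bar>b - c0\<bar> < e2 ==> \<bar>a' - a0\<bar> < e2 ==> \<bar>b' - c0\<bar> < e2 ==>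
   P s a = P s b ==> P s a' = P s b' ==> a = a' & b = b'"
  by (rule double_unique[OF t2]) (rule that)
 define e where "e = min e1 e2"
 have e: "e > 0" "e <= e1" "e <= e2" using e1(1) e2(1) by (auto simp: e_def)
 let ?U = "ball s0 e \<times> {a0 - e<..<a0 + e} \<times> {b0 - e<..<b0 + e} \<times> {c0 - e<..<c0 + e}"
 have oU: "open ?U" by (intro open_Times) auto
 have "closed {z::'a \<times> real \<times> real \<times> real. fst (snd z) <= fst (snd (snd z)) & fst (snd (snd z)) <= snd (snd (snd z))}"
  by (intro closed_Collect_conj closed_Collect_le continuous_intros)
 then have cK3: "compact ?K3"
  by (intro compact_Int_closed compact_triples) (simp add: case_prod_unfold)
 have in2: "\<forall>y. (s0, y) \<notin> ?K2"
  using tv by auto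
 have in3: "\<forall>z. (s0, z) \<in> ?K3 --> (s0, z) \<in> ?U"
 proof (intro allI impI)
  fix z assume z: "(s0, z) \<in> ?K3"
  obtain a b c where zz: "z = (a, b, c)" by (cases z) auto
  have "(a, b, c) = (a0, b0, c0)"
   using z unfolding zz by (intro only) (auto simp: slope_zero_iff[OF s0])
  then show "(s0, z) \<in> ?U" using zz e(1) by simp
 qed
 obtain d2 where d2: "d2 > 0" "\<forall>s y. dist s s0 < d2 --> (s, y) \<notin> ?K2"
  using compact_tube_empty[OF compact_doubles_closed[OF closed_tangential] in2] by (elim exE conjE)
 obtain d3 where d3: "d3 > 0" "\<forall>s y. (s, y) \<in> ?K3 --> dist s s0 < d3 --> (s, y) \<in> ?U"
  using compact_tube_ex[OF cK3 oU in3] by (elim exE conjE)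
 define d where "d = Min {d2, d3, e}"
 have dpos: "d > 0" using d2(1) d3(1) e(1) by (simp add: d_def)
 show ?thesis
 proof (rule that[OF dpos])
  fix s assume s: "s \<in> S" "dist s s0 < d"
  then have ds: "dist s s0 < d2" "dist s s0 < d3" "dist s s0 < e1" "dist s s0 < e2"
   using e by (simp_all add: d_def)
  have pp: "P s a0 = P s b0" "P s a0 = P s c0" using P[OF s(1)] by auto
  have three: "(a, b, c) = (a0, b0, c0)" if "a < b" "b < c" "P s a = P s b" "P s a = P s c" for a b c
  proof -
   have "(s, (a, b, c)) \<in> ?K3" using that s(1) by (simp add: slope_zero_iff)
   then have "(s, (a, b, c)) \<in> ?U" using d3(2) ds(2) by blast
   then have "abs (a - a0) < e" "abs (b - b0) < e" "abs (c - c0) < e" by (auto simp: abs_less_iff)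
   then show ?thesis
    using e1(2)[OF ds(3), of a b a0 b0] e2(2)[OF ds(4), of a c a0 c0] e e1(1) e2(1) that pp by simp
  qed
  have three': "pr (F (s, a)) = pr (F (s, a0)) & a \<in> {a0, b0, c0} & b \<in> {a0, b0, c0} & c \<in> {a0, b0, c0}"
   if "slope s a b = 0" "slope s a c = 0" "slope s b c = 0" for a b c
  proof -
   have ne: "a ~= b" "a ~= c" "b ~= c" and pq: "P s a = P s b" "P s a = P s c" using that by (simp_all add: slope_zero_iff[OF s(1)])
   consider "a < b" "b < c" | "a < c" "c < b" | "b < a" "a < c" | "b < c" "c < a" | "c < a" "a < b" | "c < b" "b < a"
    using ne by linarith
   then have "a \<in> {a0, b0, c0} & b \<in> {a0, b0, c0} & c \<in> {a0, b0, c0}"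
   proof cases
    case 1 show ?thesis using three[OF 1 pq] by simp
   next
    case 2 show ?thesis using three[OF 2 pq(2,1)] by simp
   next
    case 3 show ?thesis using three[OF 3 pq(1)[symmetric] trans[OF pq(1)[symmetric] pq(2)]] by simp
   next
    case 4 show ?thesis using three[OF 4 trans[OF pq(1)[symmetric] pq(2)] pq(1)[symmetric]] by simp
   next
    case 5 show ?thesis using three[OF 5 pq(2)[symmetric] trans[OF pq(2)[symmetric] pq(1)]] by simp
   next
    case 6 show ?thesis using three[OF 6 trans[OF pq(2)[symmetric] pq(1)] pq(2)[symmetric]] by simp
   qed
   moreover from this have "P s a = P s a0" using pp by auto
   ultimately show ?thesis using same_point_iff[of s a a0] by simp
  qed
  have notan: "crs (P1 s a) (P1 s b) ~= 0" if "slope s a b = 0" for a b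
   using d2(2)[rule_format, of s "(a, b)"] that s(1) ds(1) by auto
  have gen: "generic_point (slice F s) q" if q: "q ~= pr (F (s, a0))" for q
  proof (rule ccontr)
   assume "~ ?thesis"
   then consider a b where "slope s a b = 0" "crs (P1 s a) (P1 s b) = 0" "pr (F (s, a)) = q"
    | a b c where "slope s a b = 0" "slope s a c = 0" "slope s b c = 0" "pr (F (s, a)) = q"
    unfolding not_generic_iff[OF s(1)] by blast
   then show False
   proof cases
    case (1 a b) then show False using notan by blast
   next
    case (2 a b c) then show False using three'[OF 2(1,2,3)] q by simp
   qed
  qed
  have br: "branches (slice F s) (pr (F (s, a0))) = {a0, b0, c0}"
  proof -
   have "t \<in> {a0, b0, c0}" if "pr (F (s, t)) = pr (F (s, a0))" for t
   proof (rule ccontr)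
    assume t: "t \<notin> {a0, b0, c0}"
    have "P s t = P s a0" using that same_point_iff[of s t a0] by simp
    then have "slope s a0 b0 = 0" "slope s a0 t = 0" "slope s b0 t = 0" using t abc pp s(1) by (auto simp: slope_zero_iff)
    then show False using three'[of a0 b0 t] t by blast
   qed
   moreover have "pr (F (s, b0)) = pr (F (s, a0))" "pr (F (s, c0)) = pr (F (s, a0))"
    using pp same_point_iff[of s b0 a0] same_point_iff[of s c0 a0] by auto
   ultimately show ?thesis by (auto simp: branches_def)
  qed
  have "multi_crossing 3 (slice F s) (pr (F (s, a0)))"
  proof -
   have "slope s x y = 0" if "x \<in> {a0, b0, c0}" "y \<in> {a0, b0, c0}" "x ~= y" for x y
    using that pp s(1) by (auto simp: slope_zero_iff)
   then have "pairwise (transversal (slice F s)) {a0, b0, c0}"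
    unfolding pairwise_def transversal_family_iff using notan by blast
   then show ?thesis unfolding multi_crossing_def br using abc by simp
  qed
  then show "codim1_point (slice F s) (pr (F (s, a0))) &
   (\<forall>q. q ~= pr (F (s, a0)) --> generic_point (slice F s) q)"
   using gen by (simp add: codim1_point_def)
 qed
qed

end

section \<open>Tangent vectors to the strata\<close>

lemma family_velocity_real:
 assumes "smooth (G :: real \<times> real => real^3)"
 shows "((%e. G (e, t)) has_vector_derivative family_velocity G e0 1 t) (at e0)"
proof -
 have "((%e. G (e, t)) has_derivative (%h. frechet_derivative G (at (e0, t)) (h, 0))) (at e0)"
  by (rule has_derivative_compose[of "%e. (e, t)" "%h. (h, 0)", OF _ smooth_has_derivative[OF assms]])
   (auto intro!: derivative_eq_intros)
 moreover have "frechet_derivative G (at (e0, t)) (h, 0) = h *\<^sub>R family_velocity G e0 1 t" for h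
 proof -
  have "linear (frechet_derivative G (at (e0, t)))"
   by (rule has_derivative_linear[OF smooth_has_derivative[OF assms]])
  from linear_cmul[OF this, of h "(1, 0)"] show ?thesis by (simp add: family_velocity_def)
 qed
 ultimately show ?thesis by (simp add: has_vector_derivative_def)
qed

lemma family_velocity_smooth: "smooth F ==> smooth (family_velocity F s a)"
 unfolding family_velocity_def by (rule smooth_slice[OF smooth_frechet])

lemma family_velocity_scaleR:
 assumes "smooth F"
 shows "family_velocity F s (c *\<^sub>R a) t = c *\<^sub>R family_velocity F s a t"
proof -
 have "linear (frechet_derivative F (at (s, t)))"
  by (rule has_derivative_linear[OF smooth_has_derivative[OF assms]])
 from linear_cmul[OF this, of c "(a, 0)"] show ?thesis by (simp add: family_velocity_def)
qed

lemma family_velocity_zero: "smooth F ==> family_velocity F s 0 t = 0"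
 using family_velocity_scaleR[of F s 0 0 t] by simp

lemma family_velocity_outside:
 assumes F: "smooth F" and o: "!!s'. F (s', t) = x_axis t"
 shows "family_velocity F s a t = 0"
proof -
 have "((%r. (s + r *\<^sub>R a, t)) has_derivative (%h. (h *\<^sub>R a, 0))) (at 0)"
  by (auto intro!: derivative_eq_intros)
 from has_derivative_compose[OF this] smooth_has_derivative[OF F, of "(s, t)"]
 have "((%r. F (s + r *\<^sub>R a, t)) has_derivative (%h. frechet_derivative F (at (s, t)) (h *\<^sub>R a, 0))) (at 0)"
  by simp
 then have "((%r. x_axis t) has_derivative (%h. frechet_derivative F (at (s, t)) (h *\<^sub>R a, 0))) (at (0::real))"
  unfolding o .
 from has_derivative_unique[OF this has_derivative_const]
 have "frechet_derivative F (at (s, t)) (1 *\<^sub>R a, 0) = 0" by (rule fun_cong)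
 then show ?thesis by (simp add: family_velocity_def)
qed

lemma x_axis_scaleR: "x_axis t = t *\<^sub>R axis 1 1"
 by (simp add: x_axis_def vec_eq_iff forall_3 axis_def)

lemma DT_outside:
 assumes G: "smooth G" and o: "!!t. abs t >= R ==> G (e, t) = x_axis t" and t: "abs t > R"
 shows "DT G (e, t) = axis 1 1"
proof -
 have "((%t. t *\<^sub>R axis 1 1 :: real^3) has_vector_derivative axis 1 1) (at t)"
  by (auto intro!: derivative_eq_intros)
 then have "((slice G e) has_vector_derivative axis 1 1) (at t)"
  by (rule has_vector_derivative_transform_within_open[of _ _ _ "{t. abs t > R}"])
   (use t o in \<open>auto intro!: open_Collect_less continuous_intros simp: x_axis_scaleR[symmetric]\<close>)
 then show ?thesis using DT_vector_derivative[OF G, of e t] vector_derivative_unique_at by blast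
qed

text \<open>Outside \<open>[-R, R]\<close> nothing moves, so nonvanishing of the projected velocity
  is an open condition on a compact range; after that \<open>embedding_stable\<close> gives
  injectivity.\<close>

lemma perturb_params:
 fixes G :: "real \<times> real => real^3"
 assumes G: "smooth G" and R: "R > 0" and o: "!!e t. abs t >= R ==> G (e, t) = x_axis t"
  and p: "(slice G 0) \<in> params_upto R"
 obtains delta where "delta > 0" "!!e. e \<in> {-delta..delta} ==> (slice G e) \<in> params_upto R" "knot_family G {-delta..delta} R"
proof -
 let ?K = "({-1..1} \<times> {-(R+1)..R+1}) \<inter> {z. pz (DT G z) = 0}"
 have "closed {z. pz (DT G z) = 0}"
  by (intro closed_Collect_eq continuous_intros bounded_linear.continuous_on[OF bounded_linear_pz]
    smooth_continuous smooth_DT G)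
 then have K: "compact ?K" by (intro compact_Int_closed compact_Times) auto
 have e0: "\<forall>t. (0, t) \<notin> ?K"
  using params_uptoD(4)[OF p] by (auto simp: velocity_DT[OF G])
 obtain d1 where d1: "d1 > 0" "\<forall>e t. dist e 0 < d1 --> (e, t) \<notin> ?K"
  using compact_tube_empty[OF K e0] by (elim exE conjE)
 define d where "d = min (d1 / 2) 1"
 have d: "d > 0" "d < d1" "d <= 1" using d1(1) by (auto simp: d_def)
 have "knot_family G {-d..d} R"
 proof
  show "pz (DT G (e, t)) ~= 0" if "e \<in> {-d..d}" for e t
  proof (cases "abs t > R")
   case True
   have "DT G (e, t) = axis 1 1" by (rule DT_outside[OF G o True])
   then show ?thesis by (simp add: complex_eq_iff axis_def)
  next
   case False
   have "(e, t) \<notin> ?K" using d1(2)[rule_format, of e t] that d by (simp add: dist_real_def abs_less_iff)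
   then show ?thesis using False that d by (auto simp: abs_le_iff)
  qed
 qed (use G R o in auto)
 then interpret knot_family G "{-d..d}" R .
 have "0 \<in> {-d..d}" using d by simp
 from embedding_stable[OF this params_uptoD(2)[OF p]]
 obtain delta where delta: "delta > 0" "!!s. s \<in> {-d..d} ==> dist s 0 < delta ==> (slice G s) \<in> params_upto R"
  by blast
 define m where "m = min (delta / 2) d"
 have m: "m > 0" "m <= d" "m < delta" using delta(1) d by (auto simp: m_def)
 have *: "(slice G e) \<in> params_upto R" if "e \<in> {-m..m}" for e
  using delta(2)[of e] that m by (simp add: dist_real_def abs_less_iff)
 then have "knot_family G {-m..m} R" using G R by (intro knot_familyI) auto
 then show ?thesis using that[OF m(1) *] by blast
qed

lemma tangent_vectors_props:
 assumes "v \<in> tangent_vectors X f"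
 obtains G :: "real \<times> real => real^3" and delta R where "v = family_velocity G 0 1" "delta > 0" "smooth G" "R > 0"
  "!!e. e \<in> {-delta<..<delta} ==> (slice G e) \<in> params_upto R" "(slice G 0) = f"
  "!!e. e \<in> {-delta<..<delta} ==> range (slice G e) \<in> X" "smooth v" "!!t. abs t >= R ==> v t = 0"
proof -
 obtain G :: "real \<times> real => real^3" and delta where G: "v = family_velocity G 0 1" "delta > 0" "smooth_family {-delta<..<delta} G" "(slice G 0) = f"
  "!!e. e \<in> {-delta<..<delta} ==> range (slice G e) \<in> X"
  using assms unfolding tangent_vectors_def mem_Collect_eq by (elim exE conjE) (rule that, auto)
 obtain R where R: "smooth G" "!!e. e \<in> {-delta<..<delta} ==> (slice G e) \<in> params_upto R"
  using G(3) unfolding smooth_family_def by blast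
 have "v t = 0" if t: "abs t >= max R 1" for t
 proof -
  have "((%e. x_axis t) has_vector_derivative 0) (at (0::real))" by simp
  then have "((%e. G (e, t)) has_vector_derivative 0) (at 0)"
   by (rule has_vector_derivative_transform_within_open[of _ _ _ "{-delta<..<delta}"])
    (use G(2) params_uptoD(5)[OF R(2)] t in auto)
  then show ?thesis
   using family_velocity_real[OF R(1), of t 0] vector_derivative_unique_at G(1) by blast
 qed
 then show ?thesis
  using that[OF G(1,2) R(1), of "max R 1"] R(2) G(4,5) family_velocity_smooth[OF R(1)] G(1)
   params_upto_mono[of _ R "max R 1"] by auto
qed

text \<open>The generic stratum is open, so any curve of knots through \<open>f\<close> stays in it
  for a while.\<close>

lemma tangent_vectors_stratum0:
 assumes f: "f \<in> params" and g: "!!q. generic_point f q" and v: "v \<in> tangent_vectors (topspace M1) f"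
 shows "v \<in> tangent_vectors stratum0 f"
proof -
 obtain G :: "real \<times> real => real^3" and delta R where G: "v = family_velocity G 0 1" "delta > 0" "smooth G" "R > 0"
  "!!e. e \<in> {-delta<..<delta} ==> (slice G e) \<in> params_upto R" "(slice G 0) = f"
  by (rule tangent_vectors_props[OF v]) (rule that, assumption+)
 interpret knot_family G "{-delta/2..delta/2}" R
  using G by (intro knot_familyI) auto
 have "0 \<in> {-delta/2..delta/2}" using G(2) by simp
 moreover have "!!q. generic_point (slice G 0) q" using g G(6) by simp
 ultimately obtain d where d: "d > 0" "!!s q. s \<in> {-delta/2..delta/2} ==> dist s 0 < d ==> generic_point (slice G s) q"
  by (rule generic_stable) (rule that)
 define m where "m = min d (delta/2)"
 have m: "m > 0" "m <= d" "m <= delta/2" using d(1) G(2) by (auto simp: m_def)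
 have "range (slice G e) \<in> stratum0" if "e \<in> {-m<..<m}" for e
 proof -
  have p: "(slice G e) \<in> params_upto R" using that m G(2) by (intro G(5)) auto
  have "\<forall>q. generic_point (slice G e) q"
   using d(2)[of e] that m by (simp add: dist_real_def abs_less_iff)
  then show ?thesis using strata_iff(1)[OF params_upto_params[OF p]] by simp
 qed
 moreover have "smooth_family {-m<..<m} G"
  unfolding smooth_family_def using G(3,5) m G(2) by (intro conjI exI[of _ R]) auto
 ultimately show ?thesis unfolding tangent_vectors_def mem_Collect_eq using G(1,6) m(1) by blast
qed

lemma smooth_snd_compose:
 assumes "smooth (h :: real => 'b::real_normed_vector)"
 shows "smooth (%z::'a::euclidean_space \<times> real. h (snd z))"
 by (rule smooth_compose[OF assms smooth_snd])

text \<open>Strata consist of images, so a field along the knot is free: moving the parameter by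
  \<open>rho (e, t) = t + e * xi t\<close> adds \<open>xi * velocity f\<close> to the velocity and
  leaves the image alone. It therefore suffices that the straight line in direction
  \<open>w - xi * velocity f\<close> stays in \<open>X\<close>.\<close>

lemma tangent_vectorsI:
 assumes f: "f \<in> params_upto R" and R: "R > 0"
  and w: "smooth w" "!!t. abs t >= R ==> w t = 0" and xi: "smooth xi" "!!t. abs t >= R ==> xi t = 0"
  and S: "delta > 0" "!!e. abs e < delta ==> range (%t. f t + e *\<^sub>R (w t - xi t *\<^sub>R velocity f t)) \<in> X"
 shows "w \<in> tangent_vectors X f"
proof -
 define w1 where "w1 t = w t - xi t *\<^sub>R velocity f t" for t
 define rho where "rho z = snd z + fst z * xi (snd z)" for z :: "real \<times> real"
 define G where "G z = f (rho z) + fst z *\<^sub>R w1 (rho z)" for z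
 note sf = params_uptoD(1)[OF f]
 have sw1: "smooth w1" unfolding w1_def[abs_def] by (intro smooth_diff smooth_scaleR w xi smooth_velocity sf)
 have srho: "smooth rho" unfolding rho_def[abs_def]
  by (intro smooth_add smooth_mult smooth_fst smooth_snd smooth_snd_compose xi)
 have sG: "smooth G" unfolding G_def[abs_def]
  by (intro smooth_add smooth_scaleR smooth_fst smooth_compose[OF sf srho] smooth_compose[OF sw1 srho])
 have w1o: "w1 t = 0" if "abs t >= R" for t using w(2) xi(2) that by (simp add: w1_def)
 have Go: "G (e, t) = x_axis t" if "abs t >= R" for e t
  using that xi(2) w1o params_uptoD(5)[OF f] by (simp add: G_def rho_def)
 have G0: "(slice G 0) = f" by (simp add: G_def rho_def)
 then have "(slice G 0) \<in> params_upto R" using f by simp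
 then obtain d where d: "d > 0" "!!e. e \<in> {-d..d} ==> (slice G e) \<in> params_upto R"
  using perturb_params[OF sG R Go] by blast
 have vel: "family_velocity G 0 1 t = w t" for t
 proof -
  have r: "((%e. rho (e, t)) has_vector_derivative xi t) (at 0)"
   unfolding rho_def by (auto intro!: derivative_eq_intros)
  have 1: "((%e. f (rho (e, t))) has_vector_derivative xi t *\<^sub>R velocity f (rho (0, t))) (at 0)"
   using vector_diff_chain_at[OF r smooth_velocity(2)[OF sf]] by (simp add: comp_def)
  have 2: "((%e. w1 (rho (e, t))) has_vector_derivative xi t *\<^sub>R velocity w1 (rho (0, t))) (at 0)"
   using vector_diff_chain_at[OF r smooth_velocity(2)[OF sw1]] by (simp add: comp_def)
  have 3: "((%e. e *\<^sub>R w1 (rho (e, t))) has_vector_derivative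
    0 *\<^sub>R (xi t *\<^sub>R velocity w1 (rho (0, t))) + 1 *\<^sub>R w1 (rho (0, t))) (at 0)"
   by (rule has_vector_derivative_scaleR[OF DERIV_ident 2])
  have "((%e. G (e, t)) has_vector_derivative xi t *\<^sub>R velocity f t + w1 t) (at 0)"
   using has_vector_derivative_add[OF 1 3] by (simp add: G_def rho_def)
  then have "family_velocity G 0 1 t = xi t *\<^sub>R velocity f t + w1 t"
   using family_velocity_real[OF sG, of t 0] vector_derivative_unique_at by blast
  then show ?thesis by (simp add: w1_def)
 qed
 have rng: "range (slice G e) = range (%t. f t + e *\<^sub>R w1 t)" for e
 proof
  show "range (slice G e) \<subseteq> range (%t. f t + e *\<^sub>R w1 t)" by (auto simp: G_def)
  \<comment> \<open>For equal images it is enough that \<open>rho (e, .)\<close> is onto, and this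
    holds because it is the identity at both far ends.\<close>
  have "f y + e *\<^sub>R w1 y \<in> range (slice G e)" for y
  proof -
   define b where "b = abs y + R"
   have "continuous_on {-b..b} (%t. rho (e, t))"
    by (rule continuous_on_compose2[OF smooth_continuous[OF srho, of UNIV]]) (auto intro!: continuous_intros)
   moreover have "rho (e, -b) <= y" "y <= rho (e, b)" "-b <= b"
    using xi(2)[of b] xi(2)[of "-b"] R by (auto simp: rho_def b_def)
   ultimately obtain t where "rho (e, t) = y" using IVT'[of "%t. rho (e, t)" "-b" y b] by blast
   then show ?thesis by (intro image_eqI[of _ _ t]) (auto simp: G_def)
  qed
  then show "range (%t. f t + e *\<^sub>R w1 t) \<subseteq> range (slice G e)" by blast
 qed
 define m where "m = min d delta"
 have m: "m > 0" "m <= d" "m <= delta" using d(1) S(1) by (auto simp: m_def)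
 have "range (slice G e) \<in> X" if "e \<in> {-m<..<m}" for e
  unfolding rng w1_def using that m by (intro S(2)) (auto simp: abs_less_iff)
 moreover have "smooth_family {-m<..<m} G"
  unfolding smooth_family_def using sG d(2) m by (intro conjI exI[of _ R]) auto
 moreover have "w = family_velocity G 0 1" using vel by (simp add: fun_eq_iff)
 ultimately show ?thesis unfolding tangent_vectors_def mem_Collect_eq using G0 m(1) by blast
qed

text \<open>Disjoint bumps that are 1 near the nodes: near \<open>a\<close> the field is affine,
  near \<open>b\<close> and \<open>c\<close> constant, which fixes values and first derivatives
  there.\<close>

lemma interpolation:
 fixes a b c :: real and x x' y z :: "'b::real_normed_vector"
 assumes "a ~= b" "a ~= c" "b ~= c" "abs a < R" "abs b < R" "abs c < R"
 obtains xi where "smooth xi" "!!t. abs t >= R ==> xi t = 0" "xi a = x" "velocity xi a = x'"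
  "xi b = y" "velocity xi b = 0" "xi c = z" "velocity xi c = 0"
proof -
 define r where "r = Min {abs (a-b)/2, abs (a-c)/2, abs (b-c)/2, R-abs a, R-abs b, R-abs c}"
 have r: "r > 0" "2*r <= abs (a-b)" "2*r <= abs (a-c)" "2*r <= abs (b-c)" "r <= R-abs a" "r <= R-abs b" "r <= R-abs c"
 proof -
  let ?A = "{abs (a-b)/2, abs (a-c)/2, abs (b-c)/2, R-abs a, R-abs b, R-abs c}"
  have "r \<in> ?A" unfolding r_def by (rule Min_in) auto
  then show "r > 0" using assms by auto
  have le: "r <= x" if "x \<in> ?A" for x unfolding r_def by (rule Min_le[OF _ that]) simp
  show "2*r <= abs (a-b)" "2*r <= abs (a-c)" "2*r <= abs (b-c)"
   using le[of "abs (a-b)/2"] le[of "abs (a-c)/2"] le[of "abs (b-c)/2"] by simp_all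
  show "r <= R-abs a" "r <= R-abs b" "r <= R-abs c" by (intro le, simp)+
 qed
 define xi where "xi t = bump a r t *\<^sub>R (x + (t - a) *\<^sub>R x') + bump b r t *\<^sub>R y + bump c r t *\<^sub>R z" for t
 have s: "smooth xi" unfolding xi_def[abs_def]
  by (intro smooth_add smooth_scaleR smooth_bump smooth_const smooth_diff smooth_ident)
 have na: "xi t = x + (t - a) *\<^sub>R x'" if "t \<in> {a - r/2<..<a + r/2}" for t
 proof -
  have "abs (t - a) < r/2" using that unfolding abs_less_iff greaterThanLessThan_iff by linarith
  moreover from this have "r <= abs (t - b)" "r <= abs (t - c)" using r(1-4) by linarith+
  ultimately have "bump a r t = 1" "bump b r t = 0" "bump c r t = 0"
   using r(1) by (simp_all add: bump_inside bump_outside)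
  then show ?thesis by (simp add: xi_def)
 qed
 have nb: "xi t = y" if "t \<in> {b - r/2<..<b + r/2}" for t
 proof -
  have "abs (t - b) < r/2" using that unfolding abs_less_iff greaterThanLessThan_iff by linarith
  moreover from this have "r <= abs (t - a)" "r <= abs (t - c)" using r(1-4) by linarith+
  ultimately have "bump b r t = 1" "bump a r t = 0" "bump c r t = 0"
   using r(1) by (simp_all add: bump_inside bump_outside)
  then show ?thesis by (simp add: xi_def)
 qed
 have nc: "xi t = z" if "t \<in> {c - r/2<..<c + r/2}" for t
 proof -
  have "abs (t - c) < r/2" using that unfolding abs_less_iff greaterThanLessThan_iff by linarith
  moreover from this have "r <= abs (t - a)" "r <= abs (t - b)" using r(1-4) by linarith+
  ultimately have "bump c r t = 1" "bump a r t = 0" "bump b r t = 0"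
   using r(1) by (simp_all add: bump_inside bump_outside)
  then show ?thesis by (simp add: xi_def)
 qed
 have "((%t. x + (t - a) *\<^sub>R x') has_vector_derivative x') (at a)"
  by (auto intro!: derivative_eq_intros)
 then have "(xi has_vector_derivative x') (at a)"
  by (rule has_vector_derivative_transform_within_open[of _ _ _ "{a - r/2<..<a + r/2}"]) (use r na in auto)
 then have va: "velocity xi a = x'" by (rule velocity_at)
 have "((%t. y) has_vector_derivative 0) (at b)" by simp
 then have "(xi has_vector_derivative 0) (at b)"
  by (rule has_vector_derivative_transform_within_open[of _ _ _ "{b - r/2<..<b + r/2}"]) (use r nb in auto)
 then have vb: "velocity xi b = 0" by (rule velocity_at)
 have "((%t. z) has_vector_derivative 0) (at c)" by simp
 then have "(xi has_vector_derivative 0) (at c)"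
  by (rule has_vector_derivative_transform_within_open[of _ _ _ "{c - r/2<..<c + r/2}"]) (use r nc in auto)
 then have vc: "velocity xi c = 0" by (rule velocity_at)
 have o: "xi t = 0" if "abs t >= R" for t
 proof -
  have "r <= abs (t - a)" "r <= abs (t - b)" "r <= abs (t - c)" using r(1,5-7) that by linarith+
  then have "bump a r t = 0" "bump b r t = 0" "bump c r t = 0" using r(1) by (simp_all add: bump_outside)
  then show ?thesis by (simp add: xi_def)
 qed
 show ?thesis
  by (rule that[OF s o _ va _ vb _ vc]) (use na[of a] nb[of b] nc[of c] r in auto)
qed

lemma linear_perturbation:
 assumes f: "f \<in> params_upto R" and R: "R > 0" and w: "smooth w" "!!t. abs t >= R ==> w t = 0"
 defines "H \<equiv> %z::real \<times> real. f (snd z) + fst z *\<^sub>R w (snd z)"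
 obtains delta where "delta > 0" "!!e. e \<in> {-delta..delta} ==> (%t. f t + e *\<^sub>R w t) \<in> params_upto R" "knot_family H {-delta..delta} R"
  "!!e t. knot_family.P H e t = pz (f t) + e *\<^sub>R pz (w t)"
  "!!e t. knot_family.P1 H e t = pz (velocity f t) + e *\<^sub>R pz (velocity w t)"
  "!!t. knot_family.P2 H 0 t = pz (velocity (velocity f) t)"
proof -
 note sf = params_uptoD(1)[OF f]
 have sH: "smooth H" unfolding H_def
  by (intro smooth_add smooth_scaleR smooth_fst smooth_snd_compose sf w)
 have o: "H (e, t) = x_axis t" if "abs t >= R" for e t
  using params_uptoD(5)[OF f that] w(2)[OF that] by (simp add: H_def)
 have p0: "(slice H 0) \<in> params_upto R" using f by (simp add: H_def)
 obtain delta where d: "delta > 0" "!!e. e \<in> {-delta..delta} ==> (slice H e) \<in> params_upto R" "knot_family H {-delta..delta} R"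
  by (rule perturb_params[OF sH R o p0]) (assumption, rule that, assumption+)
 interpret knot_family H "{-delta..delta}" R by (rule d(3))
 have v: "velocity (slice H e) = (%t. velocity f t + e *\<^sub>R velocity w t)" for e
  unfolding H_def by (rule ext, rule velocity_at) (auto intro!: derivative_eq_intros smooth_velocity sf w)
 have v2: "velocity (%t. velocity f t + 0 *\<^sub>R velocity w t) = (%t. velocity (velocity f) t)"
  by simp
 show ?thesis
 proof (rule that[OF d(1) _ d(3)])
  show "(%t. f t + e *\<^sub>R w t) \<in> params_upto R" if "e \<in> {-delta..delta}" for e
   using d(2)[OF that] by (simp add: H_def)
  show "P e t = pz (f t) + e *\<^sub>R pz (w t)" for e t unfolding P_def unfolding H_def by simp
  show "P1 e t = pz (velocity f t) + e *\<^sub>R pz (velocity w t)" for e t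
   unfolding P_velocity(1)[symmetric] v by simp
  show "P2 0 t = pz (velocity (velocity f) t)" for t
   unfolding P_velocity(2)[symmetric] v v2 by simp
 qed
qed

text \<open>The conditions on \<open>w\<close> keep the double point and the speed ratio
  \<open>c\<close> for every \<open>e\<close>, so \<open>tangency_persists\<close> applies to the
  straight line through \<open>f\<close>.\<close>

lemma tangency_stratum1:
 assumes f: "f \<in> params_upto R" and R: "R > 0" and w: "smooth w" "!!t. abs t >= R ==> w t = 0"
  and ab: "a0 ~= b0" "pz (f a0) = pz (f b0)" "pz (velocity f a0) = c *\<^sub>R pz (velocity f b0)"
  and nd: "crs (pz (velocity (velocity f) a0) - c\<^sup>2 *\<^sub>R pz (velocity (velocity f) b0)) (pz (velocity f b0)) ~= 0"
  and wab: "pz (w a0) = pz (w b0)" "pz (velocity w a0) = c *\<^sub>R pz (velocity w b0)"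
  and only: "!!a b. a ~= b ==> pz (f a) = pz (f b) ==> crs (pz (velocity f a)) (pz (velocity f b)) = 0 ==>
   (a, b) = (a0, b0) | (a, b) = (b0, a0)"
  and no3: "!!a b c. a ~= b ==> a ~= c ==> b ~= c ==> pz (f a) = pz (f b) ==> pz (f a) = pz (f c) ==> False"
 obtains delta where "delta > 0" "!!e. abs e < delta ==> range (%t. f t + e *\<^sub>R w t) \<in> stratum1"
proof -
 let ?H = "%z::real \<times> real. f (snd z) + fst z *\<^sub>R w (snd z)"
 obtain d where d: "d > 0" "!!e. e \<in> {-d..d} ==> (%t. f t + e *\<^sub>R w t) \<in> params_upto R" "knot_family ?H {-d..d} R"
  "!!e t. knot_family.P ?H e t = pz (f t) + e *\<^sub>R pz (w t)"
  "!!e t. knot_family.P1 ?H e t = pz (velocity f t) + e *\<^sub>R pz (velocity w t)"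
  "!!t. knot_family.P2 ?H 0 t = pz (velocity (velocity f) t)"
  by (rule linear_perturbation[OF f R w]) (assumption, rule that, assumption+)
 interpret knot_family ?H "{-d..d}" R by (rule d(3))
 have 0: "(0::real) \<in> {-d..d}" using d(1) by simp
 have sl: "slope 0 a b = 0 \<longleftrightarrow> a ~= b & pz (f a) = pz (f b)" for a b
  using slope_zero_iff[OF 0] d(4) by simp
 obtain delta where delta: "delta > 0" "!!s. s \<in> {-d..d} ==> dist s 0 < delta ==> codim1_point (%t. ?H (s, t)) (pr (?H (s, a0))) &
   (\<forall>q. q ~= pr (?H (s, a0)) --> generic_point (%t. ?H (s, t)) q)"
 proof (rule tangency_persists[OF 0 ab(1)])
  show "P s a0 = P s b0" for s unfolding d(4) using ab(2) wab(1) by simp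
  show "crs (P1 s a0) (P1 s b0) = 0" for s
  proof -
   have "P1 s a0 = c *\<^sub>R P1 s b0" unfolding d(5) using ab(3) wab(2) by (simp add: scaleR_add_right)
   then show ?thesis by simp
  qed
  show "tang_nondeg1 0 a0 b0" unfolding tang_nondeg1_def d(5,6) using ab(3) nd by (intro exI[of _ c]) simp
  show "(a, b) = (a0, b0) | (a, b) = (b0, a0)" if "slope 0 a b = 0" "crs (P1 0 a) (P1 0 b) = 0" for a b
   using that unfolding sl d(5) by (intro only) auto
  show False if "slope 0 a b = 0" "slope 0 a c = 0" "slope 0 b c = 0" for a b c
   using that no3[of a b c] unfolding sl by blast
 qed (rule that, assumption+)
 define m where "m = min d delta"
 have m: "m > 0" "m <= d" "m <= delta" using d(1) delta(1) by (auto simp: m_def)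
 have "range (%t. f t + e *\<^sub>R w t) \<in> stratum1" if "abs e < m" for e
 proof -
  have e: "e \<in> {-d..d}" "dist e 0 < delta" using that m by (auto simp: dist_real_def)
  show ?thesis
   unfolding strata_iff(2)[OF params_upto_params[OF d(2)[OF e(1)]]]
   using delta(2)[OF e] by auto
 qed
 then show ?thesis using that m(1) by blast
qed

lemma triple_stratum1:
 assumes f: "f \<in> params_upto R" and R: "R > 0" and w: "smooth w" "!!t. abs t >= R ==> w t = 0"
  and abc: "a0 < b0" "b0 < c0" "pz (f a0) = pz (f b0)" "pz (f a0) = pz (f c0)"
  and wab: "pz (w a0) = pz (w b0)" "pz (w a0) = pz (w c0)"
  and tv: "!!a b. a ~= b ==> pz (f a) = pz (f b) ==> crs (pz (velocity f a)) (pz (velocity f b)) ~= 0"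
  and only: "!!a b c. a < b ==> b < c ==> pz (f a) = pz (f b) ==> pz (f a) = pz (f c) ==> (a, b, c) = (a0, b0, c0)"
 obtains delta where "delta > 0" "!!e. abs e < delta ==> range (%t. f t + e *\<^sub>R w t) \<in> stratum1"
proof -
 let ?H = "%z::real \<times> real. f (snd z) + fst z *\<^sub>R w (snd z)"
 obtain d where d: "d > 0" "!!e. e \<in> {-d..d} ==> (%t. f t + e *\<^sub>R w t) \<in> params_upto R" "knot_family ?H {-d..d} R"
  "!!e t. knot_family.P ?H e t = pz (f t) + e *\<^sub>R pz (w t)"
  "!!e t. knot_family.P1 ?H e t = pz (velocity f t) + e *\<^sub>R pz (velocity w t)"
  "!!t. knot_family.P2 ?H 0 t = pz (velocity (velocity f) t)"
  by (rule linear_perturbation[OF f R w]) (assumption, rule that, assumption+)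
 interpret knot_family ?H "{-d..d}" R by (rule d(3))
 have 0: "(0::real) \<in> {-d..d}" using d(1) by simp
 have sl: "slope 0 a b = 0 \<longleftrightarrow> a ~= b & pz (f a) = pz (f b)" for a b
  using slope_zero_iff[OF 0] d(4) by simp
 obtain delta where delta: "delta > 0" "!!s. s \<in> {-d..d} ==> dist s 0 < delta ==> codim1_point (%t. ?H (s, t)) (pr (?H (s, a0))) &
   (\<forall>q. q ~= pr (?H (s, a0)) --> generic_point (%t. ?H (s, t)) q)"
 proof (rule triple_persists[OF 0 abc(1,2)])
  show "P s a0 = P s b0" "P s a0 = P s c0" for s unfolding d(4) using abc(3,4) wab by simp_all
  show "crs (P1 0 a) (P1 0 b) ~= 0" if "slope 0 a b = 0" for a b
   using that tv[of a b] unfolding sl d(5) by auto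
  show "(a, b, c) = (a0, b0, c0)" if "a < b" "b < c" "P 0 a = P 0 b" "P 0 a = P 0 c" for a b c
   using that unfolding d(4) by (intro only) auto
 qed (rule that, assumption+)
 define m where "m = min d delta"
 have m: "m > 0" "m <= d" "m <= delta" using d(1) delta(1) by (auto simp: m_def)
 have "range (%t. f t + e *\<^sub>R w t) \<in> stratum1" if "abs e < m" for e
 proof -
  have e: "e \<in> {-d..d}" "dist e 0 < delta" using that m by (auto simp: dist_real_def)
  show ?thesis
   unfolding strata_iff(2)[OF params_upto_params[OF d(2)[OF e(1)]]]
   using delta(2)[OF e] by auto
 qed
 then show ?thesis using that m(1) by blast
qed

lemma transverse_at_stratum0:
 assumes F: "smooth F" and f: "(slice F s) \<in> params" and g: "!!q. generic_point (slice F s) q" and T: "0 \<in> T"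
 shows "transverse_at F T stratum0 s"
 unfolding transverse_at_def
proof (intro ballI)
 fix v assume "v \<in> tangent_vectors (topspace M1) (slice F s)"
 then have "v \<in> tangent_vectors stratum0 (slice F s)" by (rule tangent_vectors_stratum0[OF f g])
 then show "\<exists>a\<in>T. \<exists>w\<in>tangent_vectors stratum0 (slice F s). \<forall>t. v t = family_velocity F s a t + w t"
  using T by (intro bexI[of _ 0] bexI[of _ v]) (simp_all add: family_velocity_zero[OF F])
qed

text \<open>In codimension 1 the stratum is described by one functional \<open>l\<close> whose
  kernel is tangent to it; a family direction with nonzero \<open>l\<close> supplies the missing
  dimension.\<close>

lemma transverse_at_hypersurface:
 fixes F :: "'a::euclidean_space \<times> real => real^3" and l :: "(real => real^3) => real"
 assumes F: "smooth F" and R: "R > 0" and o: "!!s' t. abs t >= R ==> F (s', t) = x_axis t"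
  and a: "!!r. r *\<^sub>R a \<in> T" "l (family_velocity F s a) ~= 0"
  and l: "!!v w r. l (%t. v t - r *\<^sub>R w t) = l v - r * l w"
  and S: "!!w R'. smooth w ==> R' >= R ==> (!!t. abs t >= R' ==> w t = 0) ==> l w = 0 ==> w \<in> tangent_vectors X (slice F s)"
 shows "transverse_at F T X s"
 unfolding transverse_at_def
proof (intro ballI)
 fix v assume v: "v \<in> tangent_vectors (topspace M1) (slice F s)"
 obtain G :: "real \<times> real => real^3" and delta R1 where R1: "smooth v" "!!t. abs t >= R1 ==> v t = 0"
  by (rule tangent_vectors_props[OF v]) (rule that, assumption+)
 define r where "r = l v / l (family_velocity F s a)"
 define w where "w t = v t - r *\<^sub>R family_velocity F s a t" for t
 have "w \<in> tangent_vectors X (slice F s)"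
 proof (rule S)
  show "smooth w" unfolding w_def[abs_def]
   by (intro smooth_diff smooth_scaleR smooth_const R1 family_velocity_smooth F)
  show "max R R1 >= R" by simp
  show "w t = 0" if "abs t >= max R R1" for t
   using that R1(2) family_velocity_outside[OF F o] by (simp add: w_def)
  show "l w = 0" unfolding w_def[abs_def] l using a(2) by (simp add: r_def)
 qed
 moreover have "v t = family_velocity F s (r *\<^sub>R a) t + w t" for t
  by (simp add: w_def family_velocity_scaleR[OF F])
 ultimately show "\<exists>a\<in>T. \<exists>w\<in>tangent_vectors X (slice F s). \<forall>t. v t = family_velocity F s a t + w t"
  using a(1) by blast
qed

lemma third_point:
 assumes "abs a < R" "abs b < (R::real)"
 obtains c where "c ~= a" "c ~= b" "abs c < R"
proof -
 have "infinite {-R<..<R}" using assms by (simp add: infinite_Ioo)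
 then have "infinite ({-R<..<R} - {a, b})" by simp
 then obtain c where "c \<in> {-R<..<R} - {a, b}" using infinite_imp_nonempty by blast
 then show ?thesis using that[of c] by (auto simp: abs_less_iff)
qed

text \<open>Position and velocity at the tangency give four scalar equations; the hypothesis on
  \<open>w\<close> is the normal part of the position. The remaining three are solved by sliding
  along the knot with a field \<open>xi\<close>, whose value and slope at \<open>a0\<close> and
  value at \<open>b0\<close> are free.\<close>

lemma tangency_tangent_vector:
 assumes f: "f \<in> params_upto R" and R: "R > 0" and w: "smooth w" "!!t. abs t >= R ==> w t = 0"
  and ab: "a0 ~= b0" "pz (f a0) = pz (f b0)" "pz (velocity f a0) = c *\<^sub>R pz (velocity f b0)" "abs a0 < R" "abs b0 < R"
  and nd: "crs (pz (velocity (velocity f) a0) - c\<^sup>2 *\<^sub>R pz (velocity (velocity f) b0)) (pz (velocity f b0)) ~= 0"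
  and only: "!!a b. a ~= b ==> pz (f a) = pz (f b) ==> crs (pz (velocity f a)) (pz (velocity f b)) = 0 ==>
   (a, b) = (a0, b0) | (a, b) = (b0, a0)"
  and no3: "!!a b c. a ~= b ==> a ~= c ==> b ~= c ==> pz (f a) = pz (f b) ==> pz (f a) = pz (f c) ==> False"
  and l: "crs (pz (w a0) - pz (w b0)) (pz (velocity f b0)) = 0"
 shows "w \<in> tangent_vectors stratum1 f"
proof -
 let ?p1 = "%t. pz (velocity f t)" and ?p2 = "%t. pz (velocity (velocity f) t)"
 note sf = params_uptoD(1)[OF f]
 have nz: "?p1 b0 ~= 0" "?p1 a0 ~= 0" using params_uptoD(4)[OF f] by auto
 have c0: "c ~= 0" using ab(3) nz by auto
 obtain rho where rho: "pz (w a0) - pz (w b0) = rho *\<^sub>R ?p1 b0" using crs_eq_0D[OF l nz(1)] by blast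
 \<comment> \<open>Chosen to cancel the normal part of the velocity equation; the denominator is the
   determinant that expresses an ordinary tangency. Then \<open>y\<close> settles the tangential
   part of the position.\<close>
 define x where "x = (crs (pz (velocity w a0) - c *\<^sub>R pz (velocity w b0)) (?p1 b0) - c * rho * crs (?p2 b0) (?p1 b0)) /
  crs (?p2 a0 - c\<^sup>2 *\<^sub>R ?p2 b0) (?p1 b0)"
 define y where "y = c * x - rho"
 have "crs (pz (velocity w a0) - x *\<^sub>R ?p2 a0 - c *\<^sub>R (pz (velocity w b0) - y *\<^sub>R ?p2 b0)) (?p1 b0)
   = crs (pz (velocity w a0) - c *\<^sub>R pz (velocity w b0)) (?p1 b0) - c * rho * crs (?p2 b0) (?p1 b0)
    - x * crs (?p2 a0 - c\<^sup>2 *\<^sub>R ?p2 b0) (?p1 b0)"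
  by (simp add: y_def algebra_simps power2_eq_square)
 also have "\<dots> = 0" using nd by (simp add: x_def)
 finally obtain r where r: "pz (velocity w a0) - x *\<^sub>R ?p2 a0 - c *\<^sub>R (pz (velocity w b0) - y *\<^sub>R ?p2 b0) = r *\<^sub>R ?p1 b0"
  using crs_eq_0D[OF _ nz(1)] by blast
 obtain d where d: "d ~= a0" "d ~= b0" "abs d < R" by (rule third_point[OF ab(4,5)])
 obtain xi where xi: "smooth xi" "!!t. abs t >= R ==> xi t = 0" "xi a0 = x" "velocity xi a0 = r / c" "xi b0 = y" "velocity xi b0 = 0"
  by (rule interpolation[OF ab(1) d(1,2)[symmetric] ab(4,5) d(3), of x "r / c" y 0]) (rule that, assumption+)
 define w1 where "w1 t = w t - xi t *\<^sub>R velocity f t" for t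
 have sw: "smooth w1" unfolding w1_def[abs_def] by (intro smooth_diff smooth_scaleR w xi smooth_velocity sf)
 have wo: "w1 t = 0" if "abs t >= R" for t using w(2) xi(2) that by (simp add: w1_def)
 have vw: "velocity w1 t = velocity w t - (xi t *\<^sub>R velocity (velocity f) t + velocity xi t *\<^sub>R velocity f t)" for t
  unfolding w1_def[abs_def]
  using smooth_velocity(2)[OF xi(1), of t]
  by (intro velocity_at has_vector_derivative_diff has_vector_derivative_scaleR smooth_velocity w sf)
   (simp add: has_real_derivative_iff_has_vector_derivative)
 have 1: "pz (w1 a0) = pz (w1 b0)"
 proof -
  have "pz (w1 a0) - pz (w1 b0) = (pz (w a0) - pz (w b0)) - x *\<^sub>R ?p1 a0 + y *\<^sub>R ?p1 b0"
   by (simp add: w1_def xi)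
  also have "\<dots> = 0" unfolding rho ab(3) y_def by (simp add: algebra_simps)
  finally show ?thesis by simp
 qed
 have 2: "pz (velocity w1 a0) = c *\<^sub>R pz (velocity w1 b0)"
 proof -
  have "pz (velocity w1 a0) - c *\<^sub>R pz (velocity w1 b0) =
    (pz (velocity w a0) - x *\<^sub>R ?p2 a0 - c *\<^sub>R (pz (velocity w b0) - y *\<^sub>R ?p2 b0)) - (r / c) *\<^sub>R ?p1 a0"
   by (simp add: vw xi algebra_simps)
  also have "\<dots> = 0" unfolding r ab(3) using c0 by simp
  finally show ?thesis by simp
 qed
 obtain delta where "delta > 0" "!!e. abs e < delta ==> range (%t. f t + e *\<^sub>R w1 t) \<in> stratum1"
  by (rule tangency_stratum1[OF f R sw wo ab(1,2,3) nd 1 2 only no3]) (assumption, assumption+, rule that, assumption+)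
 then show ?thesis
  unfolding w1_def by (intro tangent_vectorsI[OF f R w xi(1,2)]) auto
qed

text \<open>A slide by \<open>x\<close> along the branch of \<open>a0\<close> has to bring it onto
  both other branches. Each pair determines \<open>x\<close> by Cramer's rule, and the functional is
  the difference of the two values.\<close>

lemma triple_tangent_vector:
 assumes f: "f \<in> params_upto R" and R: "R > 0" and w: "smooth w" "!!t. abs t >= R ==> w t = 0"
  and abc: "a0 < b0" "b0 < c0" "pz (f a0) = pz (f b0)" "pz (f a0) = pz (f c0)" "abs a0 < R" "abs b0 < R" "abs c0 < R"
  and tv: "!!a b. a ~= b ==> pz (f a) = pz (f b) ==> crs (pz (velocity f a)) (pz (velocity f b)) ~= 0"
  and only: "!!a b c. a < b ==> b < c ==> pz (f a) = pz (f b) ==> pz (f a) = pz (f c) ==> (a, b, c) = (a0, b0, c0)"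
  and l: "crs (pz (w a0) - pz (w b0)) (pz (velocity f b0)) / crs (pz (velocity f a0)) (pz (velocity f b0)) -
   crs (pz (w a0) - pz (w c0)) (pz (velocity f c0)) / crs (pz (velocity f a0)) (pz (velocity f c0)) = 0"
 shows "w \<in> tangent_vectors stratum1 f"
proof -
 let ?p1 = "%t. pz (velocity f t)"
 note sf = params_uptoD(1)[OF f]
 have nz: "?p1 b0 ~= 0" "?p1 c0 ~= 0" using params_uptoD(4)[OF f] by auto
 have t: "crs (?p1 a0) (?p1 b0) ~= 0" "crs (?p1 a0) (?p1 c0) ~= 0" using tv[of a0 b0] tv[of a0 c0] abc by auto
 define x where "x = crs (pz (w a0) - pz (w b0)) (?p1 b0) / crs (?p1 a0) (?p1 b0)"
 have x: "x = crs (pz (w a0) - pz (w c0)) (?p1 c0) / crs (?p1 a0) (?p1 c0)" using l by (simp add: x_def)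
 have "crs (pz (w a0) - pz (w b0) - x *\<^sub>R ?p1 a0) (?p1 b0) = 0" using t by (simp add: x_def)
 then obtain y where y: "pz (w a0) - pz (w b0) - x *\<^sub>R ?p1 a0 = y *\<^sub>R ?p1 b0" using crs_eq_0D[OF _ nz(1)] by blast
 have "crs (pz (w a0) - pz (w c0) - x *\<^sub>R ?p1 a0) (?p1 c0) = 0" using t by (simp add: x)
 then obtain z where z: "pz (w a0) - pz (w c0) - x *\<^sub>R ?p1 a0 = z *\<^sub>R ?p1 c0" using crs_eq_0D[OF _ nz(2)] by blast
 have ne: "a0 ~= b0" "a0 ~= c0" "b0 ~= c0" using abc by auto
 obtain xi where xi: "smooth xi" "!!t. abs t >= R ==> xi t = 0" "xi a0 = x" "xi b0 = - y" "xi c0 = - z"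
  by (rule interpolation[OF ne abc(5,6,7), of x 0 "- y" "- z"]) (rule that, assumption+)
 define w1 where "w1 t = w t - xi t *\<^sub>R velocity f t" for t
 have sw: "smooth w1" unfolding w1_def[abs_def] by (intro smooth_diff smooth_scaleR w xi smooth_velocity sf)
 have wo: "w1 t = 0" if "abs t >= R" for t using w(2) xi(2) that by (simp add: w1_def)
 have 1: "pz (w1 a0) = pz (w1 b0)" "pz (w1 a0) = pz (w1 c0)"
  using y z by (simp_all add: w1_def xi algebra_simps)
 obtain delta where "delta > 0" "!!e. abs e < delta ==> range (%t. f t + e *\<^sub>R w1 t) \<in> stratum1"
  by (rule triple_stratum1[OF f R sw wo abc(1-4) 1 tv only]) (assumption, assumption+, rule that, assumption+)
 then show ?thesis
  unfolding w1_def by (intro tangent_vectorsI[OF f R w xi(1,2)]) auto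
qed

section \<open>Tangencies with a third branch\<close>

text \<open>Symmetry of the mixed derivative: integrate it over \<open>t\<close>, differentiate
  under the integral sign, and differentiate the resulting increment of the family velocity.\<close>

lemma mixed_partials:
 fixes F :: "'a::euclidean_space \<times> real => real^3"
 assumes F: "smooth F"
 shows "velocity (family_velocity F s h) t = frechet_derivative (DT F) (at (s, t)) (h, 0)"
proof -
 define K where "K r tau = frechet_derivative (DT F) (at (s + r *\<^sub>R h, tau)) (h, 0)" for r tau
 have line: "((%r. G (s + r *\<^sub>R h, tau)) has_vector_derivative frechet_derivative G (at (s + r *\<^sub>R h, tau)) (h, 0)) (at r)"
  if G: "smooth G" for G :: "'a \<times> real => real^3" and r tau
 proof -
  have "((%r. (s + r *\<^sub>R h, tau)) has_derivative (%k. (k *\<^sub>R h, 0))) (at r)"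
   by (auto intro!: derivative_eq_intros)
  from has_derivative_compose[OF this smooth_has_derivative[OF G]]
  have "((%r. G (s + r *\<^sub>R h, tau)) has_derivative (%k. frechet_derivative G (at (s + r *\<^sub>R h, tau)) (k *\<^sub>R h, 0))) (at r)" .
  moreover have "frechet_derivative G (at (s + r *\<^sub>R h, tau)) (k *\<^sub>R h, 0) = k *\<^sub>R frechet_derivative G (at (s + r *\<^sub>R h, tau)) (h, 0)" for k
   using linear_cmul[OF has_derivative_linear[OF smooth_has_derivative[OF G]], of _ k "(h, 0)"] by simp
  ultimately show ?thesis by (simp add: has_vector_derivative_def)
 qed
 have contK: "continuous_on UNIV (%z. K (fst z) (snd z))"
  unfolding K_def
  by (rule continuous_on_compose2[OF smooth_continuous[OF smooth_frechet[OF smooth_DT[OF F]], of UNIV]])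
   (auto intro!: continuous_intros)
 have int: "integral {t1..t2} (K 0) = family_velocity F s h t2 - family_velocity F s h t1" if "t1 <= t2" for t1 t2
 proof -
  have ftc: "integral {t1..t2} (%tau. DT F (s + r *\<^sub>R h, tau)) = F (s + r *\<^sub>R h, t2) - F (s + r *\<^sub>R h, t1)" for r
   by (rule integral_unique, rule fundamental_theorem_of_calculus[OF that])
    (rule has_vector_derivative_at_within[OF DT_vector_derivative[OF F]])
  have "((%r. integral (cbox t1 t2) (%tau. DT F (s + r *\<^sub>R h, tau))) has_vector_derivative integral (cbox t1 t2) (K 0)) (at 0 within UNIV)"
  proof (rule leibniz_rule_vector_derivative)
   show "((%r. DT F (s + r *\<^sub>R h, tau)) has_vector_derivative K r tau) (at r within UNIV)" for r tau
    unfolding K_def using line[OF smooth_DT[OF F]] by simp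
   show "(%tau. DT F (s + r *\<^sub>R h, tau)) integrable_on cbox t1 t2" for r
    by (intro integrable_continuous continuous_on_compose2[OF smooth_continuous[OF smooth_DT[OF F], of UNIV]])
     (auto intro!: continuous_intros)
   show "continuous_on (UNIV \<times> cbox t1 t2) (%(r, tau). K r tau)"
    using continuous_on_subset[OF contK] by (simp add: case_prod_unfold)
  qed auto
  moreover have "((%r. F (s + r *\<^sub>R h, t2) - F (s + r *\<^sub>R h, t1)) has_vector_derivative
    family_velocity F s h t2 - family_velocity F s h t1) (at 0)"
   using has_vector_derivative_diff[OF line[OF F, of t2 0] line[OF F, of t1 0]] by (simp add: family_velocity_def)
  ultimately show ?thesis
   using vector_derivative_unique_at by (fastforce simp: ftc)
 qed
 have cK: "continuous_on {t-1..t+1} (K 0)"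
 proof -
  have "continuous_on {t-1..t+1} (%tau. K (fst (0::real, tau)) (snd (0::real, tau)))"
   by (rule continuous_on_compose2[OF contK]) (auto intro!: continuous_intros)
  then show ?thesis by simp
 qed
 have "((%u. integral {t-1..u} (K 0)) has_vector_derivative K 0 t) (at t within {t-1..t+1})"
  by (rule integral_has_vector_derivative[OF cK]) simp
 then have "((%u. integral {t-1..u} (K 0)) has_vector_derivative K 0 t) (at t)"
  by (simp add: at_within_interior[of t "{t-1..t+1}"])
 then have "((%u. family_velocity F s h u - family_velocity F s h (t-1)) has_vector_derivative K 0 t) (at t)"
  by (rule has_vector_derivative_transform_within_open[of _ _ _ "{t-1<..<t+1}"]) (auto simp: int)
 then have "((%u. (family_velocity F s h u - family_velocity F s h (t-1)) + family_velocity F s h (t-1)) has_vector_derivative K 0 t + 0) (at t)"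
  by (rule has_vector_derivative_add) simp
 then show ?thesis by (intro velocity_at) (simp add: K_def)
qed

text \<open>Unit directions towards points of the same level subconverge, and the derivative
  annihilates the limit. This linearizes the condition of lying in a stratum along a curve.\<close>

lemma derivative_kernel:
 fixes f :: "'a::euclidean_space => 'b::real_normed_vector"
 assumes d: "(f has_derivative f') (at x)" and x: "X \<longlonglongrightarrow> x" "!!n. X n ~= x" "!!n. f (X n) = f x"
 obtains u where "norm u = 1" "f' u = 0"
proof -
 define u where "u n = (1 / norm (X n - x)) *\<^sub>R (X n - x)" for n
 have nu: "norm (u n) = 1" for n using x(2) by (simp add: u_def)
 have "compact (sphere (0::'a) 1)" by simp
 moreover have "\<forall>n. u n \<in> sphere 0 1" using nu by simp
 ultimately obtain l r where l: "l \<in> sphere 0 1" "strict_mono r" "(u \<circ> r) \<longlonglongrightarrow> l"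
  unfolding compact_def by blast
 have bl: "bounded_linear f'" using d by (rule has_derivative_bounded_linear)
 have "((%y. norm (f y - f x - f' (y - x)) / norm (y - x)) \<longlongrightarrow> 0) (at x)"
  using d unfolding has_derivative_iff_norm by blast
 moreover have "filterlim X (at x) sequentially"
  using x(1,2) by (simp add: filterlim_at)
 ultimately have "(%n. norm (f (X n) - f x - f' (X n - x)) / norm (X n - x)) \<longlonglongrightarrow> 0"
  by (rule filterlim_compose)
 moreover have "norm (f (X n) - f x - f' (X n - x)) / norm (X n - x) = norm (f' (u n))" for n
  using x(3) linear_cmul[OF bounded_linear.linear[OF bl]] by (simp add: u_def)
 ultimately have "(%n. norm (f' (u n))) \<longlonglongrightarrow> 0" by simp
 then have "(%n. norm (f' (u (r n)))) \<longlonglongrightarrow> 0"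
  using LIMSEQ_subseq_LIMSEQ[OF _ l(2)] by (fastforce simp: comp_def)
 moreover have "(%n. norm (f' (u (r n)))) \<longlonglongrightarrow> norm (f' l)"
  using l(3) by (intro tendsto_norm bounded_linear.tendsto[OF bl]) (simp add: comp_def)
 ultimately have "norm (f' l) = 0" using LIMSEQ_unique by blast
 then show ?thesis using that[of l] l(1) by simp
qed

context knot_family
begin

text \<open>Common zeros of \<open>tmap\<close> are tangencies of the branches \<open>a\<close>, \<open>b\<close> that lie on a third branch \<open>c\<close>.\<close>

definition tmap :: "'a \<times> real \<times> real \<times> real => complex \<times> complex \<times> real" where
 "tmap z = (case z of (s, a, b, c) => (P s a - P s b, P s a - P s c, crs (P1 s a) (P1 s b)))"

definition tmap' :: "'a => real => real => real => 'a \<times> real \<times> real \<times> real => complex \<times> complex \<times> real" where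
 "tmap' s a b c u = (case u of (h, x, y, z) =>
  (pz (family_velocity F s h a) + x *\<^sub>R P1 s a - pz (family_velocity F s h b) - y *\<^sub>R P1 s b,
  pz (family_velocity F s h a) + x *\<^sub>R P1 s a - pz (family_velocity F s h c) - z *\<^sub>R P1 s c,
  crs (pz (velocity (family_velocity F s h) a) + x *\<^sub>R P2 s a) (P1 s b) +
  crs (P1 s a) (pz (velocity (family_velocity F s h) b) + y *\<^sub>R P2 s b)))"

lemma frechet_split:
 assumes G: "smooth (G :: 'a \<times> real => real^3)"
 shows "frechet_derivative G (at (s, t)) (h, k) = frechet_derivative G (at (s, t)) (h, 0) + k *\<^sub>R DT G (s, t)"
proof -
 have l: "linear (frechet_derivative G (at (s, t)))"
  by (rule has_derivative_linear[OF smooth_has_derivative[OF G]])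
 have "(h, k) = (h, 0) + k *\<^sub>R (0, 1)" by simp
 then show ?thesis
  using linear_add[OF l, of "(h, 0)" "k *\<^sub>R (0, 1)"] linear_cmul[OF l, of k "(0, 1)"] by (simp add: DT_def)
qed

lemma tmap_has_derivative: "(tmap has_derivative tmap' s a b c) (at (s, a, b, c))"
proof -
 have P: "((%z. pz (G (fst z, g z))) has_derivative
   (%u. pz (frechet_derivative G (at (s, t)) (fst u, 0)) + g' u *\<^sub>R pz (DT G (s, t)))) (at (s, a, b, c))"
  if G: "smooth G" and g: "(g has_derivative g') (at (s, a, b, c))" "g (s, a, b, c) = t"
  for G :: "'a \<times> real => real^3" and g :: "'a \<times> real \<times> real \<times> real => real" and g' t
 proof -
  have "((%z. (fst z, g z)) has_derivative (%u. (fst u, g' u))) (at (s, a, b, c))"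
   by (intro has_derivative_Pair has_derivative_fst has_derivative_ident g)
  from has_derivative_compose[OF this] smooth_has_derivative[OF G, of "(s, t)"] g(2)
  have "((%z. G (fst z, g z)) has_derivative (%u. frechet_derivative G (at (s, t)) (fst u, g' u))) (at (s, a, b, c))"
   by simp
  from bounded_linear.has_derivative[OF bounded_linear_pz this]
  show ?thesis
   by (rule has_derivative_eq_rhs) (rule ext, subst frechet_split[OF G], simp)
 qed
 have g: "((%z. fst (snd z)) has_derivative (%u. fst (snd u))) (at (s, a, b, c))"
  "((%z. fst (snd (snd z))) has_derivative (%u. fst (snd (snd u)))) (at (s, a, b, c))"
  "((%z. snd (snd (snd z))) has_derivative (%u. snd (snd (snd u)))) (at (s, a, b, c))"
  by (auto intro!: derivative_eq_intros)
 note A = P[OF smF g(1), of a] and B = P[OF smF g(2), of b] and C = P[OF smF g(3), of c]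
  and A1 = P[OF smooth_DT[OF smF] g(1), of a] and B1 = P[OF smooth_DT[OF smF] g(2), of b]
 have e: "tmap = (%z. (pz (F (fst z, fst (snd z))) - pz (F (fst z, fst (snd (snd z)))),
   pz (F (fst z, fst (snd z))) - pz (F (fst z, snd (snd (snd z)))),
   crs (pz (DT F (fst z, fst (snd z)))) (pz (DT F (fst z, fst (snd (snd z)))))))"
  by (simp add: tmap_def fun_eq_iff P_def P1_def)
 show ?thesis
  unfolding e
  by (rule has_derivative_eq_rhs[OF has_derivative_Pair[OF has_derivative_diff[OF A B]
      has_derivative_Pair[OF has_derivative_diff[OF A C] bounded_bilinear.FDERIV[OF bounded_bilinear_crs A1 B1]]]])
   (auto simp: fun_eq_iff tmap'_def P1_def P2_def mixed_partials[OF smF, unfolded family_velocity_def] family_velocity_def algebra_simps)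
qed

lemma tmap_continuous: "continuous_on A tmap"
proof -
 have "continuous_on UNIV (%z. (P (fst z) (fst (snd z)) - P (fst z) (fst (snd (snd z))),
   P (fst z) (fst (snd z)) - P (fst z) (snd (snd (snd z))), crs (P1 (fst z) (fst (snd z))) (P1 (fst z) (fst (snd (snd z))))))"
  by (intro continuous_intros P_cont crs_continuous)
 then have "continuous_on UNIV tmap" by (simp add: tmap_def[abs_def] case_prod_unfold)
 then show ?thesis using continuous_on_subset by blast
qed

end

context knot_family
begin

text \<open>The codimension 2 diagrams with a tangency on a third branch, written in parameters; the
  last two clauses exclude every other tangency and triple point.\<close>

definition tangency_on_branch :: "'a => real => real => real => bool" where
 "tangency_on_branch s a b c \<longleftrightarrow> a ~= b & a ~= c & b ~= c & P s a = P s b & P s a = P s c &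
  crs (P1 s a) (P1 s b) = 0 & crs (P1 s a) (P1 s c) ~= 0 & tang_nondeg1 s a b &
  (\<forall>x y. slope s x y = 0 --> crs (P1 s x) (P1 s y) = 0 --> (x, y) = (a, b) | (x, y) = (b, a)) &
  (\<forall>x y z. slope s x y = 0 --> slope s x z = 0 --> slope s y z = 0 --> {x, y, z} = {a, b, c})"

text \<open>Of all codimension 2 types only this one survives nearby: a flex tangency contradicts
  the second graph derivatives, and a quadruple point or two separate codimension 1 points
  contradict the uniqueness of the tangency and of the triple point.\<close>

lemma stratum2_near:
 assumes s0: "s0 \<in> S" and t: "tangency_on_branch s0 a0 b0 c0" and eps: "eps > 0"
 obtains delta where "delta > 0"
  "!!s. s \<in> S ==> dist s s0 < delta ==> (slice F s) \<in> params ==> range (slice F s) \<in> stratum2 ==>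
   \<exists>a b c. abs (a - a0) < eps & abs (b - b0) < eps & abs (c - c0) < eps & P s a = P s b & P s a = P s c & crs (P1 s a) (P1 s b) = 0"
proof -
 have ne: "a0 ~= b0" "a0 ~= c0" "b0 ~= c0" and tc: "crs (P1 s0 a0) (P1 s0 c0) ~= 0" and nd: "tang_nondeg1 s0 a0 b0"
  and only2: "!!x y. slope s0 x y = 0 ==> crs (P1 s0 x) (P1 s0 y) = 0 ==> (x, y) = (a0, b0) | (x, y) = (b0, a0)"
  and only3: "!!x y z. slope s0 x y = 0 ==> slope s0 x z = 0 ==> slope s0 y z = 0 ==> {x, y, z} = {a0, b0, c0}"
  using t unfolding tangency_on_branch_def by blast+
 let ?K2 = "{(s, a, b). s \<in> S & slope s a b = 0 & (s, a, b) \<in> {(s, a, b). crs (P1 s a) (P1 s b) = 0}}"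
 let ?K3 = "{(s, a, b, c). s \<in> S & slope s a b = 0 & slope s a c = 0 & slope s b c = 0}"
 obtain e1 where e1: "e1 > 0"
  "!!s a b a' b'. dist s s0 < e1 ==> \<bar>a - a0\<bar> < e1 ==> \<bar>b - b0\<bar> < e1 ==> \<bar>a' - a0\<bar> < e1 ==> \<bar>b' - b0\<bar> < e1 ==>
   P s a = P s b ==> crs (P1 s a) (P1 s b) = 0 ==> P s a' = P s b' ==> a = a' & b = b'"
  by (rule tangency_unique[OF s0 nd]) (rule that)
 obtain e2 where e2: "e2 > 0"
  "!!s a b a' b'. dist s s0 < e2 ==> \<bar>a - a0\<bar> < e2 ==> \<bar>b - c0\<bar> < e2 ==> \<bar>a' - a0\<bar> < e2 ==> \<bar>b' - c0\<bar> < e2 ==>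
   P s a = P s b ==> P s a' = P s b' ==> a = a' & b = b'"
  by (rule double_unique[OF tc]) (rule that)
 obtain r where r: "P1 s0 a0 = r *\<^sub>R P1 s0 b0" using nd by (auto simp: tang_nondeg1_def)
 define T where "T = P1 s0 b0"
 have g: "gr T 2 s0 a0 ~= gr T 2 s0 b0" using tang_nondeg1_gr[OF s0 nd] by (simp add: T_def)
 obtain e3 where e3: "e3 > 0"
  "!!s t. dist s s0 < e3 ==> \<bar>t - a0\<bar> < e3 ==> T \<bullet> P1 s t ~= 0"
  "!!s t. dist s s0 < e3 ==> \<bar>t - b0\<bar> < e3 ==> T \<bullet> P1 s t ~= 0"
  "!!s t t'. dist s s0 < e3 ==> \<bar>t - a0\<bar> < e3 ==> \<bar>t' - b0\<bar> < e3 ==> gr T 2 s t ~= gr T 2 s t'"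
  by (rule tangency_box[OF s0 r T_def _ g]) (blast, rule that)
 define e where "e = Min {eps, e1, e2, e3, abs (a0 - b0) / 2, abs (a0 - c0) / 2, abs (b0 - c0) / 2}"
 have e: "e > 0" "e <= eps" "e <= e1" "e <= e2" "e <= e3" "2 * e <= abs (a0 - b0)" "2 * e <= abs (a0 - c0)" "2 * e <= abs (b0 - c0)"
 proof -
  let ?A = "{eps, e1, e2, e3, abs (a0 - b0) / 2, abs (a0 - c0) / 2, abs (b0 - c0) / 2}"
  have "e \<in> ?A" unfolding e_def by (rule Min_in) auto
  then show "e > 0" using eps e1(1) e2(1) e3(1) ne by auto
  have le: "e <= x" if "x \<in> ?A" for x unfolding e_def by (rule Min_le[OF _ that]) simp
  show "e <= eps" "e <= e1" "e <= e2" "e <= e3" by (intro le, simp)+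
  show "2 * e <= abs (a0 - b0)" "2 * e <= abs (a0 - c0)" "2 * e <= abs (b0 - c0)"
   using le[of "abs (a0 - b0) / 2"] le[of "abs (a0 - c0) / 2"] le[of "abs (b0 - c0) / 2"] by simp_all
 qed
 let ?I = "%x::real. {x - e<..<x + e}"
 let ?U2 = "ball s0 e \<times> (?I a0 \<times> ?I b0 \<union> ?I b0 \<times> ?I a0)"
 let ?U3 = "ball s0 e \<times> (?I a0 \<times> ?I b0 \<times> ?I c0 \<union> ?I a0 \<times> ?I c0 \<times> ?I b0 \<union> ?I b0 \<times> ?I a0 \<times> ?I c0 \<union>
  ?I b0 \<times> ?I c0 \<times> ?I a0 \<union> ?I c0 \<times> ?I a0 \<times> ?I b0 \<union> ?I c0 \<times> ?I b0 \<times> ?I a0)"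
 have oU2: "open ?U2" and oU3: "open ?U3" by (intro open_Times open_Un open_ball open_greaterThanLessThan)+
 have in2: "\<forall>y. (s0, y) \<in> ?K2 --> (s0, y) \<in> ?U2"
 proof (intro allI impI)
  fix y assume y: "(s0, y) \<in> ?K2"
  obtain a b where ab: "y = (a, b)" by (cases y)
  then have "(a, b) = (a0, b0) | (a, b) = (b0, a0)" using y by (intro only2) auto
  then show "(s0, y) \<in> ?U2" using e(1) unfolding ab by (elim disjE) simp_all
 qed
 have in3: "\<forall>y. (s0, y) \<in> ?K3 --> (s0, y) \<in> ?U3"
 proof (intro allI impI)
  fix y assume y: "(s0, y) \<in> ?K3"
  obtain a b c where abc: "y = (a, b, c)" by (cases y)
  have "{a, b, c} = {a0, b0, c0}" using y unfolding abc by (intro only3) auto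
  moreover have "a ~= b" "a ~= c" "b ~= c" using y unfolding abc by (auto simp: slope_zero_iff[OF s0])
  moreover from calculation(1) have "a \<in> {a0, b0, c0}" "b \<in> {a0, b0, c0}" "c \<in> {a0, b0, c0}" by blast+
  ultimately have "y \<in> {(a0, b0, c0), (a0, c0, b0), (b0, a0, c0), (b0, c0, a0), (c0, a0, b0), (c0, b0, a0)}"
   unfolding abc by (elim insertE emptyE) simp_all
  then show "(s0, y) \<in> ?U3" using e(1) by (elim insertE emptyE) simp_all
 qed
 obtain d2 where d2: "d2 > 0" "\<forall>s y. (s, y) \<in> ?K2 --> dist s s0 < d2 --> (s, y) \<in> ?U2"
  using compact_tube_ex[OF compact_doubles_closed[OF closed_tangential] oU2 in2] by (elim exE conjE)
 obtain d3 where d3: "d3 > 0" "\<forall>s y. (s, y) \<in> ?K3 --> dist s s0 < d3 --> (s, y) \<in> ?U3"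
  using compact_tube_ex[OF compact_triples oU3 in3] by (elim exE conjE)
 define d where "d = Min {d2, d3, e}"
 have dpos: "d > 0" using d2(1) d3(1) e(1) by (simp add: d_def)
 show ?thesis
 proof (rule that[OF dpos])
  fix s assume s: "s \<in> S" "dist s s0 < d" and par: "(slice F s) \<in> params" and st2: "range (slice F s) \<in> stratum2"
  let ?f = "%t. F (s, t)"
  have ds: "dist s s0 < d2" "dist s s0 < d3" "dist s s0 < e1" "dist s s0 < e2" "dist s s0 < e3"
   using s(2) e by (simp_all add: d_def)
  define near where "near a b \<longleftrightarrow> \<bar>a - b\<bar> < e" for a b :: real
  define tan where "tan a b \<longleftrightarrow> near a a0 & near b b0 & P s a = P s b & crs (P1 s a) (P1 s b) = 0" for a b
  define trip where "trip a b c \<longleftrightarrow> near a a0 & near b b0 & near c c0 & P s a = P s b & P s a = P s c" for a b c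
  have sl: "slope s a b = 0 \<longleftrightarrow> a ~= b & P s a = P s b" for a b by (rule slope_zero_iff[OF s(1)])
  have tanI: "tan a b | tan b a" if ab: "a ~= b" "P s a = P s b" "crs (P1 s a) (P1 s b) = 0" for a b
  proof -
   have "(s, (a, b)) \<in> ?K2" using ab s(1) by (simp add: sl)
   then have "(s, (a, b)) \<in> ?U2" using d2(2) ds(1) by blast
   then have "(near a a0 & near b b0) | (near a b0 & near b a0)" unfolding near_def abs_less_iff by auto
   moreover have "crs (P1 s b) (P1 s a) = 0" using ab(3) crs_swap[of "P1 s b"] by simp
   ultimately show ?thesis using ab by (auto simp: tan_def)
  qed
  have tripI: "\<exists>x y z. {x, y, z} = {a, b, c} & trip x y z" if abc: "a ~= b" "a ~= c" "b ~= c" "P s a = P s b" "P s a = P s c" for a b c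
  proof -
   have "(s, (a, b, c)) \<in> ?K3" using abc s(1) by (simp add: sl)
   then have "(s, (a, b, c)) \<in> ?U3" using d3(2) ds(2) by blast
   then consider "near a a0" "near b b0" "near c c0" | "near a a0" "near b c0" "near c b0" | "near a b0" "near b a0" "near c c0"
    | "near a b0" "near b c0" "near c a0" | "near a c0" "near b a0" "near c b0" | "near a c0" "near b b0" "near c a0"
    unfolding near_def abs_less_iff by auto
   then show ?thesis
   proof cases
    case 1 then show ?thesis using abc by (intro exI[of _ a] exI[of _ b] exI[of _ c]) (simp add: trip_def)
   next
    case 2 then show ?thesis using abc by (intro exI[of _ a] exI[of _ c] exI[of _ b]) (auto simp: trip_def)
   next
    case 3 then show ?thesis using abc by (intro exI[of _ b] exI[of _ a] exI[of _ c]) (auto simp: trip_def)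
   next
    case 4 then show ?thesis using abc by (intro exI[of _ c] exI[of _ a] exI[of _ b]) (auto simp: trip_def)
   next
    case 5 then show ?thesis using abc by (intro exI[of _ b] exI[of _ c] exI[of _ a]) (auto simp: trip_def)
   next
    case 6 then show ?thesis using abc by (intro exI[of _ c] exI[of _ b] exI[of _ a]) (auto simp: trip_def)
   qed
  qed
  have tan_unique: "a = a' & b = b'" if "tan a b" "near a' a0" "near b' b0" "P s a' = P s b'" for a b a' b'
   using that e1(2)[OF ds(3), of a b a' b'] e(3) by (simp add: tan_def near_def)
  have trip_unique: "a = a' & c = c'" if "trip a b c" "trip a' b' c'" for a b c a' b' c'
   using that e(4) unfolding trip_def near_def
   by (elim conjE) (rule e2(2)[OF ds(4), of a c a' c']; (assumption | linarith))
  have no2: False if ab: "a ~= b" "P s a = P s b" and c2: "contact_ge 2 ?f a b" for a b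
  proof -
   have pf: "pz (F (s, a)) = pz (F (s, b))" using ab(2) by (simp add: P_def)
   obtain c1 c2 where c: "P1 s a = c1 *\<^sub>R P1 s b" "P2 s a = c1\<^sup>2 *\<^sub>R P2 s b + (2 * c2) *\<^sub>R P1 s b"
    using contact_geD[OF smooth_curve pf c2] unfolding P_velocity by (metis order_refl one_le_numeral)
   have "crs (P1 s a) (P1 s b) = 0" using c(1) by simp
   then consider "tan a b" | "tan b a" using tanI ab by blast
   then show False
   proof cases
    case 1
    then have n: "abs (a - a0) < e3" "abs (b - b0) < e3" using e(5) by (auto simp: tan_def near_def)
    have "gr T 2 s a = gr T 2 s b"
     by (rule contact_2_gr[OF c e3(2)[OF ds(5) n(1)] e3(3)[OF ds(5) n(2)]])
    then show False using e3(4)[OF ds(5) n] by simp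
   next
    case 2
    then have n: "abs (b - a0) < e3" "abs (a - b0) < e3" using e(5) by (auto simp: tan_def near_def)
    have "gr T 2 s a = gr T 2 s b"
     by (rule contact_2_gr[OF c e3(3)[OF ds(5) n(2)] e3(2)[OF ds(5) n(1)]])
    then show False using e3(4)[OF ds(5) n] by simp
   qed
  qed
  have contact1: "crs (P1 s a) (P1 s b) = 0" if "P s a = P s b" "contact 1 ?f a b" for a b
  proof -
   have pf: "pz (F (s, a)) = pz (F (s, b))" using that(1) by (simp add: P_def)
   have nz: "pz (velocity ?f b) ~= 0" using P1_nonzero[OF s(1)] P_velocity by simp
   show ?thesis using that(2) contact_1_iff[OF smooth_curve pf nz] P_velocity by (simp add: contact_def)
  qed
  have brP: "P s x = P s y" if "x \<in> branches ?f q" "y \<in> branches ?f q" for x y q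
   using that same_point_iff[of s x y] by (simp add: branches_def)
  have codim1: "(\<exists>a b. tan a b & a \<in> branches ?f q) | (\<exists>a b c. trip a b c & a \<in> branches ?f q)" if c1: "codim1_point ?f q" for q
  proof (cases "self_tangency 1 ?f q")
   case True
   then obtain a b where ab: "a ~= b" "branches ?f q = {a, b}" "contact 1 ?f a b" by (auto simp: self_tangency_def)
   then have "P s a = P s b" using brP[of a q b] by simp
   then have "tan a b | tan b a" using tanI[OF ab(1)] contact1 ab(3) by blast
   then show ?thesis using ab(2) by blast
  next
   case False
   then have m: "multi_crossing 3 ?f q" using c1 by (simp add: codim1_point_def)
   then obtain a b c where abc: "branches ?f q = {a, b, c}" "a ~= b" "a ~= c" "b ~= c"
    unfolding multi_crossing_def card_3_iff by auto
   then have "P s a = P s b" "P s a = P s c" using brP[of a q b] brP[of a q c] by simp_all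
   then obtain x y z where xyz: "{x, y, z} = {a, b, c}" "trip x y z" using tripI[OF abc(2-4)] by metis
   then show ?thesis using abc(1) by blast
  qed
  show "\<exists>a b c. abs (a - a0) < eps & abs (b - b0) < eps & abs (c - c0) < eps & P s a = P s b & P s a = P s c & crs (P1 s a) (P1 s b) = 0"
  proof -
   consider q where "codim2_point ?f q" | q r where "q ~= r" "codim1_point ?f q" "codim1_point ?f r"
    using st2 unfolding strata_iff(3)[OF par] by blast
   then show ?thesis
   proof cases
    case (1 q)
    then consider "self_tangency 2 ?f q" | "tangency_with_transverse_branch ?f q" | "multi_crossing 4 ?f q"
     by (auto simp: codim2_point_def)
    then show ?thesis
    proof cases
     case 1
     then obtain a b where ab: "a ~= b" "branches ?f q = {a, b}" "contact 2 ?f a b" by (auto simp: self_tangency_def)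
     then show ?thesis using no2[of a b] brP[of a q b] by (simp add: contact_def)
    next
     case 2
     then obtain x y z where xyz: "x ~= y" "x ~= z" "y ~= z" "branches ?f q = {x, y, z}" "contact 1 ?f x y"
      by (auto simp: tangency_with_transverse_branch_def)
     have P: "P s x = P s y" "P s x = P s z" using brP[of x q y] brP[of x q z] xyz(4) by simp_all
     have "tan x y | tan y x" using tanI[OF xyz(1) P(1)] contact1[OF P(1) xyz(5)] by blast
     then obtain a b where ab: "tan a b" "{a, b} = {x, y}" by blast
     obtain u v w where uvw: "{u, v, w} = {x, y, z}" "trip u v w" using tripI[OF xyz(1,2,3) P] by metis
     then have "a = u & b = v" using tan_unique[OF ab(1), of u v] by (simp add: trip_def)
     then show ?thesis using ab(1) uvw(2) e(2)
      by (intro exI[of _ u] exI[of _ v] exI[of _ w]) (auto simp: tan_def trip_def near_def)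
    next
     case 3
     then have "card (branches ?f q) = 4" by (simp only: multi_crossing_def)
     then have "3 <= card (branches ?f q)" by linarith
     then obtain X where X: "X \<subseteq> branches ?f q" "card X = 3"
      by (rule obtain_subset_with_card_n)
     then obtain x y z where xyz: "X = {x, y, z}" "x ~= y" "x ~= z" "y ~= z" unfolding card_3_iff by auto
     have "card (branches ?f q) = 4" using 3 by (simp only: multi_crossing_def)
     then have "X ~= branches ?f q" using X(2) by auto
     then obtain t where t: "t \<in> branches ?f q" "t \<notin> X" using X(1) by blast
     have P: "P s x = P s y" "P s x = P s z" using brP[of x q y] brP[of x q z] X(1) xyz(1) by auto
     obtain u v w where uvw: "{u, v, w} = {x, y, z}" "trip u v w" using tripI[OF xyz(2,3,4) P] by metis
     have inb: "u \<in> branches ?f q" "v \<in> branches ?f q" "w \<in> branches ?f q"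
      using uvw(1) X(1) xyz(1) by blast+
     have dist: "u ~= v" "u ~= w" "v ~= w"
      using uvw(2) e(6-8) unfolding trip_def near_def by linarith+
     have tn: "t ~= u" "t ~= v" "t ~= w" using t(2) uvw(1) xyz(1) by auto
     have P': "P s t = P s v" "P s t = P s w" using brP[OF t(1) inb(2)] brP[OF t(1) inb(3)] by simp_all
     obtain u' v' w' where uvw': "{u', v', w'} = {t, v, w}" "trip u' v' w'" using tripI[OF tn(2,3) dist(3) P'] by metis
     have "u' = u" using trip_unique[OF uvw'(2) uvw(2)] by simp
     then have "u \<in> {t, v, w}" using uvw'(1) by blast
     then show ?thesis using tn dist by auto
    qed
   next
    case (2 q r)
    have neq: "x ~= y" if "x \<in> branches ?f q" "y \<in> branches ?f r" for x y
     using that 2(1) by (auto simp: branches_def)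
    \<comment> \<open>Any two nearby singularities share their parameter close to \<open>a0\<close>,
      so they cannot sit at two different points of the plane.\<close>
    have trtan: "a = x" if "tan a b" "trip x y z" for a b x y z
     using tan_unique[OF that(1), of x y] that(2) by (simp add: trip_def)
    have tata: "a = x" if "tan a b" "tan x y" for a b x y
     using tan_unique[OF that(1), of x y] that(2) by (simp add: tan_def)
    from codim1[OF 2(2)] obtain x where x: "x \<in> branches ?f q" "(\<exists>b. tan x b) | (\<exists>b c. trip x b c)"
     by (elim disjE exE conjE) (rule that; blast)+
    from codim1[OF 2(3)] obtain y where y: "y \<in> branches ?f r" "(\<exists>b. tan y b) | (\<exists>b c. trip y b c)"
     by (elim disjE exE conjE) (rule that; blast)+
    have "x = y"
     using x(2)
    proof (elim disjE exE)
     fix b assume t: "tan x b"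
     show "x = y" using y(2) by (elim disjE exE) (rule tata[OF t], assumption, rule trtan[OF t], assumption)
    next
     fix b c assume t: "trip x b c"
     show "x = y" using y(2)
      by (elim disjE exE) (rule trtan[OF _ t, symmetric], assumption, rule conjunct1[OF trip_unique[OF t]], assumption)
    qed
    then show ?thesis using neq[OF x(1) y(1)] by simp
   qed
  qed
 qed
qed

end

lemma seq_close:
 fixes x :: "nat => real"
 assumes "!!n. abs (x n - l) < inverse (real (Suc n))"
 shows "x \<longlonglongrightarrow> l"
proof -
 have "(%n. x n - l) \<longlonglongrightarrow> 0"
  by (rule Lim_null_comparison[OF _ LIMSEQ_inverse_real_of_nat], rule always_eventually, rule allI,
   unfold real_norm_def, rule less_imp_le[OF assms])
 then show ?thesis by (rule LIM_zero_cancel)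
qed

context knot_family
begin

lemma compact_quadruples:
 "compact {(s, a, b, c, d). s \<in> S & slope s a b = 0 & slope s a c = 0 & slope s b c = 0 &
  slope s a d = 0 & slope s b d = 0 & slope s c d = 0}"
proof -
 obtain B where B0: "!!s a b. s \<in> S ==> slope s a b = 0 ==> \<bar>a\<bar> <= B & abs b <= B"
  using double_bounded by metis
 have B: "a \<in> {-B..B}" "b \<in> {-B..B}" if "s \<in> S" "slope s a b = 0" for s a b
  using B0[OF that] by (auto simp: abs_le_iff)
 let ?s = "%z::'a \<times> real \<times> real \<times> real \<times> real. fst z" and ?a = "%z::'a \<times> real \<times> real \<times> real \<times> real. fst (snd z)"
  and ?b = "%z::'a \<times> real \<times> real \<times> real \<times> real. fst (snd (snd z))" and ?c = "%z::'a \<times> real \<times> real \<times> real \<times> real. fst (snd (snd (snd z)))"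
  and ?d = "%z::'a \<times> real \<times> real \<times> real \<times> real. snd (snd (snd (snd z)))"
 let ?C = "{z. slope (?s z) (?a z) (?b z) = 0} \<inter> {z. slope (?s z) (?a z) (?c z) = 0} \<inter> {z. slope (?s z) (?b z) (?c z) = 0} \<inter>
  {z. slope (?s z) (?a z) (?d z) = 0} \<inter> {z. slope (?s z) (?b z) (?d z) = 0} \<inter> {z. slope (?s z) (?c z) (?d z) = 0}"
 have "{(s, a, b, c, d). s \<in> S & slope s a b = 0 & slope s a c = 0 & slope s b c = 0 &
  slope s a d = 0 & slope s b d = 0 & slope s c d = 0} = (S \<times> {-B..B} \<times> {-B..B} \<times> {-B..B} \<times> {-B..B}) \<inter> ?C"
  by (rule set_eqI) (auto simp del: atLeastAtMost_iff intro: B)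
 moreover have "closed ?C" by (intro closed_Int closed_Collect_eq slope_cont continuous_intros)
 ultimately show ?thesis by (simp add: compact_Int_closed compact_Times compS)
qed

text \<open>Along a curve in the stratum zeros of \<open>tmap\<close> accumulate at the base point,
  so \<open>derivative_kernel\<close> provides a kernel vector. Its first component \<open>h\<close>
  is nonzero, since otherwise sliding along transversal branches would keep three points together;
  dividing by \<open>h\<close> gives the infinitesimal equations.\<close>

lemma stratum2_tangent:
 assumes s0: "s0 \<in> S" and t: "tangency_on_branch s0 a0 b0 c0"
  and w: "w \<in> tangent_vectors stratum2 (slice F s0)"
 obtains x y z where "pz (w a0) + x *\<^sub>R P1 s0 a0 = pz (w b0) + y *\<^sub>R P1 s0 b0"
  "pz (w a0) + x *\<^sub>R P1 s0 a0 = pz (w c0) + z *\<^sub>R P1 s0 c0"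
  "crs (pz (velocity w a0) + x *\<^sub>R P2 s0 a0) (P1 s0 b0) + crs (P1 s0 a0) (pz (velocity w b0) + y *\<^sub>R P2 s0 b0) = 0"
proof -
 obtain G :: "real \<times> real => real^3" and delta R' where G: "w = family_velocity G 0 1" "delta > 0" "smooth G" "R' > 0"
  "!!e. e \<in> {-delta<..<delta} ==> (slice G e) \<in> params_upto R'" "(slice G 0) = (slice F s0)"
  "!!e. e \<in> {-delta<..<delta} ==> range (slice G e) \<in> stratum2" "smooth w"
  by (rule tangent_vectors_props[OF w]) (rule that, assumption+)
 interpret G: knot_family G "{-delta/2..delta/2}" R'
  using G by (intro knot_familyI) auto
 have G0: "0 \<in> {-delta/2..delta/2}" using G(2) by simp
 have PG: "G.P 0 t = P s0 t" "G.P1 0 t = P1 s0 t" "G.P2 0 t = P2 s0 t" for t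
  unfolding G.P_velocity[symmetric] P_velocity[symmetric] G(6) using fun_cong[OF G(6), of t] by (simp_all add: G.P_def P_def)
 have slG: "G.slope 0 a b = 0 \<longleftrightarrow> slope s0 a b = 0" for a b
  unfolding G.slope_zero_iff[OF G0] slope_zero_iff[OF s0] PG ..
 have tG: "G.tangency_on_branch 0 a0 b0 c0"
  using t unfolding G.tangency_on_branch_def tangency_on_branch_def G.tang_nondeg1_def tang_nondeg1_def PG slG .
 have "\<exists>e a b c. 0 < e & abs (e - 0) < inverse (real (Suc n)) & abs (a - a0) < inverse (real (Suc n)) & abs (b - b0) < inverse (real (Suc n)) &
   abs (c - c0) < inverse (real (Suc n)) & G.tmap (e, a, b, c) = 0" for n
 proof -
  let ?i = "inverse (real (Suc n))"
  have i: "?i > 0" by simp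
  obtain d where d: "d > 0" "!!s. s \<in> {-delta/2..delta/2} ==> dist s 0 < d ==> (slice G s) \<in> params ==> range (slice G s) \<in> stratum2 ==>
   \<exists>a b c. abs (a - a0) < ?i & abs (b - b0) < ?i & abs (c - c0) < ?i & G.P s a = G.P s b & G.P s a = G.P s c & crs (G.P1 s a) (G.P1 s b) = 0"
   by (rule G.stratum2_near[OF G0 tG i]) (rule that, assumption+)
  define e where "e = min (d/2) (min (delta/2) (?i/2))"
  have e: "e > 0" "e < d" "e <= delta/2" "e < ?i" using d(1) G(2) i by (auto simp: e_def min_less_iff_disj simp del: inverse_eq_divide)
  have "e \<in> {-delta/2..delta/2}" "e \<in> {-delta<..<delta}" "dist e 0 < d" using e G(2) by auto
  from d(2)[OF this(1,3) params_upto_params[OF G(5)[OF this(2)]] G(7)[OF this(2)]]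
  obtain a b c where "abs (a - a0) < ?i" "abs (b - b0) < ?i" "abs (c - c0) < ?i" "G.P e a = G.P e b" "G.P e a = G.P e c" "crs (G.P1 e a) (G.P1 e b) = 0"
   by (elim exE conjE)
  then show ?thesis using e(1,4)
   by (intro exI[of _ e] exI[of _ a] exI[of _ b] exI[of _ c]) (simp add: G.tmap_def zero_prod_def)
 qed
 then obtain e a b c where X: "!!n. 0 < e n" "!!n. abs (e n - 0) < inverse (real (Suc n))" "!!n. abs (a n - a0) < inverse (real (Suc n))"
  "!!n. abs (b n - b0) < inverse (real (Suc n))" "!!n. abs (c n - c0) < inverse (real (Suc n))" "!!n. G.tmap (e n, a n, b n, c n) = 0"
  by metis
 have lim: "(%n. (e n, a n, b n, c n)) \<longlonglongrightarrow> (0, a0, b0, c0)"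
  by (intro tendsto_Pair seq_close X)
 have ne: "(e n, a n, b n, c n) ~= (0, a0, b0, c0)" for n using X(1)[of n] by simp
 have "G.P 0 a0 - G.P 0 b0 = 0" "G.P 0 a0 - G.P 0 c0 = 0" "crs (G.P1 0 a0) (G.P1 0 b0) = 0"
  using t unfolding PG tangency_on_branch_def right_minus_eq by blast+
 then have "G.tmap (0, a0, b0, c0) = 0" unfolding G.tmap_def zero_prod_def by (simp only: case_prod_conv)
 then have val: "G.tmap (e n, a n, b n, c n) = G.tmap (0, a0, b0, c0)" for n using X(6) by simp
 obtain u where u: "norm u = 1" "G.tmap' 0 a0 b0 c0 u = 0"
  by (rule derivative_kernel[OF G.tmap_has_derivative lim ne val]) (rule that, assumption+)
 obtain h x y z where uu: "u = (h, x, y, z)" by (cases u)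
 have fv: "family_velocity G 0 h = (%t. h *\<^sub>R w t)"
  using family_velocity_scaleR[OF G(3), of 0 h 1] by (simp add: G(1) fun_eq_iff)
 have vv: "velocity (%t. h *\<^sub>R w t) = (%t. h *\<^sub>R velocity w t)"
  by (rule velocity_linear[OF bounded_linear_scaleR_right G(8)])
 have E: "h *\<^sub>R pz (w a0) + x *\<^sub>R P1 s0 a0 - h *\<^sub>R pz (w b0) - y *\<^sub>R P1 s0 b0 = 0"
  "h *\<^sub>R pz (w a0) + x *\<^sub>R P1 s0 a0 - h *\<^sub>R pz (w c0) - z *\<^sub>R P1 s0 c0 = 0"
  "crs (h *\<^sub>R pz (velocity w a0) + x *\<^sub>R P2 s0 a0) (P1 s0 b0) + crs (P1 s0 a0) (h *\<^sub>R pz (velocity w b0) + y *\<^sub>R P2 s0 b0) = 0"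
  using u(2) unfolding uu G.tmap'_def by (simp_all add: fv vv PG zero_prod_def)
 have h: "h ~= 0"
 proof
  assume h0: "h = 0"
  have e1: "x *\<^sub>R P1 s0 a0 = y *\<^sub>R P1 s0 b0" and e2: "x *\<^sub>R P1 s0 a0 = z *\<^sub>R P1 s0 c0" using E(1,2) h0 by simp_all
  have "crs (x *\<^sub>R P1 s0 a0) (P1 s0 c0) = 0" unfolding e2 by simp
  then have x0: "x = 0" using t by (simp add: tangency_on_branch_def)
  then have "y = 0" "z = 0" using e1 e2 P1_nonzero[OF s0] by simp_all
  then show False using u(1) uu h0 x0 by simp
 qed
 show ?thesis
 proof (rule that[of "x / h" "y / h" "z / h"])
  have sc: "A + (x / h) *\<^sub>R B = C + (v / h) *\<^sub>R D" if "h *\<^sub>R A + x *\<^sub>R B - h *\<^sub>R C - v *\<^sub>R D = 0" for A B C D :: complex and v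
  proof -
   have "h *\<^sub>R (A + (x / h) *\<^sub>R B) = h *\<^sub>R (C + (v / h) *\<^sub>R D)"
    using that h by (simp add: scaleR_add_right algebra_simps)
   then show ?thesis using h by simp
  qed
  show "pz (w a0) + (x / h) *\<^sub>R P1 s0 a0 = pz (w b0) + (y / h) *\<^sub>R P1 s0 b0" by (rule sc[OF E(1)])
  show "pz (w a0) + (x / h) *\<^sub>R P1 s0 a0 = pz (w c0) + (z / h) *\<^sub>R P1 s0 c0" by (rule sc[OF E(2)])
  have "h * (crs (pz (velocity w a0) + (x / h) *\<^sub>R P2 s0 a0) (P1 s0 b0) + crs (P1 s0 a0) (pz (velocity w b0) + (y / h) *\<^sub>R P2 s0 b0)) = 0"
   using E(3) h by (simp add: algebra_simps)
  then show "crs (pz (velocity w a0) + (x / h) *\<^sub>R P2 s0 a0) (P1 s0 b0) + crs (P1 s0 a0) (pz (velocity w b0) + (y / h) *\<^sub>R P2 s0 b0) = 0"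
   using h by simp
 qed
qed

definition lift :: "complex => real^3" where
 "lift z = vector [Re z, Im z, 0]"

lemma pz_lift [simp]: "pz (lift z) = z"
 by (simp add: lift_def complex_eq_iff)

text \<open>Fields with prescribed 1-jets at the three parameters produce every value of the
  linearized equations. Transversality splits such a field into a family direction and a tangent
  vector of the stratum, and the latter satisfies the homogeneous equations by
  \<open>stratum2_tangent\<close>.\<close>

lemma tmap'_surj:
 assumes s0: "s0 \<in> S" and t: "tangency_on_branch s0 a0 b0 c0" and par: "(slice F s0) \<in> params_upto R"
  and tr: "transverse_at F UNIV stratum2 s0"
 shows "surj (tmap' s0 a0 b0 c0)"
proof -
 have "\<exists>u. tmap' s0 a0 b0 c0 u = (A, B, C)" for A B C
 proof -
  define r where "r = R + abs a0 + abs b0 + abs c0"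
  have r: "r > 0" "r >= R" "abs a0 < r" "abs b0 < r" "abs c0 < r" using R_pos by (auto simp: r_def)
  have ne: "a0 ~= b0" "a0 ~= c0" "b0 ~= c0" using t by (auto simp: tangency_on_branch_def)
  \<comment> \<open>The tangent turned by a right angle has determinant minus its square length with
    the tangent, so this factor contributes exactly \<open>C\<close>.\<close>
  define k where "k = - C / (P1 s0 b0 \<bullet> P1 s0 b0)"
  obtain v where v: "smooth v" "!!t. abs t >= r ==> v t = 0" "v a0 = 0" "velocity v a0 = lift (k *\<^sub>R (\<i> * P1 s0 b0))"
   "v b0 = lift (- A)" "velocity v b0 = 0" "v c0 = lift (- B)"
   by (rule interpolation[OF ne r(3-5), of 0 "lift (k *\<^sub>R (\<i> * P1 s0 b0))" "lift (- A)" "lift (- B)"]) (rule that, assumption+)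
  have parr: "(slice F s0) \<in> params_upto r" by (rule params_upto_mono[OF par r(2)])
  obtain delta where d: "delta > 0" "!!e. e \<in> {-delta..delta} ==> (%t. F (s0, t) + e *\<^sub>R v t) \<in> params_upto r"
   by (rule linear_perturbation[OF parr r(1) v(1,2)]) (assumption, rule that, assumption+)
  have "v \<in> tangent_vectors (topspace M1) (slice F s0)"
  proof (rule tangent_vectorsI[OF parr r(1) v(1,2) smooth_const refl d(1)])
   fix e assume "abs e < delta"
   then have "(%t. F (s0, t) + e *\<^sub>R v t) \<in> params_upto r" by (intro d(2)) auto
   then show "range (%t. F (s0, t) + e *\<^sub>R (v t - 0 *\<^sub>R velocity (slice F s0) t)) \<in> topspace M1"
    unfolding topspace_M1 using params_upto_params by simp
  qed
  then obtain h w where hw: "w \<in> tangent_vectors stratum2 (slice F s0)" "!!t. v t = family_velocity F s0 h t + w t"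
   using tr unfolding transverse_at_def by blast
  obtain x y z where xyz: "pz (w a0) + x *\<^sub>R P1 s0 a0 = pz (w b0) + y *\<^sub>R P1 s0 b0"
   "pz (w a0) + x *\<^sub>R P1 s0 a0 = pz (w c0) + z *\<^sub>R P1 s0 c0"
   "crs (pz (velocity w a0) + x *\<^sub>R P2 s0 a0) (P1 s0 b0) + crs (P1 s0 a0) (pz (velocity w b0) + y *\<^sub>R P2 s0 b0) = 0"
   by (rule stratum2_tangent[OF s0 t hw(1)]) (rule that, assumption+)
  let ?g = "family_velocity F s0 h"
  have w: "w = (%t. v t - ?g t)" using hw(2) by (simp add: fun_eq_iff)
  have vw: "velocity w t = velocity v t - velocity ?g t" for t
   unfolding w by (intro velocity_at has_vector_derivative_diff smooth_velocity v(1) family_velocity_smooth smF)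
  have N: "P1 s0 b0 \<bullet> P1 s0 b0 ~= 0" using P1_nonzero[OF s0] by simp
  have ci: "crs (\<i> * P1 s0 b0) (P1 s0 b0) = - (P1 s0 b0 \<bullet> P1 s0 b0)"
   by (simp add: crs_def inner_complex_def)
  have "crs (pz (velocity ?g a0) + (- x) *\<^sub>R P2 s0 a0) (P1 s0 b0) + crs (P1 s0 a0) (pz (velocity ?g b0) + (- y) *\<^sub>R P2 s0 b0)
   = crs (pz (velocity v a0)) (P1 s0 b0) + crs (P1 s0 a0) (pz (velocity v b0))"
   using xyz(3) by (simp add: vw algebra_simps)
  also have "\<dots> = C" using N by (simp add: v ci k_def)
  finally have e3: "crs (pz (velocity ?g a0) + (- x) *\<^sub>R P2 s0 a0) (P1 s0 b0) + crs (P1 s0 a0) (pz (velocity ?g b0) + (- y) *\<^sub>R P2 s0 b0) = C" .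
  have e1: "pz (?g a0) + (- x) *\<^sub>R P1 s0 a0 - pz (?g b0) - (- y) *\<^sub>R P1 s0 b0 = A"
   using xyz(1) v(3,5) by (simp add: w algebra_simps)
  have e2: "pz (?g a0) + (- x) *\<^sub>R P1 s0 a0 - pz (?g c0) - (- z) *\<^sub>R P1 s0 c0 = B"
   using xyz(2) v(3,7) by (simp add: w algebra_simps)
  show ?thesis
   using e1 e2 e3 by (intro exI[of _ "(h, - x, - y, - z)"]) (simp only: tmap'_def case_prod_conv)
 qed
 then show ?thesis unfolding surj_def by (metis prod_cases3)
qed

text \<open>Three plane vectors satisfy a linear relation whose coefficients are the determinants of
  the opposite pairs. If these have one sign, no covector is positive on all three vectors.\<close>

lemma star_of_same_signs:
 assumes s: "s \<in> S" and abc: "a ~= b" "a ~= c" "b ~= c" "P s a = P s b" "P s a = P s c"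
  and no4: "!!d. d ~= a ==> d ~= b ==> d ~= c ==> P s a ~= P s d"
  and pos: "crs (P1 s a) (P1 s b) * crs (P1 s c) (P1 s a) > 0" "crs (P1 s b) (P1 s c) * crs (P1 s c) (P1 s a) > 0"
 shows "star_like_triple_crossing (slice F s) (pr (F (s, a)))"
proof -
 let ?f = "%t. F (s, t)"
 have br: "branches ?f (pr (F (s, a))) = {a, b, c}"
 proof -
  have "t \<in> {a, b, c}" if "pr (F (s, t)) = pr (F (s, a))" for t
   using that no4[of t] same_point_iff[of s t a] by (cases "t \<in> {a, b, c}") auto
  moreover have "pr (F (s, b)) = pr (F (s, a))" "pr (F (s, c)) = pr (F (s, a))"
   using abc(4,5) same_point_iff[of s b a] same_point_iff[of s c a] by auto
  ultimately show ?thesis by (auto simp: branches_def)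
 qed
 have cn: "crs (P1 s a) (P1 s b) ~= 0" "crs (P1 s b) (P1 s c) ~= 0" "crs (P1 s c) (P1 s a) ~= 0" using pos by auto
 have cn': "crs (P1 s b) (P1 s a) ~= 0" "crs (P1 s c) (P1 s b) ~= 0" "crs (P1 s a) (P1 s c) ~= 0"
  using cn crs_swap[of "P1 s b" "P1 s a"] crs_swap[of "P1 s c" "P1 s b"] crs_swap[of "P1 s a" "P1 s c"] by auto
 have m: "multi_crossing 3 ?f (pr (F (s, a)))"
  unfolding multi_crossing_def br pairwise_def transversal_family_iff using abc cn cn' by simp
 have "~ (\<exists>n. \<forall>t \<in> {a, b, c}. n \<bullet> direction ?f t > 0)"
 proof
  assume "\<exists>n. \<forall>t \<in> {a, b, c}. n \<bullet> direction ?f t > 0"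
  then obtain n where n: "\<forall>t \<in> {a, b, c}. n \<bullet> direction ?f t > 0" by blast
  define m where "m = Complex (n $ 1) (n $ 2)"
  have nd: "n \<bullet> direction ?f t = m \<bullet> P1 s t" for t
   by (simp add: direction_nth[OF smooth_curve] inner_vec_def UNIV_2 m_def inner_complex_def P_velocity(1)[symmetric])
  have p: "m \<bullet> P1 s a > 0" "m \<bullet> P1 s b > 0" "m \<bullet> P1 s c > 0" using n unfolding nd by auto
  let ?A = "crs (P1 s b) (P1 s c)" and ?B = "crs (P1 s c) (P1 s a)" and ?C = "crs (P1 s a) (P1 s b)"
  have z: "?A * (m \<bullet> P1 s a) + ?B * (m \<bullet> P1 s b) + ?C * (m \<bullet> P1 s c) = 0"
   by (simp add: crs_def inner_complex_def algebra_simps)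
  have "?B * (?A * (m \<bullet> P1 s a) + ?B * (m \<bullet> P1 s b) + ?C * (m \<bullet> P1 s c)) =
    (?A * ?B) * (m \<bullet> P1 s a) + ?B * ?B * (m \<bullet> P1 s b) + (?C * ?B) * (m \<bullet> P1 s c)" by (simp add: algebra_simps)
  moreover have "(?A * ?B) * (m \<bullet> P1 s a) > 0" "(?C * ?B) * (m \<bullet> P1 s c) > 0"
   using pos p by (simp_all add: mult_pos_pos)
  moreover have "?B * ?B * (m \<bullet> P1 s b) >= 0" by (rule mult_nonneg_nonneg[OF zero_le_square less_imp_le[OF p(2)]])
  ultimately have "?B * (?A * (m \<bullet> P1 s a) + ?B * (m \<bullet> P1 s b) + ?C * (m \<bullet> P1 s c)) > 0" by linarith
  then show False unfolding z by simp
 qed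
 then show ?thesis unfolding star_like_triple_crossing_def br using m by blast
qed

text \<open>As the tangents at \<open>a0\<close> and \<open>b0\<close> are opposite, the
  determinants \<open>b0\<close>, \<open>c0\<close> and \<open>c0\<close>, \<open>a0\<close> share a
  sign \<open>sgm\<close>. A surjective derivative makes \<open>tmap\<close> locally onto, so some
  nearby diagram has a triple point whose third determinant is small and of sign \<open>sgm\<close>
  too.\<close>

lemma tangency_on_branch_star:
 assumes s0: "s0 \<in> interior S" and t: "tangency_on_branch s0 a0 b0 c0" and anti: "P1 s0 a0 \<bullet> P1 s0 b0 < 0"
  and su: "surj (tmap' s0 a0 b0 c0)"
 obtains s q where "s \<in> S" "star_like_triple_crossing (slice F s) q"
proof -
 have s0S: "s0 \<in> S" using s0 interior_subset by blast
 let ?K = "{(s, a, b, c, d). s \<in> S & slope s a b = 0 & slope s a c = 0 & slope s b c = 0 &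
  slope s a d = 0 & slope s b d = 0 & slope s c d = 0}"
 have only3: "!!x y z. slope s0 x y = 0 ==> slope s0 x z = 0 ==> slope s0 y z = 0 ==> {x, y, z} = {a0, b0, c0}"
  using t unfolding tangency_on_branch_def by blast
 have in4: "\<forall>y. (s0, y) \<notin> ?K"
 proof (intro allI notI)
  fix y assume y: "(s0, y) \<in> ?K"
  obtain a b c d where yy: "y = (a, b, c, d)" by (cases y)
  have sl: "slope s0 a b = 0" "slope s0 a c = 0" "slope s0 b c = 0" "slope s0 a d = 0" "slope s0 b d = 0" "slope s0 c d = 0"
   using y unfolding yy by simp_all
  have "{a, b, c} = {a0, b0, c0}" "{a, b, d} = {a0, b0, c0}" by (intro only3 sl)+
  then have "d \<in> {a, b, c}" by blast
  moreover have "a ~= d" "b ~= d" "c ~= d" using sl(4-6) by (simp_all add: slope_zero_iff[OF s0S])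
  ultimately show False by auto
 qed
 obtain d4 where d4: "d4 > 0" "\<forall>s y. dist s s0 < d4 --> (s, y) \<notin> ?K"
  using compact_tube_empty[OF compact_quadruples in4] by (elim exE conjE) (rule that, assumption+)
 define sgm where "sgm = sgn (crs (P1 s0 c0) (P1 s0 a0))"
 obtain r where r: "P1 s0 a0 = r *\<^sub>R P1 s0 b0" using t by (auto simp: tangency_on_branch_def tang_nondeg1_def)
 have r0: "r < 0" using anti inner_ge_zero[of "P1 s0 b0"] by (auto simp: r mult_less_0_iff)
 have cc: "crs (P1 s0 c0) (P1 s0 a0) ~= 0" using t crs_swap[of "P1 s0 c0"] by (simp add: tangency_on_branch_def)
 have "crs (P1 s0 c0) (P1 s0 a0) = - r * crs (P1 s0 b0) (P1 s0 c0)"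
  using crs_swap[of "P1 s0 c0" "P1 s0 b0"] by (simp add: r)
 then have bb: "sgm * crs (P1 s0 b0) (P1 s0 c0) > 0"
  using r0 cc unfolding sgm_def by (auto simp: sgn_mult sgn_if zero_less_mult_iff mult_less_0_iff)
 have aa: "sgm * crs (P1 s0 c0) (P1 s0 a0) > 0" using cc by (auto simp: sgm_def sgn_if)
 let ?a = "%z::'a \<times> real \<times> real \<times> real. fst (snd z)" and ?b = "%z::'a \<times> real \<times> real \<times> real. fst (snd (snd z))"
  and ?c = "%z::'a \<times> real \<times> real \<times> real. snd (snd (snd z))"
 let ?T = "{z. fst z \<in> interior S} \<inter> {z. dist (fst z) s0 < d4} \<inter> {z. sgm * crs (P1 (fst z) (?c z)) (P1 (fst z) (?a z)) > 0} \<inter>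
  {z. sgm * crs (P1 (fst z) (?b z)) (P1 (fst z) (?c z)) > 0} \<inter> {z. ?a z ~= ?b z} \<inter> {z. ?a z ~= ?c z} \<inter> {z. ?b z ~= ?c z}"
 have "open {z::'a \<times> real \<times> real \<times> real. fst z \<in> interior S}"
  using open_vimage_fst[OF open_interior, of S] by (simp add: vimage_def)
 then have oT: "open ?T"
  by (intro open_Int open_Collect_less open_Collect_neq continuous_intros crs_continuous P_cont)
 have inT: "(s0, a0, b0, c0) \<in> ?T"
  using s0 d4(1) aa bb t by (simp add: tangency_on_branch_def)
 have inT': "(s0, a0, b0, c0) \<in> interior ?T" unfolding interior_open[OF oT] by (rule inT)
 have bl: "bounded_linear (tmap' s0 a0 b0 c0)"
  by (rule has_derivative_bounded_linear[OF tmap_has_derivative])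
 obtain g where g: "linear g" "tmap' s0 a0 b0 c0 \<circ> g = id"
  using linear_surjective_right_inverse[OF bounded_linear.linear[OF bl] su] by blast
 have blg: "bounded_linear g" using g(1) by (simp add: linear_conv_bounded_linear)
 \<comment> \<open>Sussmann's open mapping theorem: continuity and a right inverse of the derivative
   at this one point suffice, also when the domain has the larger dimension.\<close>
 have "tmap (s0, a0, b0, c0) \<in> interior (tmap ` ?T)"
  by (rule sussmann_open_mapping[OF open_UNIV tmap_continuous UNIV_I tmap_has_derivative blg g(2) subset_UNIV inT'])
 moreover have "P s0 a0 - P s0 b0 = 0" "P s0 a0 - P s0 c0 = 0" "crs (P1 s0 a0) (P1 s0 b0) = 0"
  using t unfolding tangency_on_branch_def right_minus_eq by blast+
 then have "tmap (s0, a0, b0, c0) = (0, 0, 0)" unfolding tmap_def by (simp only: case_prod_conv)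
 ultimately have "(0, 0, 0) \<in> interior (tmap ` ?T)" by simp
 then obtain e where e: "e > 0" "ball (0, 0, 0) e \<subseteq> tmap ` ?T" unfolding mem_interior by blast
 have "(0, 0, sgm * (e / 2)) \<in> ball (0::complex, 0::complex, 0::real) e"
  using e(1) by (auto simp: dist_Pair_Pair sgm_def sgn_if dist_real_def)
 then have "(0, 0, sgm * (e / 2)) \<in> tmap ` ?T" by (rule subsetD[OF e(2)])
 then obtain z where z: "tmap z = (0, 0, sgm * (e / 2))" "z \<in> ?T" by (elim imageE) (rule that, erule sym, assumption)
 obtain s a b c where zz: "z = (s, a, b, c)" by (cases z)
 have sS: "s \<in> S" using z(2) interior_subset[of S] unfolding zz by (simp add: subset_iff)
 have P: "P s a = P s b" "P s a = P s c" "crs (P1 s a) (P1 s b) = sgm * (e / 2)" using z(1)[unfolded zz tmap_def case_prod_conv prod.inject right_minus_eq] by blast+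
 have ne: "a ~= b" "a ~= c" "b ~= c" and ds: "dist s s0 < d4"
  and q: "sgm * crs (P1 s c) (P1 s a) > 0" "sgm * crs (P1 s b) (P1 s c) > 0" using z(2) unfolding zz by simp_all
 have no4: "P s a ~= P s d" if d: "d ~= a" "d ~= b" "d ~= c" for d
 proof
  assume "P s a = P s d"
  then have "(s, (a, b, c, d)) \<in> ?K" using sS ne P d by (auto simp: slope_zero_iff[OF sS])
  then show False using d4(2) ds by blast
 qed
 have sg: "sgm * sgm = 1" using cc by (auto simp: sgm_def sgn_if)
 have 1: "crs (P1 s a) (P1 s b) * crs (P1 s c) (P1 s a) > 0"
 proof -
  have "e / 2 * (sgm * crs (P1 s c) (P1 s a)) > 0" by (rule mult_pos_pos[OF _ q(1)]) (use e(1) in simp)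
  then show ?thesis unfolding P(3) by (simp only: mult_ac)
 qed
 have "(sgm * crs (P1 s b) (P1 s c)) * (sgm * crs (P1 s c) (P1 s a)) > 0" using q by (rule mult_pos_pos[rotated])
 then have "(sgm * sgm) * (crs (P1 s b) (P1 s c) * crs (P1 s c) (P1 s a)) > 0" by (simp add: mult_ac)
 then have 2: "crs (P1 s b) (P1 s c) * crs (P1 s c) (P1 s a) > 0" unfolding sg by simp
 show ?thesis
  by (rule that[OF sS star_of_same_signs[OF sS ne P(1,2) no4 1 2]])
qed

end

section \<open>Generic families without star-like triple crossings\<close>

locale generic_family = knot_family F S R
 for F :: "'a::euclidean_space \<times> real => real^3" and S :: "'a set" and R :: real +
 assumes par: "!!s. s \<in> S ==> (slice F s) \<in> params_upto R"
  and strata: "!!s. s \<in> S ==> \<exists>X\<in>{stratum0, stratum1, stratum2}. range (slice F s) \<in> X & transverse_at F UNIV X s"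
  and boundary: "!!s. s \<in> S ==> s \<notin> interior S ==> range (slice F s) \<in> stratum0 \<union> stratum1"
  and no_star: "!!s. s \<in> S ==> ~ has_star_like_triple_crossing (range (slice F s))"
begin

lemma par': "s \<in> S ==> (slice F s) \<in> params"
 by (rule params_upto_params[OF par])

text \<open>The boundary of the parameter set meets only strata 0 and 1, so codimension 2 points
  occur at interior parameters, where the unfolding has room in all directions.\<close>

lemma point_cases:
 assumes s: "s \<in> S"
 shows "generic_point (slice F s) q | codim1_point (slice F s) q \<or>
  codim2_point (slice F s) q & s \<in> interior S & transverse_at F UNIV stratum2 s &
  (\<forall>q'. q' ~= q --> generic_point (slice F s) q')"
proof -
 let ?f = "%t. F (s, t)"
 note si = strata_iff[OF par'[OF s]]
 have low: "generic_point ?f q | codim1_point ?f q" if "range ?f \<in> stratum0 \<union> stratum1"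
 proof -
  have "(\<forall>q. generic_point ?f q) | (\<exists>q. codim1_point ?f q & (\<forall>q'. q' ~= q --> generic_point ?f q'))"
   using that unfolding Un_iff si(1,2) .
  then show ?thesis
  proof (elim disjE exE conjE)
   fix r assume "codim1_point ?f r" "\<forall>q'. q' ~= r --> generic_point ?f q'"
   then show ?thesis by (cases "q = r") auto
  qed simp
 qed
 obtain X where X: "X \<in> {stratum0, stratum1, stratum2}" "range ?f \<in> X" "transverse_at F UNIV X s"
  using strata[OF s] by (elim bexE conjE) (rule that, assumption+)
 show ?thesis
 proof (cases "range ?f \<in> stratum0 \<union> stratum1")
  case True then show ?thesis using low by blast
 next
  case False
  then have X2: "range ?f \<in> stratum2" "transverse_at F UNIV stratum2 s" using X by auto
  have int: "s \<in> interior S" using boundary[OF s] False by blast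
  show ?thesis using X2(1) unfolding si(3)
  proof (elim disjE exE conjE)
   fix r assume "codim2_point ?f r" "\<forall>q'. q' ~= r --> generic_point ?f q'"
   then show ?thesis using int X2(2) by (cases "q = r") auto
  next
   fix r r' assume "codim1_point ?f r" "codim1_point ?f r'" "\<forall>q'. q' ~= r & q' ~= r' --> generic_point ?f q'"
   then show ?thesis by (cases "q = r | q = r'") auto
  qed
 qed
qed

text \<open>Passes from the contact orders in the strata to conditions on derivatives. For order 2
  the criterion for contact of order 3 is used contrapositively.\<close>

lemma contact_nondeg:
 assumes s: "s \<in> S" and P: "P s a = P s b"
 shows "contact 1 (slice F s) a b ==> tang_nondeg1 s a b"
  "contact 2 (slice F s) a b ==> tang_nondeg2 s a b"
proof -
 let ?f = "%t. F (s, t)"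
 have P': "pz (?f a) = pz (?f b)" using P by (simp add: P_def)
 have n: "P1 s b ~= 0" by (rule P1_nonzero[OF s])
 note c1 = contact_1_iff[OF smooth_curve P', unfolded P_velocity, OF n]
  and c2 = contact_2_iff[OF smooth_curve P', unfolded P_velocity, OF n]
  and c3 = contact_3I[OF smooth_curve P', unfolded P_velocity, OF n]
  and cD = contact_geD[OF smooth_curve P', unfolded P_velocity]
 show "tang_nondeg1 s a b" if c: "contact 1 ?f a b"
 proof -
  have "crs (P1 s a) (P1 s b) = 0" using c c1 by (simp add: contact_def)
  then obtain k where k: "P1 s a = k *\<^sub>R P1 s b" using crs_eq_0D[OF _ n] by blast
  have "~ contact_ge 2 ?f a b" using c by (simp add: contact_def numeral_2_eq_2)
  then have "crs (P2 s a - k\<^sup>2 *\<^sub>R P2 s b) (P1 s b) ~= 0" unfolding c2[OF k] .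
  then show ?thesis unfolding tang_nondeg1_def using k by blast
 qed
 show "tang_nondeg2 s a b" if c: "contact 2 ?f a b"
 proof -
  have ge: "contact_ge 2 ?f a b" and n3: "~ contact_ge 3 ?f a b" using c by (simp_all add: contact_def numeral_3_eq_3 numeral_2_eq_2)
  obtain k k2 where k: "P1 s a = k *\<^sub>R P1 s b" "P2 s a = k\<^sup>2 *\<^sub>R P2 s b + (2 * k2) *\<^sub>R P1 s b"
   by (rule cD[OF ge]) (metis order_refl one_le_numeral)
  have "crs (P3 s a - k^3 *\<^sub>R P3 s b - (6 * k * k2) *\<^sub>R P2 s b) (P1 s b) ~= 0" using c3[OF k] n3 by blast
  then show ?thesis unfolding tang_nondeg2_def using k by blast
 qed
qed

lemma not_tangency_on_branch:
 assumes s: "s \<in> interior S" and tr: "transverse_at F UNIV stratum2 s" and anti: "P1 s a \<bullet> P1 s b < 0"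
 shows "~ tangency_on_branch s a b c"
proof
 assume t: "tangency_on_branch s a b c"
 have sS: "s \<in> S" using s interior_subset by blast
 obtain s' q where sq: "s' \<in> S" "star_like_triple_crossing (slice F s') q"
  by (rule tangency_on_branch_star[OF s t anti tmap'_surj[OF sS t par[OF sS] tr]]) (rule that, assumption+)
 then show False using no_star[OF sq(1)] unfolding strata_iff(4)[OF par'[OF sq(1)]] by blast
qed

text \<open>An antiparallel self-tangency lying on a third branch would produce a star-like triple
 crossing nearby, so the only antiparallel self-tangencies are isolated double points.\<close>

lemma anti_tangency:
 assumes s: "s \<in> S" and ab: "a ~= b" "P s a = P s b" and tan: "crs (P1 s a) (P1 s b) = 0" and anti: "P1 s a \<bullet> P1 s b < 0"
 shows "branches (slice F s) (pr (F (s, a))) = {a, b} &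
  (tang_nondeg1 s a b | tang_nondeg2 s a b | tang_nondeg1 s b a | tang_nondeg2 s b a)"
proof -
 let ?f = "%t. F (s, t)"
 define q where "q = pr (F (s, a))"
 have abq: "a \<in> branches ?f q" "b \<in> branches ?f q" using ab(2) same_point_iff[of s a b] by (simp_all add: branches_def q_def)
 have nt: "~ transversal ?f a b" "~ transversal ?f b a"
  using tan crs_swap[of "P1 s b" "P1 s a"] by (simp_all add: transversal_family_iff)
 have ng: "~ generic_point ?f q" using ab(1) abq nt unfolding generic_point_iff by blast
 have nm: "~ multi_crossing n ?f q" for n using ab(1) abq nt unfolding multi_crossing_def pairwise_def by blast
 have st: ?thesis if st1: "self_tangency k ?f q" and k: "k = 1 | k = 2" for k
 proof -
  obtain a' b' where c: "branches ?f q = {a', b'}" "contact k ?f a' b'"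
   using st1 unfolding self_tangency_def by (elim exE conjE) (rule that, assumption+)
  have cs: "(a', b') = (a, b) | (a', b') = (b, a)" using abq ab(1) unfolding c(1) by auto
  have "tang_nondeg1 s a' b' | tang_nondeg2 s a' b'" using cs contact_nondeg[OF s, of a' b'] ab(2) c(2) k by auto
  then show ?thesis using cs c(1) unfolding q_def by auto
 qed
 \<comment> \<open>All other points of the diagram are generic, so every tangency and every triple
   point sits at \<open>q\<close>; this is the situation that \<open>not_tangency_on_branch\<close>
   rules out.\<close>
 have 2: False if tw: "tangency_with_transverse_branch ?f q" and i: "s \<in> interior S" and tr: "transverse_at F UNIV stratum2 s"
  and gen: "\<forall>q'. q' ~= q --> generic_point ?f q'"
 proof -
  obtain a' b' c' where d: "a' ~= b'" "a' ~= c'" "b' ~= c'" "branches ?f q = {a', b', c'}" "contact 1 ?f a' b'"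
   "transversal ?f a' c'" "transversal ?f b' c'"
   using tw unfolding tangency_with_transverse_branch_def by (elim exE conjE) (rule that, assumption+)
  have tc: "crs (P1 s a') (P1 s c') ~= 0" "crs (P1 s b') (P1 s c') ~= 0" using d(6,7) unfolding transversal_family_iff by simp_all
  have tc': "crs (P1 s c') (P1 s a') ~= 0" "crs (P1 s c') (P1 s b') ~= 0"
   using tc crs_swap[of "P1 s c'" "P1 s a'"] crs_swap[of "P1 s c'" "P1 s b'"] by simp_all
  have pr': "pr (F (s, a')) = q" "pr (F (s, b')) = q" "pr (F (s, c')) = q" using d(4) unfolding branches_def by auto
  then have PP: "P s a' = P s b'" "P s a' = P s c'" using same_point_iff[of s a' b'] same_point_iff[of s a' c'] by simp_all
  have nd: "tang_nondeg1 s a' b'" by (rule contact_nondeg(1)[OF s PP(1) d(5)])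
  then obtain k where "P1 s a' = k *\<^sub>R P1 s b'" unfolding tang_nondeg1_def by blast
  then have t0: "crs (P1 s a') (P1 s b') = 0" by simp
  have pair: "(x, y) = (a', b') | (x, y) = (b', a')"
   if "x \<in> {a', b', c'}" "y \<in> {a', b', c'}" "x ~= y" "crs (P1 s x) (P1 s y) = 0" for x y
   using that tc tc' by auto
  have atq: "x \<in> {a', b', c'} & y \<in> {a', b', c'}" if xy: "slope s x y = 0" "crs (P1 s x) (P1 s y) = 0 | slope s x z = 0 & slope s y z = 0" for x y z
  proof -
   have e: "x ~= y" "pr (F (s, x)) = pr (F (s, y))" using xy(1) unfolding double_iff[OF s] by simp_all
   have "~ generic_point ?f (pr (F (s, x)))"
    unfolding not_generic_iff[OF s] using xy by blast
   then have "pr (F (s, x)) = q" using gen by blast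
   then show ?thesis using e(2) unfolding d(4)[symmetric] branches_def by simp
  qed
  have "tangency_on_branch s a' b' c'"
   unfolding tangency_on_branch_def
  proof (intro conjI allI impI)
   fix x y assume xy: "slope s x y = 0" "crs (P1 s x) (P1 s y) = 0"
   have "x ~= y" using xy(1) slope_zero_iff[OF s, of x y] by simp
   with pair[of x y] atq[of x y 0] xy show "(x, y) = (a', b') | (x, y) = (b', a')" by blast
  next
   fix x y z assume z: "slope s x y = 0" "slope s x z = 0" "slope s y z = 0"
   have "x ~= y" "x ~= z" "y ~= z" using z slope_zero_iff[OF s] by simp_all
   moreover have "x \<in> {a', b', c'}" "y \<in> {a', b', c'}" using atq[of x y z] z by blast+
   moreover have "z \<in> {a', b', c'}" 
   proof -
    have "pr (F (s, z)) = pr (F (s, x))" using z(2) unfolding double_iff[OF s] by simp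
    moreover have "pr (F (s, x)) = q" using \<open>x \<in> {a', b', c'}\<close> pr' by auto
    ultimately show ?thesis unfolding d(4)[symmetric] branches_def by simp
   qed
   ultimately show "{x, y, z} = {a', b', c'}" by auto
  qed (use d PP t0 tc nd in simp_all)
  moreover have "P1 s a' \<bullet> P1 s b' < 0"
   using pair[of a b] abq ab(1) tan anti unfolding d(4) by (auto simp: inner_commute)
  ultimately show False using not_tangency_on_branch[OF i tr] by blast
 qed
 show ?thesis
  using point_cases[OF s, of q] ng nm st[of 1] st[of 2] 2 unfolding codim1_point_def codim2_point_def by blast
qed

text \<open>Nondegeneracy is stated from one branch towards the other, so the count is made from
  whichever side \<open>anti_tangency\<close> provides and swapped if necessary.\<close>

lemma anti_tangency_count:
 assumes s0: "s0 \<in> S" and ab: "a0 ~= b0" "P s0 a0 = P s0 b0" and tan: "crs (P1 s0 a0) (P1 s0 b0) = 0" and anti: "P1 s0 a0 \<bullet> P1 s0 b0 < 0"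
 obtains eps where "eps > 0"
  "!!s. dist s s0 < eps ==> finite {(a, b). abs (a - a0) < eps & abs (b - b0) < eps & P s a = P s b} &
   card {(a, b). abs (a - a0) < eps & abs (b - b0) < eps & P s a = P s b} <= 3"
proof -
 have "tang_nondeg1 s0 a0 b0 | tang_nondeg2 s0 a0 b0 | tang_nondeg1 s0 b0 a0 | tang_nondeg2 s0 b0 a0"
  using anti_tangency[OF s0 ab tan anti] by blast
 then consider "tang_nondeg1 s0 a0 b0 | tang_nondeg2 s0 a0 b0" | "tang_nondeg1 s0 b0 a0 | tang_nondeg2 s0 b0 a0" by blast
 then show ?thesis
 proof cases
  case 1 then show ?thesis by (rule tangency_count[OF s0]) (rule that)
 next
  case 2
  then obtain eps where e: "eps > 0"
   "!!s. dist s s0 < eps ==> finite {(a, b). abs (a - b0) < eps & abs (b - a0) < eps & P s a = P s b} &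
   card {(a, b). abs (a - b0) < eps & abs (b - a0) < eps & P s a = P s b} <= 3"
   by (rule tangency_count[OF s0]) (rule that)
  have sw: "{(a, b). abs (a - a0) < eps & abs (b - b0) < eps & P s a = P s b} =
   prod.swap ` {(a, b). abs (a - b0) < eps & abs (b - a0) < eps & P s a = P s b}" for s
   by (force simp: image_iff)
  show ?thesis
   by (rule that[OF e(1)]) (unfold sw, use e(2) in \<open>simp add: card_image\<close>)
 qed
qed

text \<open>On the compact set of triple points with nonnegative determinant and nonpositive scalar
  product the determinant has no zero, since that would be an antiparallel tangency on a third
  branch. Its minimum determines the threshold \<open>eta\<close>.\<close>

lemma third_branch_gap:
 obtains eta where "eta > 0" "!!s a b c. s \<in> S ==> a ~= b ==> P s a = P s b ==> 0 <= crs (P1 s a) (P1 s b) ==>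
  crs (P1 s a) (P1 s b) <= eta * - (P1 s a \<bullet> P1 s b) ==> P s c = P s a ==> c = a | c = b"
proof -
 let ?T = "{(s, a, b, c). s \<in> S & slope s a b = 0 & slope s a c = 0 & slope s b c = 0}"
 let ?cr = "%z. crs (P1 (fst z) (fst (snd z))) (P1 (fst z) (fst (snd (snd z))))"
 let ?dt = "%z. P1 (fst z) (fst (snd z)) \<bullet> P1 (fst z) (fst (snd (snd z)))"
 define C where "C = ?T \<inter> ({z. ?cr z >= 0} \<inter> {z. ?dt z <= 0})"
 have "compact C" unfolding C_def
  by (intro compact_Int_closed compact_triples closed_Int closed_Collect_le crs_continuous P_cont continuous_intros)
 have cc: "continuous_on C ?cr" by (intro crs_continuous P_cont continuous_intros)
 have cd: "continuous_on C ?dt" by (intro P_cont continuous_intros)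
 have pos: "?cr z > 0" if "z \<in> C" for z
 proof (rule ccontr)
  assume n: "~ ?cr z > 0"
  obtain s a b c where z: "z = (s, a, b, c)" by (cases z)
  have s: "s \<in> S" and sl: "slope s a b = 0" "slope s a c = 0" "slope s b c = 0" and cr: "crs (P1 s a) (P1 s b) = 0" and dt: "P1 s a \<bullet> P1 s b <= 0"
   using that n unfolding z C_def by auto
  obtain k where k: "P1 s a = k *\<^sub>R P1 s b" using crs_eq_0D[OF cr P1_nonzero[OF s]] by blast
  have "P1 s a \<bullet> P1 s b ~= 0" using k P1_nonzero[OF s, of a] P1_nonzero[OF s, of b] by auto
  then have dt': "P1 s a \<bullet> P1 s b < 0" using dt by simp
  have ab: "a ~= b" "P s a = P s b" and c: "c ~= a" "c ~= b" "P s a = P s c" using sl slope_zero_iff[OF s] by auto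
  have "branches (slice F s) (pr (F (s, a))) = {a, b}" using anti_tangency[OF s ab cr dt'] by blast
  moreover have "c \<in> branches (slice F s) (pr (F (s, a)))"
   unfolding branches_iff using c(3) same_point_iff[of s c a] by simp
  ultimately show False using c(1,2) by simp
 qed
 have "\<exists>eta>0. \<forall>z\<in>C. ?cr z > eta * - ?dt z"
 proof (cases "C = {}")
  case False
  obtain z1 where z1: "z1 \<in> C" "!!z. z \<in> C ==> ?cr z1 <= ?cr z" using continuous_attains_inf[OF \<open>compact C\<close> False cc] by blast
  obtain z2 where z2: "z2 \<in> C" "!!z. z \<in> C ==> ?dt z2 <= ?dt z" using continuous_attains_inf[OF \<open>compact C\<close> False cd] by blast
  \<comment> \<open>Half the least determinant over 1 minus the least scalar product: the 1 keeps
    the denominator positive, the half makes the final inequality strict.\<close>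
  define eta where "eta = ?cr z1 / (2 * (1 - ?dt z2))"
  have d2: "?dt z2 <= 0" using z2(1) by (simp add: C_def)
  have e: "eta > 0" using pos[OF z1(1)] d2 by (simp add: eta_def)
  have "?cr z > eta * - ?dt z" if "z \<in> C" for z
  proof -
   have "eta * - ?dt z <= eta * (1 - ?dt z2)" using e z2(2)[OF that] by (intro mult_left_mono) auto
   also have "\<dots> = ?cr z1 / 2" using d2 by (simp add: eta_def field_simps)
   also have "\<dots> < ?cr z" using pos[OF z1(1)] z1(2)[OF that] by linarith
   finally show ?thesis .
  qed
  then show ?thesis using e by blast
 qed (auto intro: exI[of _ 1])
 then obtain eta where e: "eta > 0" "!!z. z \<in> C ==> ?cr z > eta * - ?dt z" by blast
 show ?thesis
 proof (rule that[OF e(1)])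
  fix s a b c assume s: "s \<in> S" and ab: "a ~= b" "P s a = P s b" and cr: "0 <= crs (P1 s a) (P1 s b)"
   "crs (P1 s a) (P1 s b) <= eta * - (P1 s a \<bullet> P1 s b)" and c: "P s c = P s a"
  have dt: "P1 s a \<bullet> P1 s b <= 0" using cr e(1) by (smt (verit) mult_minus_right mult_pos_pos)
  show "c = a | c = b"
  proof (rule ccontr)
   assume "~ (c = a | c = b)"
   then have "(s, a, b, c) \<in> C" using s ab c cr(1) dt by (simp add: C_def slope_zero_iff[OF s])
   then show False using e(2)[of "(s, a, b, c)"] cr(2) by simp
  qed
 qed
qed

end

section \<open>Continuous arguments along a half-line\<close>

lemma Ln_polar: "z ~= 0 ==> z = of_real (cmod z) * cis (Im (Ln z))"
 using exp_eq_polar[of "Ln z"] by (metis exp_Ln norm_exp_eq_Re)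

text \<open>Total turning 0 expressed without limits: the continuous argument started at 0 finally
  stays within a quarter turn. For paths that end in the right half-plane the alternative is a
  nonzero number of full turns.\<close>

definition untwisted :: "(real => complex) => bool" where
 "untwisted A \<longleftrightarrow> (\<exists>theta. continuous_on {0..} theta & theta 0 = (0::real) &
  (\<forall>u\<ge>0. \<exists>r>0. A u = of_real r * cis (theta u)) & (\<exists>T. \<forall>u\<ge>T. abs (theta u) < pi / 2))"

lemma untwistedI_angle:
 assumes "continuous_on {0..} theta" "theta 0 = 0" "!!u. u >= 0 ==> \<exists>r>0. A u = of_real r * cis (theta u)" "!!u. u >= T ==> \<bar>theta u\<bar> < pi / 2"
 shows "untwisted A"
 unfolding untwisted_def using assms by blast

text \<open>The quotient of \<open>B\<close> by \<open>A\<close> stays in the right half-plane, so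
  its principal argument is continuous and below a quarter turn; added to the argument of
  \<open>A\<close> it gives one of \<open>B\<close>. At the end the sum is below a half turn while
  \<open>Re (B u) > 0\<close>, hence below a quarter turn.\<close>

lemma untwisted_perturb:
 assumes u: "untwisted A" and cA: "continuous_on {0..} A" and cB: "continuous_on {0..} B"
  and pos: "!!u. u >= 0 ==> Re (cnj (A u) * B u) > 0" and B0: "Im (B 0) = 0" and B_end: "!!u. u >= U ==> Re (B u) > 0"
 shows "untwisted B"
proof -
 obtain theta T where th: "continuous_on {0..} theta" "theta 0 = 0" "!!u. u >= 0 ==> \<exists>r>0. A u = of_real r * cis (theta u)" "!!u. u >= T ==> \<bar>theta u\<bar> < pi / 2"
  using u unfolding untwisted_def by (elim exE conjE) (rule that, assumption+, auto)
 define L where "L u = Im (Ln (cnj (A u) * B u))" for u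
 have nz: "cnj (A u) * B u ~= 0" if "u >= 0" for u using pos[OF that] by (metis less_irrefl zero_complex.simps(1))
 have cL: "continuous_on {0..} L" unfolding L_def
 proof (intro continuous_intros cA cB)
  fix u :: real assume "u \<in> {0..}"
  then show "cnj (A u) * B u \<notin> \<real>\<^sub>\<le>\<^sub>0" using pos[of u] by (auto simp: complex_nonpos_Reals_iff)
 qed
 have Llt: "abs (L u) < pi / 2" if "u >= 0" for u unfolding L_def by (rule Re_Ln_pos_lt_imp[OF pos[OF that]])
 have polar: "\<exists>r>0. B u = of_real r * cis (theta u + L u)" if u: "u >= 0" for u
 proof -
  obtain r where r: "r > 0" "A u = of_real r * cis (theta u)" using th(3)[OF u] by blast
  have "cnj (A u) * B u = of_real (cmod (cnj (A u) * B u)) * cis (L u)" unfolding L_def by (rule Ln_polar[OF nz[OF u]])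
  then have "(A u * cnj (A u)) * B u = of_real (r * cmod (cnj (A u) * B u)) * cis (theta u + L u)"
   using r(2) by (simp add: cis_mult[symmetric] mult_ac)
  moreover have "cmod (A u) = r" using r by (simp add: norm_mult)
  then have "A u * cnj (A u) = of_real (r\<^sup>2)" by (simp only: complex_norm_square[symmetric])
  ultimately have "of_real (r\<^sup>2) * B u = of_real (r * cmod (cnj (A u) * B u)) * cis (theta u + L u)" by simp
  then have "B u = of_real (r * cmod (cnj (A u) * B u) / r\<^sup>2) * cis (theta u + L u)" using r(1) by (simp add: field_simps)
  moreover have "r * cmod (cnj (A u) * B u) / r\<^sup>2 > 0" using r(1) nz[OF u] by simp
  ultimately show ?thesis by blast
 qed
 show ?thesis
 proof (rule untwistedI_angle[of "%u. theta u + L u" B "max 0 (max T U)"])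
  show "continuous_on {0..} (%u. theta u + L u)" by (intro continuous_intros th cL)
  obtain r where r: "r > 0" "A 0 = of_real r" using th(3)[of 0] th(2) by auto
  then have "Re (cnj (A 0) * B 0) > 0" "Im (cnj (A 0) * B 0) = 0" using pos[of 0] B0 by simp_all
  then have "L 0 = 0" unfolding L_def using Im_Ln_eq_0[OF nz[of 0]] by simp
  then show "theta 0 + L 0 = 0" by (simp add: th)
  show "\<exists>r>0. B u = of_real r * cis (theta u + L u)" if "u >= 0" for u by (rule polar[OF that])
  fix u assume u: "max 0 (max T U) <= u"
  then have lt: "abs (theta u + L u) < pi" using Llt[of u] th(4)[of u] by auto
  obtain r where "r > 0" "B u = of_real r * cis (theta u + L u)" using polar[of u] u by auto
  then have "cos (theta u + L u) > 0" using B_end[of u] u by (simp add: zero_less_mult_iff)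
  then have c: "cos \<bar>theta u + L u\<bar> > 0" by simp
  show "abs (theta u + L u) < pi / 2"
  proof (rule ccontr)
   assume "~ abs (theta u + L u) < pi / 2"
   then have "cos \<bar>theta u + L u\<bar> <= cos (pi / 2)" using lt by (intro cos_monotone_0_pi_le) auto
   then show False using c by simp
  qed
 qed
qed

lemma untwisted_rescale:
 assumes u: "untwisted A" and h: "continuous_on {0..} h" "!!u. u >= 0 ==> h u >= 0" "h 0 = 0" "!!T. \<exists>U. \<forall>u\<ge>U. h u >= T"
  and B: "!!u. u >= 0 ==> k u > 0 & B u = of_real (k u) * A (h u)"
 shows "untwisted B"
proof -
 obtain theta T where th: "continuous_on {0..} theta" "theta 0 = 0" "!!u. u >= 0 ==> \<exists>r>0. A u = of_real r * cis (theta u)" "!!u. u >= T ==> \<bar>theta u\<bar> < pi / 2"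
  using u unfolding untwisted_def by (elim exE conjE) (rule that, assumption+, auto)
 obtain U where U: "!!u. u >= U ==> h u >= T" using h(4)[of T] by blast
 show ?thesis
 proof (rule untwistedI_angle[of "%u. theta (h u)" B U])
  show "continuous_on {0..} (%u. theta (h u))" by (rule continuous_on_compose2[OF th(1) h(1)]) (use h(2) in auto)
  show "theta (h 0) = 0" by (simp add: h th)
  show "\<exists>r>0. B u = of_real r * cis (theta (h u))" if u: "u >= 0" for u
  proof -
   obtain r where "r > 0" "A (h u) = of_real r * cis (theta (h u))" using th(3)[OF h(2)[OF u]] by blast
   then show ?thesis using B[OF u] by (intro exI[of _ "k u * r"]) simp
  qed
  show "abs (theta (h u)) < pi / 2" if "u >= U" for u using th(4) U that by blast
 qed
qed

lemma Ln_of_Ln_minus: "Im z < 0 ==> Im (Ln (- z)) = Im (Ln z) + pi"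
 by (subst Ln_minus) (auto dest: arg_cong[of z 0 Im])

text \<open>Neither path ever points straight up, so after multiplication by \<open>\<i>\<close>
  both avoid the cut of the logarithm, and the difference of the principal arguments is a continuous
  argument of the product.\<close>

lemma untwistedI:
 assumes c: "continuous_on {0..} X" "continuous_on {0..} Y" and up: "!!u. u >= 0 ==> Re (X u) = 0 ==> Im (X u) < 0" "!!u. u >= 0 ==> Re (Y u) = 0 ==> Im (Y u) < 0"
  and 0: "X 0 = Y 0" and U: "!!u. u >= U ==> Y u = 1" "!!u. u >= U ==> Re (X u) > 0"
 shows "untwisted (%u. X u * cnj (Y u))"
proof -
 have nz: "\<i> * X u ~= 0" "\<i> * Y u ~= 0" if "u >= 0" for u using up[OF that] by (auto simp: complex_eq_iff)
 show ?thesis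
 proof (rule untwistedI_angle[of "%u. Im (Ln (\<i> * X u)) - Im (Ln (\<i> * Y u))" _ U])
  show "continuous_on {0..} (%u. Im (Ln (\<i> * X u)) - Im (Ln (\<i> * Y u)))"
   by (intro continuous_intros c) (use up in \<open>force simp: complex_nonpos_Reals_iff\<close>)+
  show "Im (Ln (\<i> * X 0)) - Im (Ln (\<i> * Y 0)) = 0" by (simp add: 0)
  show "\<exists>r>0. X u * cnj (Y u) = of_real r * cis (Im (Ln (\<i> * X u)) - Im (Ln (\<i> * Y u)))" if u: "u >= 0" for u
  proof (intro exI[of _ "cmod (\<i> * X u) * cmod (\<i> * Y u)"] conjI)
   have "X u * cnj (Y u) = (\<i> * X u) * cnj (\<i> * Y u)" by (simp add: complex_eq_iff)
   also have "\<dots> = (of_real (cmod (\<i> * X u)) * cis (Im (Ln (\<i> * X u)))) * cnj (of_real (cmod (\<i> * Y u)) * cis (Im (Ln (\<i> * Y u))))"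
    using Ln_polar[OF nz(1)[OF u]] Ln_polar[OF nz(2)[OF u]] by simp
   also have "\<dots> = of_real (cmod (\<i> * X u) * cmod (\<i> * Y u)) * cis (Im (Ln (\<i> * X u)) - Im (Ln (\<i> * Y u)))"
    by (simp add: cis_divide[symmetric] cis_cnj divide_inverse)
   finally show "X u * cnj (Y u) = of_real (cmod (\<i> * X u) * cmod (\<i> * Y u)) * cis (Im (Ln (\<i> * X u)) - Im (Ln (\<i> * Y u)))" .
  qed (use nz[OF u] in simp)
  show "abs (Im (Ln (\<i> * X u)) - Im (Ln (\<i> * Y u))) < pi / 2" if u: "u >= U" for u
  proof -
   have "Im (Ln (\<i> * Y u)) = pi / 2" using U(1)[OF u] by simp
   moreover have "0 < Im (Ln (\<i> * X u)) & Im (Ln (\<i> * X u)) < pi" using U(2)[OF u] by (intro Im_Ln_pos_lt_imp) simp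
   ultimately show ?thesis unfolding abs_less_iff by linarith
  qed
 qed
qed

text \<open>Here \<open>X\<close> never points straight down and \<open>Y\<close> never straight up.
  With arguments measured from these opposite cuts, any continuous argument differs from
  \<open>psi\<close> by a constant odd multiple of \<open>pi\<close>. A start to the left makes it
  \<open>psi - pi\<close>, which ends at most at \<open>- 3 * pi / 2\<close>.\<close>

lemma not_untwistedI:
 assumes c: "continuous_on {0..} X" "continuous_on {0..} Y" and dn: "!!u. u >= 0 ==> Re (X u) = 0 ==> Im (X u) > 0" and up: "!!u. u >= 0 ==> Re (Y u) = 0 ==> Im (Y u) < 0"
  and 0: "X 0 = Y 0" "Re (X 0) < 0" and U: "!!u. u >= U ==> Y u = 1" "!!u. u >= U ==> Re (X u) > 0"
 shows "~ untwisted (%u. X u * cnj (Y u))"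
proof
 assume "untwisted (%u. X u * cnj (Y u))"
 then obtain theta T where th: "continuous_on {0..} theta" "theta 0 = 0" "!!u. u >= 0 ==> \<exists>r>0. X u * cnj (Y u) = of_real r * cis (theta u)" "!!u. u >= T ==> \<bar>theta u\<bar> < pi / 2"
  unfolding untwisted_def by (elim exE conjE) (rule that, assumption+, auto)
 have nz: "- (\<i> * X u) ~= 0" "\<i> * Y u ~= 0" if "u >= 0" for u using dn[OF that] up[OF that] by (auto simp: complex_eq_iff)
 define psi where "psi u = Im (Ln (- (\<i> * X u))) - Im (Ln (\<i> * Y u))" for u
 have cpsi: "continuous_on {0..} psi" unfolding psi_def
  by (intro continuous_intros c) (use dn up in \<open>force simp: complex_nonpos_Reals_iff\<close>)+
 have m1: "cis (theta u - psi u) = - 1" if u: "u >= 0" for u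
 proof -
  obtain r where r: "r > 0" "X u * cnj (Y u) = of_real r * cis (theta u)" using th(3)[OF u] by blast
  have "X u * cnj (Y u) = - (- (\<i> * X u) * cnj (\<i> * Y u))" by (simp add: complex_eq_iff)
  also have "\<dots> = - ((of_real (cmod (- (\<i> * X u))) * cis (Im (Ln (- (\<i> * X u))))) * cnj (of_real (cmod (\<i> * Y u)) * cis (Im (Ln (\<i> * Y u)))))"
   using Ln_polar[OF nz(1)[OF u]] Ln_polar[OF nz(2)[OF u]] by simp
  also have "\<dots> = - (of_real (cmod (X u) * cmod (Y u)) * cis (psi u))"
   by (simp add: psi_def cis_divide[symmetric] cis_cnj divide_inverse norm_mult)
  finally have e: "of_real r * cis (theta u) = - (of_real (cmod (X u) * cmod (Y u)) * cis (psi u))" using r(2) by simp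
  have "r = cmod (X u) * cmod (Y u)" using arg_cong[OF e, of cmod] r(1) by (simp add: norm_mult)
  then have "of_real r * (cis (theta u) + cis (psi u)) = 0" using e by (simp add: algebra_simps)
  then have "cis (theta u) = - cis (psi u)" using r(1) by (simp add: eq_neg_iff_add_eq_0)
  then show ?thesis by (simp add: cis_divide[symmetric])
 qed
 have "(%u. (theta u - psi u - pi) / (2 * pi)) constant_on {0..}"
 proof (rule continuous_discrete_range_constant)
  show "continuous_on {0..} (%u. (theta u - psi u - pi) / (2 * pi))" by (intro continuous_intros th cpsi) auto
  have int: "(theta u - psi u - pi) / (2 * pi) \<in> \<int>" if "u \<in> {0..}" for u
  proof -
   have "cos (theta u - psi u - pi) = 1" using m1[of u] that by (simp add: cos_diff complex_eq_iff)
   then obtain n where n: "theta u - psi u - pi = real_of_int n * (2 * pi)"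
    unfolding cos_one_2pi_int by (elim exE) (rule that, simp)
   show ?thesis unfolding n by simp
  qed
  fix u :: real assume u: "u \<in> {0..}"
  show "\<exists>e>0. \<forall>v. v \<in> {0..} & (theta v - psi v - pi) / (2 * pi) ~= (theta u - psi u - pi) / (2 * pi) -->
    e <= norm ((theta v - psi v - pi) / (2 * pi) - (theta u - psi u - pi) / (2 * pi))"
   using Ints_nonzero_abs_ge1[OF Ints_diff[OF int int[OF u]]] by (intro exI[of _ 1]) auto
 qed auto
 then obtain k where k: "!!u. u >= 0 ==> (theta u - psi u - pi) / (2 * pi) = k" unfolding constant_on_def by auto
 have "psi 0 = pi" unfolding psi_def 0(1)[symmetric] using Ln_of_Ln_minus[of "\<i> * X 0"] 0(2) by simp
 then have "k = - 1" using k[of 0] th(2) by (simp add: field_simps)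
 define u where "u = max 0 (max T U)"
 have u: "u >= 0" "u >= T" "u >= U" by (auto simp: u_def)
 have "theta u = psi u - pi" using k[OF u(1)] \<open>k = - 1\<close> by (simp add: field_simps)
 moreover have "Im (Ln (- (\<i> * X u))) <= 0"
 proof -
  have "Im (- (\<i> * X u)) < 0" using U(2)[OF u(3)] by simp
  then show ?thesis using Im_Ln_pos_le[OF nz(1)[OF u(1)]] Im_Ln_le_pi[OF nz(1)[OF u(1)]] by auto
 qed
 moreover have "Im (Ln (\<i> * Y u)) = pi / 2" using U(1)[OF u(3)] by simp
 ultimately show False using th(4)[OF u(2)] pi_gt_zero unfolding psi_def abs_less_iff by linarith
qed

section \<open>The weight of a long knot\<close>

text \<open>The position of \<open>f (b + u)\<close> seen from \<open>f b\<close>, measured against the tangent at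
 \<open>f (b + u)\<close>; \<open>untwisted\<close> says that this angle, started at \<open>0\<close>, returns to \<open>0\<close> at the end of the knot.\<close>

definition turning :: "(real => real^3) => real => real => complex" where
 "turning f b u = (if u = 0 then pz (velocity f b) else (pz (f (b + u)) - pz (f b)) /\<^sub>R u) * cnj (pz (velocity f (b + u)))"

definition cross :: "(real => real^3) => real \<times> real => real" where
 "cross f z = crs (pz (velocity f (fst z))) (pz (velocity f (snd z)))"

definition dot :: "(real => real^3) => real \<times> real => real" where
 "dot f z = pz (velocity f (fst z)) \<bullet> pz (velocity f (snd z))"

text \<open>The quotient of \<open>cross\<close> by \<open>- dot\<close> is the tangent of the angle
  to the antiparallel position. Pairs are ordered and \<open>cross\<close> is nonnegative, so that
  only one of the two crossings born at an ordinary tangency is counted.\<close>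

definition near_anti :: "real => (real => real^3) => (real \<times> real) set" where
 "near_anti eta f = {z. fst z < snd z & pz (f (fst z)) = pz (f (snd z)) & 0 <= cross f z & cross f z <= eta * - dot f z &
  ~ untwisted (turning f (snd z))}"

text \<open>\<open>cross\<close> and \<open>dot\<close> scale alike under reparametrization, so the
  value belongs to the knot. At the threshold angle a term is 0, which lets crossings enter and
  leave the sum continuously.\<close>

definition weight :: "real => (real => real^3) => real" where
 "weight eta f = (\<Sum>z\<in>near_anti eta f. 1 - cross f z / (eta * - dot f z))"

text \<open>The two turning paths agree up to a positive factor and the time change
  \<open>phi (b + u) - phi b\<close>.\<close>

lemma reparam_untwisted1:
 assumes r: "is_reparam phi theta f g" and u: "untwisted (turning g (phi b))"
 shows "untwisted (turning f b)"
proof (rule untwisted_rescale[OF u])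
 have e: "pz (velocity f t) = of_real (velocity phi t) * pz (velocity g (phi t))" for t
  by (simp add: reparam_velocity[OF r] scaleR_conv_of_real[where 'a=complex])
 have cphi: "continuous_on A phi" for A by (rule smooth_continuous[OF reparam_smooth(1)[OF r]])
 show "continuous_on {0..} (%u. phi (b + u) - phi b)" by (intro continuous_intros continuous_on_compose2[OF cphi[of UNIV]]) auto
 show "phi (b + u) - phi b >= 0" if "u >= 0" for u
  using that reparam_less[OF r, of "b + u" b] by (simp add: not_less[symmetric])
 show "\<exists>U. \<forall>u\<ge>U. phi (b + u) - phi b >= T" for T
 proof (intro exI[of _ "theta (T + phi b) - b"] allI impI)
  fix u assume "theta (T + phi b) - b <= u"
  then have "~ phi (b + u) < phi (theta (T + phi b))" unfolding reparam_less[OF r] by simp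
  then show "phi (b + u) - phi b >= T" unfolding reparam_inverse(2)[OF r] by simp
 qed
 show "(if u = 0 then velocity phi b else (phi (b + u) - phi b) / u) * velocity phi (b + u) > 0 &
   turning f b u = of_real ((if u = 0 then velocity phi b else (phi (b + u) - phi b) / u) * velocity phi (b + u)) * turning g (phi b) (phi (b + u) - phi b)"
  if u: "u >= 0" for u
 proof (cases "u = 0")
  case True
  then show ?thesis using reparam_pos[OF r, of b] by (simp add: turning_def e mult_ac)
 next
  case False
  then have p: "phi (b + u) - phi b > 0" using u reparam_less[OF r, of b "b + u"] by simp
  then show ?thesis using False u reparam_pos[OF r, of "b + u"]
   by (simp add: turning_def e reparam_eq[OF r] scaleR_conv_of_real[where 'a=complex] field_simps)
 qed
qed simp

lemma reparam_untwisted: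
 assumes r: "is_reparam phi theta f g"
 shows "untwisted (turning f b) \<longleftrightarrow> untwisted (turning g (phi b))"
 using reparam_untwisted1[OF r] reparam_untwisted1[OF reparam_sym[OF r], of "phi b"] reparam_inverse(1)[OF r] by auto

lemma reparam_cross:
 assumes r: "is_reparam phi theta f g"
 shows "cross f z = velocity phi (fst z) * velocity phi (snd z) * cross g (map_prod phi phi z)"
  "dot f z = velocity phi (fst z) * velocity phi (snd z) * dot g (map_prod phi phi z)"
 by (simp_all add: cross_def dot_def reparam_velocity[OF r])

lemma reparam_near_anti:
 assumes r: "is_reparam phi theta f g"
 shows "z \<in> near_anti eta f \<longleftrightarrow> map_prod phi phi z \<in> near_anti eta g"
proof -
 define v where "v = velocity phi (fst z) * velocity phi (snd z)"
 have v: "v > 0" unfolding v_def by (intro mult_pos_pos reparam_pos[OF r])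
 have c: "cross f z = v * cross g (map_prod phi phi z)" "dot f z = v * dot g (map_prod phi phi z)" unfolding v_def by (rule reparam_cross[OF r])+
 have "v * x <= eta * - (v * y) \<longleftrightarrow> x <= eta * - y" for x y
 proof -
  have "v * x <= eta * - (v * y) \<longleftrightarrow> v * x <= v * (eta * - y)" by (simp add: mult_ac)
  then show ?thesis using v by (simp only: mult_le_cancel_left_pos)
 qed
 moreover have "0 <= v * x \<longleftrightarrow> 0 <= x" for x using v by (simp add: zero_le_mult_iff)
 ultimately show ?thesis
  unfolding near_anti_def mem_Collect_eq c
  by (simp add: reparam_less[OF r] reparam_eq[OF r] reparam_untwisted[OF r] map_prod_def split_beta)
qed

lemma reparam_weight:
 assumes r: "is_reparam phi theta f g"
 shows "weight eta f = weight eta g"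
 unfolding weight_def
proof (rule sum.reindex_bij_witness[of _ "map_prod theta theta" "map_prod phi phi"])
 fix z
 have i: "map_prod theta theta (map_prod phi phi z) = z" "map_prod phi phi (map_prod theta theta z) = z" by (cases z, simp add: reparam_inverse[OF r])+
 then show "map_prod theta theta (map_prod phi phi z) = z" "map_prod phi phi (map_prod theta theta z) = z" by simp_all
 show "map_prod phi phi z \<in> near_anti eta g" if "z \<in> near_anti eta f" using that reparam_near_anti[OF r] by blast
 show "map_prod theta theta z \<in> near_anti eta f" if "z \<in> near_anti eta g" using that unfolding reparam_near_anti[OF r] i .
 define v where "v = velocity phi (fst z) * velocity phi (snd z)"
 have v: "v > 0" unfolding v_def by (intro mult_pos_pos reparam_pos[OF r])
 show "1 - cross g (map_prod phi phi z) / (eta * - dot g (map_prod phi phi z)) = 1 - cross f z / (eta * - dot f z)"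
  unfolding reparam_cross[OF r] v_def[symmetric] using v by simp
qed

section \<open>The weight varies continuously modulo integers\<close>

text \<open>A principle for sums over the fibres of a compact set: if near each point of the fibre
  over \<open>s0\<close> the local sum is stable modulo \<open>M\<close>, then so is the total. It
  will be applied with the integers for \<open>M\<close>, and with \<open>{0}\<close> where no
  tangency is counted.\<close>

lemma local_sums:
 fixes K :: "('a::metric_space \<times> 'b::metric_space) set" and phi :: "'a => 'b => real" and M :: "real set"
 assumes K: "compact K" and M: "0 \<in> M" "!!m n. m \<in> M ==> n \<in> M ==> m + n \<in> M" and s0: "s0 \<in> S"
  and loc: "!!y eps. (s0, y) \<in> K ==> eps > 0 ==> \<exists>r0>0. \<forall>r. 0 < r & r < r0 --> (\<exists>delta>0. \<forall>s\<in>S. dist s s0 < delta -->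
   finite {z \<in> ball y r. (s, z) \<in> K} & (\<exists>m\<in>M. abs ((\<Sum>z | z \<in> ball y r & (s, z) \<in> K. phi s z) - phi s0 y - m) < eps))"
  and e: "eps > 0"
 shows "\<exists>delta>0. \<forall>s\<in>S. dist s s0 < delta --> (\<exists>m\<in>M. abs ((\<Sum>z | (s, z) \<in> K. phi s z) - (\<Sum>z | (s0, z) \<in> K. phi s0 z) - m) < eps)"
proof -
 let ?K = "%s. {z. (s, z) \<in> K}"
 have finK: "finite (?K s0)"
 proof -
  have "compact (snd ` (K \<inter> (%z. fst z) -` {s0}))"
   by (intro compact_continuous_image continuous_intros compact_Int_closed[OF K] continuous_closed_vimage)
  also have "snd ` (K \<inter> (%z. fst z) -` {s0}) = ?K s0" by force
  finally have cK: "compact (?K s0)" .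
  have ex: "\<exists>r>0. finite {z \<in> ball y r. (s0, z) \<in> K}" if y: "(s0, y) \<in> K" for y
  proof -
   from loc[OF y zero_less_one] obtain r0 where r0: "r0 > 0" and l: "\<forall>r. 0 < r & r < r0 --> (\<exists>delta>0. \<forall>s\<in>S. dist s s0 < delta -->
    finite {z \<in> ball y r. (s, z) \<in> K} & (\<exists>m\<in>M. abs ((\<Sum>z | z \<in> ball y r & (s, z) \<in> K. phi s z) - phi s0 y - m) < 1))"
    by (elim exE conjE) (rule that, assumption+)
   have "0 < r0 / 2 & r0 / 2 < r0" using r0 by simp
   with l obtain delta where "delta > 0" "\<forall>s\<in>S. dist s s0 < delta --> finite {z \<in> ball y (r0 / 2). (s, z) \<in> K}" by blast
   then have "finite {z \<in> ball y (r0 / 2). (s0, z) \<in> K}" using s0 by simp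
   then show ?thesis using r0 by (intro exI[of _ "r0 / 2"]) simp
  qed
  have "\<forall>y\<in>?K s0. \<exists>r>0. finite {z \<in> ball y r. (s0, z) \<in> K}" using ex by simp
  from bchoice[OF this] obtain r where r: "\<forall>y\<in>?K s0. r y > 0 & finite {z \<in> ball y (r y). (s0, z) \<in> K}" by (elim exE)
  have cov: "?K s0 \<subseteq> (\<Union>y\<in>?K s0. ball y (r y))" using r by force
  obtain T where T: "T \<subseteq> ?K s0" "finite T" "?K s0 \<subseteq> (\<Union>y\<in>T. ball y (r y))"
   by (rule compactE_image[OF cK _ cov]) auto
  have "?K s0 \<subseteq> (\<Union>y\<in>T. {z \<in> ball y (r y). (s0, z) \<in> K})" using T(3) by blast
  moreover have "finite (\<Union>y\<in>T. {z \<in> ball y (r y). (s0, z) \<in> K})"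
   by (rule finite_UN_I[OF T(2)]) (use T(1) r in blast)
  ultimately show ?thesis by (rule finite_subset)
 qed
 \<comment> \<open>One more than the number of points, so that local errors below
   \<open>eps / N\<close> add up to less than \<open>eps\<close>, also for an empty fibre.\<close>
 define N where "N = real (Suc (card (?K s0)))"
 have N: "N > 0" "real (card (?K s0)) < N" by (simp_all add: N_def)
 define Q where "Q s y r m \<longleftrightarrow> finite {z \<in> ball y r. (s, z) \<in> K} &
  abs ((\<Sum>z | z \<in> ball y r & (s, z) \<in> K. phi s z) - phi s0 y - m) < eps / N" for s y r m
 have "\<forall>y\<in>?K s0. \<exists>r0. r0 > 0 & (\<forall>r. 0 < r & r < r0 --> (\<exists>delta>0. \<forall>s\<in>S. dist s s0 < delta --> (\<exists>m\<in>M. Q s y r m)))"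
  using loc[of _ "eps / N"] e N unfolding Q_def by simp
 from bchoice[OF this] obtain r0 where r0: "\<forall>y\<in>?K s0. r0 y > 0 & (\<forall>r. 0 < r & r < r0 y --> (\<exists>delta>0. \<forall>s\<in>S. dist s s0 < delta --> (\<exists>m\<in>M. Q s y r m)))"
  by (elim exE)
 \<comment> \<open>Half distances make the balls disjoint, the radii \<open>r0\<close> make the
   local estimates valid, and the element 1 keeps the set nonempty.\<close>
 define D where "D = (%p. dist (fst p) (snd p) / 2) ` (?K s0 \<times> ?K s0 \<inter> {p. fst p ~= snd p}) \<union> r0 ` ?K s0 \<union> {1}"
 have finD: "finite D" unfolding D_def using finK by simp
 define r where "r = Min D / 2"
 have "\<forall>x\<in>D. x > 0" unfolding D_def using r0 by auto
 then have mD: "Min D > 0" using finD by (subst Min_gr_iff) (auto simp: D_def)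
 then have r: "r > 0" "!!x. x \<in> D ==> r < x" unfolding r_def using Min_le[OF finD] by (simp, force)
 have disj: "ball x r \<inter> ball y r = {}" if "x \<in> ?K s0" "y \<in> ?K s0" "x ~= y" for x y
 proof -
  have "dist x y / 2 \<in> D" unfolding D_def
   by (rule UnI1, rule UnI1, rule image_eqI[of _ _ "(x, y)"]) (use that in auto)
  then have "r < dist x y / 2" by (rule r(2))
  then show ?thesis by (intro disjoint_ballI) simp
 qed
 have "\<forall>y\<in>?K s0. \<exists>delta. delta > 0 & (\<forall>s\<in>S. dist s s0 < delta --> (\<exists>m\<in>M. Q s y r m))"
 proof
  fix y assume y: "y \<in> ?K s0"
  have "r < r0 y" by (rule r(2)) (use y in \<open>auto simp: D_def\<close>)
  then show "\<exists>delta. delta > 0 & (\<forall>s\<in>S. dist s s0 < delta --> (\<exists>m\<in>M. Q s y r m))"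
   using bspec[OF r0 y] r(1) by blast
 qed
 from bchoice[OF this] obtain delta where d: "\<forall>y\<in>?K s0. delta y > 0 & (\<forall>s\<in>S. dist s s0 < delta y --> (\<exists>m\<in>M. Q s y r m))"
  by (elim exE)
 have "\<forall>z. (s0, z) \<in> K --> (s0, z) \<in> UNIV \<times> (\<Union>y\<in>?K s0. ball y r)" using r(1) by auto
 then obtain d1 where d1: "d1 > 0" "!!s z. (s, z) \<in> K ==> dist s s0 < d1 ==> (s, z) \<in> UNIV \<times> (\<Union>y\<in>?K s0. ball y r)"
  using compact_tube_ex[OF K, of "UNIV \<times> (\<Union>y\<in>?K s0. ball y r)" s0] open_Times[OF open_UNIV open_UN[of "?K s0" "%y. ball y r"]]
  by auto
 define d0 where "d0 = Min (insert d1 (delta ` ?K s0))"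
 have d0: "d0 > 0" "d0 <= d1" "!!y. y \<in> ?K s0 ==> d0 <= delta y"
  unfolding d0_def using finK d d1(1) by (auto simp: Min_gr_iff)
 show ?thesis
 proof (intro exI[of _ d0] conjI ballI impI)
  fix s assume s: "s \<in> S" "dist s s0 < d0"
  have near: "dist s s0 < delta y" if "y \<in> ?K s0" for y using s(2) d0(3)[OF that] by linarith
  then have "\<forall>y\<in>?K s0. \<exists>m. m \<in> M & Q s y r m" using d s(1) by blast
  from bchoice[OF this] obtain m where mm: "\<forall>y\<in>?K s0. m y \<in> M & Q s y r (m y)" by (elim exE)
  have F: "!!y. y \<in> ?K s0 ==> finite {z \<in> ball y r. (s, z) \<in> K}" and m: "!!y. y \<in> ?K s0 ==> m y \<in> M"
   "!!y. y \<in> ?K s0 ==> \<bar>(\<Sum>z | z \<in> ball y r & (s, z) \<in> K. phi s z) - phi s0 y - m y\<bar> < eps / N"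
   using mm unfolding Q_def by blast+
  have "dist s s0 < d1" using s(2) d0(2) by linarith
  then have un: "?K s = (\<Union>y\<in>?K s0. {z \<in> ball y r. (s, z) \<in> K})" using d1(2) by blast
  have "(\<Sum>z\<in>?K s. phi s z) = (\<Sum>y\<in>?K s0. \<Sum>z | z \<in> ball y r & (s, z) \<in> K. phi s z)"
   unfolding un by (rule sum.UNION_disjoint[OF finK]) (use F disj in blast)+
  then have "(\<Sum>z\<in>?K s. phi s z) - (\<Sum>z\<in>?K s0. phi s0 z) - (\<Sum>y\<in>?K s0. m y) =
    (\<Sum>y\<in>?K s0. (\<Sum>z | z \<in> ball y r & (s, z) \<in> K. phi s z) - phi s0 y - m y)" by (simp add: sum_subtractf)
  also have "abs (\<dots>) <= (\<Sum>y\<in>?K s0. eps / N)"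
   by (rule order_trans[OF sum_abs sum_mono]) (use m(2) less_imp_le in blast)
  also have "\<dots> < eps" using N e by (simp add: field_simps)
  finally have "abs ((\<Sum>z\<in>?K s. phi s z) - (\<Sum>z\<in>?K s0. phi s0 z) - (\<Sum>y\<in>?K s0. m y)) < eps" .
  moreover have "(\<Sum>y\<in>?K s0. m y) \<in> M"
   using finK m(1) by (induction rule: finite_induct) (auto intro: M)
  ultimately show "\<exists>m\<in>M. abs ((\<Sum>z\<in>?K s. phi s z) - (\<Sum>z\<in>?K s0. phi s0 z) - m) < eps" by blast
 qed (rule d0)
qed

context knot_family
begin

text \<open>Openness at a transversal double point of the map taking \<open>(s, a, b)\<close> to
  \<open>(s, P s a - P s b)\<close>; keeping \<open>s\<close> as a component makes every nearby
  parameter a first component of a zero.\<close>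

lemma crossing_persists:
 assumes cr: "crs (P1 s0 a0) (P1 s0 b0) ~= 0" and P: "P s0 a0 = P s0 b0" and r: "r > 0"
 obtains delta where "delta > 0" "!!s. dist s s0 < delta ==> \<exists>a b. abs (a - a0) < r & abs (b - b0) < r & P s a = P s b"
proof -
 define g where "g z = (fst z, P (fst z) (fst (snd z)) - P (fst z) (snd (snd z)))" for z :: "'a \<times> real \<times> real"
 define DF where "DF t h = pz (frechet_derivative F (at (s0, t)) (h, 0))" for t h
 define L where "L u = (fst u, (DF a0 (fst u) + fst (snd u) *\<^sub>R P1 s0 a0) - (DF b0 (fst u) + snd (snd u) *\<^sub>R P1 s0 b0))" for u :: "'a \<times> real \<times> real"
 have Q: "((%z. P (fst z) (q z)) has_derivative (%u. DF t (fst u) + q u *\<^sub>R P1 s0 t)) (at (s0, a0, b0))"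
  if q: "(q has_derivative q) (at (s0, a0, b0))" "q (s0, a0, b0) = t" for q :: "'a \<times> real \<times> real => real" and t
 proof -
  have "((%z. (fst z, q z)) has_derivative (%u. (fst u, q u))) (at (s0, a0, b0))"
   by (intro has_derivative_Pair has_derivative_fst has_derivative_ident q)
  from has_derivative_compose[OF this] smooth_has_derivative[OF smF, of "(s0, t)"] q(2)
  have "((%z. F (fst z, q z)) has_derivative (%u. frechet_derivative F (at (s0, t)) (fst u, q u))) (at (s0, a0, b0))"
   by simp
  from bounded_linear.has_derivative[OF bounded_linear_pz this]
  have "((%z. pz (F (fst z, q z))) has_derivative (%u. DF t (fst u) + q u *\<^sub>R P1 s0 t)) (at (s0, a0, b0))"
   by (rule has_derivative_eq_rhs) (rule ext, subst frechet_split[OF smF], simp add: DF_def P1_def)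
  then show ?thesis by (simp only: P_def)
 qed
 have der: "(g has_derivative L) (at (s0, a0, b0))"
  unfolding g_def[abs_def] L_def[abs_def]
  by (intro has_derivative_Pair has_derivative_diff Q has_derivative_fst has_derivative_snd has_derivative_ident) simp_all
 have cont: "continuous_on UNIV g" unfolding g_def[abs_def] by (intro continuous_intros P_cont)
 have surj: "surj L" unfolding surj_def
 proof
  fix y :: "'a \<times> complex"
  obtain h w where y: "y = (h, w)" by (cases y)
  define v c where "v = w - DF a0 h + DF b0 h" and "c = crs (P1 s0 a0) (P1 s0 b0)"
  have "c *\<^sub>R v = crs v (P1 s0 b0) *\<^sub>R P1 s0 a0 - crs v (P1 s0 a0) *\<^sub>R P1 s0 b0"
   unfolding c_def by (simp add: complex_eq_iff crs_def algebra_simps)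
  then have "(1 / c) *\<^sub>R (c *\<^sub>R v) = (1 / c) *\<^sub>R (crs v (P1 s0 b0) *\<^sub>R P1 s0 a0 - crs v (P1 s0 a0) *\<^sub>R P1 s0 b0)" by (simp only:)
  then have v: "v = (crs v (P1 s0 b0) / c) *\<^sub>R P1 s0 a0 - (crs v (P1 s0 a0) / c) *\<^sub>R P1 s0 b0"
   using cr by (simp add: c_def scaleR_diff_right)
  have w: "w = v + DF a0 h - DF b0 h" by (simp add: v_def)
  have "y = L (h, crs v (P1 s0 b0) / c, crs v (P1 s0 a0) / c)"
   unfolding y L_def by (subst w, subst v) (simp add: algebra_simps)
  then show "\<exists>x. y = L x" ..
 qed
 have bl: "bounded_linear L" by (rule has_derivative_bounded_linear[OF der])
 obtain k where k: "linear k" "L \<circ> k = id"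
  using linear_surjective_right_inverse[OF bounded_linear.linear[OF bl] surj] by blast
 have blk: "bounded_linear k" using k(1) by (simp add: linear_conv_bounded_linear)
 let ?T = "UNIV \<times> ball a0 r \<times> ball b0 r :: ('a \<times> real \<times> real) set"
 have inT: "(s0, a0, b0) \<in> interior ?T"
  unfolding interior_open[OF open_Times[OF open_UNIV open_Times[OF open_ball open_ball]]] using r by simp
 have "g (s0, a0, b0) \<in> interior (g ` ?T)"
  by (rule sussmann_open_mapping[OF open_UNIV cont UNIV_I der blk k(2) subset_UNIV inT])
 moreover have "g (s0, a0, b0) = (s0, 0)" by (simp add: g_def P)
 ultimately obtain e where e: "e > 0" "ball (s0, 0) e \<subseteq> g ` ?T" unfolding mem_interior by auto
 show ?thesis
 proof (rule that[OF e(1)])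
  fix s assume "dist s s0 < e"
  then have "(s, 0) \<in> ball (s0, 0::complex) e" by (simp add: dist_Pair_Pair dist_commute)
  then have "(s, 0) \<in> g ` ?T" by (rule subsetD[OF e(2)])
  then obtain z where z: "(s, 0) = g z" "z \<in> ?T" by (elim imageE) (rule that, assumption+)
  obtain s' a b where zz: "z = (s', a, b)" by (cases z)
  have "s' = s" "P s a = P s b" using z(1) unfolding zz g_def by simp_all
  moreover have "abs (a - a0) < r" "abs (b - b0) < r" using z(2) unfolding zz by (simp_all add: dist_real_def abs_minus_commute)
  ultimately show "\<exists>a b. abs (a - a0) < r & abs (b - b0) < r & P s a = P s b" by blast
 qed
qed

definition "tw s b u = slope s b (b + u) * cnj (P1 s (b + u))"

lemma turning_family: "turning (slice F s) b u = tw s b u"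
proof (cases "u = 0")
 case False
 have "P s (b + u) - P s b = u *\<^sub>R slope s b (b + u)" using slope_eq[of s "b + u" b] by simp
 then have "(P s (b + u) - P s b) /\<^sub>R u = slope s b (b + u)" using False by simp
 then show ?thesis using False by (simp add: turning_def tw_def P_velocity P_def)
qed (simp add: turning_def tw_def P_velocity slope_diag)

lemma tw_cont:
 assumes "continuous_on A f" "continuous_on A g" "continuous_on A h"
 shows "continuous_on A (%x. tw (f x) (g x) (h x))"
 unfolding tw_def by (intro continuous_intros slope_cont P_cont assms)

lemma P1_outside:
 assumes s: "s \<in> S" and t: "t > R"
 shows "P1 s t = 1"
proof -
 have "(of_real has_vector_derivative 1) (at t)" 
  using bounded_linear.has_vector_derivative[OF bounded_linear_of_real has_vector_derivative_id, of "at t"] by simp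
 then have "(P s has_vector_derivative 1) (at t)"
  by (rule has_vector_derivative_transform_within_open[of _ _ _ "{R<..}"]) (use t R_pos P_outside[OF s] in auto)
 then show ?thesis using P_deriv(1)[of s t] vector_derivative_unique_at by blast
qed

text \<open>If the point at \<open>b0\<close> is not met again later, its turning path never
  vanishes and a nearby path stays within a right angle of it. For bounded \<open>u\<close> this is
  compactness; beyond \<open>U\<close> the curve is the x-axis and both paths are explicit, so the
  comparison is uniform.\<close>

lemma untwisted_locally:
 assumes s0: "s0 \<in> S" and later: "!!t. t > b0 ==> P s0 t ~= P s0 b0"
 obtains delta where "delta > 0" "!!s b. s \<in> S ==> dist (s, b) (s0, b0) < delta ==> untwisted (tw s b) \<longleftrightarrow> untwisted (tw s0 b0)"
proof -
 \<comment> \<open>From here on \<open>b + u\<close> lies on the standard end for all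
   \<open>b\<close> within 1 of \<open>b0\<close>, and the chord from \<open>b0\<close> has real
   part at least 1; a change \<open>\<Delta>\<close> below 1/2 cannot turn it by a right
   angle.\<close>
 define U where "U = R + abs b0 + cmod (P s0 b0) + 2"
 have U: "U > 0" using R_pos norm_ge_zero[of "P s0 b0"] unfolding U_def by linarith
 have nz: "tw s0 b0 u ~= 0" if "u >= 0" for u
  using slope_zero_iff[OF s0, of b0 "b0 + u"] later[of "b0 + u"] P1_nonzero[OF s0] that by (force simp: tw_def)
 have "isCont (%z. of_real (snd z) - P (fst z) (snd z)) (s0, b0)"
  by (rule continuous_on_interior[of UNIV]) (auto intro!: continuous_intros P_cont)
 then obtain d1 where d1: "d1 > 0" "!!z. dist z (s0, b0) < d1 ==> dist (of_real (snd z) - P (fst z) (snd z)) (of_real b0 - P s0 b0) < 1/2"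
  unfolding continuous_at_eps_delta by (metis (no_types, lifting) fst_conv snd_conv half_gt_zero zero_less_one)
 let ?K = "((S \<times> cball b0 1) \<times> {0..U}) \<inter> {z. Re (cnj (tw s0 b0 (snd z)) * tw (fst (fst z)) (snd (fst z)) (snd z)) <= 0}"
 have cK: "compact ?K"
  by (intro compact_Int_closed compact_Times compS closed_Collect_le continuous_intros tw_cont) auto
 have "\<forall>u. ((s0, b0), u) \<notin> ?K"
 proof (intro allI notI)
  fix u assume u: "((s0, b0), u) \<in> ?K"
  then have "Re (cnj (tw s0 b0 u) * tw s0 b0 u) <= 0" "u >= 0" by auto
  moreover have "Re (cnj (tw s0 b0 u) * tw s0 b0 u) = (cmod (tw s0 b0 u))\<^sup>2"
   unfolding cmod_power2 by (simp add: power2_eq_square)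
  ultimately show False using nz[of u] by simp
 qed
 from compact_tube_empty[OF cK this]
 obtain d2 where d2: "d2 > 0" "\<forall>z u. dist z (s0, b0) < d2 --> (z, u) \<notin> ?K"
  by (elim exE conjE) (rule that, assumption+)
 have far: "tw s b u = (of_real (b + u) - P s b) /\<^sub>R u" if s: "s \<in> S" and u: "u >= U" "abs (b - b0) < 1" for s b u
 proof -
  have "b + u > R" using u norm_ge_zero[of "P s0 b0"] unfolding U_def by linarith
  then have "P1 s (b + u) = 1" "P s (b + u) = of_real (b + u)" using P1_outside[OF s] P_outside[OF s, of "b + u"] R_pos by auto
  moreover have "slope s b (b + u) = (P s (b + u) - P s b) /\<^sub>R u" using slope_eq[of s "b + u" b] u(1) U by simp
  ultimately show ?thesis by (simp add: tw_def)
 qed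
 have re1: "Re (of_real (b0 + u) - P s0 b0) >= 1" if "u >= U" for u
  using that abs_Re_le_cmod[of "P s0 b0"] R_pos unfolding U_def by simp
 show ?thesis
 proof (rule that[of "min 1 (min d1 d2)"])
  show "min 1 (min d1 d2) > 0" using d1 d2 by simp
  fix s b assume s: "s \<in> S" and ds: "dist (s, b) (s0, b0) < min 1 (min d1 d2)"
  have b1: "abs (b - b0) < 1" using dist_snd_le[of "(s, b)" "(s0, b0)"] ds by (simp add: dist_real_def)
  define \<Delta> where "\<Delta> = (of_real b - P s b) - (of_real b0 - P s0 b0)"
  have D: "cmod \<Delta> < 1/2" using d1(2)[of "(s, b)"] ds by (simp add: \<Delta>_def dist_norm)
  have farA: "tw s0 b0 u = (of_real (b0 + u) - P s0 b0) /\<^sub>R u" if "u >= U" for u using far[OF s0 that, of b0] by simp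
  have farB: "tw s b u = ((of_real (b0 + u) - P s0 b0) + \<Delta>) /\<^sub>R u" if "u >= U" for u
   using far[OF s that b1] by (simp add: \<Delta>_def)
  have pos: "Re (cnj (tw s0 b0 u) * tw s b u) > 0" if u: "u >= 0" for u
  proof (cases "u <= U")
   case True
   have "((s, b), u) \<notin> ?K" using d2(2) ds by simp
   then show ?thesis using s b1 u True by (simp add: dist_real_def abs_minus_commute)
  next
   case False
   then have uU: "u >= U" by simp
   let ?z = "of_real (b0 + u) - P s0 b0"
   have z: "cmod ?z >= 1" using re1[OF uU] complex_Re_le_cmod[of ?z] by linarith
   have "abs (Re (cnj ?z * \<Delta>)) <= cmod ?z * cmod \<Delta>" using abs_Re_le_cmod[of "cnj ?z * \<Delta>"] by (simp only: norm_mult complex_mod_cnj)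
   also have "\<dots> <= cmod ?z * (1/2)" using D by (intro mult_left_mono) auto
   also have "\<dots> < cmod ?z * cmod ?z" using z by (intro mult_strict_left_mono) auto
   also have "\<dots> = Re (cnj ?z * ?z)" unfolding power2_eq_square[symmetric] cmod_power2 by (simp add: power2_eq_square)
   finally have "Re (cnj ?z * (?z + \<Delta>)) > 0" unfolding distrib_left plus_complex.sel by linarith
   moreover have "Re (cnj (?z /\<^sub>R u) * ((?z + \<Delta>) /\<^sub>R u)) = Re (cnj ?z * (?z + \<Delta>)) * (inverse u * inverse u)"
    by (simp add: algebra_simps)
   ultimately show ?thesis unfolding farA[OF uU] farB[OF uU] using False U by simp
  qed
  then have pos': "Re (cnj (tw s b u) * tw s0 b0 u) > 0" if "u >= 0" for u using pos[OF that] by (simp add: mult.commute)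
  have im0: "Im (tw s b 0) = 0" for s b by (simp add: tw_def slope_diag)
  have endA: "Re (tw s0 b0 u) > 0" if "u >= U" for u
   unfolding farA[OF that] using re1[OF that] that U by simp
  have endB: "Re (tw s b u) > 0" if "u >= U" for u
  proof -
   have "Re \<Delta> > - 1/2" using D abs_Re_le_cmod[of \<Delta>] by linarith
   then show ?thesis unfolding farB[OF that] using re1[OF that] that U by (simp add: zero_less_mult_iff)
  qed
  have c: "continuous_on {0..} (tw s b)" for s b by (intro tw_cont continuous_intros)
  show "untwisted (tw s b) \<longleftrightarrow> untwisted (tw s0 b0)"
   using untwisted_perturb[OF _ c c pos im0 endB] untwisted_perturb[OF _ c c pos' im0 endA] by blast
 qed
qed

end

section \<open>Lifting a circle-valued function over the disc\<close>

lemma connected_punctured_circle: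
 assumes "cmod z0 = 1"
 shows "connected (sphere (0::complex) 1 - {z0})"
proof -
 define \<alpha> where "\<alpha> = Arg z0"
 have z0: "z0 = cis \<alpha>" unfolding \<alpha>_def using cis_Arg[of z0] assms by (cases "z0 = 0") (auto simp: sgn_div_norm)
 have "sphere 0 1 - {z0} = cis ` {\<alpha><..<\<alpha> + 2 * pi}"
 proof (intro subset_antisym subsetI)
  fix z assume z: "z \<in> sphere 0 1 - {z0}"
  define w \<beta> where "w = z * cis (- \<alpha>)" and "\<beta> = Arg2pi w"
  have "cmod w = 1" using z by (simp add: w_def norm_mult)
  then have w: "w = cis \<beta>" using Arg2pi_eq[of w] unfolding \<beta>_def cis_conv_exp by simp
  have zz: "z = cis (\<alpha> + \<beta>)" using arg_cong[OF w, of "%x. x * cis \<alpha>"] by (simp add: w_def cis_mult mult.assoc add.commute)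
  have "\<beta> ~= 0" using z zz z0 by auto
  moreover have "0 <= \<beta>" "\<beta> < 2 * pi" unfolding \<beta>_def by (rule Arg2pi_ge_0 Arg2pi_lt_2pi)+
  ultimately show "z \<in> cis ` {\<alpha><..<\<alpha> + 2 * pi}" unfolding zz by auto
 next
  fix z assume "z \<in> cis ` {\<alpha><..<\<alpha> + 2 * pi}"
  then obtain t where t: "z = cis t" "\<alpha> < t" "t < \<alpha> + 2 * pi" by auto
  have "z ~= z0"
  proof
   assume "z = z0"
   then have "cis (t - \<alpha>) = 1" unfolding t(1) z0 by (simp add: cis_divide[symmetric])
   then have "cos (t - \<alpha>) = 1" by (simp add: complex_eq_iff)
   then obtain n :: int where n: "t - \<alpha> = real_of_int n * 2 * pi" unfolding cos_one_2pi_int ..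
   have "0 < real_of_int n * (2 * pi)" "real_of_int n * (2 * pi) < 1 * (2 * pi)" using t(2,3) n unfolding mult.assoc by linarith+
   then have "0 < n" "n < 1" by (simp_all add: zero_less_mult_iff)
   then show False by linarith
  qed
  then show "z \<in> sphere 0 1 - {z0}" by (simp add: t(1))
 qed
 moreover have "connected (cis ` {\<alpha><..<\<alpha> + 2 * pi})"
  by (intro connected_continuous_image continuous_intros) auto
 ultimately show ?thesis by simp
qed

text \<open>On the disc the circle-valued function has a continuous logarithm, so \<open>W\<close>
  agrees modulo integers with a continuous \<open>g\<close>. On the connected punctured circle the
  integer \<open>g - W\<close> is constant, and continuity of \<open>g\<close> at \<open>z0\<close>
  makes all limits of \<open>W\<close> at \<open>z0\<close> equal.\<close>

lemma circle_jump:
 fixes W :: "complex => real"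
 assumes c: "continuous_on (cball 0 1) (%s. cis (2 * pi * W s))" and z0: "cmod z0 = 1"
  and W: "continuous_on (sphere 0 1 - {z0}) W"
  and x: "!!n. x n \<in> sphere 0 1 - {z0}" "x \<longlonglongrightarrow> z0" "(%n. W (x n)) \<longlonglongrightarrow> p"
  and y: "!!n. y n \<in> sphere 0 1 - {z0}" "y \<longlonglongrightarrow> z0" "(%n. W (y n)) \<longlonglongrightarrow> q"
 shows "p = q"
proof -
 obtain h where h: "continuous_on (cball 0 1) h" "!!s. s \<in> cball 0 1 ==> cis (2 * pi * W s) = exp (h s)"
  using continuous_logarithm_on_cball[OF c] by (metis cis_neq_zero)
 define g where "g s = Im (h s) / (2 * pi)" for s
 have cg: "continuous_on (cball 0 1) g" unfolding g_def by (intro continuous_intros h(1)) auto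
 have int: "g s - W s \<in> \<int>" if "s \<in> cball 0 1" for s
 proof -
  have "cmod (exp (h s)) = 1" using h(2)[OF that] by (metis norm_cis)
  then have "exp (Re (h s)) = 1" unfolding norm_exp_eq_Re .
  then have "exp (h s) = cis (Im (h s))" using exp_eq_polar[of "h s"] by (simp only: of_real_1 mult_1)
  then have "cis (Im (h s) - 2 * pi * W s) = 1" using h(2)[OF that] by (simp add: cis_divide[symmetric])
  then have "cos (Im (h s) - 2 * pi * W s) = 1" by (simp add: complex_eq_iff)
  then obtain n :: int where n: "Im (h s) - 2 * pi * W s = real_of_int n * 2 * pi" unfolding cos_one_2pi_int ..
  have "g s - W s = (Im (h s) - 2 * pi * W s) / (2 * pi)" by (simp add: g_def field_simps)
  then show ?thesis unfolding n by simp
 qed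
 have sub: "sphere 0 1 - {z0} \<subseteq> cball 0 1" by auto
 have "(%s. g s - W s) constant_on (sphere 0 1 - {z0})"
 proof (rule continuous_discrete_range_constant[OF connected_punctured_circle[OF z0]])
  show "continuous_on (sphere 0 1 - {z0}) (%s. g s - W s)"
   by (intro continuous_intros W continuous_on_subset[OF cg sub])
  fix u assume u: "u \<in> sphere 0 1 - {z0}"
  show "\<exists>e>0. \<forall>v. v \<in> sphere 0 1 - {z0} & g v - W v ~= g u - W u --> e <= norm (g v - W v - (g u - W u))"
  proof (intro exI[of _ 1] conjI allI impI)
   fix v assume v: "v \<in> sphere 0 1 - {z0} & g v - W v ~= g u - W u"
   have i: "g v - W v - (g u - W u) \<in> \<int>" by (intro Ints_diff int subsetD[OF sub]) (use u v in auto)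
   then show "1 <= norm (g v - W v - (g u - W u))" using v Ints_nonzero_abs_ge1[OF i] by simp
  qed simp
 qed
 then obtain k where k: "!!s. s \<in> sphere 0 1 - {z0} ==> g s - W s = k" unfolding constant_on_def by blast
 have lim: "g z0 = k + r" if v: "!!n. v n \<in> sphere 0 1 - {z0}" "v \<longlonglongrightarrow> z0" "(%n. W (v n)) \<longlonglongrightarrow> r" for v r
 proof (rule LIMSEQ_unique)
  show "(%n. g (v n)) \<longlonglongrightarrow> g z0"
   by (rule continuous_on_tendsto_compose[OF cg v(2)]) (use z0 v(1) in auto)
  have "g (v n) = k + W (v n)" for n using k[OF v(1)[of n]] by simp
  then show "(%n. g (v n)) \<longlonglongrightarrow> k + r" using tendsto_add[OF tendsto_const v(3)] by simp
 qed
 show ?thesis using lim[OF x] lim[OF y] by simp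
qed

lemma dist_snd_Pair_le: "dist (s, snd z) (s0, snd z0) <= dist (s, z) (s0, z0)"
 unfolding dist_Pair_Pair by (intro real_sqrt_le_mono add_left_mono power_mono dist_snd_le) simp

section \<open>The weight over a generic family\<close>

context generic_family
begin

definition "cs s z = crs (P1 s (fst z)) (P1 s (snd z))"
definition "dt s z = P1 s (fst z) \<bullet> P1 s (snd z)"

context
 fixes eta :: real
 assumes eta: "eta > 0" and gap: "!!s a b c. s \<in> S ==> a ~= b ==> P s a = P s b ==> 0 <= crs (P1 s a) (P1 s b) ==>
  crs (P1 s a) (P1 s b) <= eta * - (P1 s a \<bullet> P1 s b) ==> P s c = P s a ==> c = a | c = b"
begin

text \<open>The turning condition is split off from \<open>K0\<close>: the rest is visibly compact,
  and only near points of \<open>K0\<close> is the turning known to be locally constant.\<close>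

definition "K0 = {(s, z). s \<in> S & fst z < snd z & P s (fst z) = P s (snd z) & 0 <= cs s z & cs s z <= eta * - dt s z}"
definition "K = {(s, z). (s, z) \<in> K0 & ~ untwisted (tw s (snd z))}"
definition "phi s z = 1 - cs s z / (eta * - dt s z)"

lemma cross_family: "cross (slice F s) z = cs s z" "dot (slice F s) z = dt s z"
 by (simp_all add: cross_def dot_def cs_def dt_def P_velocity)

lemma near_anti_K: "s \<in> S ==> z \<in> near_anti eta (slice F s) \<longleftrightarrow> (s, z) \<in> K"
proof -
 have "turning (slice F s) b = tw s b" for b by (rule ext) (rule turning_family)
 then show "s \<in> S ==> z \<in> near_anti eta (slice F s) \<longleftrightarrow> (s, z) \<in> K"
  by (simp add: near_anti_def K_def K0_def cross_family P_def)
qed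

lemma weight_K: "s \<in> S ==> weight eta (slice F s) = (\<Sum>z | (s, z) \<in> K. phi s z)"
 unfolding weight_def cross_family phi_def[symmetric] using near_anti_K by (intro sum.cong) auto

lemma K0D:
 assumes "(s, z) \<in> K0"
 shows "s \<in> S" "fst z < snd z" "P s (fst z) = P s (snd z)" "cs s z >= 0" "cs s z <= eta * - dt s z" "dt s z < 0"
proof -
 show a: "s \<in> S" "fst z < snd z" "P s (fst z) = P s (snd z)" "cs s z >= 0" "cs s z <= eta * - dt s z"
  using assms unfolding K0_def by auto
 have le: "dt s z <= 0" using a(4,5) eta by (smt (verit) mult_minus_right mult_pos_pos)
 have "dt s z ~= 0"
 proof
  assume d0: "dt s z = 0"
  then have "crs (P1 s (fst z)) (P1 s (snd z)) = 0" using a(4,5) by (simp add: cs_def)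
  then obtain k where "P1 s (fst z) = k *\<^sub>R P1 s (snd z)" using crs_eq_0D[OF _ P1_nonzero[OF a(1)]] by blast
  then show False using d0 P1_nonzero[OF a(1), of "fst z"] P1_nonzero[OF a(1), of "snd z"] by (auto simp: dt_def)
 qed
 then show "dt s z < 0" using le by simp
qed

text \<open>Here the absence of a third branch pays: the double point is not met again, as
  \<open>untwisted_locally\<close> requires.\<close>

lemma K0_later:
 assumes z: "(s, z) \<in> K0" and t: "t > snd z"
 shows "P s t ~= P s (snd z)"
proof
 assume e: "P s t = P s (snd z)"
 note k = K0D[OF z]
 have "t = fst z | t = snd z"
  by (rule gap[OF k(1) less_imp_neq[OF k(2)] k(3) k(4,5)[unfolded cs_def dt_def]]) (simp add: e k(3))
 then show False using t k(2) by auto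
qed

lemma cs_cont:
 assumes "continuous_on A f" "continuous_on A g"
 shows "continuous_on A (%x. cs (f x) (g x))" "continuous_on A (%x. dt (f x) (g x))"
 unfolding cs_def dt_def by (intro crs_continuous P_cont continuous_intros assms)+

lemma compact_K0: "compact K0"
proof -
 let ?C = "{x. fst (snd x) <= snd (snd x)} \<inter> {x. 0 <= cs (fst x) (snd x)} \<inter> {x. cs (fst x) (snd x) <= eta * - dt (fst x) (snd x)}"
 have "closed ?C" by (intro closed_Int closed_Collect_le cs_cont continuous_intros)
 from compact_doubles_closed[OF this] show ?thesis
 proof (rule back_subst[of compact])
  show "{(s, a, b). s \<in> S & slope s a b = 0 & (s, a, b) \<in> ?C} = K0"
   by (rule set_eqI) (auto simp: K0_def slope_zero_iff)
 qed
qed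

lemma untwisted_near_K0:
 assumes z: "(s0, z0) \<in> K0"
 obtains delta where "delta > 0" "!!s z. s \<in> S ==> dist (s, z) (s0, z0) < delta ==> untwisted (tw s (snd z)) \<longleftrightarrow> untwisted (tw s0 (snd z0))"
proof -
 obtain delta where d: "delta > 0" "!!s b. s \<in> S ==> dist (s, b) (s0, snd z0) < delta ==> untwisted (tw s b) \<longleftrightarrow> untwisted (tw s0 (snd z0))"
  by (rule untwisted_locally[OF K0D(1)[OF z] K0_later[OF z]]) (assumption, rule that, assumption+)
 show ?thesis by (rule that[OF d(1)]) (rule d(2), assumption, rule le_less_trans[OF dist_snd_Pair_le])
qed

text \<open>Around every untwisted point of \<open>K0\<close> some ball misses \<open>K\<close>, so
  \<open>K\<close> is \<open>K0\<close> minus an open set.\<close>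

lemma compact_K: "compact K"
proof -
 define O' where "O' = \<Union>{ball x e | x e. ball x e \<inter> K = {}}"
 have "open O'" unfolding O'_def by (rule open_Union) auto
 moreover have "K = K0 - O'"
 proof (intro subset_antisym subsetI)
  fix x assume "x \<in> K" then show "x \<in> K0 - O'" unfolding O'_def K_def by auto
 next
  fix x assume x: "x \<in> K0 - O'"
  obtain s z where xx: "x = (s, z)" by (cases x)
  have z: "(s, z) \<in> K0" using x xx by simp
  obtain delta where d: "delta > 0" "!!s' z'. s' \<in> S ==> dist (s', z') (s, z) < delta ==> untwisted (tw s' (snd z')) \<longleftrightarrow> untwisted (tw s (snd z))"
   by (rule untwisted_near_K0[OF z]) (rule that, assumption+)
  have "~ untwisted (tw s (snd z))"
  proof
   assume u: "untwisted (tw s (snd z))"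
   have "ball x delta \<inter> K = {}"
   proof -
    have False if "x' \<in> ball x delta" "x' \<in> K" for x'
    proof -
     obtain s' z' where xx': "x' = (s', z')" by (cases x')
     have "(s', z') \<in> K0" and nu: "~ untwisted (tw s' (snd z'))" using that(2) unfolding xx' K_def by simp_all
     then have "s' \<in> S" by (intro K0D(1))
     moreover have "dist (s', z') (s, z) < delta" using that(1) unfolding xx xx' mem_ball by (simp add: dist_commute)
     ultimately show False using d(2)[of s' z'] u nu by simp
    qed
    then show ?thesis by blast
   qed
   then have "x \<in> O'" unfolding O'_def using d(1) by (intro UnionI[of "ball x delta"] CollectI exI[of _ x] exI[of _ delta]) simp_all
   then show False using x by simp
  qed
  then show "x \<in> K" using z unfolding xx K_def by simp
 qed
 ultimately show ?thesis using compact_diff[OF compact_K0] by simp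
qed

text \<open>At a tangency at most three crossings are near, all of weight close to 1, so the change
  is an integer up to a small error. At a transversal crossing inside the threshold exactly one
  crossing persists. At the threshold the weight is 0 and at most one crossing is near, counted or
  not.\<close>

lemma weight_local:
 assumes z: "(s0, z0) \<in> K" and e: "eps > 0" and M: "M = \<int> | cs s0 z0 ~= 0 & M = {0}"
 shows "\<exists>r0>0. \<forall>r. 0 < r & r < r0 --> (\<exists>delta>0. \<forall>s\<in>S. dist s s0 < delta -->
   finite {z \<in> ball z0 r. (s, z) \<in> K} & (\<exists>m\<in>M. abs ((\<Sum>z | z \<in> ball z0 r & (s, z) \<in> K. phi s z) - phi s0 z0 - m) < eps))"
proof -
 have zK0: "(s0, z0) \<in> K0" and nu: "~ untwisted (tw s0 (snd z0))" using z by (auto simp: K_def)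
 note k = K0D[OF zK0]
 obtain a0 b0 where z0: "z0 = (a0, b0)" by (cases z0)
 have "isCont (%x. phi (fst x) (snd x)) (s0, z0)"
 proof (rule continuous_on_interior)
  have od: "open {x. dt (fst x) (snd x) < 0}" by (intro open_Collect_less cs_cont continuous_intros)
  show "continuous_on {x. dt (fst x) (snd x) < 0} (%x. phi (fst x) (snd x))"
   unfolding phi_def by (intro continuous_intros cs_cont) (use eta in auto)
  show "(s0, z0) \<in> interior {x. dt (fst x) (snd x) < 0}" using k(6) by (simp add: interior_open[OF od])
 qed
 then obtain d where d: "d > 0" "!!s z. dist (s, z) (s0, z0) < d ==> \<bar>phi s z - phi s0 z0\<bar> < eps / 4"
  unfolding continuous_at_eps_delta dist_real_def using e by (metis fst_conv snd_conv zero_less_divide_iff zero_less_numeral)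
 have box: "abs (fst z - a0) < r" "abs (snd z - b0) < r" if "z \<in> ball z0 r" for z r
  using that dist_fst_le[of z z0] dist_snd_le[of z z0] unfolding z0 mem_ball by (auto simp: dist_real_def dist_commute)
 have close: "dist (s, z) (s0, z0) < u" if "z \<in> ball z0 r" "dist s s0 < r'" "r <= u / 2" "r' <= u / 2" for s z r r' u
  using dist_Pair_le[of s z s0 z0] that by (simp add: dist_commute)
 show ?thesis
 proof (cases "cs s0 z0 = 0")
  case True
  have one: "phi s0 z0 = 1" using True by (simp add: phi_def)
  obtain e1 where e1: "e1 > 0"
   "!!s. dist s s0 < e1 ==> finite {(a, b). abs (a - a0) < e1 & abs (b - b0) < e1 & P s a = P s b} &
   card {(a, b). abs (a - a0) < e1 & abs (b - b0) < e1 & P s a = P s b} <= 3"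
   using k True unfolding z0 cs_def dt_def fst_conv snd_conv
   by (elim anti_tangency_count[OF k(1), of a0 b0, rotated -1]) (rule that | assumption | simp)+
  show ?thesis
  proof (rule exI[of _ "min e1 (d / 2)"], intro conjI allI impI)
   show "min e1 (d / 2) > 0" using e1 d by simp
   fix r assume r: "0 < r & r < min e1 (d / 2)"
   show "\<exists>delta>0. \<forall>s\<in>S. dist s s0 < delta --> finite {z \<in> ball z0 r. (s, z) \<in> K} &
     (\<exists>m\<in>M. abs ((\<Sum>z | z \<in> ball z0 r & (s, z) \<in> K. phi s z) - phi s0 z0 - m) < eps)"
   proof (rule exI[of _ "min e1 (d / 2)"], intro conjI[of "min e1 (d / 2) > 0"] ballI impI)
    show "min e1 (d / 2) > 0" using e1 d by simp
    fix s assume s: "s \<in> S" "dist s s0 < min e1 (d / 2)"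
    let ?A = "{z. z \<in> ball z0 r & (s, z) \<in> K}" and ?B = "{(a, b). abs (a - a0) < e1 & abs (b - b0) < e1 & P s a = P s b}"
    have "?A \<subseteq> ?B"
    proof
     fix x assume x: "x \<in> ?A"
     then have "(s, x) \<in> K0" by (simp add: K_def)
     then have "P s (fst x) = P s (snd x)" by (rule K0D)
     moreover have "abs (fst x - a0) < e1" "abs (snd x - b0) < e1" using box[of x r] x r by auto
     ultimately show "x \<in> ?B" by (simp add: case_prod_unfold)
    qed
    moreover have "finite ?B & card ?B <= 3" using e1(2) s(2) by simp
    ultimately have A: "finite ?A" "card ?A <= 3" using finite_subset card_mono[of ?B ?A] by (blast, linarith)
    \<comment> \<open>The integer is the change in the number of crossings; each of the at most
      three terms is off by at most \<open>eps / 4\<close>.\<close>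
    have "(\<Sum>z\<in>?A. phi s z) - phi s0 z0 - (real (card ?A) - 1) = (\<Sum>z\<in>?A. phi s z - 1)"
     using one by (simp add: sum_subtractf)
    also have "abs (\<dots>) <= (\<Sum>z\<in>?A. eps / 4)"
    proof (rule order_trans[OF sum_abs sum_mono])
     fix x assume x: "x \<in> ?A"
     have "dist (s, x) (s0, z0) < d" by (rule close[of x r _ "d/2"]) (use x r s in auto)
     then show "abs (phi s x - 1) <= eps / 4" using d(2)[of s x] one by simp
    qed
    also have "\<dots> <= 3 * (eps / 4)" using A(2) e by simp
    also have "\<dots> < eps" using e by simp
    finally have "abs ((\<Sum>z\<in>?A. phi s z) - phi s0 z0 - (real (card ?A) - 1)) < eps" .
    moreover have "real (card ?A) - 1 \<in> M" using M True by auto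
    ultimately show "finite ?A & (\<exists>m\<in>M. abs ((\<Sum>z\<in>?A. phi s z) - phi s0 z0 - m) < eps)" using A(1) by blast
   qed
  qed
 next
  case False
  then have cpos: "cs s0 z0 > 0" using k(4) by simp
  have M0: "0 \<in> M" using M by auto
  have crn: "crs (P1 s0 a0) (P1 s0 b0) ~= 0" using False unfolding z0 cs_def by simp
  obtain e1 where e1: "e1 > 0"
   "!!s a b a' b'. dist s s0 < e1 ==> \<bar>a - a0\<bar> < e1 ==> \<bar>b - b0\<bar> < e1 ==> \<bar>a' - a0\<bar> < e1 ==> \<bar>b' - b0\<bar> < e1 ==>
   P s a = P s b ==> P s a' = P s b' ==> a = a' & b = b'"
   by (rule double_unique[OF crn]) (rule that)
  have uniq: "x = y" if "dist s s0 < e1" "x \<in> ball z0 r" "y \<in> ball z0 r" "r <= e1" "P s (fst x) = P s (snd x)" "P s (fst y) = P s (snd y)" for s x y r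
   using e1(2)[OF that(1) _ _ _ _ that(5,6)] box[OF that(2)] box[OF that(3)] that(4) by (simp add: prod_eq_iff)
  have KP: "P s (fst x) = P s (snd x)" if "(s, x) \<in> K" for s x using that K0D(3) by (simp add: K_def)
  show ?thesis
  proof (cases "cs s0 z0 < eta * - dt s0 z0")
   case True
   let ?W = "{x. fst (snd x) < snd (snd x)} \<inter> {x. 0 < cs (fst x) (snd x)} \<inter> {x. cs (fst x) (snd x) < eta * - dt (fst x) (snd x)}"
   have "open ?W" by (intro open_Int open_Collect_less cs_cont continuous_intros)
   moreover have "(s0, z0) \<in> ?W" using k(2) cpos True by simp
   ultimately obtain d2 where d2: "d2 > 0" "ball (s0, z0) d2 \<subseteq> ?W" using open_contains_ball by blast
   obtain d3 where d3: "d3 > 0" "!!s z. s \<in> S ==> dist (s, z) (s0, z0) < d3 ==> untwisted (tw s (snd z)) \<longleftrightarrow> untwisted (tw s0 (snd z0))"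
    by (rule untwisted_near_K0[OF zK0]) (rule that, assumption+)
   define r0 where "r0 = min (min e1 (d / 2)) (min (d2 / 2) (d3 / 2))"
   have r0: "r0 > 0" "r0 <= e1" "r0 <= d / 2" "r0 <= d2 / 2" "r0 <= d3 / 2" using e1 d d2 d3 by (auto simp: r0_def)
   show ?thesis
   proof (rule exI[of _ r0], intro conjI allI impI)
    show "r0 > 0" by (rule r0)
    fix r assume r: "0 < r & r < r0"
    have P0: "P s0 a0 = P s0 b0" using k(3) by (simp add: z0)
    have r2: "r / 2 > 0" using r by simp
    obtain d4 where d4: "d4 > 0" "!!s. dist s s0 < d4 ==> \<exists>a b. abs (a - a0) < r / 2 & abs (b - b0) < r / 2 & P s a = P s b"
     by (rule crossing_persists[OF crn P0 r2]) (rule that, assumption+)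
    show "\<exists>delta>0. \<forall>s\<in>S. dist s s0 < delta --> finite {z \<in> ball z0 r. (s, z) \<in> K} &
      (\<exists>m\<in>M. abs ((\<Sum>z | z \<in> ball z0 r & (s, z) \<in> K. phi s z) - phi s0 z0 - m) < eps)"
    proof (rule exI[of _ "min d4 r0"], intro conjI[of "min d4 r0 > 0"] ballI impI)
     show "min d4 r0 > 0" using d4 r0 by simp
     fix s assume s: "s \<in> S" "dist s s0 < min d4 r0"
     obtain a b where ab: "abs (a - a0) < r / 2" "abs (b - b0) < r / 2" "P s a = P s b" using d4(2)[of s] s(2) by auto
     have ball: "(a, b) \<in> ball z0 r"
      using dist_Pair_le[of a b a0 b0] ab(1,2) unfolding z0 mem_ball by (simp add: dist_commute[of "(a0, b0)"] dist_real_def)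
     have near: "dist (s, (a, b)) (s0, z0) < u" if "r0 <= u / 2" for u
      by (rule close[OF ball, of _ r0]) (use s r that in auto)
     have "(s, (a, b)) \<in> ball (s0, z0) d2" using near[OF r0(4)] unfolding mem_ball by (simp add: dist_commute)
     then have "(s, (a, b)) \<in> ?W" by (rule subsetD[OF d2(2)])
     moreover have "~ untwisted (tw s b)" using d3(2)[OF s(1) near[OF r0(5)]] nu by simp
     ultimately have inK: "(s, (a, b)) \<in> K" using s(1) ab(3) by (simp add: K_def K0_def)
     have A: "{z. z \<in> ball z0 r & (s, z) \<in> K} = {(a, b)}"
     proof (intro subset_antisym subsetI)
      fix x assume x: "x \<in> {z. z \<in> ball z0 r & (s, z) \<in> K}"
      have "x = (a, b)" by (rule uniq[of s x r]) (use s r r0(2) x ball KP[of s x] ab(3) in auto)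
      then show "x \<in> {(a, b)}" by simp
     qed (use ball inK in simp)
     have "abs (phi s (a, b) - phi s0 z0) < eps" using d(2)[OF near[OF r0(3)]] e by linarith
     then show "finite {z. z \<in> ball z0 r & (s, z) \<in> K} &
       (\<exists>m\<in>M. abs ((\<Sum>z | z \<in> ball z0 r & (s, z) \<in> K. phi s z) - phi s0 z0 - m) < eps)"
      unfolding A using M0 by (intro conjI bexI[of _ 0]) simp_all
    qed
   qed
  next
   case eq: False
   then have "cs s0 z0 = eta * - dt s0 z0" using k(5) by simp
   then have zero: "phi s0 z0 = 0" using k(6) eta by (simp add: phi_def)
   define r0 where "r0 = min e1 (d / 2)"
   have r0: "r0 > 0" "r0 <= e1" "r0 <= d / 2" using e1 d by (auto simp: r0_def)
   show ?thesis
   proof (rule exI[of _ r0], intro conjI allI impI)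
    show "r0 > 0" by (rule r0)
    fix r assume r: "0 < r & r < r0"
    show "\<exists>delta>0. \<forall>s\<in>S. dist s s0 < delta --> finite {z \<in> ball z0 r. (s, z) \<in> K} &
      (\<exists>m\<in>M. abs ((\<Sum>z | z \<in> ball z0 r & (s, z) \<in> K. phi s z) - phi s0 z0 - m) < eps)"
    proof (rule exI[of _ r0], intro conjI[of "r0 > 0"] ballI impI)
     show "r0 > 0" by (rule r0)
     fix s assume s: "s \<in> S" "dist s s0 < r0"
     let ?A = "{z. z \<in> ball z0 r & (s, z) \<in> K}"
     have "?A = {} | (\<exists>x\<in>?A. ?A = {x})"
     proof -
      have "x = y" if "x \<in> ?A" "y \<in> ?A" for x y
       by (rule uniq[of s x r y]) (use s r r0(2) that KP[of s x] KP[of s y] in auto)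
      then show ?thesis by blast
     qed
     then show "finite ?A & (\<exists>m\<in>M. abs ((\<Sum>z\<in>?A. phi s z) - phi s0 z0 - m) < eps)"
     proof (elim disjE bexE)
      assume A: "?A = {}"
      show ?thesis unfolding A using M0 e zero by (intro conjI bexI[of _ 0]) simp_all
     next
      fix x assume x: "x \<in> ?A" and A: "?A = {x}"
      have "dist (s, x) (s0, z0) < d" by (rule close[of x r _ r0]) (use x r s r0(3) in auto)
      from d(2)[OF this] have "abs (phi s x - phi s0 z0) < eps" using e by linarith
      then show ?thesis unfolding A using M0 by (intro conjI bexI[of _ 0]) simp_all
     qed
    qed
   qed
  qed
 qed
qed

lemma weight_mod_1:
 assumes s0: "s0 \<in> S" and e: "eps > 0"
 obtains delta where "delta > 0" "!!s. s \<in> S ==> dist s s0 < delta ==>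
  \<exists>m\<in>\<int>. abs (weight eta (slice F s) - weight eta (slice F s0) - m) < eps"
proof -
 have "\<exists>delta>0. \<forall>s\<in>S. dist s s0 < delta --> (\<exists>m\<in>\<int>. abs ((\<Sum>z | (s, z) \<in> K. phi s z) - (\<Sum>z | (s0, z) \<in> K. phi s0 z) - m) < eps)"
  by (rule local_sums[OF compact_K _ _ s0 _ e], simp, simp, rule weight_local, assumption, assumption, simp)
 then show ?thesis using that weight_K[OF s0] weight_K by (elim exE conjE) metis
qed

lemma weight_continuous:
 assumes s0: "s0 \<in> S" and n: "!!z. z \<in> near_anti eta (slice F s0) ==> cross (slice F s0) z ~= 0" and e: "eps > 0"
 obtains delta where "delta > 0" "!!s. s \<in> S ==> dist s s0 < delta ==>
  abs (weight eta (slice F s) - weight eta (slice F s0)) < eps"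
proof -
 have nz: "cs s0 z ~= 0" if "(s0, z) \<in> K" for z using n[of z] that unfolding near_anti_K[OF s0] cross_family by simp
 have "\<exists>delta>0. \<forall>s\<in>S. dist s s0 < delta --> (\<exists>m\<in>{0}. abs ((\<Sum>z | (s, z) \<in> K. phi s z) - (\<Sum>z | (s0, z) \<in> K. phi s0 z) - m) < eps)"
  by (rule local_sums[OF compact_K _ _ s0 _ e], simp, simp, rule weight_local, assumption, assumption, simp add: nz)
 then show ?thesis using that weight_K[OF s0] weight_K by (elim exE conjE) (metis diff_zero singletonD)
qed

lemma cis_weight_continuous: "continuous_on S (%s. cis (2 * pi * weight eta (slice F s)))"
 unfolding continuous_on_iff
proof (intro ballI allI impI)
 fix s0 e assume s0: "s0 \<in> S" and e: "0 < (e::real)"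
 have "continuous_on UNIV (%x. cis (2 * pi * x))" by (intro continuous_intros)
 then have "isCont (%x. cis (2 * pi * x)) 0" by (simp add: continuous_on_eq_continuous_at)
 then obtain t where t: "t > 0" "!!x. abs x < t ==> dist (cis (2 * pi * x)) 1 < e"
  unfolding continuous_at_eps_delta using e by (auto simp: dist_real_def)
 obtain delta where d: "delta > 0" "!!s. s \<in> S ==> dist s s0 < delta ==>
  \<exists>m\<in>\<int>. abs (weight eta (slice F s) - weight eta (slice F s0) - m) < t"
  by (rule weight_mod_1[OF s0 t(1)]) (rule that, assumption+)
 show "\<exists>d>0. \<forall>s\<in>S. dist s s0 < d --> dist (cis (2 * pi * weight eta (slice F s))) (cis (2 * pi * weight eta (slice F s0))) < e"
 proof (intro exI[of _ delta] conjI ballI impI)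
  fix s assume s: "s \<in> S" "dist s s0 < delta"
  let ?w = "weight eta (slice F s)" and ?v = "weight eta (slice F s0)"
  obtain m where m: "m \<in> \<int>" "abs (?w - ?v - m) < t"
   by (rule bexE[OF d(2)[OF s]]) (rule that, assumption+)
  obtain n :: int where "m = of_int n" using m(1) by (rule Ints_cases)
  then have n: "abs (?w - ?v - n) < t" using m(2) by simp
  have "cis (2 * pi * ?w) = cis (2 * pi * (?w - ?v - n)) * cis (2 * pi * ?v) * cis (2 * pi * n)"
   by (simp add: cis_mult algebra_simps)
  also have "cis (2 * pi * n) = 1" by (rule cis_multiple_2pi) simp
  finally have "cis (2 * pi * ?w) - cis (2 * pi * ?v) = (cis (2 * pi * (?w - ?v - n)) - 1) * cis (2 * pi * ?v)"
   by (simp add: algebra_simps)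
  then have "dist (cis (2 * pi * ?w)) (cis (2 * pi * ?v)) = dist (cis (2 * pi * (?w - ?v - n))) 1"
   by (simp add: dist_norm norm_mult)
  then show "dist (cis (2 * pi * ?w)) (cis (2 * pi * ?v)) < e" using t(2)[OF n] by simp
 qed (rule d)
qed

end

end

section \<open>A family of double points\<close>

text \<open>The curves \<open>(t\<^sup>3 - 3 t, t x / 2 + t\<^sup>2 (g + K x - x\<^sup>2))\<close>, with \<open>x = t\<^sup>3 - 3 t\<close>.  Two parameters
 with the same \<open>x\<close> satisfy \<open>a\<^sup>2 + a b + b\<^sup>2 = 3\<close> and are determined by \<open>sgm = a + b\<close>.\<close>

definition cubic :: "real => real" where "cubic t = t ^ 3 - 3 * t"
definition quad :: "real => real => real => real" where "quad K g X = g + K * X - X\<^sup>2"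
definition ycoord :: "real => real => real => real" where "ycoord K g t = t * cubic t / 2 + t\<^sup>2 * quad K g (cubic t)"
definition cubic' :: "real => real" where "cubic' t = 3 * t\<^sup>2 - 3"
definition ycoord' :: "real => real => real => real" where
 "ycoord' K g t = cubic t / 2 + 2 * t * quad K g (cubic t) + (t / 2 + t\<^sup>2 * (K - 2 * cubic t)) * cubic' t"
definition ycoord'' :: "real => real => real => real" where
 "ycoord'' K g t = cubic' t + 2 * quad K g (cubic t) + 4 * t * (K - 2 * cubic t) * cubic' t - 2 * t\<^sup>2 * (cubic' t)\<^sup>2 +
  (t / 2 + t\<^sup>2 * (K - 2 * cubic t)) * (6 * t)"

lemma cubic_derivs:
 "(cubic has_real_derivative cubic' t) (at t)" "(cubic' has_real_derivative 6 * t) (at t)"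
 "(ycoord K g has_real_derivative ycoord' K g t) (at t)" "(ycoord' K g has_real_derivative ycoord'' K g t) (at t)"
proof -
 show c: "(cubic has_real_derivative cubic' t) (at t)" for t
  unfolding cubic_def[abs_def] cubic'_def by (auto intro!: derivative_eq_intros)
 show c': "(cubic' has_real_derivative 6 * t) (at t)" for t
  unfolding cubic'_def[abs_def] by (auto intro!: derivative_eq_intros)
 show "(ycoord K g has_real_derivative ycoord' K g t) (at t)"
  unfolding ycoord_def[abs_def] ycoord'_def quad_def
  by (rule derivative_eq_intros c refl | simp)+ (simp add: field_simps power2_eq_square)
 show "(ycoord' K g has_real_derivative ycoord'' K g t) (at t)"
  unfolding ycoord'_def[abs_def] ycoord''_def quad_def
  by (rule derivative_eq_intros c c' refl | simp)+ (simp add: field_simps power2_eq_square)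
qed

text \<open>What is left of the equation of equal heights after cancelling \<open>a - b\<close> and
  \<open>a + b\<close>, see \<open>ycoord_diff\<close>. The cancelled factor \<open>a + b\<close> is
  the permanent double point at plus and minus \<open>sqrt 3\<close>; double zeros of
  \<open>disc\<close> are tangencies.\<close>

definition disc :: "real => real => real => real" where
 "disc K g sgm = g + (3 - sgm\<^sup>2) / 2 + K * sgm * (3 - sgm\<^sup>2) - sgm\<^sup>2 * (3 - sgm\<^sup>2)\<^sup>2"
definition disc' :: "real => real => real" where
 "disc' K sgm = 3 * (1 - sgm\<^sup>2) * (K - 2 * sgm * (3 - sgm\<^sup>2)) - sgm"
definition disc'' :: "real => real => real" where
 "disc'' K sgm = 72 * sgm\<^sup>2 - 30 * sgm ^ 4 - 19 - 6 * sgm * K"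

lemma disc_derivs:
 "(disc K g has_real_derivative disc' K sgm) (at sgm)" "(disc' K has_real_derivative disc'' K sgm) (at sgm)"
proof -
 show "(disc K g has_real_derivative disc' K sgm) (at sgm)"
  unfolding disc_def[abs_def] disc'_def
  by (rule derivative_eq_intros refl | simp)+ (simp add: field_simps power2_eq_square)
 show "(disc' K has_real_derivative disc'' K sgm) (at sgm)"
  unfolding disc'_def[abs_def] disc''_def
  by (rule derivative_eq_intros refl | simp)+ (simp add: field_simps power2_eq_square power4_eq_xxxx)
qed

text \<open>Changing the sign of the parameter sum amounts to changing that of \<open>K\<close>, so
  estimates are made for nonnegative sums only.\<close>

lemma disc_flip: "disc K g (- sgm) = disc (- K) g sgm" "disc' K (- sgm) = - disc' (- K) sgm" "disc'' K (- sgm) = disc'' (- K) sgm"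
 by (simp_all add: disc_def disc'_def disc''_def algebra_simps)

lemma cubic_eq_iff: "a ~= b ==> cubic a = cubic b \<longleftrightarrow> a\<^sup>2 + a * b + b\<^sup>2 = 3"
proof -
 have "cubic a - cubic b = (a - b) * (a\<^sup>2 + a * b + b\<^sup>2 - 3)" by (simp add: cubic_def algebra_simps power2_eq_square power3_eq_cube)
 then show "a ~= b ==> ?thesis" by (metis diff_eq_diff_eq eq_iff_diff_eq_0 mult_eq_0_iff)
qed

lemma quad_disc: "sgm * (3 - sgm\<^sup>2) / 2 + sgm * quad K g (sgm * (3 - sgm\<^sup>2)) = sgm * disc K g sgm"
 unfolding quad_def disc_def by (simp add: field_simps power2_eq_square)

text \<open>The crossing determinant of a pair \<open>a\<close>, \<open>b\<close> is \<open>(b - a) * cross_poly (a + b)\<close>.\<close>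

definition cross_poly :: "real => real => real => real" where
 "cross_poly K g sgm = 3 * ((4 - sgm\<^sup>2) * (disc K g sgm + sgm * disc' K sgm) - sgm * (sgm * disc K g sgm))"

text \<open>The determinant with x, \<open>quad\<close> and its derivative as independent variables,
  which keeps the polynomial identities small. \<open>cpoly'\<close> is its derivative in
  \<open>sgm\<close> along \<open>X' = 3 - 3 sgm^2\<close>, \<open>q' = q1 X'\<close>,
  \<open>q1' = -2 X'\<close>.\<close>

definition "cpoly sgm X q q1 = - 3 * sgm * X / 2 - 6 * q * (sgm\<^sup>2 - 2) + 9 * (sgm\<^sup>2 - 1) * (sgm\<^sup>2 - 4) * (1 / 2 + sgm * q1)"
 for sgm X q q1 :: real

definition "cpoly' sgm X q q1 = - 3 * X / 2 - 3 * sgm * (3 - 3 * sgm\<^sup>2) / 2 - 6 * (q1 * (3 - 3 * sgm\<^sup>2)) * (sgm\<^sup>2 - 2) - 12 * q * sgm +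
  (36 * sgm ^ 3 - 90 * sgm) * (1 / 2 + sgm * q1) + 9 * (sgm\<^sup>2 - 1) * (sgm\<^sup>2 - 4) * (q1 - 2 * sgm * (3 - 3 * sgm\<^sup>2))"
 for sgm X q q1 :: real

lemma cpoly_cross: "cpoly sgm (sgm * (3 - sgm\<^sup>2)) (quad K g (sgm * (3 - sgm\<^sup>2))) (K - 2 * (sgm * (3 - sgm\<^sup>2))) = cross_poly K g sgm"
 unfolding cpoly_def cross_poly_def disc_def disc'_def quad_def by (simp add: field_simps power2_eq_square)

lemma cpoly'_cross: "cpoly' sgm (sgm * (3 - sgm\<^sup>2)) (quad K g (sgm * (3 - sgm\<^sup>2))) (K - 2 * (sgm * (3 - sgm\<^sup>2))) =
 3 * ((4 - sgm\<^sup>2) * (2 * disc' K sgm + sgm * disc'' K sgm) - 3 * sgm * (disc K g sgm + sgm * disc' K sgm) - sgm * disc K g sgm)"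
 unfolding cpoly'_def disc_def disc'_def disc''_def quad_def
 by (simp add: field_simps power2_eq_square power3_eq_cube power4_eq_xxxx)

context
 fixes a b :: real
 assumes h: "a\<^sup>2 + a * b + b\<^sup>2 = 3"
begin

lemma prod_sum: "a * b = (a + b)\<^sup>2 - 3"
 using h by (simp add: power2_eq_square algebra_simps)

lemma cubic_sum: "cubic a = (a + b) * (3 - (a + b)\<^sup>2)" "cubic b = (a + b) * (3 - (a + b)\<^sup>2)"
proof -
 have "cubic a - (a + b) * (3 - (a + b)\<^sup>2) = (a\<^sup>2 + a * b + b\<^sup>2 - 3) * (b + 2 * a)" unfolding cubic_def by algebra
 then show "cubic a = (a + b) * (3 - (a + b)\<^sup>2)" using h by simp
 have "cubic b - (a + b) * (3 - (a + b)\<^sup>2) = (a\<^sup>2 + a * b + b\<^sup>2 - 3) * (2 * b + a)" unfolding cubic_def by algebra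
 then show "cubic b = (a + b) * (3 - (a + b)\<^sup>2)" using h by simp
qed

lemma cubic'_prod: "cubic' a * cubic' b = 9 * ((a + b)\<^sup>2 - 1) * ((a + b)\<^sup>2 - 4)"
proof -
 have "cubic' a * cubic' b - 9 * ((a + b)\<^sup>2 - 1) * ((a + b)\<^sup>2 - 4) = (a\<^sup>2 + a * b + b\<^sup>2 - 3) * (9 - 9 * b\<^sup>2 - 27 * a * b - 9 * a\<^sup>2)"
  unfolding cubic'_def by algebra
 then show ?thesis using h by simp
qed

lemma cubic'_sum: "cubic' a + cubic' b = 3 * (4 - (a + b)\<^sup>2)"
proof -
 have "cubic' a + cubic' b - 3 * (4 - (a + b)\<^sup>2) = (a\<^sup>2 + a * b + b\<^sup>2 - 3) * 6" unfolding cubic'_def by algebra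
 then show ?thesis using h by simp
qed

lemma diff_square: "(b - a)\<^sup>2 = 3 * (4 - (a + b)\<^sup>2)"
proof -
 have "(b - a)\<^sup>2 - 3 * (4 - (a + b)\<^sup>2) = (a\<^sup>2 + a * b + b\<^sup>2 - 3) * 4" by algebra
 then show ?thesis using h by simp
qed

lemma ycoord_diff: "ycoord K g a - ycoord K g b = (a - b) * ((a + b) * disc K g (a + b))"
proof -
 define X where "X = (a + b) * (3 - (a + b)\<^sup>2)"
 have "ycoord K g a - ycoord K g b = (a - b) * (X / 2 + (a + b) * quad K g X)"
  unfolding ycoord_def cubic_sum X_def[symmetric] by (simp add: field_simps power2_eq_square)
 also have "X / 2 + (a + b) * quad K g X = (a + b) * disc K g (a + b)"
  unfolding X_def by (rule quad_disc)
 finally show ?thesis .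
qed

text \<open>Behind the algebra: with \<open>d = b - a\<close> and
  \<open>D = sgm * disc K g sgm\<close> the height difference is \<open>d D\<close>, where
  \<open>d^2 = 3 (4 - sgm^2)\<close>. Its derivative along the pairs of equal x is
  \<open>cross_poly / d\<close> by the product rule, and it is also the determinant divided by
  \<open>d^2\<close>.\<close>

lemma cross_det:
 "cubic' a * ycoord' K g b - cubic' b * ycoord' K g a = (b - a) * cross_poly K g (a + b)"
proof -
 define X q q1 where "X = (a + b) * (3 - (a + b)\<^sup>2)" and "q = quad K g X" and "q1 = K - 2 * X"
 have "cubic' a * ycoord' K g b - cubic' b * ycoord' K g a =
  cubic' a * (X / 2 + 2 * b * q + (b / 2 + b\<^sup>2 * q1) * cubic' b) - cubic' b * (X / 2 + 2 * a * q + (a / 2 + a\<^sup>2 * q1) * cubic' a)"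
  unfolding ycoord'_def cubic_sum X_def[symmetric] q_def q1_def ..
 also have "\<dots> = (b - a) * cpoly (a + b) X q q1"
 proof -
  define sgm d where "sgm = a + b" and "d = b - a"
  have "cubic' a * (X / 2 + 2 * b * q + (b / 2 + b\<^sup>2 * q1) * cubic' b) - cubic' b * (X / 2 + 2 * a * q + (a / 2 + a\<^sup>2 * q1) * cubic' a)
   = (cubic' a - cubic' b) * (X / 2) + 2 * q * (b * cubic' a - a * cubic' b) + (cubic' a * cubic' b) * ((b - a) / 2 + (b - a) * (a + b) * q1)"
   by algebra
  also have "cubic' a - cubic' b = - 3 * (b - a) * (a + b)" by (simp add: cubic'_def algebra_simps power2_eq_square)
  also have "b * cubic' a - a * cubic' b = - 3 * (b - a) * (a * b + 1)" by (simp add: cubic'_def algebra_simps power2_eq_square)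
  finally show ?thesis
   unfolding prod_sum cubic'_prod cpoly_def sgm_def[symmetric] d_def[symmetric] by (simp add: algebra_simps)
 qed
 also have "cpoly (a + b) X q q1 = cross_poly K g (a + b)"
  unfolding X_def q_def q1_def by (rule cpoly_cross)
 finally show ?thesis .
qed

text \<open>The left side is a combination of \<open>cpoly'\<close> and \<open>cpoly\<close>; at a
  double zero of \<open>disc\<close> only the term with \<open>disc''\<close> survives. So a zero of
  order exactly 2 will give an ordinary tangency.\<close>

lemma second_order:
 assumes d: "disc K g (a + b) = 0" "disc' K (a + b) = 0"
 shows "cubic' b * (6 * a * ycoord' K g b - ycoord'' K g a * cubic' b) + cubic' a * (cubic' a * ycoord'' K g b - ycoord' K g a * (6 * b))
  = 9 * (4 - (a + b)\<^sup>2)\<^sup>2 * (b - a) * (a + b) * disc'' K (a + b)"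
proof -
 define X q q1 where "X = (a + b) * (3 - (a + b)\<^sup>2)" and "q = quad K g X" and "q1 = K - 2 * X"
 have y: "ycoord' K g t = X / 2 + 2 * t * q + (t / 2 + t\<^sup>2 * q1) * cubic' t"
  "ycoord'' K g t = cubic' t + 2 * q + 4 * t * q1 * cubic' t - 2 * t\<^sup>2 * (cubic' t)\<^sup>2 + (t / 2 + t\<^sup>2 * q1) * (6 * t)"
  if "cubic t = X" for t unfolding ycoord'_def ycoord''_def that q_def q1_def by simp_all
 have cX: "cubic a = X" "cubic b = X" unfolding X_def by (rule cubic_sum)+
 define u v sgm d where "u = cubic' a" and "v = cubic' b" and "sgm = a + b" and "d = b - a"
 have uv: "u * v = 9 * (sgm\<^sup>2 - 1) * (sgm\<^sup>2 - 4)" "u + v = 3 * (4 - sgm\<^sup>2)" "a * b = sgm\<^sup>2 - 3"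
  unfolding u_def v_def sgm_def by (rule cubic'_prod cubic'_sum prod_sum)+
 have "v - u = 3 * d * sgm" "b\<^sup>2 - a\<^sup>2 = d * sgm" "b * u - a * v = - 3 * d * (a * b + 1)" "b * u + a * v = 3 * sgm * (a * b - 1)"
  unfolding u_def v_def sgm_def d_def cubic'_def by algebra+
 then have dd: "v - u = 3 * d * sgm" "b\<^sup>2 - a\<^sup>2 = d * sgm" "b * u - a * v = - 3 * d * (sgm\<^sup>2 - 2)" "b * u + a * v = 3 * sgm * (sgm\<^sup>2 - 4)"
  unfolding uv(3) by (simp_all add: algebra_simps)
 have "cubic' b * (6 * a * ycoord' K g b - ycoord'' K g a * cubic' b) + cubic' a * (cubic' a * ycoord'' K g b - ycoord' K g a * (6 * b))
  = X * (- 3 * (b * u - a * v)) + q * (- 2 * (v - u) * ((u + v) - 6 * (a * b))) +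
   q1 * (6 * (b\<^sup>2 - a\<^sup>2) * ((b * u + a * v) * (u + v) - (u * v) * sgm) + 4 * (u * v) * (b * u - a * v)) +
   ((v - u) * (3 * (a * b) * (u + v) - u * v) - 2 * (u * v)\<^sup>2 * (b\<^sup>2 - a\<^sup>2) + 3 * (b * u - a * v) * (b * u + a * v))"
  unfolding y[OF cX(1)] y[OF cX(2)] u_def[symmetric] v_def[symmetric] sgm_def by algebra
 also have "\<dots> = 3 * (4 - (a + b)\<^sup>2) * (b - a) * cpoly' (a + b) X q q1 - 3 * (b - a) * (a + b) * cpoly (a + b) X q q1"
  unfolding dd uv unfolding sgm_def[symmetric] d_def[symmetric] cpoly_def cpoly'_def by algebra
 also have "cpoly (a + b) X q q1 = cross_poly K g (a + b)"
  unfolding X_def q_def q1_def by (rule cpoly_cross)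
 also have "\<dots> = 0" by (simp add: cross_poly_def d)
 also have "cpoly' (a + b) X q q1 = 3 * ((4 - (a + b)\<^sup>2) * (2 * disc' K (a + b) + (a + b) * disc'' K (a + b)) -
   3 * (a + b) * (disc K g (a + b) + (a + b) * disc' K (a + b)) - (a + b) * disc K g (a + b))"
  unfolding X_def q_def q1_def by (rule cpoly'_cross)
 finally show ?thesis unfolding d by (simp add: power2_eq_square)
qed

end

section \<open>Estimates for the zeros of \<open>disc\<close> and the tangencies on the
  ellipse\<close>

lemma square_bounds: "0 <= l ==> l <= x ==> x <= u ==> l\<^sup>2 <= x\<^sup>2 & x\<^sup>2 <= u\<^sup>2" for x :: real
 by (simp add: power_mono)

context
 fixes K g :: real
 assumes K: "abs K <= 2 / 5" and g: "abs g <= 1 / 10"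
begin

lemma K_mult: "0 <= x ==> x <= u ==> \<bar>K * x\<bar> <= 2 / 5 * u"
 using mult_mono[of "abs K" "2 / 5" x u] K by (simp add: abs_mult)

text \<open>With the three facts that follow this locates the double zeros: \<open>disc\<close> is
  positive on [0, 1/4], decreasing up to 9/10, negative up to 3/2 and concave on [3/2, 2]. Hence a
  double zero with nonnegative sum lies in the last interval, and there is at most one.\<close>

lemma disc_pos_near_0:
 assumes "0 <= sgm" "sgm <= 1 / 4"
 shows "disc K g sgm > 0"
proof -
 define w where "w = sgm * (3 - sgm\<^sup>2)"
 have s: "0 <= sgm\<^sup>2" "sgm\<^sup>2 <= 1 / 16" using square_bounds[of 0 sgm "1/4"] assms by (auto simp: power_divide)
 have w: "0 <= w" "w <= 1 / 4 * 3" unfolding w_def using assms s by (simp, intro mult_mono) auto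
 have "w\<^sup>2 <= (3 / 4)\<^sup>2" using w by (intro power_mono) auto
 then have w2: "w\<^sup>2 <= 9 / 16" by (simp add: power_divide)
 have "abs (K * w) <= 2 / 5 * (3 / 4)" by (rule K_mult) (use w in auto)
 then have "K * w >= - 3 / 10" by (simp add: abs_le_iff)
 moreover have "g >= - 1 / 10" using g by simp
 ultimately have "0 < g + (3 - 1 / 16) / 2 + K * w - 9 / 16" by simp
 also have "\<dots> <= g + (3 - sgm\<^sup>2) / 2 + K * w - w\<^sup>2" using s w2 by (intro diff_mono add_mono) auto
 also have "\<dots> = disc K g sgm" unfolding disc_def w_def by (simp add: power_mult_distrib)
 finally show ?thesis .
qed

lemma disc'_neg:
 assumes "1 / 4 <= sgm" "sgm <= 9 / 10"
 shows "disc' K sgm < 0"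
proof -
 have s: "sgm\<^sup>2 <= 81 / 100" using square_bounds[of "1/4" sgm "9/10"] assms by (auto simp: power_divide)
 have "1 / 4 * 2 <= sgm * (3 - sgm\<^sup>2)" using assms s by (intro mult_mono) auto
 then have "K - 2 * (sgm * (3 - sgm\<^sup>2)) <= 0" using K by linarith
 then have "(1 - sgm\<^sup>2) * (K - 2 * (sgm * (3 - sgm\<^sup>2))) <= 0" using s by (intro mult_nonneg_nonpos) auto
 moreover have "disc' K sgm = 3 * ((1 - sgm\<^sup>2) * (K - 2 * (sgm * (3 - sgm\<^sup>2)))) - sgm" unfolding disc'_def by algebra
 ultimately show ?thesis using assms(1) by linarith
qed

lemma disc_neg:
 assumes "9 / 10 <= sgm" "sgm <= 3 / 2"
 shows "disc K g sgm < 0"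
proof -
 define u v where "u = sgm\<^sup>2" and "v = 3 - u"
 have u: "81 / 100 <= u" "u <= 9 / 4" using square_bounds[of "9/10" sgm "3/2"] assms by (auto simp: power_divide u_def)
 \<comment> \<open>\<open>u * (3 - u)\<close> is concave and takes the value 27/16 at both 3/4 and
   9/4, so it is at least that on the range of \<open>u\<close>.\<close>
 have "0 <= (u - 3 / 4) * (9 / 4 - u)" using u by (intro mult_nonneg_nonneg) auto
 moreover have "u * v - 27 / 16 = (u - 3 / 4) * (9 / 4 - u)" unfolding v_def by (simp add: field_simps)
 ultimately have uv: "u * v >= 27 / 16" by linarith
 have "abs (K * sgm) <= 2 / 5 * (3 / 2)" by (rule K_mult) (use assms in auto)
 then have "1 / 2 + K * sgm - u * v <= - 1 / 2" using uv by linarith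
 then have "v * (1 / 2 + K * sgm - u * v) <= v * (- 1 / 2)" using u by (intro mult_left_mono) (auto simp: v_def)
 also have "\<dots> <= - 3 / 8" using u by (simp add: v_def)
 finally have "v * (1 / 2 + K * sgm - u * v) <= - 3 / 8" .
 moreover have "disc K g sgm = g + v * (1 / 2 + K * sgm - u * v)"
  unfolding disc_def v_def u_def by (simp add: field_simps power2_eq_square)
 ultimately show ?thesis using g by linarith
qed

lemma disc''_neg:
 assumes "3 / 2 <= sgm" "sgm <= 2"
 shows "disc'' K sgm < 0"
proof -
 define u where "u = sgm\<^sup>2"
 have u: "9 / 4 <= u" using square_bounds[of "3/2" sgm 2] assms by (auto simp: power_divide u_def)
 then have "0 <= (u - 9 / 4) * (u - 3 / 20)" by (intro mult_nonneg_nonneg) auto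
 then have "72 * u - 30 * u\<^sup>2 <= 81 / 8" by (simp add: algebra_simps power2_eq_square)
 moreover have "abs (K * sgm) <= 2 / 5 * 2" by (rule K_mult) (use assms in auto)
 moreover have "disc'' K sgm = 72 * u - 30 * u\<^sup>2 - 19 - 6 * (K * sgm)"
  unfolding disc''_def u_def by (simp add: power_mult[symmetric])
 ultimately show ?thesis by linarith
qed

lemma disc_2: "disc K g 2 < 0"
 using K g by (simp add: disc_def)

lemma disc'_decreasing:
 assumes "3 / 2 <= sgm" "sgm < tau" "tau <= 2"
 shows "disc' K tau < disc' K sgm"
proof (rule DERIV_neg_imp_decreasing[OF assms(2)])
 fix x assume "sgm <= x" "x <= tau"
 then show "\<exists>y. (disc' K has_real_derivative y) (at x) & y < 0"
  using disc_derivs(2)[of K x] disc''_neg[of x] assms by auto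
qed

text \<open>By strict concavity on this interval a critical zero is the strict maximum.\<close>

lemma disc_max:
 assumes s: "3 / 2 <= sgm" "sgm <= 2" and 0: "disc K g sgm = 0" "disc' K sgm = 0" and t: "3 / 2 <= tau" "tau <= 2" "tau ~= sgm"
 shows "disc K g tau < 0"
proof (cases "sgm < tau")
 case True
 obtain z where z: "sgm < z" "z < tau" "disc K g tau - disc K g sgm = (tau - sgm) * disc' K z"
  using MVT2[OF True, of "disc K g" "disc' K"] disc_derivs(1) by blast
 then show ?thesis using disc'_decreasing[of sgm z] s t True 0 by (simp add: mult_pos_neg)
next
 case False
 then have lt: "tau < sgm" using t by simp
 obtain z where z: "tau < z" "z < sgm" "disc K g sgm - disc K g tau = (sgm - tau) * disc' K z"
  using MVT2[OF lt, of "disc K g" "disc' K"] disc_derivs(1) by blast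
 then have "disc' K z > 0" using disc'_decreasing[of z sgm] s t 0 by simp
 then have "(sgm - tau) * disc' K z > 0" using lt by simp
 then show ?thesis using z(3) 0 by simp
qed

end

lemma sqrt3: "3 / 2 <= sqrt 3" "sqrt 3 <= 2" "(sqrt 3)\<^sup>2 = 3"
 by (rule real_le_rsqrt real_le_lsqrt; simp add: power_divide)+ simp

lemma disc_sqrt3: "disc K g (sqrt 3) = g"
 by (simp add: disc_def)

text \<open>The ellipse with semi-axes 2/5 and 1/10, the image of the unit circle under
  \<open>kc\<close> and \<open>gc\<close>.\<close>

definition on_loop :: "real => real => bool" where "on_loop K g \<longleftrightarrow> 25 / 4 * K\<^sup>2 + 100 * g\<^sup>2 = 1"

lemma on_loop_bounds:
 assumes "on_loop K g"
 shows "abs K <= 2 / 5" "abs g <= 1 / 10"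
proof -
 have "K\<^sup>2 <= 4 / 25" "g\<^sup>2 <= 1 / 100"
  using assms zero_le_power2[of g] zero_le_power2[of K] unfolding on_loop_def by linarith+
 then show "abs K <= 2 / 5" "abs g <= 1 / 10"
  using power2_le_iff_abs_le[of "2/5" K] power2_le_iff_abs_le[of "1/10" g] by (simp_all add: power_divide)
qed

lemma on_loop_uminus [simp]: "on_loop (- K) g \<longleftrightarrow> on_loop K g"
 by (simp add: on_loop_def)

text \<open>\<open>g\<close> is the value of \<open>disc\<close> at \<open>sqrt 3\<close>, hence
  negative, unless the double zero is \<open>sqrt 3\<close> itself; that would need
  \<open>g = 0\<close> and \<open>K = - sqrt 3 / 6\<close>, off the ellipse. A wrong sign of
  \<open>K * (3 - sgm^2)\<close> contradicts the size or the sign of \<open>g\<close>. The two signs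
  will show that the loop crosses the tangency stratum.\<close>

lemma loop_tangency_pos:
 assumes l: "on_loop K g" and s: "3 / 2 <= sgm" "sgm < 2" and 0: "disc K g sgm = 0" "disc' K sgm = 0"
 shows "g < 0 & K * (sgm * (3 - sgm\<^sup>2)) > 0"
proof -
 note b = on_loop_bounds[OF l]
 have gs: "g < 0 & sgm ~= sqrt 3"
 proof (cases "sgm = sqrt 3")
  case True
  then have "g = 0" using 0(1) by (simp add: disc_sqrt3)
  then have "K\<^sup>2 = 4 / 25" using l by (simp add: on_loop_def)
  moreover have e: "6 * K = - sqrt 3" using 0(2) unfolding True disc'_def by simp
  have "(6 * K)\<^sup>2 = 3" unfolding e by simp
  then have "36 * K\<^sup>2 = 3" by (simp add: power_mult_distrib)
  ultimately show ?thesis by simp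
 next
  case False
  then have "sqrt 3 ~= sgm" by simp
  from disc_max[OF b s(1) less_imp_le[OF s(2)] 0 sqrt3(1,2) this] show ?thesis using False by (simp add: disc_sqrt3)
 qed
 define v where "v = 3 - sgm\<^sup>2"
 have v0: "v ~= 0" using gs s real_sqrt_unique[of sgm 3] by (auto simp: v_def)
 have e: "- g = v * (1 / 2 + K * sgm) - (sgm * v)\<^sup>2"
  using 0(1) unfolding disc_def v_def by (simp add: field_simps power_mult_distrib power2_eq_square)
 have s2: "sgm\<^sup>2 >= 9 / 4" using square_bounds[of "3/2" sgm 2] s by (simp add: power_divide)
 have "K * v > 0"
 proof (cases "v > 0")
  case True
  have "K > 0"
  proof (rule ccontr)
   assume "~ K > 0"
   then have K: "K <= 0" by simp
   then have "v * (K * sgm) <= 0" using True s by (simp add: mult_le_0_iff)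
   moreover have "9 / 4 * v\<^sup>2 <= (sgm * v)\<^sup>2" unfolding power_mult_distrib using s2 by (intro mult_right_mono) auto
   \<comment> \<open>Completing the square bounds \<open>- g\<close> by 1/36; the ellipse then
     pushes |K| above 1/3, so \<open>1 / 2 + K * sgm\<close> is not positive and \<open>- g\<close>
     cannot be positive either.\<close>
   moreover have "v / 2 - 9 / 4 * v\<^sup>2 = 1 / 36 - (3 * v / 2 - 1 / 6)\<^sup>2" by (simp add: field_simps power2_eq_square)
   moreover have "- g = v / 2 + v * (K * sgm) - (sgm * v)\<^sup>2" unfolding e by (simp add: distrib_left)
   ultimately have "- g <= 1 / 36" using zero_le_power2[of "3 * v / 2 - 1 / 6"] by linarith
   then have "g\<^sup>2 <= (1 / 36)\<^sup>2" using gs power2_le_iff_abs_le[of "1/36" g] by simp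
   then have "(2 / 6)\<^sup>2 < K\<^sup>2" using l unfolding on_loop_def power_divide by simp
   then have "2 / 6 < abs K" using abs_le_square_iff[of K "2/6"] by (simp add: not_le[symmetric])
   then have K': "K <= - (2 / 6)" using K by simp
   have "K * sgm <= - (2 / 6) * (3 / 2)" using mult_mono[of "2/6" "- K" "3/2" sgm] K' s by simp
   then have "v * (1 / 2 + K * sgm) <= 0" using True by (simp add: mult_le_0_iff)
   then show False using e gs zero_le_power2[of "sgm * v"] by linarith
  qed
  then show ?thesis using True by simp
 next
  case False
  then have v: "v < 0" using v0 by simp
  have "K < 0"
  proof (rule ccontr)
   assume "~ K < 0"
   then have "1 / 2 + K * sgm > 0" using s by (auto intro: add_pos_nonneg)
   then have "v * (1 / 2 + K * sgm) < 0" using v by (simp add: mult_less_0_iff)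
   then show False using e gs zero_le_power2[of "sgm * v"] by linarith
  qed
  then show ?thesis using v by (simp add: mult_neg_neg)
 qed
 then have "sgm * (K * v) > 0" using s by simp
 then show ?thesis using gs by (simp add: v_def mult_ac)
qed

text \<open>The double zero for \<open>- K\<close> has \<open>3 - tau^2 < 0\<close>, which keeps
  \<open>g\<close> above -3/400 and so forces \<open>K\<close> up to 39/100. But then
  \<open>disc K g\<close> is positive at 17/10, whereas its double zero should be its
  maximum.\<close>

lemma loop_tangencies_unique_pos:
 assumes l: "on_loop K g" and K: "K > 0" and s1: "3 / 2 <= sgm" "sgm < 2" "disc K g sgm = 0" "disc' K sgm = 0"
  and s2: "3 / 2 <= tau" "tau < 2" "disc (- K) g tau = 0" "disc' (- K) tau = 0"
 shows False
proof -
 note b = on_loop_bounds[OF l]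
 have g: "g < 0" and x: "tau * (3 - tau\<^sup>2) < 0" using loop_tangency_pos[of "- K" g tau] l s2 K by (auto simp: zero_less_mult_iff mult_less_0_iff)
 define m where "m = tau\<^sup>2 - 3"
 have m: "m > 0" using x s2(1) by (simp add: m_def mult_less_0_iff)
 have e: "g = m * (1 / 2 - K * tau) + tau\<^sup>2 * m\<^sup>2"
  using s2(3) unfolding disc_def m_def by (simp add: field_simps power2_eq_square)
 have "K * tau <= 2 / 5 * 2" using b s2 K by (intro mult_mono) auto
 then have "m * (- 3 / 10) <= m * (1 / 2 - K * tau)" using m by (intro mult_left_mono) auto
 moreover have "3 * m\<^sup>2 <= tau\<^sup>2 * m\<^sup>2" using m by (intro mult_right_mono) (auto simp: m_def)
 moreover have "3 * m\<^sup>2 - 3 / 10 * m = 3 * (m - 1 / 20)\<^sup>2 - 3 / 400" by (simp add: field_simps power2_eq_square)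
 ultimately have g1: "g >= - 3 / 400" using e zero_le_power2[of "m - 1 / 20"] by linarith
 then have "g\<^sup>2 <= (3 / 400)\<^sup>2" using g power2_le_iff_abs_le[of "3/400" g] by simp
 then have "(39 / 100)\<^sup>2 <= K\<^sup>2" using l unfolding on_loop_def power_divide by simp
 then have K1: "K >= 39 / 100" using K power2_le_imp_le[of "39/100" K] by simp
 have "disc K g (17 / 10) <= 0"
 proof (cases "17 / 10 = sgm")
  case False then show ?thesis using disc_max[OF b s1(1) less_imp_le[OF s1(2)] s1(3,4), of "17/10"] by simp
 next
  case True then show ?thesis using s1(3) by (simp only: order_refl)
 qed
 then show False using g1 K1 unfolding disc_def by (simp add: power2_eq_square)
qed

definition tangent_at :: "real => real => real => bool" where
 "tangent_at K g sgm \<longleftrightarrow> \<bar>sgm\<bar> < 2 & disc K g sgm = 0 & disc' K sgm = 0"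

lemma tangent_at_uminus: "tangent_at K g (- sgm) \<longleftrightarrow> tangent_at (- K) g sgm"
 by (simp add: tangent_at_def disc_flip)

lemma tangent_at_pos:
 assumes "abs K <= 2 / 5" "abs g <= 1 / 10" "tangent_at K g sgm" "sgm >= 0"
 shows "3 / 2 <= sgm" "sgm < 2" "disc K g sgm = 0" "disc' K sgm = 0"
proof -
 show "sgm < 2" "disc K g sgm = 0" "disc' K sgm = 0" using assms(3) by (auto simp: tangent_at_def)
 then show "3 / 2 <= sgm"
  using disc_pos_near_0[OF assms(1,2,4)] disc'_neg[OF assms(1,2), of sgm] disc_neg[OF assms(1,2), of sgm] by linarith
qed

lemma loop_tangency:
 assumes l: "on_loop K g" and t: "tangent_at K g sgm"
 shows "g < 0 & K * (sgm * (3 - sgm\<^sup>2)) > 0 & 3 / 2 <= abs (sgm) & disc'' K sgm < 0"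
proof (cases "sgm >= 0")
 case True
 note p = tangent_at_pos[OF on_loop_bounds[OF l] t True]
 show ?thesis using loop_tangency_pos[OF l p] disc''_neg[OF on_loop_bounds[OF l], of sgm] p True by simp
next
 case False
 then have n: "- sgm >= 0" by simp
 have l': "on_loop (- K) g" using l by simp
 have t': "tangent_at (- K) g (- sgm)" using t tangent_at_uminus[of "- K" g sgm] by simp
 note p = tangent_at_pos[OF on_loop_bounds[OF l'] t' n]
 have "g < 0" "K * (sgm * (3 - sgm\<^sup>2)) > 0" using loop_tangency_pos[OF l' p] by simp_all
 moreover have "disc'' K sgm < 0" using disc''_neg[OF on_loop_bounds[OF l'] p(1)] p(2) disc_flip(3)[of "- K" sgm] by simp
 ultimately show ?thesis using p(1) n by simp
qed

text \<open>Two simultaneous tangencies would be a codimension 2 event, which a generic loop must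
  avoid. Sums of equal sign are excluded by concavity, opposite signs by
  \<open>loop_tangencies_unique_pos\<close>.\<close>

lemma loop_tangency_unique:
 assumes l: "on_loop K g" and t: "tangent_at K g sgm" "tangent_at K g tau"
 shows "sgm = tau"
proof -
 note b = on_loop_bounds[OF l]
 have l': "on_loop (- K) g" using l by simp
 note b' = on_loop_bounds[OF l']
 have same: "x = y" if "on_loop k g" "x >= 0" "y >= 0" "tangent_at k g x" "tangent_at k g y" for k x y
  using disc_max[OF on_loop_bounds[OF that(1)] tangent_at_pos(1)[OF on_loop_bounds[OF that(1)] that(4,2)] _ _ _
    tangent_at_pos(1)[OF on_loop_bounds[OF that(1)] that(5,3)]] that(4,5)
  by (force simp: tangent_at_def)
 have opp: False if "x >= 0" "y >= 0" "tangent_at K g x" "tangent_at (- K) g y" for x y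
 proof (cases "K > 0")
  case True
  show ?thesis by (rule loop_tangencies_unique_pos[OF l True tangent_at_pos[OF b that(3,1)] tangent_at_pos[OF b' that(4,2)]])
 next
  case False
  moreover have "K ~= 0" using loop_tangency[OF l that(3)] by auto
  ultimately have "- K > 0" by simp
  from loop_tangencies_unique_pos[OF l' this tangent_at_pos[OF b' that(4,2)]] tangent_at_pos[OF b that(3,1)]
  show ?thesis by simp
 qed
 have fl: "tangent_at (- K) g (- x) \<longleftrightarrow> tangent_at K g x" for x using tangent_at_uminus[of "- K" g x] by simp
 show ?thesis
  using same[OF l, of sgm tau] same[OF l', of "- sgm" "- tau"] opp[of sgm "- tau"] opp[of tau "- sgm"] t
  unfolding fl by fastforce
qed

section \<open>The loop\<close>

definition cutoff :: "real => real" where "cutoff t = smooth_step ((9 - t\<^sup>2) / 5)"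
text \<open>Divided by 6, the cubic meets the identity at 3 and -3, which is what lets the blend
  increase outside [-1, 1].\<close>

definition xc :: "real => real" where "xc t = cutoff t * (cubic t / 6) + (1 - cutoff t) * t"
definition kc :: "complex => real" where "kc s = 2 / 5 * Re s"
definition gc :: "complex => real" where "gc s = 1 / 10 * Im s"

text \<open>The height \<open>cutoff t * t\<close> separates the strands at all double points,
  because these lie where \<open>cutoff\<close> is 1.\<close>

definition knot :: "complex \<times> real => real^3" where
 "knot z = vector [xc (snd z), cutoff (snd z) * ycoord (kc (fst z)) (gc (fst z)) (snd z), cutoff (snd z) * snd z]"

lemma cutoff_simps: "abs t <= 2 ==> cutoff t = 1" "abs t >= 3 ==> cutoff t = 0"
 and cutoff_range: "0 <= cutoff t" "cutoff t <= 1"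
proof -
 show "cutoff t = 1" if "abs t <= 2"
 proof -
  have "t\<^sup>2 <= 2\<^sup>2" using that power2_le_iff_abs_le[of 2 t] by simp
  then show ?thesis unfolding cutoff_def by (intro smooth_step_simps) simp
 qed
 show "cutoff t = 0" if "abs t >= 3"
 proof -
  have "3\<^sup>2 <= t\<^sup>2" using that power_mono[of 3 "abs t" 2] by simp
  then show ?thesis unfolding cutoff_def by (intro smooth_step_simps) simp
 qed
qed (simp_all add: cutoff_def smooth_step_range)

lemma smooth_cutoff: "smooth cutoff"
 unfolding cutoff_def[abs_def] divide_inverse
 by (intro smooth_compose[OF smooth_smooth_step] smooth_mult smooth_diff smooth_power smooth_const smooth_ident)

lemma smooth_cubic: "smooth cubic" unfolding cubic_def[abs_def]
 by (intro smooth_mult smooth_diff smooth_power smooth_const smooth_ident)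

lemma smooth_xc: "smooth xc" unfolding xc_def[abs_def] divide_inverse
 by (intro smooth_mult smooth_add smooth_diff smooth_const smooth_ident smooth_cutoff smooth_cubic)

lemma smooth_vector3:
 assumes "smooth f" "smooth g" "smooth (h :: 'a::euclidean_space => real)"
 shows "smooth (%z. vector [f z, g z, h z] :: real^3)"
proof -
 have "(%z. vector [f z, g z, h z] :: real^3) = (%z. f z *\<^sub>R axis 1 1 + g z *\<^sub>R axis 2 1 + h z *\<^sub>R axis 3 1)"
  by (auto simp: vec_eq_iff forall_3 axis_def)
 then show ?thesis by (simp only:) (intro smooth_add smooth_scaleR assms smooth_const)
qed

lemma smooth_knot: "smooth knot"
proof -
 have l: "smooth (%z::complex \<times> real. Re (fst z))" "smooth (%z::complex \<times> real. Im (fst z))"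
  by (intro smooth_bounded_linear[OF bounded_linear_Re] smooth_bounded_linear[OF bounded_linear_Im] smooth_fst)+
 show ?thesis
  unfolding knot_def[abs_def] ycoord_def quad_def kc_def gc_def divide_inverse
  by (intro smooth_vector3 smooth_snd_compose smooth_xc smooth_mult smooth_add smooth_diff smooth_power smooth_const l
    smooth_cutoff smooth_cubic smooth_snd)
qed

lemma knot_outside: "abs t >= 3 ==> knot (s, t) = x_axis t"
 by (simp add: knot_def xc_def cutoff_simps x_axis_def)

definition pk :: "complex => real => complex" where "pk s t = pz (knot (s, t))"
definition pk1 :: "complex => real => complex" where "pk1 s t = pz (velocity (slice knot s) t)"
definition pk2 :: "complex => real => complex" where "pk2 s t = pz (velocity (velocity (slice knot s)) t)"

lemma pk_eq: "pk s t = Complex (xc t) (cutoff t * ycoord (kc s) (gc s) t)"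
 by (simp add: pk_def knot_def complex_eq_iff)

lemma pk_inside: "abs t <= 2 ==> pk s t = Complex (cubic t / 6) (ycoord (kc s) (gc s) t)"
 by (simp add: pk_eq xc_def cutoff_simps)

lemma pk_derivs:
 "(pk s has_vector_derivative pk1 s t) (at t)" "(pk1 s has_vector_derivative pk2 s t) (at t)"
proof -
 have s: "smooth (slice knot s)" by (rule smooth_slice[OF smooth_knot])
 show "(pk s has_vector_derivative pk1 s t) (at t)" "(pk1 s has_vector_derivative pk2 s t) (at t)"
  unfolding pk_def[abs_def] pk1_def[abs_def] pk2_def
  by (intro bounded_linear.has_vector_derivative[OF bounded_linear_pz] smooth_velocity s)+
qed

lemma Complex_derivative:
 assumes "(f has_real_derivative f') (at t)" "(g has_real_derivative g') (at t)"
 shows "((%t. Complex (f t) (g t)) has_vector_derivative Complex f' g') (at t)"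
 using assms by (simp add: has_vector_derivative_complex_iff has_real_derivative_iff_has_vector_derivative)

lemma pk1_inside:
 assumes "abs t < 2"
 shows "pk1 s t = Complex (cubic' t / 6) (ycoord' (kc s) (gc s) t)"
proof (rule vector_derivative_unique_at[OF pk_derivs(1)])
 have "((%t. Complex (cubic t / 6) (ycoord (kc s) (gc s) t)) has_vector_derivative Complex (cubic' t / 6) (ycoord' (kc s) (gc s) t)) (at t)"
  by (intro Complex_derivative DERIV_cdivide cubic_derivs)
 then show "(pk s has_vector_derivative Complex (cubic' t / 6) (ycoord' (kc s) (gc s) t)) (at t)"
  by (rule has_vector_derivative_transform_within_open[of _ _ _ "{-2<..<2}"]) (use assms pk_inside in auto)
qed

lemma pk2_inside:
 assumes "abs t < 2"
 shows "pk2 s t = Complex t (ycoord'' (kc s) (gc s) t)"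
proof (rule vector_derivative_unique_at[OF pk_derivs(2)])
 have "((%t. Complex (cubic' t / 6) (ycoord' (kc s) (gc s) t)) has_vector_derivative Complex (6 * t / 6) (ycoord'' (kc s) (gc s) t)) (at t)"
  by (intro Complex_derivative DERIV_cdivide cubic_derivs)
 then have "((%t. Complex (cubic' t / 6) (ycoord' (kc s) (gc s) t)) has_vector_derivative Complex t (ycoord'' (kc s) (gc s) t)) (at t)" by simp
 then show "(pk1 s has_vector_derivative Complex t (ycoord'' (kc s) (gc s) t)) (at t)"
  by (rule has_vector_derivative_transform_within_open[of _ _ _ "{-2<..<2}"]) (use assms pk1_inside in auto)
qed

text \<open>The derivative of the cutoff comes with the factor \<open>cubic t / 6 - t\<close>, a
  multiple of \<open>t^3 - 9 t\<close>. On [-3, 3] the two have the same sign, so the blending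
  contributes nonnegatively.\<close>

lemma xc_derivative:
 obtains d where "(xc has_real_derivative d) (at t)" "abs t > 1 ==> d > 0"
proof -
 obtain c' where c': "(cutoff has_real_derivative c') (at t)"
  using smooth_velocity(2)[OF smooth_cutoff] by (metis has_real_derivative_iff_has_vector_derivative)
 have sign: "c' * (t ^ 3 - 9 * t) >= 0"
 proof (cases "abs t > 3")
  case True
  have "(cutoff has_real_derivative 0) (at t)"
   by (rule has_field_derivative_transform_within_open[of "%_. 0" _ _ "{x. abs x > 3}"])
    (use True cutoff_simps(2) in \<open>auto intro!: open_Collect_less continuous_intros\<close>)
  then show ?thesis using DERIV_unique[OF c'] by simp
 next
  case False
  have mono: "cutoff y <= cutoff x" if "abs x <= abs y" for x y
   unfolding cutoff_def using that abs_le_square_iff[of x y] by (intro smooth_step_mono) simp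
  have up: "c' <= 0" if "t >= 0"
  proof (rule ccontr)
   assume "~ c' <= 0"
   then obtain d where d: "d > 0" "!!h. 0 < h ==> h < d ==> cutoff t < cutoff (t + h)"
    using DERIV_pos_inc_right[OF c'] by auto
   have "cutoff t < cutoff (t + d / 2)" by (rule d(2)) (use d(1) in auto)
   then show False using mono[of t "t + d / 2"] d(1) that by simp
  qed
  have dn: "c' >= 0" if "t <= 0"
  proof (rule ccontr)
   assume "~ c' >= 0"
   then obtain d where d: "d > 0" "!!h. 0 < h ==> h < d ==> cutoff t < cutoff (t - h)"
    using DERIV_neg_dec_left[OF c'] by auto
   have "cutoff t < cutoff (t - d / 2)" by (rule d(2)) (use d(1) in auto)
   then show False using mono[of t "t - d / 2"] d(1) that by simp
  qed
  have "c' * t <= 0" using up dn by (cases "t >= 0") (auto simp: mult_le_0_iff)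
  moreover have "t\<^sup>2 - 9 <= 0" using False power2_le_iff_abs_le[of 3 t] by simp
  ultimately have "0 <= (c' * t) * (t\<^sup>2 - 9)" by (rule mult_nonpos_nonpos)
  then show ?thesis by (simp add: algebra_simps power2_eq_square power3_eq_cube)
 qed
 define d where "d = c' * (t ^ 3 - 9 * t) / 6 + (cutoff t * ((t\<^sup>2 - 1) / 2) + (1 - cutoff t))"
 have "(xc has_real_derivative d) (at t)"
  unfolding xc_def[abs_def]
  by (rule derivative_eq_intros c' cubic_derivs refl | simp)+ (simp add: d_def cubic_def cubic'_def field_simps)
 moreover have "d > 0" if "abs t > 1"
 proof -
  have "t\<^sup>2 - 1 > 0" using that abs_square_less_1[of t] abs_square_eq_1[of t] by (smt (verit))
  then have "cutoff t * ((t\<^sup>2 - 1) / 2) + (1 - cutoff t) > 0"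
   using cutoff_range[of t] by (cases "cutoff t = 1") (auto intro!: add_nonneg_pos)
  then show ?thesis using sign unfolding d_def by simp
 qed
 ultimately show ?thesis by (rule that)
qed

lemma Re_pk1: "(xc has_real_derivative Re (pk1 s t)) (at t)"
proof -
 have "((%t. Re (pk s t)) has_vector_derivative Re (pk1 s t)) (at t)"
  by (rule bounded_linear.has_vector_derivative[OF bounded_linear_Re pk_derivs(1)])
 then show ?thesis by (simp add: pk_eq has_real_derivative_iff_has_vector_derivative)
qed

lemma Re_pk1_pos: "abs t > 1 ==> Re (pk1 s t) > 0"
 using xc_derivative[of t] DERIV_unique[OF Re_pk1[of s t]] by metis

lemma xc_mono: assumes "a < b" "1 <= a | b <= -1" shows "xc a < xc b"
proof -
 have "continuous_on {a..b} xc" by (rule smooth_continuous[OF smooth_xc])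
 then show ?thesis
 proof (rule DERIV_pos_imp_increasing_open[OF assms(1), rotated])
  fix x assume "a < x" "x < b"
  then show "\<exists>y. (xc has_real_derivative y) (at x) & 0 < y"
   using Re_pk1[of 0 x] Re_pk1_pos[of x 0] assms(2) by (intro exI[of _ "Re (pk1 0 x)"]) auto
 qed
qed

lemma xc_inside: "abs t <= 2 ==> xc t = cubic t / 6"
 by (simp add: xc_def cutoff_simps)

lemma xc_minus: "xc (- t) = - xc t"
 by (simp add: xc_def cutoff_def cubic_def field_simps)

lemma xc_range: assumes "abs t <= 2" shows "abs (xc t) <= 1 / 3"
proof -
 have "(t - 2) * (t + 1)\<^sup>2 <= 0" "(t + 2) * (t - 1)\<^sup>2 >= 0"
  using assms by (auto intro!: mult_nonpos_nonneg)
 then show ?thesis unfolding xc_inside[OF assms] cubic_def by (simp add: abs_le_iff power2_eq_square power3_eq_cube algebra_simps)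
qed

lemma xc_2: "xc 2 = 1 / 3" by (simp add: xc_inside cubic_def)

text \<open>On [-2, 2] the values of \<open>xc\<close> stay within 1/3 in absolute value, and beyond
  they leave this range monotonically.\<close>

lemma xc_double: assumes "xc a = xc b" "a ~= b" shows "abs a <= 2 & abs b <= 2"
proof -
 have key: "c <= 2" if e: "xc c = xc d" "c ~= d" for c d
 proof (rule ccontr)
  assume c: "~ c <= 2"
  then have x: "xc c > 1 / 3" using xc_mono[of 2 c] xc_2 by simp
  have "d > 2"
  proof (rule ccontr)
   assume "~ d > 2"
   then have "abs d <= 2 | 2 < - d" by auto
   then have "xc d <= 1 / 3"
    using xc_range[of d] xc_mono[of 2 "- d"] xc_2 xc_minus[of d] by auto
   then show False using x e by simp
  qed
  then show False using xc_mono[of c d] xc_mono[of d c] c e by (cases "c < d") auto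
 qed
 have "a <= 2" "b <= 2" "- a <= 2" "- b <= 2"
  using key[of a b] key[of b a] key[of "- a" "- b"] key[of "- b" "- a"] assms xc_minus by auto
 then show ?thesis by auto
qed

lemma cubic'_zero: "cubic' t = 0 \<longleftrightarrow> t = 1 | t = - 1"
 unfolding cubic'_def by (auto simp: power2_eq_1_iff)

context
 fixes s :: complex
 assumes s: "cmod s <= 1"
begin

lemma kg_bounds: "abs (kc s) <= 2 / 5" "abs (gc s) <= 1 / 10"
 using abs_Re_le_cmod[of s] abs_Im_le_cmod[of s] s by (auto simp: kc_def gc_def abs_mult)

lemma ycoord'_1: "ycoord' (kc s) (gc s) 1 < 0" "ycoord' (kc s) (gc s) (- 1) > 0"
 using kg_bounds by (auto simp: ycoord'_def cubic_def cubic'_def quad_def)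

lemma pk1_nonzero: "pk1 s t ~= 0"
proof (cases "abs t > 1")
 case True then show ?thesis using Re_pk1_pos[of t s] by auto
next
 case False
 show ?thesis
 proof
  assume "pk1 s t = 0"
  then have "cubic' t = 0" "ycoord' (kc s) (gc s) t = 0" using pk1_inside[of t s] False by (simp_all add: complex_eq_iff)
  then show False using ycoord'_1 unfolding cubic'_zero by auto
 qed
qed

lemma knot_params: "(slice knot s) \<in> params_upto 3"
proof (rule params_uptoI)
 show "smooth (slice knot s)" by (rule smooth_slice[OF smooth_knot])
 show "pz (velocity (slice knot s) t) ~= 0" for t using pk1_nonzero by (simp add: pk1_def)
 show "abs t >= 3 ==> knot (s, t) = x_axis t" for t by (rule knot_outside)
 show "inj (slice knot s)"
 proof (rule injI, rule ccontr)
  fix a b assume e: "knot (s, a) = knot (s, b)" and n: "a ~= b"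
  have "xc a = xc b" "cutoff a * a = cutoff b * b" using e by (simp_all add: knot_def vec_eq_iff forall_3)
  then show False using xc_double[of a b] n by (simp add: cutoff_simps)
 qed
qed

lemma pk_double:
 assumes "a ~= b" "pk s a = pk s b"
 shows "abs a < 2" "abs b < 2" "a\<^sup>2 + a * b + b\<^sup>2 = 3" "abs (a + b) < 2" "a + b = 0 | disc (kc s) (gc s) (a + b) = 0"
proof -
 have x: "xc a = xc b" using assms(2) by (simp add: pk_eq)
 have le: "abs a <= 2" "abs b <= 2" using xc_double[OF x assms(1)] by auto
 have "cubic a = cubic b" using x le by (simp add: xc_inside)
 then show h: "a\<^sup>2 + a * b + b\<^sup>2 = 3" using cubic_eq_iff[OF assms(1)] by simp
 have "(b - a)\<^sup>2 > 0" using assms(1) by simp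
 then have "(a + b)\<^sup>2 < 2\<^sup>2" unfolding diff_square[OF h] by simp
 then show "abs (a + b) < 2" using abs_le_square_iff[of 2 "a + b"] by (simp add: not_le[symmetric])
 have "ycoord (kc s) (gc s) a = ycoord (kc s) (gc s) b" using assms(2) le by (simp add: pk_inside)
 then show d: "a + b = 0 | disc (kc s) (gc s) (a + b) = 0" using ycoord_diff[OF h, of "kc s" "gc s"] assms(1) by simp
 \<comment> \<open>A parameter 2 or -2 is paired with the critical point -1 or 1 of the cubic, so
   the sum would be 1 or -1, where \<open>disc\<close> is negative. The strict bound is what gives
   access to the derivative formulas.\<close>
 have "False" if "{x, y} = {a, b}" "abs x = 2" for x y
 proof -
  have h': "x\<^sup>2 + x * y + y\<^sup>2 = 3" "x + y = a + b" using that(1) h by (auto simp: doubleton_eq_iff algebra_simps)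
  have "x = 2 | x = - 2" using that(2) by auto
  moreover have "(y + 1)\<^sup>2 = 0" if "x = 2" using h'(1) that by (simp add: power2_eq_square algebra_simps)
  moreover have "(y - 1)\<^sup>2 = 0" if "x = - 2" using h'(1) that by (simp add: power2_eq_square algebra_simps)
  ultimately have "a + b = 1 | a + b = - 1" using h'(2) by auto
  then show False
   using d disc_neg[OF kg_bounds, of 1] disc_neg[of "- kc s" "gc s" 1] kg_bounds disc_flip(1)[of "kc s" "gc s" 1] by auto
 qed
 from this[of a b] this[of b a] le show "abs a < 2" "abs b < 2" by (auto simp: less_le)
qed

lemma pk_double_cross:
 assumes "a ~= b" "pk s a = pk s b"
 shows "6 * crs (pk1 s a) (pk1 s b) = (b - a) * cross_poly (kc s) (gc s) (a + b)"
 using cross_det[OF pk_double(3)[OF assms], of "kc s" "gc s"]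
 by (simp add: pk1_inside pk_double(1,2)[OF assms] crs_def algebra_simps)

text \<open>At a double point \<open>(a + b) * disc\<close> vanishes, so the determinant is
  proportional to \<open>disc + (a + b) * disc'\<close>. The permanent double point with sum 0 has
  positive \<open>disc\<close> and is never tangent.\<close>

lemma pk_double_tangent:
 assumes "a ~= b" "pk s a = pk s b"
 shows "crs (pk1 s a) (pk1 s b) = 0 \<longleftrightarrow> tangent_at (kc s) (gc s) (a + b)"
proof -
 note d = pk_double[OF assms]
 have "4 - (a + b)\<^sup>2 ~= 0" using diff_square[OF d(3)] assms(1) by auto
 then have "crs (pk1 s a) (pk1 s b) = 0 \<longleftrightarrow> disc (kc s) (gc s) (a + b) + (a + b) * disc' (kc s) (a + b) = 0"
  using pk_double_cross[OF assms] assms(1) d(5) by (auto simp: cross_poly_def)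
 moreover have "disc (kc s) (gc s) 0 > 0" by (rule disc_pos_near_0[OF kg_bounds]) auto
 ultimately show ?thesis using d(4,5) by (auto simp: tangent_at_def)
qed

lemma pk_double_nondegenerate:
 assumes "a ~= b" "pk s a = pk s b" and c: "pk1 s a = c *\<^sub>R pk1 s b" and d2: "disc'' (kc s) (a + b) ~= 0"
 shows "crs (pk2 s a - c\<^sup>2 *\<^sub>R pk2 s b) (pk1 s b) ~= 0"
proof
 assume z: "crs (pk2 s a - c\<^sup>2 *\<^sub>R pk2 s b) (pk1 s b) = 0"
 note d = pk_double[OF assms(1,2)]
 have t: "tangent_at (kc s) (gc s) (a + b)" using pk_double_tangent[OF assms(1,2)] c by simp
 have "4 - (a + b)\<^sup>2 ~= 0" using diff_square[OF d(3)] assms(1) by auto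
 moreover have "a + b ~= 0" using t disc_pos_near_0[OF kg_bounds, of 0] by (auto simp: tangent_at_def)
 ultimately have "9 * (4 - (a + b)\<^sup>2)\<^sup>2 * (b - a) * (a + b) * disc'' (kc s) (a + b) ~= 0" using assms(1) d2 by simp
 moreover have "6 * (cubic' b * crs (pk2 s a) (pk1 s b) + cubic' a * crs (pk1 s a) (pk2 s b)) =
   9 * (4 - (a + b)\<^sup>2)\<^sup>2 * (b - a) * (a + b) * disc'' (kc s) (a + b)"
  using second_order[OF d(3), of "kc s" "gc s"] t
  by (simp add: pk1_inside pk2_inside d(1,2) crs_def tangent_at_def algebra_simps)
 moreover have "cubic' a = c * cubic' b" using arg_cong[OF c, of Re] by (simp add: pk1_inside d(1,2))
 then have "cubic' b * crs (pk2 s a) (pk1 s b) + cubic' a * crs (pk1 s a) (pk2 s b) = cubic' b * crs (pk2 s a - c\<^sup>2 *\<^sub>R pk2 s b) (pk1 s b)"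
  unfolding c using crs_swap[of "pk1 s b" "pk2 s b"] by (simp add: algebra_simps power2_eq_square)
 ultimately show False using z by simp
qed

text \<open>Three parameters of equal x are the roots of a cubic without quadratic term, so they sum
  to 0. Comparing the two height equations leaves \<open>quad = 0\<close>, then x = 0, and hence
  \<open>g = 0\<close>.\<close>

lemma pk_triple:
 assumes "a < b" "b < c" "pk s a = pk s b" "pk s a = pk s c"
 shows "a = - sqrt 3 & b = 0 & c = sqrt 3 & gc s = 0"
proof -
 have ne: "a ~= b" "a ~= c" "b ~= c" and e: "pk s b = pk s c" using assms by auto
 note ab = pk_double[OF ne(1) assms(3)] and ac = pk_double[OF ne(2) assms(4)] and bc = pk_double[OF ne(3) e]
 have "(b - c) * (a + b + c) = 0" using ab(3) ac(3) by (simp add: algebra_simps power2_eq_square)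
 then have c: "c = - (a + b)" using ne(3) by auto
 define X q where "X = cubic a" and "q = quad (kc s) (gc s) X"
 have cX: "cubic b = X" "cubic c = X" using cubic_eq_iff[OF ne(1)] cubic_eq_iff[OF ne(2)] ab(3) ac(3) by (simp_all add: X_def)
 have "ycoord (kc s) (gc s) a = ycoord (kc s) (gc s) b" "ycoord (kc s) (gc s) a = ycoord (kc s) (gc s) c"
  using assms(3,4) ab(1,2) ac(2) by (simp_all add: pk_inside)
 then have "(a - b) * (X / 2 + (a + b) * q) = 0" "(a - c) * (X / 2 + (a + c) * q) = 0"
  unfolding ycoord_def cX X_def[symmetric] q_def[symmetric] by (simp_all add: field_simps power2_eq_square)
 then have lin: "X / 2 + (a + b) * q = 0" "X / 2 + (a + c) * q = 0" using ne by auto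
 have "(b - c) * q = (X / 2 + (a + b) * q) - (X / 2 + (a + c) * q)" by (simp add: algebra_simps)
 then have "(b - c) * q = 0" unfolding lin by simp
 then have q0: "q = 0" using ne(3) by simp
 then have X0: "X = 0" using lin by simp
 then have "gc s = 0" using q0 by (simp add: q_def quad_def)
 moreover have root: "t = 0 | t\<^sup>2 = 3" if "cubic t = 0" for t
 proof -
  have "t * (t\<^sup>2 - 3) = 0" using that by (simp add: cubic_def algebra_simps power2_eq_square power3_eq_cube)
  then show ?thesis by auto
 qed
 have s3: "t = sqrt 3 | t = - sqrt 3" if "t\<^sup>2 = 3" for t :: real
  using real_sqrt_abs[of t] that by (auto simp: abs_if split: if_splits)
 have "a \<in> {0, sqrt 3, - sqrt 3}" "b \<in> {0, sqrt 3, - sqrt 3}" "c \<in> {0, sqrt 3, - sqrt 3}"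
  using root[of a] root[of b] root[of c] s3 cX X0 X_def by auto
 moreover have "sqrt 3 > (0::real)" by simp
 ultimately show ?thesis using assms(1,2) by auto
qed

end

definition loop :: "complex => (real^3) set" where "loop s = range (slice knot s)"

text \<open>The second coordinate is affine in \<open>s\<close>, so the derivative is read off along
  a straight line.\<close>

lemma knot_velocity: "pz (family_velocity knot s a t) = Complex 0 (cutoff t * (t\<^sup>2 * (gc a + kc a * cubic t)))"
proof -
 have "((%h. (s + h *\<^sub>R a, t)) has_derivative (%h. (h *\<^sub>R a, 0))) (at (0::real))"
  by (auto intro!: derivative_eq_intros)
 from has_derivative_compose[OF this, of knot] smooth_has_derivative[OF smooth_knot, of "(s, t)"]
 have "((%h. knot (s + h *\<^sub>R a, t)) has_derivative (%h. frechet_derivative knot (at (s, t)) (h *\<^sub>R a, 0))) (at 0)" by simp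
 moreover have "frechet_derivative knot (at (s, t)) (h *\<^sub>R a, 0) = h *\<^sub>R family_velocity knot s a t" for h
  using family_velocity_scaleR[OF smooth_knot, of s h a] by (simp add: family_velocity_def fun_eq_iff)
 ultimately have "((%h. knot (s + h *\<^sub>R a, t)) has_vector_derivative family_velocity knot s a t) (at 0)"
  by (simp add: has_vector_derivative_def)
 from bounded_linear.has_vector_derivative[OF bounded_linear_pz this]
 have 1: "((%h. pk (s + h *\<^sub>R a) t) has_vector_derivative pz (family_velocity knot s a t)) (at 0)" by (simp add: pk_def)
 have "(%h. pk (s + h *\<^sub>R a) t) = (%h. pk s t + h *\<^sub>R Complex 0 (cutoff t * (t\<^sup>2 * (gc a + kc a * cubic t))))"
  by (simp add: fun_eq_iff pk_eq complex_eq_iff ycoord_def quad_def kc_def gc_def field_simps)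
 moreover have "((%h. pk s t + h *\<^sub>R Complex 0 (cutoff t * (t\<^sup>2 * (gc a + kc a * cubic t)))) has_vector_derivative
   Complex 0 (cutoff t * (t\<^sup>2 * (gc a + kc a * cubic t)))) (at 0)"
  by (auto intro!: derivative_eq_intros)
 ultimately have "((%h. pk (s + h *\<^sub>R a) t) has_vector_derivative Complex 0 (cutoff t * (t\<^sup>2 * (gc a + kc a * cubic t)))) (at 0)" by simp
 from vector_derivative_unique_at[OF 1 this] show ?thesis .
qed

lemma on_loop_circle: "cmod s = 1 ==> on_loop (kc s) (gc s)"
proof -
 assume "cmod s = 1"
 then have "(Re s)\<^sup>2 + (Im s)\<^sup>2 = 1" using cmod_power2[of s] by simp
 then show ?thesis by (simp add: on_loop_def kc_def gc_def power_mult_distrib power_divide)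
qed

lemma pk_doubleI:
 assumes h: "a\<^sup>2 + a * b + b\<^sup>2 = 3" and ab: "a ~= b" and d: "disc (kc s) (gc s) (a + b) = 0"
 shows "pk s a = pk s b"
proof -
 have "x\<^sup>2 <= 2\<^sup>2" if "x\<^sup>2 + x * y + y\<^sup>2 = 3" for x y :: real
 proof -
  have e: "4 - x\<^sup>2 = (4 / 3) * (x / 2 + y)\<^sup>2" using that by (simp add: power2_eq_square field_simps)
  have "0 <= 4 - x\<^sup>2" unfolding e by simp
  then show ?thesis by simp
 qed
 from this[of a b] this[of b a] h have "abs a <= 2" "abs b <= 2"
  using power2_le_iff_abs_le[of 2 a] power2_le_iff_abs_le[of 2 b] by (simp_all add: algebra_simps)
 then show ?thesis using cubic_eq_iff[OF ab] h ycoord_diff[OF h, of "kc s" "gc s"] d by (simp add: pk_inside)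
qed

text \<open>With \<open>upper\<close>, the two solutions of \<open>a^2 + a b + b^2 = 3\<close> whose
  sum is \<open>sgm\<close>, that is, the pair with equal x.\<close>

definition lower :: "real => real" where "lower sgm = (sgm - sqrt (12 - 3 * sgm\<^sup>2)) / 2"
definition upper :: "real => real" where "upper sgm = (sgm + sqrt (12 - 3 * sgm\<^sup>2)) / 2"

lemma lower_upper:
 assumes "abs (sgm) < 2"
 shows "lower sgm < upper sgm" "lower sgm + upper sgm = sgm" "(lower sgm)\<^sup>2 + lower sgm * upper sgm + (upper sgm)\<^sup>2 = 3"
proof -
 have "sgm\<^sup>2 < 2\<^sup>2" using assms abs_le_square_iff[of 2 sgm] by (simp add: not_le[symmetric])
 then have p: "12 - 3 * sgm\<^sup>2 > 0" by simp
 then show "lower sgm < upper sgm" by (simp add: lower_def upper_def)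
 show "lower sgm + upper sgm = sgm" by (simp add: lower_def upper_def field_simps)
 define r where "r = sqrt (12 - 3 * sgm\<^sup>2)"
 have r: "r\<^sup>2 = 12 - 3 * sgm\<^sup>2" using p by (simp add: r_def)
 have "(lower sgm)\<^sup>2 + lower sgm * upper sgm + (upper sgm)\<^sup>2 = (3 * sgm\<^sup>2 + r\<^sup>2) / 4"
  unfolding lower_def upper_def r_def[symmetric] by (simp add: field_simps power2_eq_square)
 then show "(lower sgm)\<^sup>2 + lower sgm * upper sgm + (upper sgm)\<^sup>2 = 3" unfolding r by simp
qed

lemma pair_unique:
 assumes "a + b = a' + b'" "a\<^sup>2 + a * b + b\<^sup>2 = 3" "a'\<^sup>2 + a' * b' + b'\<^sup>2 = (3::real)"
 shows "(a, b) = (a', b') | (a, b) = (b', a')"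
proof -
 have "a * b = a' * b'" using prod_sum[OF assms(2)] prod_sum[OF assms(3)] assms(1) by simp
 moreover have "b = a' + b' - a" using assms(1) by simp
 ultimately have "(a - a') * (a - b') = 0" by (simp add: algebra_simps)
 then show ?thesis using assms(1) by auto
qed

context
 fixes s :: complex
 assumes s: "cmod s = 1"
begin

lemma s_le: "cmod s <= 1" using s by simp

lemma pk_triple_any:
 assumes "a ~= b" "a ~= c" "b ~= c" "pk s a = pk s b" "pk s a = pk s c"
 shows "gc s = 0"
proof -
 have "\<exists>x y z. {x, y, z} = {a, b, c} & x < y & y < z"
  using assms(1-3) by (metis insert_commute linorder_neqE_linordered_idom)
 then obtain x y z where xyz: "{x, y, z} = {a, b, c}" "x < y" "y < z" by blast
 then have "pk s x = pk s a" "pk s y = pk s a" "pk s z = pk s a" using assms(4,5) by (metis insertCI insertE singletonD)+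
 then show ?thesis using pk_triple[OF s_le xyz(2,3)] by simp
qed

lemma transversal_pk: "transversal (slice knot s) a b \<longleftrightarrow> crs (pk1 s a) (pk1 s b) ~= 0"
 by (simp add: transversal_iff[OF smooth_slice[OF smooth_knot]] pk1_def)

lemma branches_pk: "a \<in> branches (slice knot s) q ==> b \<in> branches (slice knot s) q ==> pk s a = pk s b"
 using pr_eq_iff[of "knot (s, a)" "knot (s, b)"] by (simp add: branches_def pk_def)

lemma loop_generic:
 assumes nt: "!!sgm. ~ tangent_at (kc s) (gc s) sgm" and g: "gc s ~= 0"
 shows "loop s \<in> stratum0 & transverse_at knot {a. orthogonal s a} stratum0 s"
proof -
 note par = params_upto_params[OF knot_params[OF s_le]]
 have "generic_point (slice knot s) q" for q
  unfolding generic_point_iff transversal_pk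
 proof (intro conjI ballI impI notI)
  fix a b assume ab: "a \<in> branches (slice knot s) q" "b \<in> branches (slice knot s) q" "a ~= b" "crs (pk1 s a) (pk1 s b) = 0"
  from pk_double_tangent[OF s_le ab(3) branches_pk[OF ab(1,2)]] ab(4) nt show False by simp
 next
  assume "\<exists>a\<in>branches (slice knot s) q. \<exists>b\<in>branches (slice knot s) q. \<exists>c\<in>branches (slice knot s) q. a ~= b & a ~= c & b ~= c"
  then obtain a b c where abc: "a \<in> branches (slice knot s) q" "b \<in> branches (slice knot s) q" "c \<in> branches (slice knot s) q"
   "a ~= b" "a ~= c" "b ~= c" by (elim bexE conjE) (rule that, assumption+)
  from pk_triple_any[OF abc(4-6) branches_pk[OF abc(1,2)] branches_pk[OF abc(1,3)]] g show False by simp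
 qed
 then show ?thesis
  using strata_iff(1)[OF par] transverse_at_stratum0[OF smooth_knot par, of "{a. orthogonal s a}"]
  by (simp add: loop_def orthogonal_clauses)
qed

lemma rotate_orthogonal: "r *\<^sub>R (\<i> * s) \<in> {a. orthogonal s a}"
 by (simp add: orthogonal_def inner_complex_def algebra_simps)

lemma rotate_kg: "kc (\<i> * s) = - 4 * gc s" "gc (\<i> * s) = kc s / 4"
 by (simp_all add: kc_def gc_def)

lemma loop_tangent:
 assumes t: "tangent_at (kc s) (gc s) sgm"
 shows "loop s \<in> stratum1 & transverse_at knot {a. orthogonal s a} stratum1 s"
proof -
 let ?f = "%t. knot (s, t)"
 note lt = loop_tangency[OF on_loop_circle[OF s] t]
 have sg: "abs (sgm) < 2" "disc (kc s) (gc s) sgm = 0" using t by (auto simp: tangent_at_def)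
 define a0 b0 where "a0 = lower sgm" and "b0 = upper sgm"
 have ab: "a0 < b0" "a0 + b0 = sgm" "a0\<^sup>2 + a0 * b0 + b0\<^sup>2 = 3" using lower_upper[OF sg(1)] by (simp_all add: a0_def b0_def)
 have ne: "a0 ~= b0" using ab(1) by simp
 have P: "pk s a0 = pk s b0" by (rule pk_doubleI[OF ab(3) ne]) (simp add: ab(2) sg(2))
 note dd = pk_double[OF s_le ne P]
 have cr: "crs (pk1 s a0) (pk1 s b0) = 0" using pk_double_tangent[OF s_le ne P] t ab(2) by simp
 obtain c where c: "pk1 s a0 = c *\<^sub>R pk1 s b0" using crs_eq_0D[OF cr pk1_nonzero[OF s_le]] by blast
 have nd: "crs (pk2 s a0 - c\<^sup>2 *\<^sub>R pk2 s b0) (pk1 s b0) ~= 0"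
  by (rule pk_double_nondegenerate[OF s_le ne P c]) (use lt ab(2) in simp)
 have only: "(a, b) = (a0, b0) | (a, b) = (b0, a0)" if e: "a ~= b" "pk s a = pk s b" "crs (pk1 s a) (pk1 s b) = 0" for a b
 proof -
  have "tangent_at (kc s) (gc s) (a + b)" using pk_double_tangent[OF s_le e(1,2)] e(3) by simp
  then have "a + b = sgm" using loop_tangency_unique[OF on_loop_circle[OF s] _ t] by blast
  then show ?thesis using pair_unique[of a b a0 b0] pk_double(3)[OF s_le e(1,2)] ab by simp
 qed
 have no3: False if "a ~= b" "a ~= c" "b ~= c" "pk s a = pk s b" "pk s a = pk s c" for a b c
  using pk_triple_any[OF that] lt by simp
 have R3: "(3::real) > 0" by simp
 obtain delta where d: "delta > 0" "!!e. abs e < delta ==> range (%t. ?f t + e *\<^sub>R 0) \<in> stratum1"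
  by (rule tangency_stratum1[OF knot_params[OF s_le] R3 smooth_const[of 0] refl ne P[unfolded pk_def] c[unfolded pk1_def] nd[unfolded pk1_def pk2_def] _ _
    only[unfolded pk_def pk1_def] no3[unfolded pk_def]])
   (simp, simp add: velocity_def, assumption+, rule that, assumption+)
 have "loop s \<in> stratum1" using d(2)[of 0] d(1) by (simp add: loop_def)
 moreover have "transverse_at knot {a. orthogonal s a} stratum1 s"
 proof (rule transverse_at_hypersurface[OF smooth_knot R3 knot_outside rotate_orthogonal, where l = "%w. crs (pz (w a0) - pz (w b0)) (pk1 s b0)"])
  define X where "X = cubic a0"
  have X: "cubic b0 = X" "X = sgm * (3 - sgm\<^sup>2)" using cubic_sum[OF ab(3)] ab(2) by (simp_all add: X_def)
  \<comment> \<open>The rate of \<open>g + K X\<close> under rotation of \<open>s\<close>.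
    Multiplied by \<open>kc s\<close> it is \<open>K^2 / 4 - 4 g (K X)\<close>, positive by the
    signs in \<open>loop_tangency\<close>; so the loop moves across the stratum.\<close>
  define m where "m = kc s / 4 - 4 * gc s * X"
  have "kc s * X > 0" "gc s < 0" using lt X(2) by auto
  then have "kc s * m > 0"
   unfolding m_def using mult_neg_pos[of "gc s" "kc s * X"] by (simp add: right_diff_distrib) (smt (verit) mult.left_commute zero_le_square)
  then have m: "m ~= 0" by auto
  have "cubic' a0 * cubic' b0 ~= 0"
  proof -
   have "sgm\<^sup>2 ~= 1" "sgm\<^sup>2 ~= 4" using lt sg(1) power2_eq_iff[of sgm 2] by (auto simp: power2_eq_1_iff)
   then show ?thesis unfolding cubic'_prod[OF ab(3)] ab(2) by simp
  qed
  then have cb: "cubic' b0 ~= 0" by simp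
  have "sgm ~= 0" using lt by auto
  then have "a0\<^sup>2 - b0\<^sup>2 ~= 0" using ne ab(2) by (simp add: power2_eq_square square_diff_square_factored)
  moreover have "pz (family_velocity knot s (\<i> * s) a0) - pz (family_velocity knot s (\<i> * s) b0) = Complex 0 ((a0\<^sup>2 - b0\<^sup>2) * m)"
   unfolding knot_velocity rotate_kg X(1) X_def[symmetric] m_def using dd(1,2)
   by (simp add: cutoff_simps complex_eq_iff algebra_simps)
  ultimately show "crs (pz (family_velocity knot s (\<i> * s) a0) - pz (family_velocity knot s (\<i> * s) b0)) (pk1 s b0) ~= 0"
   using m cb by (simp add: crs_def pk1_inside dd(2))
  fix w :: "real => real^3" and R' assume w: "smooth w" "R' >= 3" "!!t. abs t >= R' ==> w t = 0" "crs (pz (w a0) - pz (w b0)) (pk1 s b0) = 0"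
  have R': "R' > 0" "abs a0 < R'" "abs b0 < R'" using w(2) dd(1,2) by auto
  show "w \<in> tangent_vectors stratum1 ?f"
   by (rule tangency_tangent_vector[OF params_upto_mono[OF knot_params[OF s_le] w(2)] R'(1) w(1,3) ne P[unfolded pk_def] c[unfolded pk1_def] R'(2,3) nd[unfolded pk1_def pk2_def]
     only[unfolded pk_def pk1_def] no3[unfolded pk_def] w(4)[unfolded pk1_def]])
 qed (simp_all add: algebra_simps)
 ultimately show ?thesis by blast
qed

lemma loop_triple:
 assumes g: "gc s = 0"
 shows "loop s \<in> stratum1 & transverse_at knot {a. orthogonal s a} stratum1 s"
proof -
 let ?f = "%t. knot (s, t)"
 define a0 b0 c0 where "a0 = - sqrt (3::real)" and "b0 = (0::real)" and "c0 = sqrt (3::real)"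
 have lt: "abs a0 < 2" "abs b0 < 2" "abs c0 < 2" using real_less_lsqrt[of 2 3] by (simp_all add: a0_def b0_def c0_def)
 have o: "a0 < b0" "b0 < c0" by (simp_all add: a0_def b0_def c0_def)
 have cu: "cubic a0 = 0" "cubic b0 = 0" "cubic c0 = 0" by (simp_all add: cubic_def a0_def b0_def c0_def power3_eq_cube)
 have P: "pk s a0 = pk s b0" "pk s a0 = pk s c0"
  using lt cu g by (simp_all add: pk_inside ycoord_def quad_def)
 have tv: "crs (pk1 s a) (pk1 s b) ~= 0" if "a ~= b" "pk s a = pk s b" for a b
  using pk_double_tangent[OF s_le that] loop_tangency[OF on_loop_circle[OF s]] g by force
 have only: "(a, b, c) = (a0, b0, c0)" if "a < b" "b < c" "pk s a = pk s b" "pk s a = pk s c" for a b c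
  using pk_triple[OF s_le that] by (simp add: a0_def b0_def c0_def)
 have R3: "(3::real) > 0" by simp
 obtain delta where d: "delta > 0" "!!e. abs e < delta ==> range (%t. ?f t + e *\<^sub>R 0) \<in> stratum1"
  by (rule triple_stratum1[OF knot_params[OF s_le] R3 smooth_const[of 0] refl o P[unfolded pk_def] refl refl tv[unfolded pk_def pk1_def] only[unfolded pk_def]])
   (assumption+, rule that, assumption+)
 have "loop s \<in> stratum1" using d(2)[of 0] d(1) by (simp add: loop_def)
 moreover have "transverse_at knot {a. orthogonal s a} stratum1 s"
 proof (rule transverse_at_hypersurface[OF smooth_knot R3 knot_outside rotate_orthogonal,
    where l = "%w. crs (pz (w a0) - pz (w b0)) (pk1 s b0) / crs (pk1 s a0) (pk1 s b0) - crs (pz (w a0) - pz (w c0)) (pk1 s c0) / crs (pk1 s a0) (pk1 s c0)"])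
  have k: "kc s ~= 0" using on_loop_circle[OF s] g by (auto simp: on_loop_def)
  \<comment> \<open>Under rotation \<open>g\<close> moves at rate \<open>kc s / 4\<close>. The
    displacement \<open>t^2\<close> times this rate separates the two outer branches from the middle
    one and not from each other.\<close>
  have "pz (family_velocity knot s (\<i> * s) a0) - pz (family_velocity knot s (\<i> * s) b0) = Complex 0 (3 * kc s / 4)"
   "pz (family_velocity knot s (\<i> * s) a0) - pz (family_velocity knot s (\<i> * s) c0) = 0"
   unfolding knot_velocity rotate_kg cu using lt
   by (simp_all add: cutoff_simps complex_eq_iff a0_def b0_def c0_def)
  moreover have "crs (Complex 0 (3 * kc s / 4)) (pk1 s b0) ~= 0" using k lt by (simp add: crs_def pk1_inside b0_def cubic'_def)
  moreover have "crs (pk1 s a0) (pk1 s b0) ~= 0" by (rule tv) (use o P in auto)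
  ultimately show "crs (pz (family_velocity knot s (\<i> * s) a0) - pz (family_velocity knot s (\<i> * s) b0)) (pk1 s b0) / crs (pk1 s a0) (pk1 s b0) -
   crs (pz (family_velocity knot s (\<i> * s) a0) - pz (family_velocity knot s (\<i> * s) c0)) (pk1 s c0) / crs (pk1 s a0) (pk1 s c0) ~= 0" by simp
  fix w :: "real => real^3" and R' assume w: "smooth w" "R' >= 3" "!!t. abs t >= R' ==> w t = 0"
   "crs (pz (w a0) - pz (w b0)) (pk1 s b0) / crs (pk1 s a0) (pk1 s b0) - crs (pz (w a0) - pz (w c0)) (pk1 s c0) / crs (pk1 s a0) (pk1 s c0) = 0"
  have R': "R' > 0" "abs a0 < R'" "abs b0 < R'" "abs c0 < R'" using w(2) lt by auto
  show "w \<in> tangent_vectors stratum1 ?f"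
   by (rule triple_tangent_vector[OF params_upto_mono[OF knot_params[OF s_le] w(2)] R'(1) w(1,3) o P[unfolded pk_def] R'(2-4)
     tv[unfolded pk_def pk1_def] only[unfolded pk_def] w(4)[unfolded pk1_def]])
 qed (simp_all add: diff_divide_distrib add_divide_distrib algebra_simps)
 ultimately show ?thesis by blast
qed

lemma loop_stratum: "\<exists>X\<in>{stratum0, stratum1}. loop s \<in> X & transverse_at knot {a. orthogonal s a} X s"
 using loop_generic loop_tangent loop_triple by blast

text \<open>At the triple points the oriented tangents \<open>(1, y')\<close>, \<open>(-1/2, 0)\<close>, \<open>(1, y')\<close> are all
 positive on one covector, so these are braid-like.\<close>

lemma loop_no_star: "~ has_star_like_triple_crossing (loop s)"
proof
 let ?f = "%t. knot (s, t)"
 assume "has_star_like_triple_crossing (loop s)"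
 then obtain q where q: "star_like_triple_crossing ?f q"
  unfolding loop_def strata_iff(4)[OF params_upto_params[OF knot_params[OF s_le]]] by blast
 then have c3: "card (branches ?f q) = 3" by (simp add: star_like_triple_crossing_def multi_crossing_def)
 then obtain x y z where xyz: "branches ?f q = {x, y, z}" "x ~= y" "y ~= z" "x ~= z" unfolding card_3_iff by blast
 have "\<exists>a b c. {a, b, c} = {x, y, z} & a < b & b < c"
  using xyz(2-4) by (metis insert_commute linorder_neqE_linordered_idom)
 then obtain a b c where abc: "branches ?f q = {a, b, c}" "a < b" "b < c" unfolding xyz(1) by metis
 have "pk s a = pk s b" "pk s a = pk s c" using branches_pk[of _ q] unfolding abc(1) by auto
 from pk_triple[OF s_le abc(2,3) this] have e: "a = - sqrt 3" "b = 0" "c = sqrt 3" "gc s = 0" by auto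
 have k2: "(kc s)\<^sup>2 = 4 / 25" using on_loop_circle[OF s] e(4) by (simp add: on_loop_def)
 have lt: "sqrt (3::real) < 2" using real_less_lsqrt[of 2 3] by simp
 have dir: "direction ?f t $ 1 = Re (pk1 s t)" "direction ?f t $ 2 = Im (pk1 s t)" for t
  by (simp_all add: direction_nth[OF smooth_slice[OF smooth_knot]] pk1_def)
 have v: "pk1 s (- sqrt 3) = Complex 1 (- 3 * sqrt 3 + 18 * kc s)" "pk1 s 0 = Complex (- 1 / 2) 0" "pk1 s (sqrt 3) = Complex 1 (3 * sqrt 3 + 18 * kc s)"
  using lt by (simp_all add: pk1_inside cubic'_def ycoord'_def cubic_def quad_def e(4) complex_eq_iff power3_eq_cube algebra_simps)
 \<comment> \<open>With |K| = 2/5 the smaller slope is \<open>36 / 5 - 3 * sqrt 3\<close> in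
   absolute value; this bound keeps it above 9/5, more than the 1 that the first coordinate
   costs.\<close>
 have sq3: "sqrt (3::real) < 9 / 5" by (rule real_less_lsqrt) (simp_all add: power_divide)
 have "kc s = 2 / 5 | kc s = - 2 / 5" using k2 power2_eq_iff[of "kc s" "2/5"] by (simp add: power_divide)
 then have "\<exists>m. \<forall>t\<in>{a, b, c}. - Re (pk1 s t) + m * Im (pk1 s t) > 0"
 proof
  assume k: "kc s = 2 / 5"
  show ?thesis using sq3 sqrt3(1) by (intro exI[of _ 1]) (simp add: e v k)
 next
  assume k: "kc s = - 2 / 5"
  show ?thesis using sq3 sqrt3(1) by (intro exI[of _ "- 1"]) (simp add: e v k)
 qed
 then obtain m where m: "\<forall>t\<in>{a, b, c}. - Re (pk1 s t) + m * Im (pk1 s t) > 0" ..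
 define n :: "real^2" where "n = vector [-1, m]"
 have "n \<bullet> direction ?f t = - Re (pk1 s t) + m * Im (pk1 s t)" for t
  by (simp add: inner_vec_def UNIV_2 n_def dir)
 then have "\<exists>n. \<forall>t\<in>branches ?f q. n \<bullet> direction ?f t > 0" unfolding abc(1) using m by metis
 then show False using q unfolding star_like_triple_crossing_def by blast
qed

end

section \<open>Continuity and contractibility of the loop\<close>

definition shape :: "nat => real => real^3" where
 "shape n t = vector [0, cutoff t * (t\<^sup>2 * cubic t ^ n), 0]"

lemma knot_affine: "knot (s, t) = knot (0, t) + kc s *\<^sub>R shape 1 t + gc s *\<^sub>R shape 0 t"
 by (simp add: knot_def shape_def vec_eq_iff forall_3 ycoord_def quad_def kc_def gc_def algebra_simps)

lemma smooth_shape: "smooth (shape n)"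
 unfolding shape_def[abs_def]
 by (intro smooth_vector3 smooth_mult smooth_power smooth_const smooth_ident smooth_cutoff smooth_cubic)

lemma smooth_iterated_velocity: "smooth f ==> smooth ((velocity ^^ i) f)" for f :: "real => 'b::real_normed_vector"
 by (induction i) (simp_all add: smooth_velocity)

lemma iterated_velocity_add:
 fixes f g :: "real => 'b::real_normed_vector"
 assumes "smooth f" "smooth g"
 shows "(velocity ^^ i) (%t. f t + c *\<^sub>R g t) = (%t. (velocity ^^ i) f t + c *\<^sub>R (velocity ^^ i) g t)"
proof (induction i)
 case (Suc i)
 have "((%t. (velocity ^^ i) f t + c *\<^sub>R (velocity ^^ i) g t) has_vector_derivative
   (velocity ^^ Suc i) f t + c *\<^sub>R (velocity ^^ Suc i) g t) (at t)" for t
  using smooth_velocity(2)[OF smooth_iterated_velocity[OF assms(1), of i]] smooth_velocity(2)[OF smooth_iterated_velocity[OF assms(2), of i]]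
  by (auto intro!: derivative_eq_intros)
 then have "velocity (%t. (velocity ^^ i) f t + c *\<^sub>R (velocity ^^ i) g t) = (%t. (velocity ^^ Suc i) f t + c *\<^sub>R (velocity ^^ Suc i) g t)"
  by (intro ext velocity_at)
 then show ?case using Suc by simp
qed simp

lemma iterated_velocity_zero:
 fixes f :: "real => 'b::real_normed_vector"
 assumes f: "smooth f" "!!t. abs t >= r ==> f t = 0"
 shows "abs t > r ==> (velocity ^^ i) f t = 0"
proof (induction i arbitrary: t)
 case (Suc i)
 have "((velocity ^^ i) f has_vector_derivative 0) (at t)"
  by (rule has_vector_derivative_transform_within_open[of "%_. 0" _ _ "{x. abs x > r}"])
   (use Suc in \<open>auto intro!: open_Collect_less continuous_intros\<close>)
 then show ?case by (simp add: velocity_at)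
qed (use f in simp)

lemma iterated_velocity_bounded:
 fixes f :: "real => 'b::real_normed_vector"
 assumes f: "smooth f" "!!t. abs t >= r ==> f t = 0"
 obtains B where "!!i t. i <= k ==> norm ((velocity ^^ i) f t) <= B"
proof -
 have "\<exists>B. \<forall>t. norm ((velocity ^^ i) f t) <= B" for i
 proof -
  have "compact ((velocity ^^ i) f ` {-abs r..abs r})"
   by (intro compact_continuous_image smooth_continuous smooth_iterated_velocity f) simp
  then obtain B where B: "\<forall>x\<in>(velocity ^^ i) f ` {-abs r..abs r}. norm x <= B" using compact_imp_bounded bounded_iff by blast
  have "norm ((velocity ^^ i) f t) <= max B 0" for t
  proof (cases "t \<in> {-abs r..abs r}")
   case True then show ?thesis using B by (simp add: le_max_iff_disj)
  next
   case False
   then have "abs t > r" by auto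
   then show ?thesis using iterated_velocity_zero[OF f] by simp
  qed
  then show ?thesis by blast
 qed
 then obtain B where B: "!!i t. norm ((velocity ^^ i) f t) <= B i" by metis
 show ?thesis
 proof (rule that)
  fix i t assume "i <= k"
  then have "B i <= Max (B ` {..k})" by (intro Max_ge) auto
  then show "norm ((velocity ^^ i) f t) <= Max (B ` {..k})" using B[of i t] by linarith
 qed
qed

text \<open>All these knots are standard beyond 3, so in the inductive limit only the topology of
  \<open>params_upto 3\<close> matters; there the affine dependence on \<open>s\<close> controls
  finitely many derivatives uniformly in \<open>t\<close>.\<close>

lemma knot_continuous: "continuous_map (top_of_set (cball 0 1)) param_space (%s t. knot (s, t))"
 unfolding continuous_map_def
proof (intro conjI allI impI)
 show "(%s t. knot (s, t)) \<in> topspace (top_of_set (cball 0 1)) \<rightarrow> topspace param_space"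
  using params_upto_params[OF knot_params] by (auto simp: topspace_param_space)
 fix U assume "openin param_space U"
 then have U: "open_params U" by (simp add: openin_param_space)
 show "openin (top_of_set (cball 0 1)) {s \<in> topspace (top_of_set (cball 0 1)). (slice knot s) \<in> U}"
  unfolding openin_euclidean_subtopology_iff
 proof (intro conjI ballI)
  fix s0 assume "s0 \<in> {s \<in> topspace (top_of_set (cball 0 1)). (slice knot s) \<in> U}"
  then have s0: "cmod s0 <= 1" "(slice knot s0) \<in> U" by auto
  have "(slice knot s0) \<in> U \<inter> params_upto 3" using s0 knot_params by auto
  with U obtain k e where e: "e > 0" "!!g. g \<in> params_upto 3 ==>
    (\<forall>i\<le>k. \<forall>t. dist ((velocity ^^ i) g t) ((velocity ^^ i) (slice knot s0) t) < e) ==> g \<in> U"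
   unfolding open_params_def by meson
  have z: "shape n t = 0" if "abs t >= 3" for n t using that by (simp add: shape_def cutoff_simps vec_eq_iff forall_3)
  obtain B1 where B1: "!!i t. i <= k ==> norm ((velocity ^^ i) (shape 1) t) <= B1"
   by (rule iterated_velocity_bounded[OF smooth_shape z]) (assumption, rule that, assumption+)
  obtain B0 where B0: "!!i t. i <= k ==> norm ((velocity ^^ i) (shape 0) t) <= B0"
   by (rule iterated_velocity_bounded[OF smooth_shape z]) (assumption, rule that, assumption+)
  define B where "B = abs B0 + abs B1 + 1"
  have Bp: "B > 0" by (simp add: B_def)
  show "\<exists>d>0. \<forall>s\<in>cball 0 1. dist s s0 < d --> s \<in> {s \<in> topspace (top_of_set (cball 0 1)). (slice knot s) \<in> U}"
  proof (intro exI[of _ "e / B"] conjI ballI impI)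
   show "e / B > 0" using e(1) Bp by simp
   fix s :: complex assume s: "s \<in> cball 0 1" "dist s s0 < e / B"
   have k: "abs (kc (s - s0)) <= cmod (s - s0)" "abs (gc (s - s0)) <= cmod (s - s0)"
    using abs_Re_le_cmod[of "s - s0"] abs_Im_le_cmod[of "s - s0"] by (auto simp: kc_def gc_def abs_mult)
   have dk: "kc (s - s0) = kc s - kc s0" "gc (s - s0) = gc s - gc s0" by (simp_all add: kc_def gc_def diff_divide_distrib)
   have "knot (s, t) = (knot (s0, t) + kc (s - s0) *\<^sub>R shape 1 t) + gc (s - s0) *\<^sub>R shape 0 t" for t
    unfolding knot_affine[of s t] knot_affine[of s0 t] dk by (simp add: scaleR_diff_left)
   then have v: "(velocity ^^ i) (slice knot s) = (%t. ((velocity ^^ i) (slice knot s0) t +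
     kc (s - s0) *\<^sub>R (velocity ^^ i) (shape 1) t) + gc (s - s0) *\<^sub>R (velocity ^^ i) (shape 0) t)" for i
    using iterated_velocity_add[of "%t. knot (s0, t) + kc (s - s0) *\<^sub>R shape 1 t" "shape 0" i "gc (s - s0)"]
     iterated_velocity_add[of "%t. knot (s0, t)" "shape 1" i "kc (s - s0)"]
    by (simp add: smooth_shape smooth_slice[OF smooth_knot] smooth_add smooth_scaleR)
   have "dist ((velocity ^^ i) (slice knot s) t) ((velocity ^^ i) (slice knot s0) t) < e" if i: "i <= k" for i t
   proof -
    have "dist ((velocity ^^ i) (slice knot s) t) ((velocity ^^ i) (slice knot s0) t) =
     norm (kc (s - s0) *\<^sub>R (velocity ^^ i) (shape 1) t + gc (s - s0) *\<^sub>R (velocity ^^ i) (shape 0) t)"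
     unfolding v dist_norm by (simp add: algebra_simps)
    also have "\<dots> <= abs (kc (s - s0)) * norm ((velocity ^^ i) (shape 1) t) + abs (gc (s - s0)) * norm ((velocity ^^ i) (shape 0) t)"
     using norm_triangle_ineq[of "kc (s - s0) *\<^sub>R (velocity ^^ i) (shape 1) t" "gc (s - s0) *\<^sub>R (velocity ^^ i) (shape 0) t"] by simp
    also have "\<dots> <= cmod (s - s0) * abs B1 + cmod (s - s0) * abs B0"
     by (intro add_mono mult_mono k order_trans[OF B1[OF i] abs_ge_self] order_trans[OF B0[OF i] abs_ge_self]) auto
    also have "\<dots> <= dist s s0 * B" by (simp add: B_def dist_norm algebra_simps)
    also have "\<dots> < e" using s(2) Bp by (simp add: pos_less_divide_eq)
    finally show ?thesis .
   qed
   then have "(slice knot s) \<in> U" using s(1) by (intro e(2) knot_params) auto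
   then show "s \<in> {s \<in> topspace (top_of_set (cball 0 1)). (slice knot s) \<in> U}" using s(1) by simp
  qed
 qed auto
qed

lemma loop_continuous: "continuous_map (top_of_set (cball 0 1)) M1 loop"
proof -
 have "loop = range \<circ> (%s t. knot (s, t))" by (simp add: fun_eq_iff loop_def)
 then show ?thesis
  using continuous_map_compose[OF knot_continuous quotient_imp_continuous_map[OF quotient_map_M1]] by simp
qed

text \<open>\<open>loop\<close> is defined on the whole disc, so the circle is shrunk radially to
  the centre.\<close>

lemma contractible_loop_loop: "contractible_loop loop"
 unfolding contractible_loop_def
proof (intro exI[of _ "loop 0"], unfold homotopic_with_def, intro exI[of _ "%z. loop ((1 - fst z) *\<^sub>R snd z)"] conjI allI ballI impI TrueI)
 have "continuous_map (prod_topology (top_of_set {0..1}) (top_of_set (sphere 0 1))) (top_of_set (cball 0 1)) (%z. (1 - fst z) *\<^sub>R snd z :: complex)"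
  unfolding prod_topology_subtopology_eu continuous_map_iff_continuous2
  by (auto intro!: continuous_intros simp: mult_le_one abs_le_iff)
 from continuous_map_compose[OF this loop_continuous]
 show "continuous_map (prod_topology (top_of_set {0..1}) (top_of_set (sphere 0 1))) M1 (%z. loop ((1 - fst z) *\<^sub>R snd z))"
  by (simp add: o_def)
qed auto

lemma generic_loop_loop: "generic_loop loop"
 unfolding generic_loop_def generic_map_def
proof (intro conjI exI[of _ knot])
 show "continuous_map (top_of_set (sphere 0 1)) M1 loop"
  using continuous_map_from_subtopology_mono[OF loop_continuous, of "sphere 0 1"] by auto
 show "smooth_family (sphere 0 1) knot"
  unfolding smooth_family_def using smooth_knot knot_params by (intro conjI exI[of _ 3]) auto
 show "\<forall>s\<in>sphere 0 1. range (slice knot s) = loop s" by (simp add: loop_def)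
 show "\<forall>s\<in>sphere 0 1. \<exists>S\<in>{stratum0, stratum1, stratum2}. loop s \<in> S & transverse_at knot {a. orthogonal s a} S s"
 proof
  fix s :: complex assume "s \<in> sphere 0 1"
  then have "cmod s = 1" by simp
  from loop_stratum[OF this]
  show "\<exists>S\<in>{stratum0, stratum1, stratum2}. loop s \<in> S & transverse_at knot {a. orthogonal s a} S s" by blast
 qed
qed

section \<open>The weight along the loop\<close>

interpretation KF: knot_family knot "cball 0 1" 3
 using smooth_knot knot_params by (intro knot_familyI) auto

lemma KF_P: "KF.P s t = pk s t" "KF.P1 s t = pk1 s t"
 by (simp_all add: KF.P_def pk_def pk1_def KF.P_velocity(1))

lemma turning_knot: "turning (slice knot s) b = (%u. KF.slope s b (b + u) * cnj (pk1 s (b + u)))"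
 by (rule ext) (simp add: KF.turning_family KF.tw_def KF_P)

context
 fixes s :: complex and a b :: real
 assumes s: "cmod s <= 1" and ab: "a < b" and P: "pk s a = pk s b"
begin

lemma ab_ne: "a ~= b" using ab by simp

lemmas dbl = pk_double[OF s ab_ne P]

lemma upper_gt: "b > - 1"
 using xc_mono[OF ab] P by (force simp: pk_eq not_less)

lemma sec_pos: "u > 0 ==> KF.slope s b (b + u) = (pk s (b + u) - pk s b) /\<^sub>R u"
 using KF.slope_eq[of s "b + u" b] by (simp add: KF_P)

lemma sec_end:
 assumes "u >= 4 - b"
 shows "pk1 s (b + u) = 1" "Re (KF.slope s b (b + u)) > 0"
proof -
 show "pk1 s (b + u) = 1" using KF.P1_outside[of s "b + u"] s assms by (simp add: KF_P)
 have u: "u > 0" using assms dbl(2) by simp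
 have "xc (b + u) = b + u" using assms by (simp add: xc_def cutoff_simps)
 moreover have "abs (xc b) <= 1 / 3" using dbl(2) by (intro xc_range) simp
 ultimately show "Re (KF.slope s b (b + u)) > 0" using assms u by (simp add: sec_pos pk_eq)
qed

text \<open>The tangent is vertical only at the critical points 1 and -1 of the cubic; beyond
  \<open>b > - 1\<close> only 1 is met, and there the curve goes down.\<close>

lemma tan_down: "u >= 0 ==> Re (pk1 s (b + u)) = 0 ==> Im (pk1 s (b + u)) < 0"
proof -
 assume u: "u >= 0" and r: "Re (pk1 s (b + u)) = 0"
 have le: "~ abs (b + u) > 1" using Re_pk1_pos[of "b + u" s] r by auto
 then have "cubic' (b + u) = 0" using r by (simp add: pk1_inside)
 then have "b + u = 1" using upper_gt u unfolding cubic'_zero by auto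
 then show ?thesis using ycoord'_1(1)[OF s] by (simp add: pk1_inside)
qed

lemma sec_tan_cont: "continuous_on {0..} (%u. KF.slope s b (b + u))" "continuous_on {0..} (%u. pk1 s (b + u))"
 by (intro KF.slope_cont KF.P_cont(2)[unfolded KF_P] continuous_intros)+

lemma quad_double:
 assumes "a + b ~= 0"
 shows "quad (kc s) (gc s) (cubic b) = ((a + b)\<^sup>2 - 3) / 2"
proof -
 have X: "cubic b = (a + b) * (3 - (a + b)\<^sup>2)" using cubic_sum(2)[OF dbl(3)] .
 have "(a + b) * ((3 - (a + b)\<^sup>2) / 2 + quad (kc s) (gc s) (cubic b)) = 0"
  using quad_disc[of "a + b" "kc s" "gc s"] dbl(5) assms unfolding X by (simp add: algebra_simps)
 then have "(3 - (a + b)\<^sup>2) / 2 + quad (kc s) (gc s) (cubic b) = 0" using assms by (simp only: mult_eq_0_iff) simp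
 then show ?thesis by (simp add: field_simps)
qed

text \<open>A vertical chord from \<open>b\<close> ends at the third parameter of equal x, which is
  \<open>- (a + b)\<close>. The double point equation for \<open>a\<close>, \<open>b\<close> then
  leaves a multiple of \<open>quad\<close>.\<close>

lemma sec_vertical:
 assumes b: "b < 1" and u: "u >= 0" and r: "Re (KF.slope s b (b + u)) = 0"
 shows "Im (KF.slope s b (b + u)) = - (2 * a + b) * quad (kc s) (gc s) (cubic b)"
proof -
 have b1: "abs b < 1" using b upper_gt by simp
 then have "b\<^sup>2 < 1" using abs_square_less_1 by blast
 then have "u ~= 0" using r b1 by (auto simp: KF.slope_diag KF_P pk1_inside cubic'_def)
 then have u0: "u > 0" using u by simp
 have x: "xc (b + u) = xc b" using r u0 by (simp add: sec_pos pk_eq)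
 have ne: "b + u ~= b" using u0 by simp
 have t2: "abs (b + u) <= 2" "abs b <= 2" using xc_double[OF x ne] by auto
 then have cu: "cubic (b + u) = cubic b" using x by (simp add: xc_inside)
 then have "(b + u)\<^sup>2 + (b + u) * b + b\<^sup>2 = 3" using cubic_eq_iff[OF ne] by simp
 then have "((b + u) - a) * (a + (b + u) + b) = 0" using dbl(3) by (simp add: algebra_simps power2_eq_square)
 then have t: "b + u = - (a + b)" using ab u0 by auto
 define X q where "X = cubic b" and "q = quad (kc s) (gc s) X"
 have lin: "X / 2 + (a + b) * q = 0"
  using quad_disc[of "a + b" "kc s" "gc s"] dbl(5) cubic_sum(2)[OF dbl(3)] unfolding q_def X_def by auto
 have "ycoord (kc s) (gc s) (b + u) - ycoord (kc s) (gc s) b = u * (X / 2 + (2 * b + u) * q)"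
  unfolding ycoord_def cu X_def[symmetric] q_def[symmetric] by (simp add: field_simps power2_eq_square)
 also have "X / 2 + (2 * b + u) * q = (X / 2 + (a + b) * q) - (2 * a + b) * q"
 proof -
  have "2 * b + u = (a + b) - (2 * a + b)" using t by simp
  then show ?thesis by (simp only: left_diff_distrib) 
 qed
 finally have "ycoord (kc s) (gc s) (b + u) - ycoord (kc s) (gc s) b = u * (- (2 * a + b) * q)" unfolding lin by (simp add: algebra_simps)
 then show ?thesis using u0 t2 unfolding sec_pos[OF u0] q_def X_def by (simp add: pk_inside)
qed

text \<open>From \<open>b\<close> on the tangent never points up, so the vertical chord decides. For
  \<open>b >= 1\<close> there is none; otherwise it points up or down with the sign of
  \<open>(a + b)^2 - 3\<close>, and \<open>not_untwistedI\<close> or \<open>untwistedI\<close>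
  applies. The borderline is a triple point, excluded by \<open>gc s ~= 0\<close>.\<close>

lemma untwisted_iff:
 assumes g: "gc s ~= 0"
 shows "untwisted (turning (slice knot s) b) \<longleftrightarrow> ~ a + b < - sqrt 3"
proof -
 have sl0: "KF.slope s b (b + 0) = pk1 s (b + 0)" by (simp add: KF.slope_diag KF_P)
 have unt: "untwisted (turning (slice knot s) b)"
  if "!!u. u >= 0 ==> Re (KF.slope s b (b + u)) = 0 ==> Im (KF.slope s b (b + u)) < 0"
  unfolding turning_knot by (rule untwistedI[OF sec_tan_cont that tan_down sl0 sec_end])
 have ls: "x < - sqrt 3 \<longleftrightarrow> x < 0 & x\<^sup>2 > 3" for x :: real
 proof -
  have "sqrt 3 < - x \<longleftrightarrow> 3 < x\<^sup>2" if "x < 0" using that real_sqrt_less_iff[of 3 "x\<^sup>2"] by simp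
  moreover have "x < 0" if "x < - sqrt 3" using that real_sqrt_ge_zero[of 3] by linarith
  ultimately show ?thesis by auto
 qed
 show ?thesis
 proof (cases "b < 1")
  case False
  have "untwisted (turning (slice knot s) b)"
  proof (rule unt)
   fix u :: real assume u: "u >= 0" "Re (KF.slope s b (b + u)) = 0"
   have "u = 0"
   proof (rule ccontr)
    assume "u ~= 0"
    then have "u > 0" using u by simp
    then show False using u(2) xc_mono[of b "b + u"] False by (simp add: sec_pos pk_eq)
   qed
   then show "Im (KF.slope s b (b + u)) < 0" using tan_down[of 0] u(2) sl0 by simp
  qed
  moreover have "~ a + b < - sqrt 3"
  proof
   assume l: "a + b < - sqrt 3"
   then have "(b - a)\<^sup>2 < 3" using ls[of "a + b"] diff_square[OF dbl(3)] by simp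
   then have "b - a < sqrt 3" by (rule real_less_rsqrt)
   then show False using l False by simp
  qed
  ultimately show ?thesis by blast
 next
  case True
  have b1: "abs b < 1" using True upper_gt by simp
  then have "b\<^sup>2 < 1" using abs_square_less_1 by blast
  moreover have "(2 * a + b)\<^sup>2 = 12 - 3 * b\<^sup>2" using dbl(3) by (simp add: power2_eq_square algebra_simps)
  ultimately have "3\<^sup>2 < (2 * a + b)\<^sup>2" by simp
  then have "3 < abs (2 * a + b)" using abs_le_square_iff[of "2 * a + b" 3] by (simp add: not_le[symmetric])
  \<comment> \<open>The square of \<open>2 * a + b\<close> exceeds 9, and \<open>a < b < 1\<close>
    excludes the positive root.\<close>
  then have m: "2 * a + b < - 3" using ab True by auto
  then have neg: "a + b < 0" using b1 by simp
  note q = quad_double[OF less_imp_neq[OF neg]]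
  have n3: "(a + b)\<^sup>2 ~= 3"
  proof
   assume e: "(a + b)\<^sup>2 = 3"
   then have "cubic b = 0" using cubic_sum(2)[OF dbl(3)] by simp
   then show False using q g e by (simp add: quad_def)
  qed
  show ?thesis
  proof (cases "(a + b)\<^sup>2 > 3")
   case True
   have "Im (KF.slope s b (b + u)) > 0" if "u >= 0" "Re (KF.slope s b (b + u)) = 0" for u
    unfolding sec_vertical[OF \<open>b < 1\<close> that] q using True m by (intro mult_pos_pos) auto
   moreover have "Re (KF.slope s b (b + 0)) < 0" unfolding sl0 using \<open>b\<^sup>2 < 1\<close> b1 by (simp add: pk1_inside cubic'_def)
   ultimately have "~ untwisted (turning (slice knot s) b)"
    unfolding turning_knot by (intro not_untwistedI[OF sec_tan_cont _ tan_down sl0 _ sec_end])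
   then show ?thesis using ls neg True by blast
  next
   case False
   have "untwisted (turning (slice knot s) b)"
   proof (rule unt)
    fix u assume u: "u >= 0" "Re (KF.slope s b (b + u)) = 0"
    show "Im (KF.slope s b (b + u)) < 0"
     unfolding sec_vertical[OF \<open>b < 1\<close> u] q using False n3 m by (intro mult_pos_neg) auto
   qed
   then show ?thesis using ls False by blast
  qed
 qed
qed

end

section \<open>The parameter at which the weight jumps\<close>

definition kk :: "real => real" where "kk omega = 2 / 5 * cos omega"
definition gg :: "real => real" where "gg omega = 1 / 10 * sin omega"

lemma kc_cis [simp]: "kc (cis omega) = kk omega" "gc (cis omega) = gg omega"
 by (simp_all add: kc_def gc_def kk_def gg_def)

lemma kg_on_loop: "on_loop (kk omega) (gg omega)" "on_loop (- kk omega) (gg omega)"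
 using on_loop_circle[of "cis omega"] by simp_all

lemmas kg_bound = on_loop_bounds[OF kg_on_loop(2)]

text \<open>\<open>disc\<close> at the sum \<open>- r\<close>, rewritten by
  \<open>disc_flip\<close>. For \<open>g\<close> nonzero its zeros between \<open>sqrt 3\<close> and
  2 are the double points of nonzero turning.\<close>

definition height :: "real => real => real" where "height omega r = disc (- kk omega) (gg omega) r"

lemma height_cont:
 fixes A :: "'a::metric_space set"
 assumes "continuous_on A f" "continuous_on A g"
 shows "continuous_on A (%x. height (f x) (g x))"
 unfolding height_def disc_def kk_def gg_def by (intro continuous_intros assms) auto

text \<open>In the fourth quadrant both sine and cosine increase, and \<open>K\<close> enters with
  the factor \<open>r (r^2 - 3)\<close>, nonnegative on this range.\<close>

lemma height_increasing:
 assumes "- pi / 2 <= omega" "omega < omega'" "omega' <= 0" "sqrt 3 <= r"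
 shows "height omega r < height omega' r"
proof -
 have "3 <= r\<^sup>2" using assms(4) by (rule sqrt_le_D)
 moreover have "r >= 0" using assms(4) real_sqrt_ge_zero[of 3] by linarith
 ultimately have "0 <= r * (r\<^sup>2 - 3)" by simp
 moreover have "sin omega < sin omega'" using assms by (intro sin_monotone_2pi) auto
 moreover have "cos omega < cos omega'" using assms pi_gt_zero by (intro cos_monotone_minus_pi_0) auto
 ultimately have "gg omega' - gg omega > 0" "(kk omega' - kk omega) * (r * (r\<^sup>2 - 3)) >= 0" by (auto simp: gg_def kk_def)
 moreover have "height omega' r - height omega r = (gg omega' - gg omega) + (kk omega' - kk omega) * (r * (r\<^sup>2 - 3))"
  by (simp add: height_def disc_def algebra_simps)
 ultimately show ?thesis by linarith
qed

lemma height_sign_near: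
 shows "height omega r > 0 ==> \<exists>d>0. \<forall>x. abs (x - omega) < d --> height x r > 0"
  and "height omega r < 0 ==> \<exists>d>0. \<forall>x. abs (x - omega) < d --> height x r < 0"
proof -
 have "continuous_on UNIV (%x. height x r)" by (intro height_cont continuous_intros)
 then have c: "isCont (%x. height x r) omega" by (simp add: continuous_on_eq_continuous_at)
 have near: "\<exists>d>0. \<forall>x. abs (x - omega) < d --> \<bar>height x r - height omega r\<bar> < e" if "e > 0" for e
  using c that unfolding continuous_at_eps_delta dist_real_def by blast
 show "\<exists>d>0. \<forall>x. abs (x - omega) < d --> height x r > 0" if h: "height omega r > 0"
 proof -
  have "height x r > 0" if "abs (height x r - height omega r) < height omega r" for x using that by linarith
  then show ?thesis using near[OF h] by blast
 qed
 show "\<exists>d>0. \<forall>x. abs (x - omega) < d --> height x r < 0" if h: "height omega r < 0"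
 proof -
  have "height x r < 0" if "abs (height x r - height omega r) < - height omega r" for x using that by linarith
  then show ?thesis using near[of "- height omega r"] h by (meson neg_0_less_iff_less)
 qed
qed

lemma height_sqrt3: "height omega (sqrt 3) = gg omega"
 by (simp add: height_def disc_sqrt3)

lemma height_derivative: "((%r. height omega r) has_real_derivative disc' (- kk omega) r) (at r)"
 unfolding height_def[abs_def] by (rule disc_derivs)

text \<open>\<open>omega0\<close> is the first angle of the fourth quadrant at which some
  \<open>r\<close> in \<open>[sqrt 3, 2]\<close> has nonnegative height, found as a minimum over a
  compact set. There the height touches 0 from below; the ends of the interval are excluded by the
  signs of \<open>g\<close> and of \<open>disc_2\<close>, so \<open>r0\<close> is an interior
  maximum, a tangency.\<close>

lemma critical_angle:
 obtains omega0 r0 where "- pi / 2 < omega0" "omega0 < 0" "sqrt 3 < r0" "r0 < 2" "height omega0 r0 = 0" "disc' (- kk omega0) r0 = 0"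
  "!!omega r. - pi / 2 <= omega ==> omega < omega0 ==> sqrt 3 <= r ==> r <= 2 ==> height omega r < 0"
proof -
 define C where "C = ({- pi / 2..0} \<times> {sqrt 3..2}) \<inter> {z. 0 <= height (fst z) (snd z)}"
 have "compact C" unfolding C_def
  by (intro compact_Int_closed compact_Times compact_Icc closed_Collect_le height_cont continuous_intros)
 moreover have "(0, sqrt 3) \<in> C" unfolding C_def using sqrt3(2) by (simp add: height_sqrt3 gg_def)
 then have "C ~= {}" by blast
 ultimately obtain z where z: "z \<in> C" "!!y. y \<in> C ==> fst z <= fst y"
  using continuous_attains_inf[of C fst] continuous_on_fst[OF continuous_on_id] by blast
 obtain omega0 r0 where zz: "z = (omega0, r0)" by (cases z)
 have w: "- pi / 2 <= omega0" "omega0 <= 0" and r: "sqrt 3 <= r0" "r0 <= 2" and h0: "0 <= height omega0 r0" using z(1) unfolding zz C_def by auto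
 have min: "height omega r < 0" if "- pi / 2 <= omega" "omega < omega0" "sqrt 3 <= r" "r <= 2" for omega r
 proof (rule ccontr)
  assume "~ height omega r < 0"
  then have "(omega, r) \<in> C" using that w(2) by (simp add: C_def)
  then show False using z(2)[of "(omega, r)"] that(2) unfolding zz by simp
 qed
 have "omega0 ~= - pi / 2"
 proof
  assume e: "omega0 = - pi / 2"
  have "kk omega0 = 0" "gg omega0 = - 1 / 10" unfolding e by (simp_all add: kk_def gg_def)
  then have "height omega0 r0 = - 1 / 10 + (3 - r0\<^sup>2) / 2 - (r0 * (3 - r0\<^sup>2))\<^sup>2" by (simp add: height_def disc_def power_mult_distrib)
  moreover have "3 <= r0\<^sup>2" using r(1) by (rule sqrt_le_D)
  then have "- 1 / 10 + (3 - r0\<^sup>2) / 2 - (r0 * (3 - r0\<^sup>2))\<^sup>2 <= - 1 / 10 + 0 - 0" by (intro diff_mono add_mono) auto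
  ultimately show False using h0 by simp
 qed
 then have w1: "- pi / 2 < omega0" using w(1) by simp
 have le: "height omega0 r <= 0" if r': "sqrt 3 <= r" "r <= 2" for r
 proof (rule ccontr)
  assume "~ height omega0 r <= 0"
  then obtain d where d: "d > 0" "!!x. abs (x - omega0) < d ==> height x r > 0" using height_sign_near(1)[of omega0 r] by auto
  define x where "x = max (omega0 - d / 2) (- pi / 2)"
  have "- pi / 2 <= x" "x < omega0" "abs (x - omega0) < d" using d(1) w1 by (auto simp: x_def)
  then show False using min[of x r] d(2)[of x] r' by simp
 qed
 have "omega0 ~= 0"
 proof
  assume "omega0 = 0"
  \<comment> \<open>87/50 lies just above \<open>sqrt 3\<close>; at angle 0 the term with
    \<open>K\<close> outweighs the others there, so the first angle comes before 0.\<close>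
  moreover have "height 0 (87 / 50) > 0" by (simp add: height_def disc_def kk_def gg_def power2_eq_square)
  moreover have "sqrt 3 <= 87 / 50" by (rule real_le_lsqrt) (simp_all add: power2_eq_square)
  ultimately show False using le[of "87 / 50"] by simp
 qed
 then have w2: "omega0 < 0" using w(2) by simp
 have eq: "height omega0 r0 = 0" using le[OF r] h0 by simp
 have "sin omega0 < 0" using w1 w2 pi_gt_zero sin_gt_zero[of "- omega0"] by simp
 then have "gg omega0 < 0" by (simp add: gg_def)
 then have "r0 ~= sqrt 3" using eq height_sqrt3 by auto
 moreover have "r0 ~= 2" using eq disc_2[OF kg_bound(1)[of omega0] kg_bound(2)[of omega0]] by (auto simp: height_def)
 ultimately have r': "sqrt 3 < r0" "r0 < 2" using r by auto
 have dz: "disc' (- kk omega0) r0 = 0"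
 proof (rule DERIV_local_max[OF height_derivative])
  show "0 < min (r0 - sqrt 3) (2 - r0)" using r' by simp
  show "\<forall>y. abs (r0 - y) < min (r0 - sqrt 3) (2 - r0) --> height omega0 y <= height omega0 r0"
   unfolding eq using le by (auto simp: abs_less_iff)
 qed
 show ?thesis by (rule that[OF w1 w2 r' eq dz min])
qed

text \<open>Between two zeros the derivative vanishes somewhere; as it is strictly decreasing, it
  would be negative at the right one.\<close>

lemma rising_zero_unique:
 assumes r: "3 / 2 <= r" "r <= 2" "height omega r = 0" "disc' (- kk omega) r > 0" and q: "3 / 2 <= q" "q <= 2" "height omega q = 0" "disc' (- kk omega) q >= 0"
 shows "q = r"
proof (rule ccontr)
 assume "q ~= r"
 have key: False if xy: "x < y" "3 / 2 <= x" "y <= 2" "height omega x = 0" "height omega y = 0" "disc' (- kk omega) y >= 0" for x y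
 proof -
  obtain z where z: "x < z" "z < y" "height omega y - height omega x = (y - x) * disc' (- kk omega) z"
   using MVT2[OF xy(1), of "height omega" "disc' (- kk omega)"] height_derivative by blast
  then have "disc' (- kk omega) z = 0" using xy by simp
  then show False using disc'_decreasing[OF kg_bound, of z y omega] z xy by simp
 qed
 then show False using key[of q r] key[of r q] assms \<open>q ~= r\<close> by (cases "q < r") auto
qed

text \<open>Just after \<open>omega0\<close> the height is positive at \<open>r0\<close> and still
  negative slightly to the left, so a zero is crossed upwards in between. The mean value theorem
  gives a positive slope to its right, and concavity carries this back to the zero.\<close>

lemma rising_zero:
 assumes w: "- pi / 2 < omega0" "omega0 < 0" and r0: "sqrt 3 < r0" "r0 < 2" "height omega0 r0 = 0" "disc' (- kk omega0) r0 = 0" and e: "eps > 0"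
 shows "\<exists>omega r. omega0 < omega & omega < 0 & omega < omega0 + eps & r0 - eps < r & r < r0 & sqrt 3 < r & height omega r = 0 & disc' (- kk omega) r > 0"
proof -
 define rho where "rho = max ((sqrt 3 + r0) / 2) (r0 - eps / 2)"
 have rho: "sqrt 3 < rho" "rho < r0" "r0 - eps < rho" using r0 e by (auto simp: rho_def less_max_iff_disj)
 have g32: "3 / 2 <= sqrt 3" by (rule sqrt3)
 have "height omega0 rho < 0"
  using disc_max[OF kg_bound(1)[of omega0] kg_bound(2)[of omega0], of r0 rho] r0 rho g32 by (simp add: height_def)
 then obtain d where d: "d > 0" "!!x. abs (x - omega0) < d ==> height x rho < 0" using height_sign_near(2)[of omega0 rho] by auto
 define omega where "omega = omega0 + min d (min eps (- omega0)) / 2"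
 have om: "omega0 < omega" "omega < 0" "omega < omega0 + eps" "abs (omega - omega0) < d" using d(1) e w by (auto simp: omega_def min_def)
 have hi: "height omega r0 > 0" using height_increasing[of omega0 omega r0] om w r0 by simp
 have lo: "height omega rho < 0" using d(2) om by simp
 have "\<exists>r\<ge>rho. r <= r0 & height omega r = 0"
  by (rule IVT') (use hi lo rho in \<open>auto intro!: height_cont continuous_intros\<close>)
 then obtain r where r: "rho <= r" "r <= r0" "height omega r = 0" by blast
 have lt: "rho < r" "r < r0" using r hi lo by (auto simp: less_le)
 obtain z where z: "r < z" "z < r0" "height omega r0 - height omega r = (r0 - r) * disc' (- kk omega) z"
  using MVT2[OF lt(2), of "height omega" "disc' (- kk omega)"] height_derivative by blast
 then have "disc' (- kk omega) z > 0" using hi r(3) lt(2) by (simp add: zero_less_mult_iff)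
 then have "disc' (- kk omega) r > 0" using disc'_decreasing[OF kg_bound, of r z omega] z r0 rho lt g32 by simp
 then show ?thesis using om rho lt r(3) by (intro exI[of _ omega] exI[of _ r]) auto
qed

lemma cross_knot: "cross (slice knot s) z = crs (pk1 s (fst z)) (pk1 s (snd z))" "dot (slice knot s) z = pk1 s (fst z) \<bullet> pk1 s (snd z)"
 by (simp_all add: cross_def dot_def pk1_def)

lemma near_anti_knot:
 assumes s: "cmod s <= 1" and g: "gc s ~= 0"
 shows "z \<in> near_anti eta (slice knot s) \<longleftrightarrow> fst z < snd z & pk s (fst z) = pk s (snd z) & 0 <= cross (slice knot s) z &
  cross (slice knot s) z <= eta * - dot (slice knot s) z & fst z + snd z < - sqrt 3"
 unfolding near_anti_def mem_Collect_eq pk_def[symmetric] using untwisted_iff[OF s _ _ g, of "fst z" "snd z"] by blast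

text \<open>At a zero of \<open>disc\<close> only the \<open>disc'\<close> term of the crossing
  polynomial remains, so the sign of the determinant is that of the slope of \<open>height\<close>:
  the rising zeros are the positive crossings.\<close>

lemma crossing_angle:
 assumes ab: "a < b" "pk (cis omega) a = pk (cis omega) b" and l: "a + b < - sqrt 3"
 shows "sqrt 3 < - (a + b)" "- (a + b) < 2" "height omega (- (a + b)) = 0"
  "crs (pk1 (cis omega) a) (pk1 (cis omega) b) >= 0 \<longleftrightarrow> disc' (- kk omega) (- (a + b)) >= 0"
  "a = lower (a + b)" "b = upper (a + b)"
proof -
 have s: "cmod (cis omega) <= 1" by simp
 have ne: "a ~= b" using ab by simp
 note d = pk_double[OF s ne ab(2)]
 show "sqrt 3 < - (a + b)" "- (a + b) < 2" using l d(4) by auto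
 have neg: "a + b < 0" using l real_sqrt_ge_zero[of 3] by linarith
 have z: "disc (kk omega) (gg omega) (a + b) = 0" using d(5) neg by simp
 then show "height omega (- (a + b)) = 0" 
  using disc_flip(1)[of "- kk omega" "gg omega" "a + b"] by (simp only: height_def minus_minus)
 have pos: "4 - (a + b)\<^sup>2 > 0" using diff_square[OF d(3)] ab(1) zero_less_power2[of "b - a"] by simp
 have dd: "disc' (- kk omega) (- (a + b)) = - disc' (kk omega) (a + b)" using disc_flip(2)[of "- kk omega" "a + b"] by simp
 have e6: "6 * crs (pk1 (cis omega) a) (pk1 (cis omega) b) = (b - a) * cross_poly (kk omega) (gg omega) (a + b)"
  using pk_double_cross[OF s ne ab(2)] by simp
 have "6 * crs (pk1 (cis omega) a) (pk1 (cis omega) b) = ((b - a) * (3 * (4 - (a + b)\<^sup>2)) * - (a + b)) * disc' (- kk omega) (- (a + b))"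
  unfolding e6 cross_poly_def z dd by algebra
 moreover have "(b - a) * (3 * (4 - (a + b)\<^sup>2)) * - (a + b) > 0" using ab(1) pos neg by (intro mult_pos_pos) auto
 ultimately show "crs (pk1 (cis omega) a) (pk1 (cis omega) b) >= 0 \<longleftrightarrow> disc' (- kk omega) (- (a + b)) >= 0"
  by (smt (verit) mult_nonneg_nonneg mult_pos_neg)
 define l u where "l = lower (a + b)" and "u = upper (a + b)"
 have "(a, b) = (l, u) | (a, b) = (u, l)"
  unfolding l_def u_def by (rule pair_unique) (simp_all only: lower_upper[OF d(4)] d(3))
 moreover have "l < u" unfolding l_def u_def by (rule lower_upper[OF d(4)])
 ultimately have "a = l" "b = u" using ab(1) by auto
 then show "a = lower (a + b)" "b = upper (a + b)" unfolding l_def u_def by blast+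
qed

lemma sin_neg_angle: "- pi / 2 <= omega ==> omega < 0 ==> gg omega < 0"
 using sin_gt_zero[of "- omega"] pi_gt_zero by (simp add: gg_def)

lemma weight_below:
 assumes w: "- pi / 2 <= omega" "omega < 0" and h: "!!r. sqrt 3 <= r ==> r <= 2 ==> height omega r < 0"
 shows "weight eta (slice knot (cis omega)) = 0"
proof -
 have "gc (cis omega) ~= 0" using sin_neg_angle[OF w] by simp
 note na = near_anti_knot[OF _ this]
 have False if "z \<in> near_anti eta (slice knot (cis omega))" for z
 proof -
  have z: "fst z < snd z" "pk (cis omega) (fst z) = pk (cis omega) (snd z)" "fst z + snd z < - sqrt 3"
   using that na[of z eta] by auto
  show False using h[of "- (fst z + snd z)"] crossing_angle(1-3)[OF z] by simp
 qed
 then have "near_anti eta (slice knot (cis omega)) = {}" by blast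
 then show ?thesis by (simp add: weight_def)
qed

text \<open>By \<open>rising_zero_unique\<close> the given zero is the only crossing counted; a
  falling zero has a negative determinant.\<close>

lemma weight_above:
 assumes w: "- pi / 2 <= omega" "omega < 0" and r: "sqrt 3 < r" "r < 2" "height omega r = 0" "disc' (- kk omega) r > 0"
  and c: "cross (slice knot (cis omega)) (lower (- r), upper (- r)) <= eta * - dot (slice knot (cis omega)) (lower (- r), upper (- r))"
 shows "weight eta (slice knot (cis omega)) =
  1 - cross (slice knot (cis omega)) (lower (- r), upper (- r)) / (eta * - dot (slice knot (cis omega)) (lower (- r), upper (- r)))"
proof -
 have g: "gc (cis omega) ~= 0" using sin_neg_angle[OF w] by simp
 have s: "cmod (cis omega) <= 1" by simp
 have r0: "abs (- r) < 2" using r real_sqrt_ge_zero[of 3] by linarith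
 note lu = lower_upper[OF r0]
 have z: "disc (kk omega) (gg omega) (- r) = 0" using r(3) by (simp add: height_def disc_flip)
 have P: "pk (cis omega) (lower (- r)) = pk (cis omega) (upper (- r))"
  by (rule pk_doubleI[OF lu(3) less_imp_neq[OF lu(1)]]) (simp add: lu(2) z)
 have l: "lower (- r) + upper (- r) < - sqrt 3" using lu(2) r(1) by simp
 have c0: "0 <= cross (slice knot (cis omega)) (lower (- r), upper (- r))"
  using crossing_angle(4)[OF lu(1) P l] r(4) by (simp add: cross_knot lu(2))
 have "near_anti eta (slice knot (cis omega)) = {(lower (- r), upper (- r))}"
 proof (intro subset_antisym subsetI)
  fix z assume zn: "z \<in> near_anti eta (slice knot (cis omega))"
  obtain a b where z: "z = (a, b)" by (cases z)
  have ab: "a < b" "pk (cis omega) a = pk (cis omega) b" "a + b < - sqrt 3" "crs (pk1 (cis omega) a) (pk1 (cis omega) b) >= 0"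
   using zn unfolding near_anti_knot[OF s g] z cross_knot by simp_all
  note ca = crossing_angle[OF ab(1-3)]
  have "- (a + b) = r"
   by (rule rising_zero_unique[of r omega]) (use ca(1-4) ab(4) r sqrt3(1) in auto)
  then have e: "a + b = - r" by simp
  show "z \<in> {(lower (- r), upper (- r))}" using ca(5,6) unfolding e z by blast
 next
  fix z assume "z \<in> {(lower (- r), upper (- r))}"
  then show "z \<in> near_anti eta (slice knot (cis omega))"
   unfolding near_anti_knot[OF s g] using lu(1) P l c c0 by simp
 qed
 then show ?thesis by (simp add: weight_def)
qed

lemma pk1_tendsto:
 assumes "x \<longlonglongrightarrow> s" "t \<longlonglongrightarrow> t0"
 shows "(%n. pk1 (x n) (t n)) \<longlonglongrightarrow> pk1 s t0"
proof -
 have "continuous_on UNIV (%z. pk1 (fst z) (snd z))"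
  unfolding KF_P(2)[symmetric] by (intro KF.P_cont(2) continuous_intros)
 from continuous_on_tendsto_compose[OF this tendsto_Pair[OF assms]] show ?thesis by simp
qed

text \<open>The product of the two x-velocities is negative when the sum lies between
  \<open>sqrt 3\<close> and 2 in absolute value, so the tangency is antiparallel.\<close>

lemma tangent_crossing:
 assumes r: "sqrt 3 < r" "r < 2" "height omega r = 0" "disc' (- kk omega) r = 0"
 shows "cross (slice knot (cis omega)) (lower (- r), upper (- r)) = 0" "dot (slice knot (cis omega)) (lower (- r), upper (- r)) < 0"
proof -
 have s: "cmod (cis omega) <= 1" by simp
 have r0: "abs (- r) < 2" using r real_sqrt_ge_zero[of 3] by linarith
 note lu = lower_upper[OF r0]
 have z: "disc (kk omega) (gg omega) (- r) = 0" "disc' (kk omega) (- r) = 0" using r(3,4) by (simp_all add: height_def disc_flip)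
 have ne: "lower (- r) ~= upper (- r)" using lu(1) by simp
 have P: "pk (cis omega) (lower (- r)) = pk (cis omega) (upper (- r))"
  by (rule pk_doubleI[OF lu(3) ne]) (simp add: lu(2) z)
 note d = pk_double[OF s ne P]
 have c: "crs (pk1 (cis omega) (lower (- r))) (pk1 (cis omega) (upper (- r))) = 0"
  unfolding pk_double_tangent[OF s ne P] lu(2) tangent_at_def using z r0 by simp
 then show "cross (slice knot (cis omega)) (lower (- r), upper (- r)) = 0" by (simp add: cross_knot)
 obtain k where k: "pk1 (cis omega) (lower (- r)) = k *\<^sub>R pk1 (cis omega) (upper (- r))"
  using crs_eq_0D[OF c pk1_nonzero[OF s]] by blast
 have "cubic' (lower (- r)) = k * cubic' (upper (- r))" using arg_cong[OF k, of Re] by (simp add: pk1_inside d(1,2))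
 moreover have "cubic' (lower (- r)) * cubic' (upper (- r)) < 0"
 proof -
  have "r > 0" using r(1) real_sqrt_ge_zero[of 3] by linarith
  then have "3 < r\<^sup>2" using r(1) real_sqrt_less_iff[of 3 "r\<^sup>2"] by simp
  moreover have "r\<^sup>2 < 2\<^sup>2" using r0 abs_le_square_iff[of 2 r] by (simp add: not_le[symmetric])
  ultimately have "9 * (r\<^sup>2 - 1) * (r\<^sup>2 - 4) < 0" by (intro mult_pos_neg) auto
  then show ?thesis unfolding cubic'_prod[OF lu(3)] lu(2) by simp
 qed
 ultimately have "k * (cubic' (upper (- r)) * cubic' (upper (- r))) < 0" by (simp add: mult.assoc)
 then have "k < 0" by (simp add: mult_less_0_iff not_less zero_le_square)
 then show "dot (slice knot (cis omega)) (lower (- r), upper (- r)) < 0"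
  unfolding cross_knot using pk1_nonzero[OF s] by (simp add: k mult_neg_pos)
qed

text \<open>Before \<open>omega0\<close> no crossing counts, after it one whose weight tends to 1.
  Another tangency of nonzero turning would have \<open>K > 0\<close> and \<open>g < 0\<close>,
  hence an angle in the fourth quadrant: before \<open>omega0\<close> all heights are negative, and
  after it the height at \<open>r0\<close> is positive, against \<open>disc_max\<close>.\<close>

lemma loop_jump:
 obtains s0 where "cmod s0 = 1"
  "!!s z eta. cmod s = 1 ==> s ~= s0 ==> z \<in> near_anti eta (slice knot s) ==> cross (slice knot s) z ~= 0"
  "!!eta. \<exists>x. (\<forall>n. x n \<in> sphere 0 1 - {s0}) & x \<longlonglongrightarrow> s0 & (%n. weight eta (slice knot (x n))) \<longlonglongrightarrow> 0"
  "!!eta. eta > 0 ==> \<exists>x. (\<forall>n. x n \<in> sphere 0 1 - {s0}) & x \<longlonglongrightarrow> s0 & (%n. weight eta (slice knot (x n))) \<longlonglongrightarrow> 1"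
proof -
 obtain omega0 r0 where w: "- pi / 2 < omega0" "omega0 < 0" and r0: "sqrt 3 < r0" "r0 < 2" "height omega0 r0 = 0" "disc' (- kk omega0) r0 = 0"
  and below: "!!omega r. - pi / 2 <= omega ==> omega < omega0 ==> sqrt 3 <= r ==> r <= 2 ==> height omega r < 0"
  by (rule critical_angle) (rule that, assumption+)
 have sin_ne: "cis omega ~= cis omega0" if "- pi / 2 <= omega" "omega < 0" "omega ~= omega0" for omega
 proof -
  have "sin omega ~= sin omega0"
   using sin_monotone_2pi[of omega omega0] sin_monotone_2pi[of omega0 omega] that w by (cases "omega < omega0") auto
  then show ?thesis by (simp add: complex_eq_iff)
 qed
 have cont: "isCont cis omega0" by (rule continuous_on_interior[of UNIV]) (auto intro!: continuous_intros)
 show ?thesis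
 proof (rule that[of "cis omega0"])
  show "cmod (cis omega0) = 1" by simp
  fix s z eta assume s: "cmod s = 1" "s ~= cis omega0" and z: "z \<in> near_anti eta (slice knot s)"
  show "cross (slice knot s) z ~= 0"
  proof
   assume c: "cross (slice knot s) z = 0"
   have sl: "cmod s <= 1" using s by simp
   obtain a b where zz: "z = (a, b)" by (cases z)
   have ab: "a < b" "pk s a = pk s b" using z by (simp_all add: near_anti_def pk_def zz)
   then have ne: "a ~= b" by simp
   have t: "tangent_at (kc s) (gc s) (a + b)" using pk_double_tangent[OF sl ne ab(2)] c by (simp add: cross_knot zz)
   note lt = loop_tangency[OF on_loop_circle[OF s(1)] t]
   have "gc s ~= 0" using lt by simp
   from near_anti_knot[OF sl this] z have l: "a + b < - sqrt 3" by (simp add: zz)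
   then have neg: "a + b < 0" using real_sqrt_ge_zero[of 3] by linarith
   have sq: "(a + b)\<^sup>2 > 3" using l neg real_sqrt_less_iff[of 3 "(a + b)\<^sup>2"] by simp
   have xp: "(a + b) * (3 - (a + b)\<^sup>2) > 0" using neg sq by (intro mult_neg_neg) auto
   have kp: "kc s > 0" by (rule zero_less_mult_pos2[OF _ xp]) (use lt in blast)
   define omega where "omega = arcsin (Im s)"
   have im: "Im s < 0" "- 1 <= Im s" "Im s <= 1" using lt abs_Im_le_cmod[of s] s by (auto simp: gc_def)
   have re: "Re s > 0" using kp by (simp add: kc_def)
   have "(Re s)\<^sup>2 = 1 - (Im s)\<^sup>2" using cmod_power2[of s] s(1) by simp
   then have "cos omega = Re s" unfolding omega_def using im re cos_arcsin[of "Im s"] real_sqrt_unique[of "Re s" "1 - (Im s)\<^sup>2"] by simp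
   moreover have "sin omega = Im s" unfolding omega_def using im by simp
   ultimately have so: "s = cis omega" by (simp add: complex_eq_iff)
   have wb: "- pi / 2 <= omega" "omega < 0"
    using arcsin_bounded[of "Im s"] im arcsin_less_mono[of "Im s" 0] by (simp_all add: omega_def)
   have P: "pk (cis omega) a = pk (cis omega) b" using ab(2) so by simp
   note ca = crossing_angle(1-3)[OF ab(1) P l]
   have dz: "disc' (- kk omega) (- (a + b)) = 0" using t so disc_flip(2)[of "- kk omega" "a + b"] by (simp add: tangent_at_def)
   show False
   proof (cases "omega < omega0")
    case True then show False using below[OF wb(1) True, of "- (a + b)"] ca by simp
   next
    case False
    then have gt: "omega0 < omega" using s(2) so by (cases "omega = omega0") auto
    have "height omega r0 > 0" using height_increasing[of omega0 omega r0] gt w wb r0 by simp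
    moreover have "height omega r0 <= 0"
     using disc_max[OF kg_bound(1)[of omega] kg_bound(2)[of omega], of "- (a + b)" r0] ca dz r0 sqrt3(1)
     by (cases "r0 = - (a + b)") (simp_all add: height_def)
    ultimately show False by simp
   qed
  qed
 next
  fix eta :: real
  define om where "om n = omega0 - (omega0 + pi / 2) * inverse (real (Suc n))" for n
  have on: "- pi / 2 <= om n" "om n < omega0" for n
  proof -
   have "(omega0 + pi / 2) * inverse (real (Suc n)) <= (omega0 + pi / 2) * 1" using w by (intro mult_left_mono) (auto simp: field_simps)
   then show "- pi / 2 <= om n" by (simp add: om_def)
   show "om n < omega0" using w by (simp add: om_def)
  qed
  have "om \<longlonglongrightarrow> omega0 - (omega0 + pi / 2) * 0"
   unfolding om_def[abs_def] by (intro tendsto_intros LIMSEQ_inverse_real_of_nat)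
  then have "om \<longlonglongrightarrow> omega0" by simp
  then have "(%n. cis (om n)) \<longlonglongrightarrow> cis omega0" by (rule isCont_tendsto_compose[OF cont])
  moreover have "cis (om n) \<in> sphere 0 1 - {cis omega0}" for n using sin_ne[of "om n"] on[of n] w by auto
  moreover have "weight eta (slice knot (cis (om n))) = 0" for n
   by (rule weight_below) (use on[of n] w below in auto)
  then have "(%n. weight eta (slice knot (cis (om n)))) \<longlonglongrightarrow> 0" by simp
  ultimately show "\<exists>x. (\<forall>n. x n \<in> sphere 0 1 - {cis omega0}) & x \<longlonglongrightarrow> cis omega0 & (%n. weight eta (slice knot (x n))) \<longlonglongrightarrow> 0"
   by (intro exI[of _ "%n. cis (om n)"]) blast
 next
  fix eta :: real assume eta: "eta > 0"
  have "\<exists>omega r. omega0 < omega & omega < 0 & omega < omega0 + inverse (real (Suc n)) & r0 - inverse (real (Suc n)) < r & r < r0 &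
    sqrt 3 < r & height omega r = 0 & disc' (- kk omega) r > 0" for n
   by (rule rising_zero[OF w r0]) simp
  then obtain om r where om: "!!n. omega0 < om n" "!!n. om n < 0" "!!n. om n < omega0 + inverse (real (Suc n))"
   and r: "!!n. r0 - inverse (real (Suc n)) < r n" "!!n. r n < r0" "!!n. sqrt 3 < r n" "!!n. height (om n) (r n) = 0" "!!n. disc' (- kk (om n)) (r n) > 0"
   by metis
  have ol: "om \<longlonglongrightarrow> omega0" by (rule seq_close) (use om(1,3) in \<open>simp add: abs_less_iff less_diff_eq diff_less_eq\<close>, smt (verit) om(1,3) inverse_positive_iff_positive of_nat_0_less_iff zero_less_Suc)
  have rl: "r \<longlonglongrightarrow> r0" by (rule seq_close) (use r(1,2) in \<open>smt (verit)\<close>)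
  define x where "x n = cis (om n)" for n
  have x: "x \<longlonglongrightarrow> cis omega0" unfolding x_def by (rule isCont_tendsto_compose[OF cont ol])
  have lu: "(%n. lower (- r n)) \<longlonglongrightarrow> lower (- r0)" "(%n. upper (- r n)) \<longlonglongrightarrow> upper (- r0)"
   unfolding lower_def upper_def by (intro tendsto_intros rl; simp)+
  define C D where "C n = cross (slice knot (x n)) (lower (- r n), upper (- r n))" and "D n = eta * - dot (slice knot (x n)) (lower (- r n), upper (- r n))" for n
  define D0 where "D0 = eta * - dot (slice knot (cis omega0)) (lower (- r0), upper (- r0))"
  note tc = tangent_crossing[OF r0]
  have "C \<longlonglongrightarrow> cross (slice knot (cis omega0)) (lower (- r0), upper (- r0))"
   unfolding C_def cross_knot fst_conv snd_conv by (intro crs_tendsto pk1_tendsto x lu)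
  then have Cl: "C \<longlonglongrightarrow> 0" unfolding tc(1) .
  have Dl: "D \<longlonglongrightarrow> D0" unfolding D_def D0_def cross_knot fst_conv snd_conv by (intro tendsto_intros pk1_tendsto x lu)
  have D0: "D0 > 0" unfolding D0_def using eta tc(2) by (simp add: mult_pos_neg)
  \<comment> \<open>Eventually the crossing lies within the threshold angle, as
    \<open>weight_above\<close> demands.\<close>
  have "(%n. D n - C n) \<longlonglongrightarrow> D0 - 0" by (intro tendsto_intros Dl Cl)
  then have ev: "eventually (%n. D n - C n > 0) sequentially" using D0 by (intro order_tendstoD(1)) auto
  have "(%n. 1 - C n / D n) \<longlonglongrightarrow> 1 - 0 / D0" by (intro tendsto_intros Dl Cl) (use D0 in simp)
  then have l1: "(%n. 1 - C n / D n) \<longlonglongrightarrow> 1" by simp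
  have "eventually (%n. 1 - C n / D n = weight eta (slice knot (x n))) sequentially"
   using ev
  proof (rule eventually_mono)
   fix n assume "D n - C n > 0"
   then have "cross (slice knot (cis (om n))) (lower (- r n), upper (- r n)) <= eta * - dot (slice knot (cis (om n))) (lower (- r n), upper (- r n))"
    by (simp add: C_def D_def x_def)
   then show "1 - C n / D n = weight eta (slice knot (x n))"
    unfolding C_def D_def x_def using weight_above[of "om n" "r n" eta] w om[of n] r[of n] r0 by simp
  qed
  from Lim_transform_eventually[OF l1 this] have "(%n. weight eta (slice knot (x n))) \<longlonglongrightarrow> 1" .
  moreover have "x n \<in> sphere 0 1 - {cis omega0}" for n
   unfolding x_def using sin_ne[of "om n"] om[of n] w by auto
  ultimately show "\<exists>x. (\<forall>n. x n \<in> sphere 0 1 - {cis omega0}) & x \<longlonglongrightarrow> cis omega0 & (%n. weight eta (slice knot (x n))) \<longlonglongrightarrow> 1"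
   using x by blast
 qed
qed

text \<open>The disc may parametrize its boundary knots differently from \<open>knot\<close>;
  \<open>reparam_weight\<close> carries the weights over. The two sequences of
  \<open>loop_jump\<close>, with limits 0 and 1, then contradict \<open>circle_jump\<close>.\<close>

lemma loop_needs_star:
 assumes \<Phi>: "generic_disc \<Phi>" and bd: "\<forall>s\<in>sphere 0 1. \<Phi> s = loop s"
 shows "\<exists>s\<in>cball 0 1. has_star_like_triple_crossing (\<Phi> s)"
proof (rule ccontr)
 assume no: "~ (\<exists>s\<in>cball 0 1. has_star_like_triple_crossing (\<Phi> s))"
 obtain F where F: "smooth_family (cball 0 1) F" "\<forall>s\<in>cball 0 1. range (slice F s) = \<Phi> s"
  "\<forall>s\<in>cball 0 1. \<exists>S\<in>{stratum0, stratum1, stratum2}. \<Phi> s \<in> S & transverse_at F UNIV S s"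
  using \<Phi> unfolding generic_disc_def generic_map_def by (elim exE conjE) (rule that, assumption+)
 obtain R where sF: "smooth F" and R: "\<forall>s\<in>cball 0 1. (slice F s) \<in> params_upto R"
  using F(1) unfolding smooth_family_def by blast
 have par: "(slice F s) \<in> params_upto (max R 1)" if "s \<in> cball 0 1" for s
  by (rule params_upto_mono[OF bspec[OF R that]]) simp
 interpret D: generic_family F "cball 0 1" "max R 1"
 proof (intro generic_family.intro generic_family_axioms.intro)
  show "knot_family F (cball 0 1) (max R 1)" by (rule knot_familyI[OF sF compact_cball _ par]) auto
  show "s \<in> cball 0 1 ==> (slice F s) \<in> params_upto (max R 1)" for s by (rule par)
  show "\<exists>X\<in>{stratum0, stratum1, stratum2}. range (slice F s) \<in> X & transverse_at F UNIV X s" if "s \<in> cball 0 1" for s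
   using bspec[OF F(3) that] unfolding bspec[OF F(2) that] .
  show "range (slice F s) \<in> stratum0 \<union> stratum1" if "s \<in> cball 0 1" "s \<notin> interior (cball 0 1)" for s
  proof -
   have s: "cmod s = 1" using that by simp
   have "range (slice F s) = loop s" using bspec[OF F(2) that(1)] bd s by simp
   then show ?thesis using loop_stratum[OF s] by auto
  qed
  show "~ has_star_like_triple_crossing (range (slice F s))" if "s \<in> cball 0 1" for s
   unfolding bspec[OF F(2) that] using no that by blast
 qed
 obtain eta where eta: "eta > 0" and gap: "!!s a b c. s \<in> cball 0 1 ==> a ~= b ==> D.P s a = D.P s b ==> 0 <= crs (D.P1 s a) (D.P1 s b) ==>
  crs (D.P1 s a) (D.P1 s b) <= eta * - (D.P1 s a \<bullet> D.P1 s b) ==> D.P s c = D.P s a ==> c = a | c = b"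
  by (rule D.third_branch_gap) (rule that, assumption+)
 define W where "W s = weight eta (slice F s)" for s
 have rep: "\<exists>phi theta. is_reparam phi theta (slice F s) (slice knot s)" if s: "cmod s = 1" for s
 proof -
  have sc: "s \<in> cball 0 1" using s by simp
  have "range (slice F s) = range (slice knot s)" using bspec[OF F(2) sc] bd s by (simp add: loop_def)
  from reparam_exists[OF params_upto_params[OF par[OF sc]] params_upto_params[OF knot_params[OF eq_refl[OF s]]] this]
  obtain phi theta where "is_reparam phi theta (slice F s) (slice knot s)" .
  then show ?thesis by blast
 qed
 have WK: "W s = weight eta (slice knot s)" if "cmod s = 1" for s
  using rep[OF that] reparam_weight unfolding W_def by blast
 obtain s0 where s0: "cmod s0 = 1"
  and nz: "!!s z eta. cmod s = 1 ==> s ~= s0 ==> z \<in> near_anti eta (slice knot s) ==> cross (slice knot s) z ~= 0"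
  and x: "!!eta. \<exists>x. (\<forall>n. x n \<in> sphere 0 1 - {s0}) & x \<longlonglongrightarrow> s0 & (%n. weight eta (slice knot (x n))) \<longlonglongrightarrow> 0"
  and y: "!!eta. eta > 0 ==> \<exists>x. (\<forall>n. x n \<in> sphere 0 1 - {s0}) & x \<longlonglongrightarrow> s0 & (%n. weight eta (slice knot (x n))) \<longlonglongrightarrow> 1"
  by (rule loop_jump) (rule that, assumption+)
 have "continuous_on (sphere 0 1 - {s0}) W"
  unfolding continuous_on_iff
 proof (intro ballI allI impI)
  fix s and e :: real assume s: "s \<in> sphere 0 1 - {s0}" and e: "0 < e"
  have s1: "s \<in> cball 0 1" "cmod s = 1" "s ~= s0" using s by auto
  obtain phi theta where rp: "is_reparam phi theta (slice F s) (slice knot s)" using rep[OF s1(2)] by blast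
  have n: "cross (slice F s) z ~= 0" if "z \<in> near_anti eta (slice F s)" for z
  proof -
   have "cross (slice knot s) (map_prod phi phi z) ~= 0"
    using that unfolding reparam_near_anti[OF rp] by (rule nz[OF s1(2,3)])
   then show ?thesis unfolding reparam_cross(1)[OF rp] using reparam_pos[OF rp, of "fst z"] reparam_pos[OF rp, of "snd z"] by simp
  qed
  obtain delta where d: "delta > 0" "!!s'. s' \<in> cball 0 1 ==> dist s' s < delta ==> \<bar>weight eta (slice F s') - weight eta (slice F s)\<bar> < e"
   by (rule D.weight_continuous[OF eta gap s1(1) n e]) (assumption+, rule that, assumption+)
  show "\<exists>d>0. \<forall>s'\<in>sphere 0 1 - {s0}. dist s' s < d --> dist (W s') (W s) < e"
   by (rule exI[of _ delta]) (use d in \<open>auto simp: W_def dist_real_def\<close>)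
 qed
 moreover have "continuous_on (cball 0 1) (%s. cis (2 * pi * W s))"
  unfolding W_def by (rule D.cis_weight_continuous[OF eta gap])
 moreover obtain u where u: "!!n. u n \<in> sphere 0 1 - {s0}" "u \<longlonglongrightarrow> s0" "(%n. weight eta (slice knot (u n))) \<longlonglongrightarrow> 0" using x[of eta] by blast
 moreover obtain v where v: "!!n. v n \<in> sphere 0 1 - {s0}" "v \<longlonglongrightarrow> s0" "(%n. weight eta (slice knot (v n))) \<longlonglongrightarrow> 1" using y[OF eta] by blast
 moreover have "(%n. W (u n)) \<longlonglongrightarrow> 0" "(%n. W (v n)) \<longlonglongrightarrow> 1"
 proof -
  have "W (u n) = weight eta (slice knot (u n))" "W (v n) = weight eta (slice knot (v n))" for n
   using u(1)[of n] v(1)[of n] by (auto intro!: WK)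
  then show "(%n. W (u n)) \<longlonglongrightarrow> 0" "(%n. W (v n)) \<longlonglongrightarrow> 1" using u(3) v(3) by simp_all
 qed
 ultimately have "(0::real) = 1" by (intro circle_jump[of W s0 u 0 v 1] s0)
 then show False by simp
qed

theorem mainTheorem1:
  shows "\<exists>l :: complex \<Rightarrow> (real^3) set.
    generic_loop l \<and>
    contractible_loop l \<and>
    (\<forall>s \<in> sphere 0 1. \<not> has_star_like_triple_crossing (l s)) \<and>
    (\<forall>\<Phi>. generic_disc \<Phi> \<and> (\<forall>s \<in> sphere 0 1. \<Phi> s = l s) \<longrightarrow>
      (\<exists>s \<in> cball 0 1. has_star_like_triple_crossing (\<Phi> s)))"
proof (intro exI[of _ loop] conjI ballI allI impI)
 show "generic_loop loop" by (rule generic_loop_loop)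
 show "contractible_loop loop" by (rule contractible_loop_loop)
 show "~ has_star_like_triple_crossing (loop s)" if "s \<in> sphere 0 1" for s
  using that by (intro loop_no_star) simp
 show "\<exists>s\<in>cball 0 1. has_star_like_triple_crossing (\<Phi> s)"
  if "generic_disc \<Phi> & (\<forall>s\<in>sphere 0 1. \<Phi> s = loop s)" for \<Phi>
  using that loop_needs_star by blast
qed

end
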